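(* Let $k,n\in\mathbb{N}_0$ with $n\geq 1$. There is a large enough prime $p$ such that, for any $r\in[0,2p-3]$, any prime $q\geq p$ and any $t\in[0,q-2]$, we have \[[(\Omega^r(D_{k,q}))^{\otimes n}:\Omega^{nr}(D_{t,q})]=\begin{cases}[(\Omega^r(D_{k,p}))^{\otimes n}:\Omega^{nr}(D_{t,p})]&\text{if }t\leq p-2,\\ 0&\text{if }t>p-2.\end{cases}\] In particular, for $k,t,n\in\mathbb{N}_0$, the following limit exists: \[\lim_{\substack{p\to\infty\\ p\text{ prime}}}[D_{k,p}^{\otimes n}:D_{t,p}].\]
   Context: For integers $a\leq b$, $[a,b]$ denotes the set of integers $c$ with $a\leq c\leq b$. For each prime $p\geq 3$ fix an algebraically closed field $F$ of characteristic $p$ and consider finite-dimensional modules over the group algebra $F\mathfrak{S}_p$ of the symmetric group on $p$ letters. $V\otimes W$ is the tensor product over $F$ with diagonal group action, and $V^{\otimes 0}$ is the trivial module. For $i\in[0,p-2]$, $D_{i,p}$ is the simple $F\mathfrak{S}_p$-module $D^{(p-i,1^i)}$ labelled by the ($p$-regular) hook partition $(p-i,1^i)$, i.e. the unique simple quotient (James) of the Specht module of that partition; it is defined only when $i\leq p-2$, and the prime $p$ in the first assertion (resp. the primes in the limit) are taken large enough for the modules to be defined. $\Omega^r(V)$ is the $r$th Heller translate of $V$. For $W$ indecomposable, $[V:W]$ is the multiplicity of $W$ as a direct summand of $V$. *)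

theory Defs
  imports "HOL-Algebra.Module" "HOL-Algebra.Sym_Groups" "HOL-Algebra.Algebraic_Closure"
    "HOL-Computational_Algebra.Primes"
begin

section \<open>Modules over a group algebra\<close>

text \<open>
  A module over the group algebra \<open>R G\<close> is an \<open>R\<close>-module carrying an \<open>R\<close>-linear action of \<open>G\<close>.
  The fields \<open>mult\<close> and \<open>one\<close>, which the record type of modules inherits from rings, are junk.
\<close>

record ('a, 'b, 'g) gmodule = "('a, 'b) module" +
  act :: "'g \<Rightarrow> 'b \<Rightarrow> 'b"

locale group_module = module R M + G?: group G
  for R :: "('a, 'r) ring_scheme" (structure) and G :: "('g, 'k) monoid_scheme" (structure)
    and M :: "('a, 'b, 'g, 'm) gmodule_scheme" (structure) +
  assumes act_closed:
      "\<lbrakk>g \<in> carrier G; x \<in> carrier M\<rbrakk> \<Longrightarrow> act M g x \<in> carrier M"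
    and act_one: "x \<in> carrier M \<Longrightarrow> act M \<one>\<^bsub>G\<^esub> x = x"
    and act_mult:
      "\<lbrakk>g \<in> carrier G; h \<in> carrier G; x \<in> carrier M\<rbrakk>
        \<Longrightarrow> act M (g \<otimes>\<^bsub>G\<^esub> h) x = act M g (act M h x)"
    and act_add:
      "\<lbrakk>g \<in> carrier G; x \<in> carrier M; y \<in> carrier M\<rbrakk>
        \<Longrightarrow> act M g (x \<oplus>\<^bsub>M\<^esub> y) = act M g x \<oplus>\<^bsub>M\<^esub> act M g y"
    and act_smult:
      "\<lbrakk>g \<in> carrier G; a \<in> carrier R; x \<in> carrier M\<rbrakk>
        \<Longrightarrow> act M g (a \<odot>\<^bsub>M\<^esub> x) = a \<odot>\<^bsub>M\<^esub> act M g x"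

definition lin_span :: "('a, 'r) ring_scheme \<Rightarrow> ('a, 'b, 'm) module_scheme \<Rightarrow> 'b set \<Rightarrow> 'b set" where
  "lin_span R M A = \<Inter>{N. submodule N R M \<and> A \<subseteq> N}"

definition fd_module ::
  "('a, 'r) ring_scheme \<Rightarrow> ('g, 'k) monoid_scheme \<Rightarrow> ('a, 'b, 'g, 'm) gmodule_scheme \<Rightarrow> bool" where
  "fd_module R G M \<longleftrightarrow> group_module R G M \<and>
     (\<exists>A. finite A \<and> A \<subseteq> carrier M \<and> lin_span R M A = carrier M)"

definition gsubmodule ::
  "('a, 'r) ring_scheme \<Rightarrow> ('g, 'k) monoid_scheme \<Rightarrow> ('a, 'b, 'g, 'm) gmodule_scheme \<Rightarrow> 'b set \<Rightarrow> bool" where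
  "gsubmodule R G M N \<longleftrightarrow> submodule N R M \<and> (\<forall>g\<in>carrier G. \<forall>x\<in>N. act M g x \<in> N)"

definition gmod_hom ::
  "('a, 'r) ring_scheme \<Rightarrow> ('g, 'k) monoid_scheme \<Rightarrow> ('a, 'b, 'g, 'm) gmodule_scheme
    \<Rightarrow> ('a, 'c, 'g, 'n) gmodule_scheme \<Rightarrow> ('b \<Rightarrow> 'c) set" where
  "gmod_hom R G M N = {f \<in> carrier M \<rightarrow> carrier N.
     (\<forall>x\<in>carrier M. \<forall>y\<in>carrier M. f (x \<oplus>\<^bsub>M\<^esub> y) = f x \<oplus>\<^bsub>N\<^esub> f y) \<and>
     (\<forall>a\<in>carrier R. \<forall>x\<in>carrier M. f (a \<odot>\<^bsub>M\<^esub> x) = a \<odot>\<^bsub>N\<^esub> f x) \<and>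
     (\<forall>g\<in>carrier G. \<forall>x\<in>carrier M. f (act M g x) = act N g (f x))}"

definition gmod_epi ::
  "('a, 'r) ring_scheme \<Rightarrow> ('g, 'k) monoid_scheme \<Rightarrow> ('a, 'b, 'g, 'm) gmodule_scheme
    \<Rightarrow> ('a, 'c, 'g, 'n) gmodule_scheme \<Rightarrow> ('b \<Rightarrow> 'c) set" where
  "gmod_epi R G M N = {f \<in> gmod_hom R G M N. f ` carrier M = carrier N}"

definition gmod_iso ::
  "('a, 'r) ring_scheme \<Rightarrow> ('g, 'k) monoid_scheme \<Rightarrow> ('a, 'b, 'g, 'm) gmodule_scheme
    \<Rightarrow> ('a, 'c, 'g, 'n) gmodule_scheme \<Rightarrow> bool" where
  "gmod_iso R G M N \<longleftrightarrow> (\<exists>f\<in>gmod_hom R G M N. bij_betw f (carrier M) (carrier N))"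

definition simple_module ::
  "('a, 'r) ring_scheme \<Rightarrow> ('g, 'k) monoid_scheme \<Rightarrow> ('a, 'b, 'g, 'm) gmodule_scheme \<Rightarrow> bool" where
  "simple_module R G M \<longleftrightarrow> carrier M \<noteq> {\<zero>\<^bsub>M\<^esub>} \<and>
     (\<forall>N. gsubmodule R G M N \<longrightarrow> N = {\<zero>\<^bsub>M\<^esub>} \<or> N = carrier M)"

definition indecomposable_module ::
  "('a, 'r) ring_scheme \<Rightarrow> ('g, 'k) monoid_scheme \<Rightarrow> ('a, 'b, 'g, 'm) gmodule_scheme \<Rightarrow> bool" where
  "indecomposable_module R G M \<longleftrightarrow> carrier M \<noteq> {\<zero>\<^bsub>M\<^esub>} \<and>
     (\<forall>U W. gsubmodule R G M U \<longrightarrow> gsubmodule R G M W \<longrightarrow>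
        U \<inter> W = {\<zero>\<^bsub>M\<^esub>} \<longrightarrow> U <+>\<^bsub>M\<^esub> W = carrier M \<longrightarrow>
        U = {\<zero>\<^bsub>M\<^esub>} \<or> W = {\<zero>\<^bsub>M\<^esub>})"


section \<open>Multiplicities of indecomposable summands\<close>

text \<open>The internal direct sum decomposition \<open>M = U 0 \<oplus> \<dots> \<oplus> U (N - 1)\<close> into indecomposables.\<close>

definition indec_decomposition ::
  "('a, 'r) ring_scheme \<Rightarrow> ('g, 'k) monoid_scheme \<Rightarrow> ('a, 'b, 'g, 'm) gmodule_scheme
    \<Rightarrow> nat \<Rightarrow> (nat \<Rightarrow> 'b set) \<Rightarrow> bool" where
  "indec_decomposition R G M N U \<longleftrightarrow>
     (\<forall>i<N. gsubmodule R G M (U i) \<and> indecomposable_module R G (M\<lparr>carrier := U i\<rparr>)) \<and>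
     bij_betw (\<lambda>x. finsum M x {..<N}) (PiE {..<N} U) (carrier M)"

text \<open>
  By the Krull-Schmidt theorem, the number below does not depend on the decomposition when
  \<open>M\<close> is finite-dimensional over a field.
\<close>

definition summand_mult ::
  "('a, 'r) ring_scheme \<Rightarrow> ('g, 'k) monoid_scheme \<Rightarrow> ('a, 'b, 'g, 'm) gmodule_scheme
    \<Rightarrow> ('a, 'c, 'g, 'n) gmodule_scheme \<Rightarrow> nat" where
  "summand_mult R G M W = (THE m. \<exists>N U. indec_decomposition R G M N U \<and>
     m = card {i. i < N \<and> gmod_iso R G (M\<lparr>carrier := U i\<rparr>) W})"


section \<open>Isomorphism classes of finite-dimensional modules\<close>

text \<open>
  Every finite-dimensional module over a field \<open>R\<close> is isomorphic to one whose carrier consists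
  of elements of type \<open>nat \<Rightarrow> 'a\<close> (transport the structure to the coordinate vectors), so this
  element type suffices for all finite-dimensional modules.  Modules that are determined only up
  to isomorphism are chosen in it.
\<close>

type_synonym ('a, 'g) vec_gmodule = "('a, nat \<Rightarrow> 'a, 'g) gmodule"

definition vec_copy ::
  "('a, 'r) ring_scheme \<Rightarrow> ('g, 'k) monoid_scheme \<Rightarrow> ('a, 'b, 'g, 'm) gmodule_scheme
    \<Rightarrow> ('a, 'g) vec_gmodule" where
  "vec_copy R G M = (SOME N. fd_module R G N \<and> gmod_iso R G M N)"


section \<open>Tensor products\<close>

text \<open>The permutation module on the \<open>G\<close>-set \<open>S\<close> with action \<open>\<sigma>\<close>: finitely supported functions
  on \<open>S\<close>, where \<open>g\<close> sends the basis vector at \<open>x\<close> to the one at \<open>\<sigma> g x\<close>.\<close>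

definition perm_module ::
  "('a, 'r) ring_scheme \<Rightarrow> ('g, 'k) monoid_scheme \<Rightarrow> 'x set \<Rightarrow> ('g \<Rightarrow> 'x \<Rightarrow> 'x)
    \<Rightarrow> ('a, 'x \<Rightarrow> 'a, 'g) gmodule" where
  "perm_module R G S \<sigma> =
     \<lparr>carrier = {f. (\<forall>x\<in>S. f x \<in> carrier R) \<and> (\<forall>x. x \<notin> S \<longrightarrow> f x = \<zero>\<^bsub>R\<^esub>) \<and>
                    finite {x. f x \<noteq> \<zero>\<^bsub>R\<^esub>}},
      mult = undefined,
      one = undefined,
      zero = (\<lambda>_. \<zero>\<^bsub>R\<^esub>),
      add = (\<lambda>f f' x. f x \<oplus>\<^bsub>R\<^esub> f' x),
      smult = (\<lambda>a f x. a \<otimes>\<^bsub>R\<^esub> f x),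
      act = (\<lambda>g f x. if x \<in> S then f (\<sigma> (m_inv G g) x) else \<zero>\<^bsub>R\<^esub>)\<rparr>"

definition basis_vec :: "('a, 'r) ring_scheme \<Rightarrow> 'x \<Rightarrow> 'x \<Rightarrow> 'a" where
  "basis_vec R x = (\<lambda>y. if y = x then \<one>\<^bsub>R\<^esub> else \<zero>\<^bsub>R\<^esub>)"

definition quot_module ::
  "('a, 'b, 'g, 'm) gmodule_scheme \<Rightarrow> 'b set \<Rightarrow> ('a, 'b set, 'g) gmodule" where
  "quot_module M N =
     \<lparr>carrier = a_rcosets\<^bsub>M\<^esub> N,
      mult = undefined,
      one = undefined,
      zero = N,
      add = (\<lambda>A B. A <+>\<^bsub>M\<^esub> B),
      smult = (\<lambda>a A. \<Union>x\<in>A. N +>\<^bsub>M\<^esub> (a \<odot>\<^bsub>M\<^esub> x)),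
      act = (\<lambda>g A. \<Union>x\<in>A. N +>\<^bsub>M\<^esub> act M g x)\<rparr>"

definition tensor_relations ::
  "('a, 'r) ring_scheme \<Rightarrow> ('a, 'b, 'm) module_scheme \<Rightarrow> ('a, 'c, 'n) module_scheme
    \<Rightarrow> ('b \<times> 'c \<Rightarrow> 'a) set" where
  "tensor_relations R V W =
     {\<lambda>z. basis_vec R (v \<oplus>\<^bsub>V\<^esub> v', w) z \<ominus>\<^bsub>R\<^esub> (basis_vec R (v, w) z \<oplus>\<^bsub>R\<^esub> basis_vec R (v', w) z)
        | v v' w. v \<in> carrier V \<and> v' \<in> carrier V \<and> w \<in> carrier W} \<union>
     {\<lambda>z. basis_vec R (v, w \<oplus>\<^bsub>W\<^esub> w') z \<ominus>\<^bsub>R\<^esub> (basis_vec R (v, w) z \<oplus>\<^bsub>R\<^esub> basis_vec R (v, w') z)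
        | v w w'. v \<in> carrier V \<and> w \<in> carrier W \<and> w' \<in> carrier W} \<union>
     {\<lambda>z. basis_vec R (a \<odot>\<^bsub>V\<^esub> v, w) z \<ominus>\<^bsub>R\<^esub> a \<otimes>\<^bsub>R\<^esub> basis_vec R (v, w) z
        | a v w. a \<in> carrier R \<and> v \<in> carrier V \<and> w \<in> carrier W} \<union>
     {\<lambda>z. basis_vec R (v, a \<odot>\<^bsub>W\<^esub> w) z \<ominus>\<^bsub>R\<^esub> a \<otimes>\<^bsub>R\<^esub> basis_vec R (v, w) z
        | a v w. a \<in> carrier R \<and> v \<in> carrier V \<and> w \<in> carrier W}"

definition tensor_module ::
  "('a, 'r) ring_scheme \<Rightarrow> ('g, 'k) monoid_scheme \<Rightarrow> ('a, 'b, 'g, 'm) gmodule_scheme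
    \<Rightarrow> ('a, 'c, 'g, 'n) gmodule_scheme \<Rightarrow> ('a, ('b \<times> 'c \<Rightarrow> 'a) set, 'g) gmodule" where
  "tensor_module R G V W =
     (let Fr = perm_module R G (carrier V \<times> carrier W) (\<lambda>g (v, w). (act V g v, act W g w))
      in quot_module Fr (lin_span R Fr (tensor_relations R V W)))"

definition trivial_module :: "('a, 'r) ring_scheme \<Rightarrow> ('a, 'a, 'g) gmodule" where
  "trivial_module R =
     \<lparr>carrier = carrier R, mult = undefined, one = undefined, zero = \<zero>\<^bsub>R\<^esub>, add = add R,
      smult = mult R, act = (\<lambda>g x. x)\<rparr>"

primrec tensor_power ::
  "('a, 'r) ring_scheme \<Rightarrow> ('g, 'k) monoid_scheme \<Rightarrow> ('a, 'b, 'g, 'm) gmodule_scheme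
    \<Rightarrow> nat \<Rightarrow> ('a, 'g) vec_gmodule" where
  "tensor_power R G V 0 = vec_copy R G (trivial_module R)"
| "tensor_power R G V (Suc n) = vec_copy R G (tensor_module R G (tensor_power R G V n) V)"


section \<open>Heller translates\<close>

text \<open>The lifting property in the category of finite-dimensional modules.\<close>

definition projective_module ::
  "('a, 'r) ring_scheme \<Rightarrow> ('g, 'k) monoid_scheme \<Rightarrow> ('a, 'b, 'g, 'm) gmodule_scheme \<Rightarrow> bool" where
  "projective_module R G P \<longleftrightarrow>
     (\<forall>(M :: ('a, 'g) vec_gmodule) (N :: ('a, 'g) vec_gmodule).
        fd_module R G M \<longrightarrow> fd_module R G N \<longrightarrow>
        (\<forall>f\<in>gmod_epi R G M N. \<forall>h\<in>gmod_hom R G P N.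
           \<exists>k\<in>gmod_hom R G P M. \<forall>x\<in>carrier P. f (k x) = h x))"

definition projective_cover ::
  "('a, 'r) ring_scheme \<Rightarrow> ('g, 'k) monoid_scheme \<Rightarrow> ('a, 'b, 'g, 'm) gmodule_scheme
    \<Rightarrow> ('a, 'c, 'g, 'n) gmodule_scheme \<Rightarrow> ('b \<Rightarrow> 'c) \<Rightarrow> bool" where
  "projective_cover R G P V \<pi> \<longleftrightarrow>
     fd_module R G P \<and> projective_module R G P \<and> \<pi> \<in> gmod_epi R G P V \<and>
     (\<forall>U. gsubmodule R G P U \<longrightarrow> \<pi> ` U = carrier V \<longrightarrow> U = carrier P)"

definition heller ::
  "('a, 'r) ring_scheme \<Rightarrow> ('g, 'k) monoid_scheme \<Rightarrow> ('a, 'g) vec_gmodule \<Rightarrow> ('a, 'g) vec_gmodule" where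
  "heller R G V = (SOME W. fd_module R G W \<and>
     (\<exists>(P :: ('a, 'g) vec_gmodule) \<pi>. projective_cover R G P V \<pi> \<and>
        gmod_iso R G (P\<lparr>carrier := a_kernel P V \<pi>\<rparr>) W))"

text \<open>
  In particular the zeroth translate of \<open>V\<close> is \<open>V\<close> itself; this agrees with the convention
  that discards projective summands whenever \<open>V\<close> has none.
\<close>

definition heller_power ::
  "('a, 'r) ring_scheme \<Rightarrow> ('g, 'k) monoid_scheme \<Rightarrow> nat \<Rightarrow> ('a, 'g) vec_gmodule
    \<Rightarrow> ('a, 'g) vec_gmodule" where
  "heller_power R G r = heller R G ^^ r"


section \<open>Specht modules and their simple heads\<close>

text \<open>
  A partition \<open>\<lambda>\<close> of \<open>n\<close> is the list of its parts.  A tabloid of shape \<open>\<lambda>\<close> is encoded by the map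
  sending each letter of \<open>{1..n}\<close> to the index of its row, and a tableau by the bijection sending
  each letter to its cell \<open>(row, column)\<close>.  Rows and columns are numbered from 0.
\<close>

definition tabloids :: "nat list \<Rightarrow> nat \<Rightarrow> (nat \<Rightarrow> nat) set" where
  "tabloids lam n = {\<tau> \<in> {1..n} \<rightarrow>\<^sub>E {..<length lam}.
     \<forall>i<length lam. card {x \<in> {1..n}. \<tau> x = i} = lam ! i}"

definition tabloid_act :: "(nat \<Rightarrow> nat) \<Rightarrow> (nat \<Rightarrow> nat) \<Rightarrow> nat \<Rightarrow> nat" where
  "tabloid_act \<pi> \<tau> = \<tau> \<circ> inv' \<pi>"

definition tableaux :: "nat list \<Rightarrow> nat \<Rightarrow> (nat \<Rightarrow> nat \<times> nat) set" where
  "tableaux lam n = {T. bij_betw T {1..n} {(r, c). r < length lam \<and> c < lam ! r}}"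

definition tabloid_of :: "nat \<Rightarrow> (nat \<Rightarrow> nat \<times> nat) \<Rightarrow> nat \<Rightarrow> nat" where
  "tabloid_of n T = (\<lambda>x\<in>{1..n}. fst (T x))"

definition column_stabilizer :: "nat \<Rightarrow> (nat \<Rightarrow> nat \<times> nat) \<Rightarrow> (nat \<Rightarrow> nat) set" where
  "column_stabilizer n T =
     {\<pi> \<in> carrier (sym_group n). \<forall>x\<in>{1..n}. snd (T (\<pi> x)) = snd (T x)}"

definition polytabloid ::
  "('a, 'r) ring_scheme \<Rightarrow> nat \<Rightarrow> (nat \<Rightarrow> nat \<times> nat) \<Rightarrow> (nat \<Rightarrow> nat) \<Rightarrow> 'a" where
  "polytabloid R n T = (\<lambda>\<tau>. finsum R
     (\<lambda>\<pi>. [(sign \<pi> :: int)] \<cdot>\<^bsub>R\<^esub> basis_vec R (tabloid_act \<pi> (tabloid_of n T)) \<tau>)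
     (column_stabilizer n T))"

definition young_perm_module ::
  "('a, 'r) ring_scheme \<Rightarrow> nat list \<Rightarrow> nat \<Rightarrow> ('a, (nat \<Rightarrow> nat) \<Rightarrow> 'a, nat \<Rightarrow> nat) gmodule" where
  "young_perm_module R lam n = perm_module R (sym_group n) (tabloids lam n) tabloid_act"

definition specht_module ::
  "('a, 'r) ring_scheme \<Rightarrow> nat list \<Rightarrow> nat \<Rightarrow> ('a, (nat \<Rightarrow> nat) \<Rightarrow> 'a, nat \<Rightarrow> nat) gmodule" where
  "specht_module R lam n = (young_perm_module R lam n)
     \<lparr>carrier := lin_span R (young_perm_module R lam n) (polytabloid R n ` tableaux lam n)\<rparr>"

text \<open>Meaningful for \<open>p\<close>-regular \<open>\<lambda>\<close>, where \<open>p\<close> is the characteristic of \<open>R\<close>: then the Specht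
  module has a unique simple quotient up to isomorphism (James).\<close>

definition simple_D ::
  "('a, 'r) ring_scheme \<Rightarrow> nat list \<Rightarrow> nat \<Rightarrow> ('a, nat \<Rightarrow> nat) vec_gmodule" where
  "simple_D R lam n = (SOME D. fd_module R (sym_group n) D \<and> simple_module R (sym_group n) D \<and>
     gmod_epi R (sym_group n) (specht_module R lam n) D \<noteq> {})"

definition hook_D :: "('a, 'r) ring_scheme \<Rightarrow> nat \<Rightarrow> nat \<Rightarrow> ('a, nat \<Rightarrow> nat) vec_gmodule" where
  "hook_D R i p = simple_D R ((p - i) # replicate i 1) p"


section \<open>Ground fields\<close>

definition has_characteristic :: "('a, 'r) ring_scheme \<Rightarrow> nat \<Rightarrow> bool" where
  "has_characteristic R p \<longleftrightarrow> (\<forall>m::nat. [m] \<cdot>\<^bsub>R\<^esub> \<one>\<^bsub>R\<^esub> = \<zero>\<^bsub>R\<^esub> \<longleftrightarrow> p dvd m)"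

end

theory Submission
 imports Defs "HOL-Library.Nat_Bijection"
begin

text \<open>
 The hook module \<open>D k\<close> is the \<open>k\<close>-th exterior power of the heart of the natural permutation
 module. Up to projective summands, \<open>D (k + 1)\<close> tensored with \<open>D 1\<close> is the direct sum of
 \<open>D (k + 2)\<close> and \<open>D k\<close> as long as \<open>k + 2 < p\<close>. In the stable category the \<open>D t\<close> have scalar
 endomorphism rings and no homomorphisms between each other, and Heller translation is compatible
 with tensor products and preserves these properties, so multiplicities of non-projective summands
 can be computed there. Hence the multiplicity in question obeys a Clebsch-Gordan recursion, which
 does not depend on \<open>p\<close> once \<open>n * k + 2 <= p\<close>.

 The computations take place with finitely supported matrices over a commutative ring into which the
 field embeds.\<close>

section \<open>Finitely supported matrices\<close>

text \<open>Two obstacles shape the proof. Modules occur on unrelated element types (functions,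
  cosets, chosen vectors), over fields given as records. Modelling each by matrices over one ring,
  with the neutral element acting as an idempotent, puts them on one footing: a summand or a kernel
  is an idempotent, a tensor product is a Kronecker product, and a vector is a one-column matrix in
  the same ring as the operators. Secondly, stable information has to yield genuine multiplicities.
  The number of copies of a brick is governed by the rank of a matrix of scalars, and a stable
  automorphism of a brick is invertible because a brick has no projective summand; this replaces the
  full Krull-Schmidt theorem. Stable vanishing is tested by traces. The heart is a subquotient of
  the natural module, but no quotient is formed: with e the sum of the basis vectors, wedging with e
  embeds the k-th exterior power of the heart in degree k + 1 of the exterior algebra of the natural
  module, as a common kernel of two operators. The anticommutation relations of creation and
  annihilation operators drive the computations there.\<close>

typedef (overloaded) ('r::comm_ring_1) fm = "{A :: nat => nat => 'r. EX n. ALL i j. A i j ~= 0 --> i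
 < n & j < n}" morphisms ent Abs_fm by auto
setup_lifting type_definition_fm

lemmas massoc = mult.assoc and massoc' = mult.assoc[symmetric]
 and ldiff = left_diff_distrib and
 rdiff = right_diff_distrib and lsum = sum_distrib_left and rsum = sum_distrib_right

lemma fm_eqI: "(!!i j. ent A i j = ent B i j) ==> A = B" by (metis ent_inject ext)

definition bnd :: "('r::comm_ring_1) fm => nat => bool" where "bnd A n = (ALL i j. ent A i j ~= 0
 --> i < n & j < n)"

lemma bnd_ex: "EX n. bnd A n" using ent by (auto simp: bnd_def)

lemma bnd_mono: "bnd A n ==> n <= m ==> bnd A m" by (fastforce simp: bnd_def)

lemma bnd_zero: "bnd A n ==> ~(i < n & j < n) ==> ent A i j = 0" by (auto simp: bnd_def)

lemma bnd_finite: "finite S ==> EX n. ALL A:S. bnd A n" proof (induction S rule: finite_induct)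
 case (insert A S)
 then obtain n where n: "ALL A:S. bnd A n" by auto
 obtain m where m: "bnd A m" using bnd_ex by auto
 show ?case using n m bnd_mono[of _ n "max n m"] bnd_mono[of _ m "max n m"] by auto
qed auto

lemma ent_Abs: "(!!i j. A i j ~= 0 ==> i < n & j < n) ==> ent (Abs_fm A) = A" by (rule
 Abs_fm_inverse) auto

instantiation fm :: (comm_ring_1) ring
begin

lift_definition zero_fm :: "'a fm" is "%_ _. 0" by simp

lift_definition plus_fm :: "'a fm => 'a fm => 'a fm" is "%A B i j. A i j + B i j" by (metis
 add.right_neutral max.strict_coboundedI1 max.strict_coboundedI2)

lift_definition uminus_fm :: "'a fm => 'a fm" is "%A i j. - A i j" by simp

definition minus_fm :: "'a fm => 'a fm => 'a fm" where "minus_fm A B = A + - B"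

text \<open>Summing over the support of row i of A keeps the sum finite without choosing a common
  bound of both factors.\<close>

lift_definition times_fm :: "'a fm => 'a fm => 'a fm" is "%A B i j. SUM k | A i k ~= 0. A i k * B k
 j" proof -
 fix A B :: "nat => nat => 'a"
 assume "EX n. ALL i j. A i j ~= 0 --> i < n & j < n" "EX n. ALL i j. B i j ~= 0 --> i < n & j < n"
 then obtain n m where n: "ALL i j. A i j ~= 0 --> i < n & j < n" and m: "ALL i j. B i j ~= 0 --> i
  < m & j < m" by auto
 have "i < max n m & j < max n m" if nz: "(SUM k | A i k ~= 0. A i k * B k j) ~= 0" for i j proof -
  obtain k where k: "A i k * B k j ~= 0" using nz by (rule sum.not_neutral_contains_not_neutral)
  hence "A i k ~= 0" "B k j ~= 0" by auto
  thus ?thesis by (simp add: n m less_max_iff_disj)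
 qed
 thus "EX n. ALL i j. (SUM k | A i k ~= 0. A i k * B k j) ~= 0 --> i < n & j < n" by auto
qed

lemma ent_add': "ent (A + B) i j = ent A i j + ent B i j" by transfer simp

lemma ent_times_gen:
 assumes "finite S" "!!k. k ~: S ==> ent A i k * ent B k j = 0"
 shows "ent (A * B) i j = (SUM k:S. ent A i k * ent B k j)" proof -
 obtain n where n: "bnd A n" using bnd_ex by auto
 have fin: "finite {k. ent A i k ~= 0}" by (rule finite_subset[of _ "{..<n}"]) (use n in "auto simp:
  bnd_def")
 have "ent (A * B) i j = (SUM k | ent A i k ~= 0. ent A i k * ent B k j)" by transfer simp
 also have "... = (SUM k:S \<union> {k. ent A i k ~= 0}. ent A i k * ent B k j)" by (rule
  sum.mono_neutral_left) (use assms fin in auto)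
 also have "... = (SUM k:S. ent A i k * ent B k j)" by (rule sum.mono_neutral_right) (use assms fin
  in auto)
 finally show ?thesis .
qed

lemma ent_times_bndl: "bnd A n ==> ent (A * B) i j = (SUM k<n. ent A i k * ent B k j)" by (rule
 ent_times_gen) (auto simp: bnd_zero)

lemma ent_times_bndr: "bnd B n ==> ent (A * B) i j = (SUM k<n. ent A i k * ent B k j)" by (rule
 ent_times_gen) (auto simp: bnd_zero)

instance proof
 fix a b c :: "'a fm"
 show "a + b + c = a + (b + c)" by transfer (simp add: add.assoc)
 show "a + b = b + a" by transfer (simp add: add.commute)
 show "0 + a = a" by transfer simp
 show "- a + a = 0" by transfer simp
 show "a - b = a + - b" by (simp add: minus_fm_def)
 obtain n where n: "ALL A:{a,b,c}. bnd A n" using bnd_finite[of "{a,b,c}"] by auto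
 show "a * b * c = a * (b * c)" proof (rule fm_eqI)
  fix i j
  have "ent (a * b * c) i j = (SUM k<n. (SUM l<n. ent a i l * ent b l k) * ent c k j)" by (simp add:
   n ent_times_bndr[of c n] ent_times_bndl[of a n])
  also have "... = (SUM l<n. SUM k<n. ent a i l * ent b l k * ent c k j)" by (simp add: rsum) (rule
   sum.swap)
  also have "... = ent (a * (b * c)) i j" by (simp add: n ent_times_bndr[of c n] ent_times_bndl[of a
   n] lsum massoc)
  finally show "ent (a * b * c) i j = ent (a * (b * c)) i j" .
 qed
 show "(a + b) * c = a * c + b * c" by (rule fm_eqI) (use n in "simp add: ent_times_bndr[of c n]
  ent_add' distrib_right sum.distrib")
 show "a * (b + c) = a * b + a * c" by (rule fm_eqI) (use n in "simp add: ent_times_bndl[of a n]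
  ent_add' distrib_left sum.distrib")
qed
end

lemma ent_zero [simp]: "ent 0 i j = 0" by transfer simp

lemma ent_add [simp]: "ent (A + B) i j = ent A i j + ent B i j" by transfer simp

lemma ent_uminus [simp]: "ent (- A) i j = - ent A i j" by transfer simp

lemma ent_minus [simp]: "ent (A - B) i j = ent A i j - ent B i j" by (metis ent_add ent_uminus
 add_uminus_conv_diff)

lemma ent_sum [simp]: "ent (SUM x:S. f x) i j = (SUM x:S. ent (f x) i j)" by (induction S rule:
 infinite_finite_induct) auto

lift_definition sm :: "'r::comm_ring_1 => 'r fm => 'r fm" is "%c A i j. c * A i j" by (metis
 mult_zero_right)

lemma ent_sm [simp]: "ent (sm c A) i j = c * ent A i j" by transfer simp

lift_definition unitm :: "'r::comm_ring_1 => nat => nat => 'r fm" is "%c a b i j. if i = a & j = b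
 then c else 0" proof -
 fix c :: 'r and a b :: nat
 show "EX n. ALL i j. (if i = a & j = b then c else 0) ~= 0 --> i < n & j < n" by (rule exI[of _
  "Suc (max a b)"]) auto
qed

lemma ent_unitm: "ent (unitm c a b) i j = (if i = a & j = b then c else 0)" by transfer simp

lemma sm_add: "sm c (A + B) = sm c A + sm c B" and sm_add_left: "sm (c + d) A = sm c A + sm d A" and
 sm_diff: "sm c (A - B) = sm c A - sm c B" and sm_diff_left: "sm (c - d) A = sm c A - sm d A" and
 sm_minus: "sm c (- A) = - sm c A" and sm_minus_left: "sm (- c) A = - sm c A" and sm_sm [simp]: "sm
 c (sm d A) = sm (c * d) A" and sm_zero [simp]: "sm c 0 = 0" and sm_zero_left [simp]: "sm 0 A = 0"
 and sm_one [simp]: "sm 1 A = A" by (auto intro!: fm_eqI simp: algebra_simps)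

lemma sm_sum: "sm c (SUM x:S. f x) = (SUM x:S. sm c (f x))" by (induction S rule:
 infinite_finite_induct) (auto simp: sm_add)

lemma sm_mult_left: "sm c A * B = sm c (A * B)" proof -
 obtain n where "bnd B n" using bnd_ex by auto
 thus ?thesis by (intro fm_eqI) (simp add: ent_times_bndr[of B n] lsum massoc)
qed

lemma sm_mult_right: "A * sm c B = sm c (A * B)" proof -
 obtain n where "bnd A n" using bnd_ex by auto
 thus ?thesis by (intro fm_eqI) (simp add: ent_times_bndl[of A n] lsum mult.left_commute)
qed

lemmas sm_mult = sm_mult_left sm_mult_right

lemma ent_unitm_mult: "ent (unitm c a b * A) i j = (if i = a then c * ent A b j else 0)" by (subst
 ent_times_gen[of "{b}"]) (auto simp: ent_unitm)

lemma ent_mult_unitm: "ent (A * unitm c a b) i j = (if j = b then ent A i a * c else 0)" by (subst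
 ent_times_gen[of "{a}"]) (auto simp: ent_unitm)

lemma unitm_mult: "unitm c a b * unitm d a' b' = (if b = a' then unitm (c * d) a b' else 0)" by
 (rule fm_eqI) (auto simp: ent_unitm_mult ent_unitm)

text \<open>Pairs of indices are coded as numbers, so tensor products stay in the same type and can
  be iterated. The price is that associativity only holds after a renumbering of the indices
  (\<open>isor_assoc\<close>).\<close>

lift_definition kron :: "'r::comm_ring_1 fm => 'r fm => 'r fm" is "%A B i j. A (fst (prod_decode i))
 (fst (prod_decode j)) * B (snd (prod_decode i)) (snd (prod_decode j))" proof -
 fix A B :: "nat => nat => 'r"
 assume "EX n. ALL i j. A i j ~= 0 --> i < n & j < n" "EX n. ALL i j. B i j ~= 0 --> i < n & j < n"
 then obtain n m where n: "!!i j. A i j ~= 0 ==> i < n & j < n" and m: "!!i j. B i j ~= 0 ==> i < m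
  & j < m" by auto
 obtain N where N: "!!x. x : prod_encode ` ({..<n} \<times> {..<m}) ==> x < N" using
  finite_nat_set_iff_bounded[of "prod_encode ` ({..<n} \<times> {..<m})"] by auto
 have *: "i < N" if "fst (prod_decode i) < n" "snd (prod_decode i) < m" for i proof (rule N)
  have "prod_encode (prod_decode i) : prod_encode ` ({..<n} \<times> {..<m})" by (rule imageI) (use
   that in "simp add: mem_Times_iff")
  thus "i : prod_encode ` ({..<n} \<times> {..<m})" by simp
 qed
 have "i < N & j < N" if "A (fst (prod_decode i)) (fst (prod_decode j)) * B (snd (prod_decode i))
  (snd (prod_decode j)) ~= 0" for i j proof -
  have "A (fst (prod_decode i)) (fst (prod_decode j)) ~= 0" "B (snd (prod_decode i)) (snd
   (prod_decode j)) ~= 0" using that by auto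
  from n[OF this(1)] m[OF this(2)] show ?thesis by (simp add: *)
 qed
 thus "EX n. ALL i j. A (fst (prod_decode i)) (fst (prod_decode j)) * B (snd (prod_decode i)) (snd
  (prod_decode j)) ~= 0 --> i < n & j < n" by auto
qed

lemma ent_kron: "ent (kron A B) i j = ent A (fst (prod_decode i)) (fst (prod_decode j)) * ent B (snd
 (prod_decode i)) (snd (prod_decode j))" by transfer simp

lemma ent_kron': "ent (kron A B) (prod_encode (i, k)) (prod_encode (j, l)) = ent A i j * ent B k l"
 by (simp add: ent_kron)

lemma kron_add_left: "kron (A + A') B = kron A B + kron A' B" and kron_add_right: "kron A (B + B') =
 kron A B + kron A B'" and kron_diff_left: "kron (A - A') B = kron A B - kron A' B" and
 kron_diff_right: "kron A (B - B') = kron A B - kron A B'" and kron_sm_left: "kron (sm c A) B = sm c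
 (kron A B)" and kron_sm_right: "kron A (sm c B) = sm c (kron A B)" and kron_zero_left [simp]: "kron
 0 B = 0" and kron_zero_right [simp]: "kron A 0 = 0" by (auto intro!: fm_eqI simp: ent_kron
 algebra_simps)

lemma kron_sum_left: "kron (SUM x:S. f x) B = (SUM x:S. kron (f x) B)" by (induction S rule:
 infinite_finite_induct) (auto simp: kron_add_left)

lemma kron_sum_right: "kron A (SUM x:S. f x) = (SUM x:S. kron A (f x))" by (induction S rule:
 infinite_finite_induct) (auto simp: kron_add_right)

lemma kron_mult: "kron A B * kron C D = kron (A * C) (B * D)" proof (rule fm_eqI)
 fix i j :: nat
 obtain n where n: "bnd A n" using bnd_ex by auto
 obtain m where m: "bnd B m" using bnd_ex by auto
 let ?a = "fst (prod_decode i)" and ?b = "snd (prod_decode i)"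
 let ?c = "fst (prod_decode j)" and ?d = "snd (prod_decode j)"
 have inj: "inj_on prod_encode Y" for Y by (simp add: inj_prod_encode)
 have "ent (kron A B * kron C D) i j = (SUM k:prod_encode ` ({..<n} \<times> {..<m}). ent (kron A B)
  i k * ent (kron C D) k j)" proof (rule ent_times_gen)
  fix k assume k: "k ~: prod_encode ` ({..<n} \<times> {..<m})"
  have "~(fst (prod_decode k) < n & snd (prod_decode k) < m)" proof
   assume "fst (prod_decode k) < n & snd (prod_decode k) < m"
   hence "prod_encode (prod_decode k) : prod_encode ` ({..<n} \<times> {..<m})" by (intro imageI)
    (simp add: mem_Times_iff)
   with k show False by simp
  qed
  hence "ent A ?a (fst (prod_decode k)) * ent B ?b (snd (prod_decode k)) = 0" using bnd_zero[OF n,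
   of ?a "fst (prod_decode k)"] bnd_zero[OF m, of ?b "snd (prod_decode k)"] by auto
  thus "ent (kron A B) i k * ent (kron C D) k j = 0" by (simp add: ent_kron)
 qed auto
 also have "... = (SUM (k,l):{..<n} \<times> {..<m}. (ent A ?a k * ent C k ?c) * (ent B ?b l * ent D
  l ?d))" by (simp add: sum.reindex[OF inj] ent_kron case_prod_beta algebra_simps)
 also have "... = (SUM k<n. ent A ?a k * ent C k ?c) * (SUM l<m. ent B ?b l * ent D l ?d)" by (simp
  add: sum_product sum.cartesian_product)
 also have "... = ent (kron (A * C) (B * D)) i j" by (simp add: ent_kron ent_times_bndl[OF n]
  ent_times_bndl[OF m])
 finally show "ent (kron A B * kron C D) i j = ent (kron (A * C) (B * D)) i j" .
qed

lemma kron_unitm: "kron (unitm c a b) (unitm d a' b') = unitm (c * d) (prod_encode (a, a'))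
 (prod_encode (b, b'))" by (rule fm_eqI) (auto simp: ent_kron ent_unitm)

lemma sum_fm_mult_left: "(SUM x:S. f x) * (A :: 'r::comm_ring_1 fm) = (SUM x:S. f x * A)" by (rule
 rsum)

section \<open>Linear algebra over a field inside a commutative ring\<close>

text \<open>The unit \<open>u\<close> of the field need not be the 1 of the ring: the ring
  constructed at the end is a product and the field sits in a single factor, so \<open>u\<close> is
  only an idempotent there.\<close>

locale subfield_in = fixes K :: "'r::comm_ring_1 set" and u :: 'r assumes K_zero [simp]: "0 : K" and
 K_unit [simp]: "u : K" and K_add [simp]: "x : K ==> y : K ==> x + y : K" and K_uminus [simp]: "x :
 K ==> - x : K" and K_mult [simp]: "x : K ==> y : K ==> x * y : K" and unit_mult [simp]: "x : K ==>
 u * x = x" and unit_nonzero [simp]: "u ~= 0" and K_inverse: "x : K ==> x ~= 0 ==> EX y:K. x * y =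
 u"
begin

lemma mult_unit [simp]: "x : K ==> x * u = x" by (simp add: mult.commute[of x u])

lemma K_diff [simp]: "x : K ==> y : K ==> x - y : K" by (metis K_add K_uminus diff_conv_add_uminus)

lemma K_sum [simp]: "(!!x. x : S ==> f x : K) ==> sum f S : K" by (induction S rule:
 infinite_finite_induct) auto

lemma K_of_nat [simp]: "x : K ==> of_nat n * x : K" by (induction n) (auto simp: distrib_right)

lemma K_mult_eq_0: "x : K ==> y : K ==> (x * y = 0) = (x = 0 | y = 0)" proof (cases "x = 0")
 case False
 assume x: "x : K" and y: "y : K"
 obtain z where "x * z = u" using K_inverse[OF x False] by auto
 hence "x * y = 0 ==> y = 0" by (metis unit_mult[OF y] massoc mult.commute mult_zero_right)
 with False show ?thesis by auto
qed simp

definition MK :: "'r fm set" where "MK = {A. ALL i j. ent A i j : K}"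

lemma MK_zero [simp]: "0 : MK" and MK_add [simp]: "A : MK ==> B : MK ==> A + B : MK" and MK_uminus
 [simp]: "A : MK ==> - A : MK" and MK_diff [simp]: "A : MK ==> B : MK ==> A - B : MK" and MK_sm
 [simp]: "c : K ==> A : MK ==> sm c A : MK" and MK_kron [simp]: "A : MK ==> B : MK ==> kron A B :
 MK" and MK_unitm [simp]: "c : K ==> unitm c a b : MK" by (auto simp: MK_def ent_kron ent_unitm)

lemma MK_mult [simp]: "A : MK ==> B : MK ==> A * B : MK" proof -
 assume *: "A : MK" "B : MK"
 obtain n where "bnd A n" using bnd_ex by auto
 thus ?thesis using * by (simp add: MK_def ent_times_bndl)
qed

lemma MK_sum [simp]: "(!!x. x : S ==> f x : MK) ==> sum f S : MK" by (induction S rule: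
 infinite_finite_induct) auto

lemma MK_ent [simp]: "A : MK ==> ent A i j : K" by (simp add: MK_def)

lemma sm_unit [simp]: "A : MK ==> sm u A = A" by (rule fm_eqI) simp

lemma sm_eq_0: "c : K ==> A : MK ==> (sm c A = 0) = (c = 0 | A = 0)" proof
 assume c: "c : K" and A: "A : MK" and *: "sm c A = 0"
 have "c * ent A i j = 0" for i j using arg_cong[OF *, of "%Y. ent Y i j"] by simp
 hence "c ~= 0 ==> ent A i j = ent 0 i j" for i j by (simp add: c A K_mult_eq_0)
 thus "c = 0 | A = 0" using fm_eqI by blast
qed auto

text \<open>Gaussian elimination, one coordinate at a time: a vector with nonzero coordinate
  \<open>i0\<close> serves as pivot and is dropped from the family. This lemma stands in for a
  theory of dimension.\<close>

lemma dependent: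
 assumes "finite I" "finite J" "card I < card J" "!!j i. v j i : K"
 shows "EX c. (ALL j. c j : K) & (EX j:J. c j ~= 0) & (ALL i:I. (SUM j:J. c j * v j i) = 0)" using
  assms proof (induction I arbitrary: J v rule: finite_induct)
 case empty
 then obtain j where "j : J" by (metis card_gt_0_iff card.empty ex_in_conv)
 thus ?case by (intro exI[of _ "%_. u"]) auto
 next case (insert i0 I)
 show ?case proof (cases "ALL j:J. v j i0 = 0")
  case True
  have "card I < card J" using insert by simp
  with insert.IH[of J v] insert.prems(1,3) obtain c where c: "ALL j. c j : K" "EX j:J. c j ~= 0"
   "ALL i:I. (SUM j:J. c j * v j i) = 0" by auto
  thus ?thesis using True by auto
  next case False
  then obtain j0 where j0: "j0 : J" "v j0 i0 ~= 0" by auto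
  obtain y where y: "y : K" "v j0 i0 * y = u" using K_inverse[OF insert.prems(3) j0(2)] by auto
  define w where "w j i = v j i - v j i0 * y * v j0 i" for j i
  have "!!j i. w j i : K" by (simp add: insert.prems(3) y w_def)
  moreover have "card I < card (J - {j0})" using insert j0 by simp
  ultimately obtain c where c: "ALL j. c j : K" "EX j:J - {j0}. c j ~= 0" "ALL i:I. (SUM j:J - {j0}.
   c j * w j i) = 0" using insert.IH[of "J - {j0}" w] insert.prems(1) by auto
  define d where "d j = (if j = j0 then - (SUM j:J - {j0}. c j * v j i0 * y) else c j)" for j
  have expand: "(SUM j:J. d j * v j i) = (SUM j:J - {j0}. c j * w j i)" for i proof -
   have "(SUM j:J. d j * v j i) = d j0 * v j0 i + (SUM j:J - {j0}. d j * v j i)" using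
    insert.prems(1) j0(1) by (simp add: sum.remove)
   also have "(SUM j:J - {j0}. d j * v j i) = (SUM j:J - {j0}. c j * v j i)" by (rule sum.cong)
    (auto simp: d_def)
   finally show ?thesis by (simp add: d_def w_def algebra_simps sum_subtractf lsum)
  qed
  have "w j i0 = 0" for j proof -
   have "v j i0 * y * v j0 i0 = v j i0 * (v j0 i0 * y)" by simp
   thus ?thesis by (simp add: insert.prems(3) y w_def)
  qed
  hence "(SUM j:J. d j * v j i) = 0" if "i : insert i0 I" for i using that c(3) by (auto simp:
   expand)
  moreover have "ALL j. d j : K" by (simp add: c(1) y insert.prems(3) d_def)
  moreover have "EX j:J. d j ~= 0" using c(2) by (auto simp: d_def)
  ultimately show ?thesis by auto
qed qed

text \<open>McCoy's lemma: if \<open>A - A P A\<close> has a generalized inverse then so does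
 \<open>A\<close>.\<close>

lemma generalized_inverse: "A : MK ==> EX B:MK. A * B * A = A" proof (induction "card {i. EX j. ent
 A i j ~= 0}" arbitrary: A rule: less_induct)
 case less
 show ?case proof (cases "A = 0")
  case True
  thus ?thesis by (intro bexI[of _ 0]) auto
  next case False
  then obtain i j where ij: "ent A i j ~= 0" using fm_eqI[of A 0] by auto
  obtain y where y: "y : K" "ent A i j * y = u" using K_inverse[OF MK_ent[OF less.prems] ij] by auto
  define P where "P = unitm y j i"
  define A' where "A' = A - A * P * A"
  have P: "P : MK" by (simp add: y P_def)
  have ent: "ent A' a b = ent A a b - ent A a j * y * ent A i b" for a b proof -
   have "ent (A * P * A) a b = ent A a j * y * ent A i b" by (subst ent_times_gen[of "{i}"]) (auto
    simp: P_def ent_mult_unitm)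
   thus ?thesis by (simp add: A'_def)
  qed
  have row: "ent A' i b = 0" for b by (simp add: y less.prems ent)
  have zero: "ent A' a b = 0" if "ALL j. ent A a j = 0" for a b by (simp add: that ent)
  obtain n where n: "bnd A n" using bnd_ex by auto
  have fin: "finite {i. EX j. ent A i j ~= 0}" by (rule finite_subset[of _ "{..<n}"]) (use n in
   "auto simp: bnd_def")
  have "{i. EX j. ent A' i j ~= 0} \<subset> {i. EX j. ent A i j ~= 0}" using zero row ij by blast
  from psubset_card_mono[OF fin this] obtain B where B: "B : MK" "A' * B * A' = A'" using
   less.hyps[of A'] P less.prems by (auto simp: A'_def)
  \<comment> \<open>This is P + (1 - P A) B (1 - A P), expanded because the ring of finitely
    supported matrices has no unit.\<close>
  let ?B = "P + B - P * A * B - B * A * P + P * A * B * A * P"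
  have "A * ?B * A = A" using B by (simp add: A'_def algebra_simps)
  moreover have "?B : MK" using B P less.prems by simp
  ultimately show ?thesis by auto
qed qed

definition E00 :: "'r fm" where "E00 = unitm u 0 0"

text \<open>A vector is a matrix concentrated in column 0, so that applying an operator to it is
  multiplication in one associative ring.\<close>

definition cols :: "'r fm set" where "cols = {v : MK. v * E00 = v}"

definition vecs :: "'r fm => 'r fm set" where "vecs e = {v : cols. e * v = v}"

lemma E00_MK [simp]: "E00 : MK" and E00_idem [simp]: "E00 * E00 = E00" by (simp_all add: E00_def
 unitm_mult)

lemma colsI: "v : MK ==> v * E00 = v ==> v : cols" and cols_MK: "v : cols ==> v : MK" and cols_E00:
 "v : cols ==> v * E00 = v" by (simp_all add: cols_def)

lemma vecsI: "v : cols ==> e * v = v ==> v : vecs e" and vecs_cols: "v : vecs e ==> v : cols" and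
 vecs_idem: "v : vecs e ==> e * v = v" by (simp_all add: vecs_def)
declare cols_MK [simp] vecs_cols [simp]

lemma vecs_mono: "v : vecs p ==> e * p = p ==> v : vecs e" by (metis vecsI vecs_idem vecs_cols
 massoc)

lemma vecs_E00: "v : vecs e ==> v * E00 = v" by (simp add: cols_E00)

lemma cols_zero [simp]: "0 : cols" and cols_add [simp]: "v : cols ==> w : cols ==> v + w : cols" and
 cols_diff [simp]: "v : cols ==> w : cols ==> v - w : cols" and cols_sm [simp]: "c : K ==> v : cols
 ==> sm c v : cols" and cols_mult [simp]: "A : MK ==> v : cols ==> A * v : cols" and cols_unitm
 [simp]: "c : K ==> unitm c i 0 : cols" by (auto intro!: colsI simp: distrib_right ldiff sm_mult
 massoc cols_E00) (auto simp: E00_def unitm_mult)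

lemma cols_sum [simp]: "(!!x. x : S ==> f x : cols) ==> sum f S : cols" by (induction S rule:
 infinite_finite_induct) auto

lemma vecs_zero [simp]: "0 : vecs e" and vecs_add [simp]: "v : vecs e ==> w : vecs e ==> v + w :
 vecs e" and vecs_diff [simp]: "v : vecs e ==> w : vecs e ==> v - w : vecs e" and vecs_sm [simp]: "c
 : K ==> v : vecs e ==> sm c v : vecs e" by (auto intro!: vecsI simp: distrib_left rdiff sm_mult
 vecs_idem)

lemma vecs_sum [simp]: "(!!x. x : S ==> f x : vecs e) ==> sum f S : vecs e" by (induction S rule:
 infinite_finite_induct) auto

lemma vecs_mult: "A : MK ==> e * A = A ==> v : cols ==> A * v : vecs e" by (rule vecsI) (simp_all
 add: massoc')

lemma cols_ent: "v : cols ==> j ~= 0 ==> ent v i j = 0" by (metis cols_E00 E00_def ent_mult_unitm)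

lemma cols_eqI: "v : cols ==> w : cols ==> (!!i. ent v i 0 = ent w i 0) ==> v = w" by (rule fm_eqI)
 (metis cols_ent)

lemma cols_expand:
 assumes "v : cols" "bnd v n"
 shows "v = (SUM i<n. sm (ent v i 0) (unitm u i 0))" proof (rule cols_eqI[OF assms(1)])
 show "(SUM i<n. sm (ent v i 0) (unitm u i 0)) : cols" using assms(1) by auto
 show "ent v i 0 = ent (SUM i<n. sm (ent v i 0) (unitm u i 0)) i 0" for i using assms by (simp add:
  ent_unitm if_distrib[of "(*) _"] bnd_zero cong: if_cong)
qed

lemma cols_test:
 assumes "A : MK" "B : MK" "A * e = A" "B * e = B" "e : MK" "e * e = e" and "!!v. v : vecs e ==> A *
  v = B * v"
 shows "A = B" proof (rule fm_eqI)
 fix i j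
 have "e * unitm u j 0 : vecs e" by (rule vecs_mult) (use assms in auto)
 hence "A * (e * unitm u j 0) = B * (e * unitm u j 0)" by (rule assms(7))
 hence "ent (A * unitm u j 0) i 0 = ent (B * unitm u j 0) i 0" by (simp add: assms massoc')
 thus "ent A i j = ent B i j" by (simp add: assms ent_mult_unitm)
qed

lemma ent_col: "M * v = (SUM j<n. sm (ent v j 0) (M * unitm u j 0))" if "v : cols" "bnd v n" by
 (subst cols_expand[OF that]) (simp add: lsum sm_mult)

lemma matrix_of_linear:
 assumes e: "e : MK" "e * e = e" and cl: "!!v. v : vecs e ==> ff v : cols" and add: "!!v w. v : vecs
  e ==> w : vecs e ==> ff (v + w) = ff v + ff w" and sm: "!!c v. c : K ==> v : vecs e ==> ff (sm c
  v) = sm c (ff v)"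
 shows "EX M:MK. M * e = M & (ALL v:vecs e. M * v = ff v)" proof -
 obtain n where n: "bnd e n" using bnd_ex by auto
 define M where "M = (SUM j<n. ff (e * unitm u j 0) * unitm u 0 j)"
 have ev: "e * unitm u j 0 : vecs e" for j by (rule vecs_mult) (use e in auto)
 have zero: "ff 0 = 0" using sm[of 0 0] by simp
 have sum: "ff (sum f S) = (SUM x:S. ff (f x))" if "!!x. x : S ==> f x : vecs e" for S and f :: "nat
  => _" using that by (induction S rule: infinite_finite_induct) (auto simp: zero add)
 have MK: "M : MK" by (auto simp: ev cl M_def)
 have *: "M * v = ff v" if v: "v : vecs e" for v proof -
  have bv: "bnd v n" proof -
   have "ent v i j = 0" if "~i < n" for i j proof -
    have "ent v i j = ent (e * v) i j" by (simp add: v vecs_idem)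
    also have "... = 0" using that n by (simp add: ent_times_bndl[OF n] bnd_zero)
    finally show ?thesis .
   qed
   \<comment> \<open>\<open>bnd\<close> bounds the columns as well as the rows, so a vector in
     column 0 needs n > 0; for n = 0 the vector is zero.\<close>
   moreover have "n > 0 | v = 0" using calculation fm_eqI[of v 0] by fastforce
   ultimately show ?thesis using v cols_ent by (auto simp: bnd_def) (metis neq0_conv vecs_cols)
  qed
  have "M * v = (SUM j<n. ff (e * unitm u j 0) * (unitm u 0 j * v))" by (simp add: M_def rsum
   massoc)
  also have "... = (SUM j<n. sm (ent v j 0) (ff (e * unitm u j 0)))" proof (rule sum.cong[OF refl])
   fix j
   have "unitm u 0 j * v = sm (ent v j 0) E00" using v by (intro cols_eqI) (auto simp:
    ent_unitm_mult E00_def ent_unitm)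
   moreover have "ff (e * unitm u j 0) * E00 = ff (e * unitm u j 0)" by (simp add: cl[OF ev[of j]]
    cols_E00)
   ultimately show "ff (e * unitm u j 0) * (unitm u 0 j * v) = sm (ent v j 0) (ff (e * unitm u j
    0))" by (simp add: sm_mult)
  qed
  also have "... = ff (SUM j<n. sm (ent v j 0) (e * unitm u j 0))" using v ev by (subst sum) (auto
   simp: sm)
  also have "(SUM j<n. sm (ent v j 0) (e * unitm u j 0)) = v" using ent_col[OF vecs_cols[OF v] bv,
   of e] v by (simp add: vecs_idem)
  finally show ?thesis .
 qed
 show ?thesis proof (intro bexI[of _ "M * e"] conjI ballI)
  show "M * e * v = ff v" if "v : vecs e" for v by (simp add: that * massoc vecs_idem)
qed (use MK e in "auto simp: massoc") qed

text \<open>Vectors chosen from the images of nonzero orthogonal idempotents are linearly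
  independent: multiplying a relation by one idempotent isolates one term. The bound is what makes
  maximal orthogonal families exist, so it takes the place of finite length.\<close>

lemma orthogonal_idempotents_bound:
 assumes "finite J" "bnd e n" "!!j. j : J ==> p j : MK" "!!j. j : J ==> p j ~= 0" "!!j. j : J ==> e
  * p j = p j" "!!i j. i : J ==> j : J ==> p i * p j = (if i = j then p j else 0)"
 shows "card J <= n" proof (rule ccontr)
 assume "~card J <= n"
 hence c: "card {..<n} < card J" by simp
 have "EX l. p j * unitm u l 0 ~= 0" if "j : J" for j proof (rule ccontr)
  assume *: "\<nexists>l. p j * unitm u l 0 ~= 0"
  have "ent (p j) a b = ent 0 a b" for a b proof -
   have "ent (p j * unitm u b 0) a 0 = 0" using * by simp
   thus ?thesis by (simp add: assms(3)[OF that] ent_mult_unitm)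
  qed
  thus False using assms(4)[OF that] fm_eqI by blast
 qed
 then obtain l where l: "!!j. j : J ==> p j * unitm u (l j) 0 ~= 0" by metis
 define w where "w j = p j * unitm u (l j) 0" for j
 define v where "v j i = (if j : J then ent (w j) i 0 else 0)" for j i
 have wc: "w j : cols" if "j : J" for j by (simp add: that assms(3) w_def)
 have "v j i : K" for j i by (simp add: wc v_def)
 from dependent[OF _ assms(1) c, of v, OF _ this] obtain d where d: "ALL j. d j : K" "EX j:J. d j ~=
  0" "ALL i:{..<n}. (SUM j:J. d j * v j i) = 0" by auto
 have z: "(SUM j:J. sm (d j) (w j)) = 0" (is "?s = 0") proof (rule cols_eqI)
  show "?s : cols" using d wc by auto
  fix i
  show "ent ?s i 0 = ent 0 i 0" proof (cases "i < n")
   case True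
   thus ?thesis using d(3) by (simp add: v_def cong: sum.cong)
   next case False
   have "ent (w j) i 0 = 0" if "j : J" for j proof -
    have "ent (w j) i 0 = ent (e * w j) i 0" by (simp add: assms(5)[OF that] w_def massoc')
    thus ?thesis by (simp add: False ent_times_bndl[OF assms(2)] bnd_zero[OF assms(2)])
   qed
   thus ?thesis by simp
 qed qed simp
 obtain k where k: "k : J" "d k ~= 0" using d by auto
 have "0 = p k * (SUM j:J. sm (d j) (w j))" by (simp add: z)
 also have "... = (SUM j:J. if j = k then sm (d k) (w k) else 0)" unfolding lsum proof (rule
  sum.cong[OF refl])
  fix j assume "j : J"
  thus "p k * sm (d j) (w j) = (if j = k then sm (d k) (w k) else 0)" by (auto simp: assms(6)[OF
   k(1), of j] sm_mult w_def massoc')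
 qed
 also have "... = sm (d k) (w k)" using k assms(1) by simp
 finally have "sm (d k) (w k) = 0" by simp
 thus False using k l d(1) wc by (simp add: sm_eq_0 w_def)
qed

text \<open>A longest family of orthogonal idempotents with image in U has a sum that fixes U
  pointwise: a vector of U that is not fixed would give one more idempotent, vector times
  functional.\<close>

lemma subspace_projection:
 assumes e: "e : MK" "e * e = e" and U: "U <= vecs e" "0 : U" "!!v w. v : U ==> w : U ==> v + w : U"
  "!!c v. c : K ==> v : U ==> sm c v : U"
 shows "EX ka:MK. ka * ka = ka & e * ka = ka & ka * e = ka & vecs ka = U" proof -
 define Q where "Q m p = ((ALL j<m. p j : MK & p j ~= 0 & e * p j = p j & p j * e = p j & (ALL
  v:cols. p j * v : U) & (ALL i<m. p j * p i = (if i = j then p i else 0))))" for m :: nat and p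
 obtain n where n: "bnd e n" using bnd_ex by auto
 have bound: "m <= n" if Qm: "EX p. Q m p" for m proof -
  obtain p where p: "Q m p" using Qm by auto
  have "card {..<m} <= n" by (rule orthogonal_idempotents_bound[OF _ n, of _ p]) (use p in "auto
   simp: Q_def")
  thus ?thesis by simp
 qed
 have "EX p. Q 0 p" by (simp add: Q_def)
 from GreatestI_nat[of "%m. EX p. Q m p", OF this bound] obtain m p where p: "Q m p" and m: "m =
  (GREATEST m. EX p. Q m p)" by auto
 have max: "m' <= m" if "EX p. Q m' p" for m' unfolding m using Greatest_le_nat[of "%m. EX p. Q m
  p", OF that bound]
 .
 define q where "q = (SUM j<m. p j)"
 have pj: "p j : MK" "p j ~= 0" "e * p j = p j" "p j * e = p j" "v : cols ==> p j * v : U" "i < m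
  ==> p j * p i = (if i = j then p i else 0)" if "j < m" for j i v using p that by (auto simp:
  Q_def)
 have q: "q : MK" by (auto simp: pj(1) q_def intro!: MK_sum)
 have qp: "q * p i = p i" "p i * q = p i" if "i < m" for i by (auto simp: pj(6) that q_def lsum
  rsum)
 have qq: "q * q = q" proof -
  have "q * q = (SUM i<m. q * p i)" by (subst (2) q_def) (rule lsum)
  also have "... = (SUM i<m. p i)" by (rule sum.cong) (auto simp: qp)
  also have "... = q" by (simp add: q_def)
  finally show ?thesis .
 qed
 have eq: "e * q = q" "q * e = q" by (auto simp: pj(3,4) q_def lsum rsum)
 have Usum: "(SUM j<k. f j) : U" if "!!j. j < k ==> f j : U" for k and f :: "nat => _" using that by
  (induction k) (auto simp: U)
 have qU: "q * v : U" if "v : cols" for v unfolding q_def rsum using pj(5)[OF _ that] by (intro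
  Usum) auto
 have fix_: "q * v = v" if v: "v : U" for v proof (rule ccontr)
  assume ne: "q * v ~= v"
  define w where "w = v - q * v"
  have vc: "v : cols" using v U(1) by auto
  have "w = v + sm (- u) (q * v)" by (simp add: q vc w_def sm_minus_left)
  hence wU: "w : U" using v qU[OF vc] U by simp
  hence wv: "w : vecs e" using U(1) by auto
  have qw: "q * w = 0" by (simp add: w_def rdiff massoc' qq)
  have "w ~= 0" using ne by (simp add: w_def)
  then obtain i where i: "ent w i 0 ~= 0" using cols_eqI[of w 0] wv by auto
  obtain y where y: "y : K" "ent w i 0 * y = u" using K_inverse[OF _ i] wv by auto
  \<comment> \<open>A functional that takes the value 1 on w (as \<open>E00\<close>) and vanishes on
    the image of q, so that \<open>w * ff\<close> is an idempotent orthogonal to the family.\<close>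
  define ff where "ff = unitm y 0 i * (e - q)"
  have phi: "ff : MK" by (simp add: y e q ff_def)
  have E0: "E00 * ff = ff" by (simp add: y(1) ff_def massoc' E00_def unitm_mult)
  have "ff * w = unitm y 0 i * w" by (simp add: ff_def massoc ldiff qw vecs_idem[OF wv])
  also have "... = E00" using y wv by (intro cols_eqI) (auto simp: ent_unitm_mult E00_def ent_unitm)
  finally have phiw: "ff * w = E00" .
  have phiq: "ff * q = 0" by (simp add: ff_def massoc ldiff qq eq)
  define r where "r = w * ff"
  have r: "r : MK" using phi wv by (simp add: r_def)
  have wE: "w * E00 = w" using wv by (simp add: vecs_E00)
  have rr: "r * r = r" by (metis r_def massoc phiw wE)
  have rw: "r * w = w" by (simp add: r_def massoc phiw wE)
  have r0: "r ~= 0" using rw \<open>w ~= 0\<close> by auto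
  have rp: "r * p j = 0" if "j < m" for j proof -
   have "r * p j = w * (ff * q) * p j" by (simp add: qp that r_def massoc)
   thus ?thesis by (simp add: phiq)
  qed
  have pr: "p j * r = 0" if "j < m" for j proof -
   have "p j * r = p j * (q * w) * ff" by (simp add: qp(2)[OF that] r_def massoc')
   thus ?thesis by (simp add: qw)
  qed
  have ru: "r * v' : U" if "v' : cols" for v' proof -
   have "ff * v' = sm (ent (ff * v') 0 0) E00" proof (rule cols_eqI)
    show "ent (ff * v') i 0 = ent (sm (ent (ff * v') 0 0) E00) i 0" for i proof -
     have "ent (ff * v') i 0 = ent (E00 * (ff * v')) i 0" by (simp add: massoc' E0)
     thus ?thesis by (auto simp: E00_def ent_unitm_mult ent_unitm)
   qed qed (use phi that in "auto simp: E00_def")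
   hence "r * v' = sm (ent (ff * v') 0 0) w" by (metis r_def massoc sm_mult_right wE)
   thus ?thesis using U(4) wU phi that by simp
  qed
  have "e * r = r" by (simp add: r_def massoc' vecs_idem[OF wv])
  moreover have "r * e = r" by (simp add: e eq r_def ff_def massoc ldiff)
  ultimately have "Q (Suc m) (p(m := r))" by (auto simp: pj r r0 rr rp pr ru Q_def)
  thus False using max[of "Suc m"] by auto
 qed
 have "vecs q = U" proof
  show "vecs q <= U" using qU vecs_idem vecs_cols by (metis subsetI)
  show "U <= vecs q" using fix_ U(1) by (auto intro!: vecsI)
 qed
 thus ?thesis using q qq eq by auto
qed
end

section \<open>Fitting's lemma in an algebra of matrices\<close>

context subfield_in
begin
primrec pw :: "'r fm => 'r fm => nat => 'r fm" where "pw e f 0 = e" | "pw e f (Suc n) = f * pw e f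
 n"

text \<open>A linear relation between the powers of f, solved for its lowest power, reads f^m =
  f^(m+1) h with h a polynomial in f; iterating it produces the projection q onto the part where f
  is invertible. The last conclusion lets an identity x f = x pass to x q = x, which is used for
  projective covers.\<close>

lemma fitting:
 assumes S: "S <= MK" "e : S" "f : S" "!!a b. a : S ==> b : S ==> a + b : S" "!!a b. a : S ==> b : S
  ==> a * b : S" "!!c a. c : K ==> a : S ==> sm c a : S" and e: "!!a. a : S ==> e * a = a" "!!a. a :
  S ==> a * e = a" obtains q h M where "q : S" "h : S" "q * q = q" "q = f * h" "q = h * f" "pw e f M
  * q = pw e f M" "!!x. x * f = x ==> x * q = x" proof -
 have pS: "pw e f n : S" for n by (induction n) (auto simp: S)
 have pa: "pw e f a * pw e f b = pw e f (a + b)" for a b by (induction a) (auto simp: e pS massoc)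
 obtain n where n: "bnd e n" using bnd_ex by auto
 have pMK: "pw e f i : MK" for i using S pS by auto
 \<comment> \<open>There are n^2 + 1 powers but only n^2 entries, since all elements of S live in an
   n by n block.\<close>
 have "card ({..<n} \<times> {..<n}) < card {..n * n}" by simp
 from dependent[OF _ _ this, of "%j (a, b). ent (pw e f j) a b"] pMK obtain c where c: "ALL j. c j :
  K" "EX j:{..n * n}. c j ~= 0" "ALL (a,b):{..<n} \<times> {..<n}. (SUM j<=n * n. c j * ent (pw e f
  j) a b) = 0" by (auto simp: case_prod_beta)
 have z: "(SUM j<=n * n. sm (c j) (pw e f j)) = 0" proof (rule fm_eqI)
  fix a b
  have "ent (pw e f j) a b = 0" if "~(a < n & b < n)" for j proof -
   have *: "pw e f j = e * pw e f j" "pw e f j = pw e f j * e" using e pS by auto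
   show ?thesis proof (cases "a < n")
    case True
    thus ?thesis using that by (subst *(2)) (simp add: ent_times_bndr[OF n] bnd_zero[OF n])
    next case False
    thus ?thesis by (subst *(1)) (simp add: ent_times_bndl[OF n] bnd_zero[OF n])
  qed qed
  thus "ent (SUM j<=n * n. sm (c j) (pw e f j)) a b = ent 0 a b" using c(3) by (cases "a < n & b <
   n") auto
 qed
 define m where "m = (LEAST j. c j ~= 0)"
 have m: "c m ~= 0" unfolding m_def by (rule LeastI_ex) (use c(2) in blast)
 have mle: "m <= n * n" unfolding m_def using c(2) by (meson Least_le atMost_iff order_trans)
 have below: "c j = 0" if "j < m" for j using not_less_Least that by (auto simp: m_def)
 obtain y where y: "y : K" "c m * y = u" using K_inverse m c(1) by auto
 \<comment> \<open>The relation divided by its lowest coefficient, with m + 1 factors f taken out of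
   the remaining terms.\<close>
 define h where "h = (SUM j:{m<..n * n}. sm (- (y * c j)) (pw e f (j - Suc m)))"
 have sumS: "sum g J : S" if "!!x. x : J ==> g x : S" "finite J" for g and J :: "nat set" using
  that(2,1) by (induction J rule: finite_induct) (use S(6)[of 0 e] S in auto)
 have hS: "h : S" unfolding h_def by (rule sumS) (use S c y pS in auto)
 have fm: "pw e f m = pw e f (Suc m) * h" proof -
  have "0 = (SUM j:{m} \<union> {m<..n * n}. sm (c j) (pw e f j))" unfolding z[symmetric] proof
   (rule sum.mono_neutral_right)
   show "ALL i:{..n * n} - ({m} \<union> {m<..n * n}). sm (c i) (pw e f i) = 0" using below by
    (metis DiffE Un_iff atMost_iff greaterThanAtMost_iff insertI1 linorder_neqE_nat sm_zero_left)
  qed (use mle in auto)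
  also have "... = sm (c m) (pw e f m) + (SUM j:{m<..n * n}. sm (c j) (pw e f j))" by simp
  finally have "sm y (sm (c m) (pw e f m)) = sm y (- (SUM j:{m<..n * n}. sm (c j) (pw e f j)))" by
   (metis eq_neg_iff_add_eq_0)
  hence "pw e f m = - sm y (SUM j:{m<..n * n}. sm (c j) (pw e f j))" using y pMK by (simp add:
   mult.commute sm_minus)
  also have "... = (SUM j:{m<..n * n}. sm (- (y * c j)) (pw e f j))" by (simp add: sm_sum sum_negf
   sm_minus_left)
  also have "... = pw e f (Suc m) * h" unfolding h_def lsum proof (rule sum.cong[OF refl])
   fix j assume j: "j : {m<..n * n}"
   hence "pw e f (Suc m) * pw e f (j - Suc m) = pw e f j" unfolding pa by simp
   thus "sm (- (y * c j)) (pw e f j) = pw e f (Suc m) * sm (- (y * c j)) (pw e f (j - Suc m))" by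
    (simp only: sm_mult)
  qed
  finally show ?thesis .
 qed
 have fpw: "f * pw e f j = pw e f j * f" for j using pa[of j "Suc 0"] S(3) by (simp add: e)
 have fh: "f * h = h * f" unfolding h_def lsum rsum by (rule sum.cong) (auto simp: sm_mult fpw)
 have ph: "pw e f j * h = h * pw e f j" for j proof (induction j)
  case (Suc j)
  thus ?case by (simp add: massoc) (simp add: massoc' fh)
 qed (simp add: e hS)
 let ?hp = "pw e h"
 have hpS: "?hp j : S" for j by (induction j) (auto simp: S hS)
 have phj: "pw e f j * ?hp l = ?hp l * pw e f j" for j l proof (induction l)
  case (Suc l)
  have "pw e f j * (h * ?hp l) = h * (pw e f j * ?hp l)" by (metis massoc ph)
  thus ?case by (simp add: Suc massoc)
 qed (simp add: e pS)
 \<comment> \<open>One more than m, so that q has a factor f even for m = 0.\<close>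
 define M where "M = Suc m"
 have fM1: "pw e f M = pw e f (Suc M) * h" by (metis M_def fm pw.simps(2) massoc)
 have step: "pw e f M = pw e f (M + j) * ?hp j" for j proof (induction j)
  case (Suc j)
  have "pw e f (M + Suc j) = pw e f j * pw e f (Suc M)" unfolding pa by (simp add: add.commute)
  hence "pw e f (M + Suc j) * ?hp (Suc j) = pw e f j * (pw e f (Suc M) * h) * ?hp j" by (simp only:
   pw.simps massoc)
  also have "... = pw e f (M + j) * ?hp j" by (simp only: fM1[symmetric] pa) (simp add: add.commute)
  finally show ?case using Suc by simp
 qed (simp add: e pS)
 define q where "q = pw e f M * ?hp M"
 have s: "pw e f M * (pw e f M * ?hp M) = pw e f M" by (subst massoc', subst pa, rule
  step[symmetric])
 have "pw e f M * q = pw e f M" by (simp only: q_def s)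
 moreover have "q * q = q" by (metis q_def massoc phj s)
 moreover have "q : S" by (simp add: q_def S pS hpS)
 moreover have "q = f * (pw e f m * ?hp M)" by (simp add: q_def M_def massoc)
 moreover have "q = (pw e f m * ?hp M) * f" using phj[of "Suc 0" M] S(3) by (simp add: q_def M_def
  massoc e fpw)
 moreover have "x * q = x" if x: "x * f = x" for x proof -
  have xe: "x * e = x" using x S(3) e(2) by (metis massoc)
  have xf: "x * pw e f j = x" for j by (induction j) (auto simp: xe x massoc')
  have "x * h = x" using xf fm by (metis massoc)
  hence "x * ?hp j = x" for j by (induction j) (auto simp: xe massoc')
  thus ?thesis by (simp add: q_def massoc' xf)
 qed
 moreover have "pw e f m * ?hp M : S" by (simp add: S pS hpS)
 ultimately show ?thesis using that by simp
qed
end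

section \<open>Representations by finitely supported matrices\<close>

locale matrix_reps = subfield_in K u + grp?: group G for K :: "'r::comm_ring_1 set" and u :: 'r and
 G :: "('g, 'k) monoid_scheme" + assumes fin_G [simp]: "finite (carrier G)"
begin

text \<open>The matrix of the neutral element is only required to be idempotent, so that submodules
 of a coordinate space are represented without choosing bases.\<close>

definition rep :: "('g => 'r fm) => bool" where "rep rh = ((ALL g:carrier G. rh g : MK) & (ALL
 g:carrier G. ALL h:carrier G. rh (mult G g h) = rh g * rh h))"
abbreviation unt :: "('g => 'r fm) => 'r fm" where "unt rh == rh (one G)"

definition homs :: "('g => 'r fm) => ('g => 'r fm) => 'r fm set" where "homs rh ss = {f : MK. unt ss
 * f = f & f * unt rh = f & (ALL g:carrier G. ss g * f = f * rh g)}"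

text \<open>The relative trace from the trivial subgroup: it turns a merely linear map h into a
  homomorphism without dividing by the order of the group.\<close>

definition tr :: "('g => 'r fm) => ('g => 'r fm) => 'r fm => 'r fm" where "tr rh ss h = (SUM
 g:carrier G. ss g * h * rh (m_inv G g))"

text \<open>By Higman's criterion these are the homomorphisms that factor through a projective
 module.\<close>

definition null :: "('g => 'r fm) => ('g => 'r fm) => 'r fm => bool" where "null rh ss f = (EX h:MK.
 f = tr rh ss h)"

lemma repD: "rep rh ==> g : carrier G ==> rh g : MK" and rep_mult: "rep rh ==> g : carrier G ==> h :
 carrier G ==> rh (mult G g h) = rh g * rh h" by (auto simp: rep_def)

lemma rep_unt [simp]: "rep rh ==> unt rh : MK" and unt_idem [simp]: "rep rh ==> unt rh * unt rh =
 unt rh" and unt_left [simp]: "rep rh ==> g : carrier G ==> unt rh * rh g = rh g" and unt_right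
 [simp]: "rep rh ==> g : carrier G ==> rh g * unt rh = rh g" and rep_inv [simp]: "rep rh ==> g :
 carrier G ==> rh g * rh (m_inv G g) = unt rh" and rep_inv' [simp]: "rep rh ==> g : carrier G ==> rh
 (m_inv G g) * rh g = unt rh" by (auto simp: repD rep_mult[symmetric])

lemma homsI: "f : MK ==> unt ss * f = f ==> f * unt rh = f ==> (!!g. g : carrier G ==> ss g * f = f
 * rh g) ==> f : homs rh ss" by (simp add: homs_def)

lemma homs_MK: "f : homs rh ss ==> f : MK" and homs_left: "f : homs rh ss ==> unt ss * f = f" and
 homs_right: "f : homs rh ss ==> f * unt rh = f" and homs_comm: "f : homs rh ss ==> g : carrier G
 ==> ss g * f = f * rh g" by (auto simp: homs_def)

lemma homs_add: "f : homs rh ss ==> f' : homs rh ss ==> f + f' : homs rh ss" and homs_diff: "f :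
 homs rh ss ==> f' : homs rh ss ==> f - f' : homs rh ss" and homs_zero [simp]: "0 : homs rh ss" and
 homs_sm: "c : K ==> f : homs rh ss ==> sm c f : homs rh ss" by (auto simp: homs_def algebra_simps
 sm_mult)

lemma homs_sum: "(!!x. x : S ==> f x : homs rh ss) ==> sum f S : homs rh ss" by (induction S rule:
 infinite_finite_induct) (auto simp: homs_add)

lemma homs_mult: "f : homs rh ss ==> g : homs ss ta ==> g * f : homs rh ta" proof (rule homsI)
 assume f: "f : homs rh ss" and g: "g : homs ss ta"
 show "g * f : MK" using f g by (simp add: homs_MK)
 show "unt ta * (g * f) = g * f" by (simp only: massoc' homs_left[OF g])
 show "g * f * unt rh = g * f" by (simp only: massoc homs_right[OF f])
 show "ta k * (g * f) = g * f * rh k" if k: "k : carrier G" for k proof -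
  have "ta k * (g * f) = g * (ss k * f)" by (simp only: massoc' homs_comm[OF g k])
  thus ?thesis by (simp only: homs_comm[OF f k] massoc)
qed qed

lemma homs_unt [simp]: "rep rh ==> unt rh : homs rh rh" by (rule homsI) auto

lemma tr_MK: "rep rh ==> rep ss ==> h : MK ==> tr rh ss h : MK" by (auto simp: tr_def repD)

lemma tr_homs: "rep rh ==> rep ss ==> h : MK ==> tr rh ss h : homs rh ss" proof (rule homsI)
 assume *: "rep rh" "rep ss" "h : MK"
 show "unt ss * tr rh ss h = tr rh ss h" "tr rh ss h * unt rh = tr rh ss h" using * by (simp_all
  add: tr_def lsum rsum massoc') (simp add: massoc)
 fix k assume k: "k : carrier G"
 have "ss k * tr rh ss h = (SUM g:carrier G. ss (mult G k g) * h * rh (m_inv G (mult G k g)) * rh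
  k)" unfolding tr_def lsum proof (rule sum.cong[OF refl])
  fix g assume g: "g : carrier G"
  have "rh (m_inv G (mult G k g)) * rh k = rh (m_inv G g)" by (simp add: * k g rep_mult[symmetric]
   inv_mult_group m_assoc)
  thus "ss k * (ss g * h * rh (m_inv G g)) = ss (mult G k g) * h * rh (m_inv G (mult G k g)) * rh k"
   by (simp add: * k g rep_mult massoc)
 qed
 also have "... = (SUM g:carrier G. ss g * h * rh (m_inv G g) * rh k)" by (rule
  sum.reindex_bij_witness[of _ "%g. mult G (m_inv G k) g" "%g. mult G k g"]) (use k in "auto simp:
  m_assoc[symmetric]")
 finally show "ss k * tr rh ss h = tr rh ss h * rh k" by (simp add: tr_def rsum)
qed (simp add: tr_MK)

lemma tr_left: "f : homs ss ta ==> f * tr rh ss h = tr rh ta (f * h)" unfolding tr_def lsum by (rule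
 sum.cong) (auto simp: massoc' homs_comm)

lemma tr_right: "f : homs ka rh ==> tr rh ss h * f = tr ka ss (h * f)" unfolding tr_def rsum by
 (rule sum.cong) (auto simp: massoc homs_comm)

lemma tr_add: "tr rh ss (h + h') = tr rh ss h + tr rh ss h'" and tr_diff: "tr rh ss (h - h') = tr rh
 ss h - tr rh ss h'" and tr_sm: "tr rh ss (sm c h) = sm c (tr rh ss h)" by (simp_all add: tr_def
 algebra_simps sum.distrib sum_subtractf sm_mult sm_sum)

lemma null_homs: "rep rh ==> rep ss ==> null rh ss f ==> f : homs rh ss" by (auto simp: null_def
 tr_homs)

lemma null_zero [simp]: "null rh ss 0" unfolding null_def by (rule bexI[of _ 0]) (auto simp: tr_def)

lemma null_add: "null rh ss f ==> null rh ss f' ==> null rh ss (f + f')" unfolding null_def by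
 (metis MK_add tr_add)

lemma null_diff: "null rh ss f ==> null rh ss f' ==> null rh ss (f - f')" unfolding null_def by
 (metis MK_diff tr_diff)

lemma null_sm: "c : K ==> null rh ss f ==> null rh ss (sm c f)" unfolding null_def by (metis MK_sm
 tr_sm)

lemma null_sum: "(!!x. x : S ==> null rh ss (f x)) ==> null rh ss (sum f S)" by (induction S rule:
 infinite_finite_induct) (auto simp: null_add)

lemma null_left: "f : homs ss ta ==> null rh ss h ==> null rh ta (f * h)" unfolding null_def by
 (metis tr_left MK_mult homs_MK)

lemma null_right: "f : homs ka rh ==> null rh ss h ==> null ka ss (h * f)" unfolding null_def by
 (metis tr_right MK_mult homs_MK)

lemma null_sym: "null rh ss (f - f') ==> null rh ss (f' - f)" using null_diff[of rh ss 0 "f - f'"]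
 by simp

lemma null_cong: "null rh ss (f - f') ==> null rh ss f = null rh ss f'" using null_add[of rh ss "f -
 f'" f'] null_diff[of rh ss f "f - f'"] by auto

lemma null_mult_cong:
 assumes "null rh ss (f - f')" "null ss ta (g - g')" "f' : homs rh ss" "g : homs ss ta"
 shows "null rh ta (g * f - g' * f')" proof -
 show ?thesis using null_add[OF null_left[OF assms(4,1)] null_right[OF assms(3,2)]] by (simp add:
  algebra_simps)
qed

lemma null_sm_unt: "c : K ==> c ~= 0 ==> f : MK ==> null rh ss (sm c f) ==> null rh ss f" proof -
 assume c: "c : K" "c ~= 0" and f: "f : MK" and n: "null rh ss (sm c f)"
 obtain y where y: "y : K" "c * y = u" using K_inverse[OF c] by auto
 show ?thesis using y f null_sm[OF y(1) n] by (simp add: mult.commute)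
qed

definition isor :: "('g => 'r fm) => ('g => 'r fm) => bool" where "isor rh ss = (EX f:homs rh ss. EX
 g:homs ss rh. g * f = unt rh & f * g = unt ss)"

lemma isor_refl: "rep rh ==> isor rh rh" unfolding isor_def by (intro bexI[of _ "unt rh"]) auto

lemma isor_sym: "isor rh ss ==> isor ss rh" by (auto simp: isor_def)

lemma isor_trans:
 assumes "isor rh ss" "isor ss ta"
 shows "isor rh ta" proof -
 obtain f g where fg: "f : homs rh ss" "g : homs ss rh" "g * f = unt rh" "f * g = unt ss" using
  assms(1) by (auto simp: isor_def)
 obtain f' g' where fg': "f' : homs ss ta" "g' : homs ta ss" "g' * f' = unt ss" "f' * g' = unt ta"
  using assms(2) by (auto simp: isor_def)
 have "(g * g') * (f' * f) = g * ((g' * f') * f)" "(f' * f) * (g * g') = f' * ((f * g) * g')" by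
  (simp_all add: massoc)
 hence "(g * g') * (f' * f) = unt rh" "(f' * f) * (g * g') = unt ta" using fg fg' by (simp_all add:
  homs_left)
 thus ?thesis unfolding isor_def using homs_mult fg fg' by blast
qed

definition tens :: "('g => 'r fm) => ('g => 'r fm) => 'g => 'r fm" where "tens rh ss = (%g. kron (rh
 g) (ss g))"

lemma tens_rep [simp]: "rep rh ==> rep ss ==> rep (tens rh ss)" by (simp add: rep_def tens_def
 kron_mult)

lemma tens_homs: "f : homs rh rh' ==> g : homs ss ss' ==> kron f g : homs (tens rh ss) (tens rh'
 ss')" by (auto simp: homs_def tens_def kron_mult)

lemma unt_tens: "unt (tens rh ss) = kron (unt rh) (unt ss)" by (simp add: tens_def)

text \<open>Since f is equivariant, it can be moved inside the sum over the group. Hence null maps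
  form a tensor ideal, which is what allows tensor products to be computed stably.\<close>

lemma tr_kron_left:
 assumes "rep ka" "f : homs ka ka'"
 shows "kron (tr rh ss h) f = tr (tens rh ka) (tens ss ka') (kron h f)" unfolding tr_def
  kron_sum_left proof (rule sum.cong[OF refl])
 fix g assume "g : carrier G"
 hence "ka' g * f * ka (m_inv G g) = f" using assms by (simp add: homs_comm homs_right massoc)
 thus "kron (ss g * h * rh (m_inv G g)) f = tens ss ka' g * kron h f * tens rh ka (m_inv G g)" by
  (simp add: tens_def kron_mult)
qed

lemma tr_kron_right:
 assumes "rep ka" "f : homs ka ka'"
 shows "kron f (tr rh ss h) = tr (tens ka rh) (tens ka' ss) (kron f h)" unfolding tr_def
  kron_sum_right proof (rule sum.cong[OF refl])
 fix g assume "g : carrier G"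
 hence "ka' g * f * ka (m_inv G g) = f" using assms by (simp add: homs_comm homs_right massoc)
 thus "kron f (ss g * h * rh (m_inv G g)) = tens ka' ss g * kron f h * tens ka rh (m_inv G g)" by
  (simp add: tens_def kron_mult)
qed

lemma null_kron_left: "rep ka ==> f : homs ka ka' ==> null rh ss h ==> null (tens rh ka) (tens ss
 ka') (kron h f)" unfolding null_def by (metis tr_kron_left MK_kron homs_MK)

lemma null_kron_right: "rep ka ==> f : homs ka ka' ==> null rh ss h ==> null (tens ka rh) (tens ka'
 ss) (kron f h)" unfolding null_def by (metis tr_kron_right MK_kron homs_MK)
end
context matrix_reps
begin

section \<open>Stable decompositions\<close>

text \<open>An isomorphism of rh with the direct sum of the \<open>ss i\<close> in the stable
  category, written with inclusions f and projections g whose relations hold modulo null maps. No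
  direct sum is ever constructed.\<close>

definition sdecd :: "('g => 'r fm) => 'i set => ('i => 'g => 'r fm) => ('i => 'r fm) => ('i => 'r
 fm) => bool" where "sdecd rh I ss f g = (finite I & rep rh & (ALL i:I. rep (ss i) & f i : homs (ss
 i) rh & g i : homs rh (ss i)) & (ALL i:I. ALL j:I. null (ss j) (ss i) (g i * f j - (if i = j then
 unt (ss i) else 0))) & null rh rh ((SUM i:I. f i * g i) - unt rh))"

definition sdec :: "('g => 'r fm) => 'i set => ('i => 'g => 'r fm) => bool" where "sdec rh I ss =
 (EX f g. sdecd rh I ss f g)"

lemma sdecdD:
 assumes "sdecd rh I ss f g"
 shows "finite I" "rep rh" "i : I ==> rep (ss i)" "i : I ==> f i : homs (ss i) rh" "i : I ==> g i :
  homs rh (ss i)" "i : I ==> j : I ==> null (ss j) (ss i) (g i * f j - (if i = j then unt (ss i)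
  else 0))" "null rh rh ((SUM i:I. f i * g i) - unt rh)" using assms by (auto simp: sdecd_def)

lemma sdecd_left:
 assumes "sdecd rh I ss f g" "x : homs rh ta"
 shows "null rh ta ((SUM i:I. (x * f i) * g i) - x)" proof -
 show ?thesis using homs_right[OF assms(2)] null_left[OF assms(2) sdecdD(7)[OF assms(1)]] by (simp
  add: rdiff lsum massoc)
qed

lemma sdecd_right:
 assumes "sdecd rh I ss f g" "x : homs ta rh"
 shows "null ta rh ((SUM i:I. f i * (g i * x)) - x)" proof -
 show ?thesis using homs_left[OF assms(2)] null_right[OF assms(2) sdecdD(7)[OF assms(1)]] by (simp
  add: ldiff rsum massoc)
qed

lemma sdecd_trans:
 assumes d: "sdecd rh I ss f g" and d': "!!i. i : I ==> sdecd (ss i) (J i) (ta i) (f' i) (g' i)"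
 shows "sdecd rh (Sigma I J) (%(i, j). ta i j) (%(i, j). f i * f' i j) (%(i, j). g' i j * g i)"
  proof -
 have "null (ta k l) (ta i j) (g' i j * g i * (f k * f' k l) - (if (i, j) = (k, l) then unt (ta i j)
  else 0))" if i: "i : I" and j: "j : J i" and k: "k : I" and l: "l : J k" for i j k l proof -
  let ?x = "g i * f k - (if i = k then unt (ss i) else 0)"
  have n: "null (ta k l) (ta i j) (g' i j * (?x * f' k l))" by (rule null_left[OF sdecdD(5)[OF d'[OF
   i] j] null_right[OF sdecdD(4)[OF d'[OF k] l] sdecdD(6)[OF d i k]]])
  show ?thesis proof (cases "i = k")
   case True
   have ff: "unt (ss i) * f' i l = f' i l" using sdecdD(4)[OF d'[OF k] l] True by (simp add:
    homs_left)
   have "null (ta k l) (ta i j) (g' i j * (?x * f' k l) + (g' i j * f' i l - (if j = l then unt (ta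
    i j) else 0)))" using sdecdD(6)[OF d'[OF i] j, of l] l True n by (intro null_add) auto
   moreover have "g' i j * (?x * f' k l) = g' i j * g i * (f k * f' k l) - g' i j * f' i l" using
    True ff by (simp add: ldiff rdiff massoc)
   ultimately show ?thesis using True by simp
   next case False
   thus ?thesis using n by (simp add: massoc)
 qed qed
 moreover have "null rh rh ((SUM (i, j):Sigma I J. f i * f' i j * (g' i j * g i)) - unt rh)" proof -
  have fin: "finite I" "!!i. i : I ==> finite (J i)" using sdecdD(1) d d' by blast+
  have "null rh rh (SUM i:I. f i * (((SUM j:J i. f' i j * g' i j) - unt (ss i)) * g i))" by (intro
   null_sum null_left[OF sdecdD(4)[OF d]] null_right[OF sdecdD(5)[OF d]] sdecdD(7)[OF d'])
  from null_add[OF this sdecdD(7)[OF d]] have "null rh rh ((SUM i:I. f i * (((SUM j:J i. f' i j * g'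
   i j) - unt (ss i)) * g i)) + ((SUM i:I. f i * g i) - unt rh))"
  .
  moreover have "(SUM i:I. f i * (((SUM j:J i. f' i j * g' i j) - unt (ss i)) * g i)) = (SUM (i,
   j):Sigma I J. f i * f' i j * (g' i j * g i)) - (SUM i:I. f i * g i)" proof -
   have "f i * (((SUM j:J i. f' i j * g' i j) - unt (ss i)) * g i) = (SUM j:J i. f i * f' i j * (g'
    i j * g i)) - f i * g i" if "i : I" for i by (simp add: homs_left[OF sdecdD(5)[OF d that]] ldiff
    rdiff lsum rsum massoc)
   thus ?thesis by (simp add: fin sum_subtractf[symmetric] sum.Sigma[symmetric])
  qed
  ultimately show ?thesis by simp
 qed
 ultimately show ?thesis unfolding sdecd_def proof (intro conjI ballI, goal_cases)
  case 1
  show ?case using sdecdD(1) d d' by (metis finite_SigmaI)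
  next case 2
  show ?case by (rule sdecdD(2)[OF d])
  next case (3 x)
  thus ?case using sdecdD(3) d' by fastforce
  next case (4 x)
  thus ?case using homs_mult sdecdD(4)[OF d] sdecdD(4)[OF d'] by fastforce
  next case (5 x)
  thus ?case using homs_mult sdecdD(5)[OF d] sdecdD(5)[OF d'] by fastforce
  next case (6 x y)
  obtain i j k l where "x = (i, j)" "y = (k, l)" by fastforce
  thus ?case using 6(1)[of i j k l] 6(3,4) by auto
  next case 7
  thus ?case by (simp add: case_prod_beta)
qed qed

lemma sdec_trans:
 assumes "sdec rh I ss" "!!i. i : I ==> sdec (ss i) (J i) (ta i)"
 shows "sdec rh (Sigma I J) (%(i, j). ta i j)" proof -
 obtain f g where d: "sdecd rh I ss f g" using assms(1) by (auto simp: sdec_def)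
 have "ALL i:I. EX f' g'. sdecd (ss i) (J i) (ta i) f' g'" using assms(2) by (auto simp: sdec_def)
 then obtain f' g' where "!!i. i : I ==> sdecd (ss i) (J i) (ta i) (f' i) (g' i)" by metis
 from sdecd_trans[OF d this] show ?thesis by (auto simp: sdec_def)
qed

lemma sdec_reindex:
 assumes "sdec rh I ss" "bij_betw ff J I"
 shows "sdec rh J (%j. ss (ff j))" proof -
 obtain f g where d: "sdecd rh I ss f g" using assms(1) by (auto simp: sdec_def)
 have inj: "inj_on ff J" and im: "!!j. j : J ==> ff j : I" using assms(2) by (auto simp:
  bij_betw_def)
 have "finite J" using assms(2) sdecdD(1)[OF d] by (simp add: bij_betw_finite)
 moreover have "(SUM j:J. f (ff j) * g (ff j)) = (SUM i:I. f i * g i)" by (rule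
  sum.reindex_bij_betw[OF assms(2)])
 moreover have "null (ss (ff j)) (ss (ff i)) (g (ff i) * f (ff j) - (if i = j then unt (ss (ff i))
  else 0))" if "i : J" "j : J" for i j using sdecdD(6)[OF d im[OF that(1)] im[OF that(2)]] that inj
  by (simp add: inj_on_eq_iff)
 ultimately have "sdecd rh J (%j. ss (ff j)) (%j. f (ff j)) (%j. g (ff j))" using d im by (auto
  simp: sdecd_def)
 thus ?thesis by (auto simp: sdec_def)
qed

lemma sdec_isor:
 assumes "isor rh ss" "rep rh" "rep ss"
 shows "sdec rh {i} (%_. ss)" proof -
 obtain f g where "f : homs rh ss" "g : homs ss rh" "g * f = unt rh" "f * g = unt ss" using assms(1)
  by (auto simp: isor_def)
 hence "sdecd rh {i} (%_. ss) (%_. g) (%_. f)" by (simp add: assms sdecd_def)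
 thus ?thesis by (auto simp: sdec_def)
qed

lemma sdec_tens_left:
 assumes "sdec rh I ss" "rep ka"
 shows "sdec (tens rh ka) I (%i. tens (ss i) ka)" proof -
 obtain f g where d: "sdecd rh I ss f g" using assms(1) by (auto simp: sdec_def)
 have e: "unt ka : homs ka ka" using assms by simp
 have "null (tens (ss j) ka) (tens (ss i) ka) (kron (g i) (unt ka) * kron (f j) (unt ka) - (if i = j
  then unt (tens (ss i) ka) else 0))" if "i : I" "j : I" for i j using null_kron_left[OF assms(2) e
  sdecdD(6)[OF d that]] assms(2) by (simp add: kron_mult kron_diff_left unt_tens split: if_splits)
 moreover have "null (tens rh ka) (tens rh ka) ((SUM i:I. kron (f i) (unt ka) * kron (g i) (unt ka))
  - unt (tens rh ka))" using null_kron_left[OF assms(2) e sdecdD(7)[OF d]] assms(2) by (simp add: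
  kron_mult kron_diff_left unt_tens kron_sum_left)
 ultimately have "sdecd (tens rh ka) I (%i. tens (ss i) ka) (%i. kron (f i) (unt ka)) (%i. kron (g
  i) (unt ka))" using d assms(2) by (auto simp: sdecd_def tens_homs)
 thus ?thesis by (auto simp: sdec_def)
qed

lemma sdec_tens_right:
 assumes "sdec rh I ss" "rep ka"
 shows "sdec (tens ka rh) I (%i. tens ka (ss i))" proof -
 obtain f g where d: "sdecd rh I ss f g" using assms(1) by (auto simp: sdec_def)
 have e: "unt ka : homs ka ka" using assms by simp
 have "null (tens ka (ss j)) (tens ka (ss i)) (kron (unt ka) (g i) * kron (unt ka) (f j) - (if i = j
  then unt (tens ka (ss i)) else 0))" if "i : I" "j : I" for i j using null_kron_right[OF assms(2) e
  sdecdD(6)[OF d that]] assms(2) by (simp add: kron_mult kron_diff_right unt_tens split: if_splits)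
 moreover have "null (tens ka rh) (tens ka rh) ((SUM i:I. kron (unt ka) (f i) * kron (unt ka) (g i))
  - unt (tens ka rh))" using null_kron_right[OF assms(2) e sdecdD(7)[OF d]] assms(2) by (simp add:
  kron_mult kron_diff_right unt_tens kron_sum_right)
 ultimately have "sdecd (tens ka rh) I (%i. tens ka (ss i)) (%i. kron (unt ka) (f i)) (%i. kron (unt
  ka) (g i))" using d assms(2) by (auto simp: sdecd_def tens_homs)
 thus ?thesis by (auto simp: sdec_def)
qed

section \<open>Stable bricks and multiplicities\<close>

text \<open>Besides stable orthogonality and scalar stable endomorphisms, the last clause excludes
  nonzero projective summands: the image of a null idempotent would be one. It is the clause that
  turns stable statements into genuine ones.\<close>

definition bricks :: "'t set => ('t => 'g => 'r fm) => bool" where "bricks T W = ((ALL t:T. rep (W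
 t) & ~null (W t) (W t) (unt (W t)) & (ALL f:homs (W t) (W t). EX c:K. null (W t) (W t) (f - sm c
 (unt (W t)))) & (ALL s:T. s ~= t --> (ALL f:homs (W t) (W s). null (W t) (W s) f)) & (ALL q:homs (W
 t) (W t). q * q = q --> null (W t) (W t) q --> q = 0)))"

lemma bricksD:
 assumes "bricks T W" "t : T"
 shows "rep (W t)" "~null (W t) (W t) (unt (W t))" "f : homs (W t) (W t) ==> EX c:K. null (W t) (W
  t) (f - sm c (unt (W t)))" "s : T ==> s ~= t ==> h : homs (W t) (W s) ==> null (W t) (W s) h" "q :
  homs (W t) (W t) ==> q * q = q ==> null (W t) (W t) q ==> q = 0" using assms by (auto simp:
  bricks_def)

text \<open>Stable homomorphisms from \<open>W t\<close> to rh are spanned by the inclusions of the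
  copies of \<open>W t\<close>, whereas the \<open>f j\<close> are stably independent because the
  \<open>g j\<close> are dual to them.\<close>

lemma brick_count_le:
 assumes b: "bricks T W" and d: "sdecd rh I (%i. W (a i)) F Gm" "a ` I <= T" and t: "t : T" and J:
  "finite J" "!!j. j : J ==> f j : homs (W t) rh" "!!j. j : J ==> g j : homs rh (W t)" "!!i j. i : J
  ==> j : J ==> null (W t) (W t) (g i * f j - (if i = j then unt (W t) else 0))"
 shows "card J <= card {i:I. a i = t}" proof (rule ccontr)
 let ?e = "unt (W t)" and ?I = "{i:I. a i = t}"
 assume "~card J <= card ?I"
 hence c: "card ?I < card J" by simp
 have "EX c:K. j : J --> l : ?I --> null (W t) (W t) (Gm l * f j - sm c ?e)" for j l proof (cases "j
  : J & l : ?I")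
  case True
  thus ?thesis using homs_mult[OF J(2)[of j] sdecdD(5)[OF d(1), of l]] bricksD(3)[OF b t] by simp
 qed (auto intro: bexI[of _ 0])
 hence "EX v. ALL j l. v j l : K & (j : J --> l : ?I --> null (W t) (W t) (Gm l * f j - sm (v j l)
  ?e))" by (intro allI choice) blast
 then obtain v where v: "!!j l. v j l : K" "!!j l. j : J ==> l : ?I ==> null (W t) (W t) (Gm l * f j
  - sm (v j l) ?e)" by auto
 have "finite ?I" using sdecdD(1)[OF d(1)] by simp
 \<comment> \<open>The composites \<open>Gm l * f j\<close> with \<open>a l = t\<close> are scalars
   modulo null maps. With more j than l, some combination of the \<open>f j\<close> is stably killed
   by all these projections; the projections to other bricks kill it anyway.\<close>
 from dependent[OF this J(1) c, of v, OF v(1)] obtain x where x: "ALL j. x j : K" "EX j:J. x j ~= 0"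
  "ALL l:?I. (SUM j:J. x j * v j l) = 0" by auto
 define y where "y = (SUM j:J. sm (x j) (f j))"
 have y: "y : homs (W t) rh" unfolding y_def by (intro homs_sum homs_sm) (use x J in auto)
 have Gy: "null (W t) (W (a l)) (Gm l * y)" if l: "l : I" for l proof (cases "a l = t")
  case True
  have "null (W t) (W t) (SUM j:J. sm (x j) (Gm l * f j - sm (v j l) ?e))" using x True l by (intro
   null_sum null_sm v(2)) auto
  moreover have "(SUM j:J. sm (x j) (Gm l * f j - sm (v j l) ?e)) = Gm l * y" proof -
   have "(SUM j:J. sm (x j) (Gm l * f j - sm (v j l) ?e)) = Gm l * y - sm (SUM j:J. x j * v j l) ?e"
    by (simp add: fm_eqI rsum y_def lsum sm_mult sm_diff sum_subtractf)
   thus ?thesis using x(3) True l by simp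
  qed
  ultimately show ?thesis using True by simp
  next case False
  show ?thesis by (rule bricksD(4)[OF b t]) (use False l d(2) homs_mult[OF y sdecdD(5)[OF d(1) l]]
   in auto)
 qed
 have ny: "null (W t) rh y" proof -
  have "null (W t) rh (SUM i:I. F i * (Gm i * y))" by (intro null_sum null_left[OF sdecdD(4)[OF
   d(1)]] Gy)
  thus ?thesis using null_cong[OF sdecd_right[OF d(1) y]] by simp
 qed
 obtain k where k: "k : J" "x k ~= 0" using x by auto
 have "null (W t) (W t) (SUM j:J. sm (x j) (g k * f j - (if k = j then ?e else 0)))" using x J(4) k
  by (intro null_sum null_sm) auto
 moreover have "(SUM j:J. sm (x j) (g k * f j - (if k = j then ?e else 0))) = g k * y - sm (x k) ?e"
  proof -
  have "(SUM j:J. sm (x j) (if k = j then ?e else 0)) = (SUM j:J. if k = j then sm (x j) ?e else 0)"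
   by (rule sum.cong) auto
  also have "... = sm (x k) ?e" using k J(1) by simp
  finally show ?thesis by (simp add: y_def lsum sm_mult sm_diff sum_subtractf)
 qed
 ultimately have "null (W t) (W t) (g k * y - sm (x k) ?e)" by simp
 hence "null (W t) (W t) (sm (x k) ?e)" using null_left[OF J(3)[OF k(1)] ny] null_cong by auto
 hence "null (W t) (W t) ?e" by (rule null_sm_unt[rotated 3]) (use x k bricksD(1)[OF b t] in auto)
 thus False using bricksD(2)[OF b t] by simp
qed

text \<open>Modulo null maps x is a nonzero scalar, hence so are its powers. As a power of x
  annihilates the complement 1 - q of its Fitting idempotent, 1 - q is null, and a brick has no
  nonzero null idempotent.\<close>

lemma brick_hom_iso:
 assumes b: "bricks T W" and t: "t : T" and x: "x : homs (W t) (W t)" "~null (W t) (W t) x" obtains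
  y where "y : homs (W t) (W t)" "x * y = unt (W t)" "y * x = unt (W t)" proof -
 let ?e = "unt (W t)" and ?S = "homs (W t) (W t)"
 note r = bricksD(1)[OF b t]
 obtain c where c: "c : K" "null (W t) (W t) (x - sm c ?e)" using bricksD(3)[OF b t x(1)] by auto
 have c0: "c ~= 0" using c x(2) by auto
 obtain q h M where qh: "q : ?S" "h : ?S" "q * q = q" "q = x * h" "q = h * x" "pw ?e x M * q = pw ?e
  x M" by (rule fitting[of ?S ?e x]) (auto simp: x homs_MK r homs_add homs_mult homs_sm homs_left
  homs_right)
 have pw: "pw ?e x n : ?S & (EX c:K. c ~= 0 & null (W t) (W t) (pw ?e x n - sm c ?e))" for n proof
  (induction n)
  case 0
  show ?case using r by (auto intro!: bexI[of _ u])
  next case (Suc n)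
  then obtain d where d: "d : K" "d ~= 0" "null (W t) (W t) (pw ?e x n - sm d ?e)" by auto
  have "null (W t) (W t) (x * pw ?e x n - sm c ?e * sm d ?e)" by (simp add: null_mult_cong[OF d(3)
   c(2)] x r d homs_sm)
  hence "null (W t) (W t) (pw ?e x (Suc n) - sm (c * d) ?e)" by (simp add: r sm_mult mult.commute)
  moreover have "c * d ~= 0" by (simp add: c c0 d K_mult_eq_0)
  moreover have "pw ?e x (Suc n) : ?S" using homs_mult[OF _ x(1)] Suc by simp
  ultimately show ?case using c d by auto
 qed
 obtain d where d: "d : K" "d ~= 0" "null (W t) (W t) (pw ?e x M - sm d ?e)" using pw by auto
 let ?p = "?e - q"
 have p: "?p : ?S" using qh r by (simp add: homs_diff)
 have "pw ?e x M * ?p = 0" using qh homs_right[OF conjunct1[OF pw[of M]]] by (simp add: rdiff)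
 hence "null (W t) (W t) (sm d ?p)" using null_sym[OF null_right[OF p d(3), unfolded ldiff]]
  homs_left[OF p] by (simp add: sm_mult)
 hence "null (W t) (W t) ?p" by (rule null_sm_unt[rotated 3]) (use d p homs_MK in auto)
 moreover have "?p * ?p = ?p" using qh r by (simp add: algebra_simps homs_left homs_right)
 ultimately have "?p = 0" using bricksD(5)[OF b t p] by simp
 thus ?thesis using that qh by simp
qed

text \<open>The submodule that is the image of an idempotent \<open>p\<close>, which need not be
 equivariant.\<close>

definition subr :: "('g => 'r fm) => 'r fm => 'g => 'r fm" where "subr rh p = (%g. rh g * p)"

lemma unt_subr [simp]: "p : MK ==> unt rh * p = p ==> unt (subr rh p) = p" by (simp add: subr_def)

lemma subr_rep:
 assumes "rep rh" "p : MK" "p * p = p" "unt rh * p = p" "!!g. g : carrier G ==> p * rh g * p = rh g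
  * p"
 shows "rep (subr rh p)" unfolding rep_def subr_def using assms by (auto simp: repD rep_mult massoc)

lemma subr_rep_hom: "rep rh ==> p : homs rh rh ==> p * p = p ==> rep (subr rh p)" by (rule subr_rep)
 (auto simp: homs_MK homs_left homs_comm[symmetric] massoc)

lemma subr_homs:
 assumes "rep rh" "p : homs rh rh" "p * p = p"
 shows "p : homs (subr rh p) rh" "p : homs rh (subr rh p)" proof -
 have u: "unt (subr rh p) = p" using assms homs_MK homs_left by simp
 have a: "p * (rh g * p) = rh g * p" if "g : carrier G" for g using homs_comm[OF assms(2) that]
  assms(3) by (metis massoc)
 show "p : homs (subr rh p) rh" "p : homs rh (subr rh p)" by (rule homsI; use assms homs_MK
  homs_left homs_right homs_comm a u in "simp add: subr_def massoc")+
qed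

definition primitive :: "('g => 'r fm) => 'r fm => bool" where "primitive rh p = (p : homs rh rh & p
 * p = p & p ~= 0 & (ALL q:homs rh rh. q * q = q --> p * q = q --> q * p = q --> q = 0 | q = p))"

definition orthogonal :: "('g => 'r fm) => 'i set => ('i => 'r fm) => bool" where "orthogonal rh I p
 = (finite I & (ALL i:I. p i : homs rh rh & p i ~= 0) & (ALL i:I. ALL j:I. p i * p j = (if i = j
 then p i else 0)))"

text \<open>The property R selects the families to be maximised: complete ones for primitive
  decompositions, and ones killed by a given map for projective covers.\<close>

lemma orthogonal_max:
 assumes "rep rh" "EX (m::nat) p. orthogonal rh {..<m} p & R m p" obtains m p where "orthogonal rh
  {..<m::nat} p" "R m p" "!!m' p'. orthogonal rh {..<m'} p' ==> R m' p' ==> m' <= m" proof -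
 obtain n where n: "bnd (unt rh) n" using bnd_ex by auto
 have bound: "m <= n" if ex: "EX p. orthogonal rh {..<m} p & R m p" for m :: nat proof -
  obtain p where p: "orthogonal rh {..<m} p" using ex by auto
  have "card {..<m} <= n" by (rule orthogonal_idempotents_bound[OF _ n, of _ p]) (use p in "auto
   simp: orthogonal_def intro: homs_MK homs_left")
  thus ?thesis by simp
 qed
 obtain m0 where m0: "EX p. orthogonal rh {..<m0::nat} p & R m0 p" using assms(2) by auto
 from GreatestI_nat[of "%m. EX p. orthogonal rh {..<m} p & R m p", OF m0 bound] obtain m p where mp:
  "orthogonal rh {..<m} p" "R m p" and m: "m = (GREATEST m. EX p. orthogonal rh {..<m} p & R m p)"
  by auto
 have "m' <= m" if "orthogonal rh {..<m'} p'" "R m' p'" for m' p' using Greatest_le_nat[of "%m. EX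
  p. orthogonal rh {..<m} p & R m p" m' n] bound that by (auto simp: m)
 thus ?thesis using that mp by simp
qed

text \<open>In a longest complete orthogonal family every member is primitive, since a proper
  idempotent below \<open>p i\<close> would allow it to be replaced by two.\<close>

lemma primitive_decomposition:
 assumes r: "rep rh" obtains m :: nat and p where "orthogonal rh {..<m} p" "(SUM i<m. p i) = unt rh"
  "!!i. i < m ==> primitive rh (p i)" proof -
 let ?R = "%(m::nat) p. (SUM i<m. p i) = unt rh"
 have ex: "EX (m::nat) p. orthogonal rh {..<m} p & ?R m p" proof (cases "unt rh = 0")
  case True
  thus ?thesis by (intro exI[of _ 0]) (simp add: orthogonal_def)
  next case False
  thus ?thesis using r by (intro exI[of _ 1] exI[of _ "%_. unt rh"]) (simp add: orthogonal_def)
 qed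
 obtain m p where mp: "orthogonal rh {..<m::nat} p" "?R m p" "!!m' p'. orthogonal rh {..<m'} p' ==>
  ?R m' p' ==> m' <= m" using orthogonal_max[OF r, of ?R, OF ex] by auto
 have pp: "p i : homs rh rh" "p i ~= 0" "j < m ==> p i * p j = (if i = j then p i else 0)" if "i <
  m" for i j using mp(1) that by (auto simp: orthogonal_def)
 have "primitive rh (p i)" if i: "i < m" for i proof (rule ccontr)
  assume "~primitive rh (p i)"
  then obtain q where q: "q : homs rh rh" "q * q = q" "p i * q = q" "q * p i = q" "q ~= 0" "q ~= p
   i" by (auto simp: pp i primitive_def)
  let ?p = "%j. if j = m then p i - q else if j = i then q else p j"
  have qj: "q * p j = 0" "p j * q = 0" if j: "j < m" "j ~= i" for j proof -
   have "q * p j = q * (p i * p j)" "p j * q = (p j * p i) * q" by (simp_all add: massoc') (simp_all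
    add: massoc q)
   thus "q * p j = 0" "p j * q = 0" using pp(3) j i by auto
  qed
  have o: "orthogonal rh {..<Suc m} ?p" unfolding orthogonal_def proof (intro conjI ballI)
   fix j k assume jk: "j : {..<Suc m}" "k : {..<Suc m}"
   show "?p j * ?p k = (if j = k then ?p j else 0)" using jk i pp q qj by (auto simp: less_Suc_eq
    algebra_simps)
   next fix j assume "j : {..<Suc m}"
   thus "?p j : homs rh rh" "?p j ~= 0" using pp q i by (auto intro: homs_diff)
  qed simp
  have "(SUM j<Suc m. ?p j) = (SUM j<m. if j = i then q else p j) + (p i - q)" by simp
  also have "(SUM j<m. if j = i then q else p j) = q + (SUM j:{..<m} - {i}. p j)" using i by (subst
   sum.remove[of _ i]) (auto)
  also have "(SUM j:{..<m} - {i}. p j) = unt rh - p i" by (simp add: i mp(2) sum_diff1)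
  finally have "(SUM j<Suc m. ?p j) = unt rh" by simp
  with mp(3)[OF o] show False by simp
 qed
 thus ?thesis using that mp by simp
qed

text \<open>Because p is not null, it passes non-trivially through some brick, and back again. The
  round trip \<open>x\<close> starting at a brick is not null, so both ends are the same brick and x
  is invertible; this splits the brick off p, and primitivity leaves nothing else.\<close>

lemma brick_summand:
 assumes b: "bricks T W" and d: "sdecd V I (%i. W (a i)) f g" "a ` I <= T" and r: "rep rh" "F : homs
  rh V" "H : homs V rh" "null rh rh (H * F - unt rh)" and p: "primitive rh p" "~null rh rh p"
  obtains t aa bb where "t : T" "aa : homs rh (W t)" "bb : homs (W t) rh" "aa * bb = unt (W t)" "bb
  * aa = p" proof -
 have pp: "p : homs rh rh" "p * p = p" "p ~= 0" using p by (auto simp: primitive_def)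
 have ph: "p * H : homs V rh" "F * p : homs rh V" using pp r homs_mult by auto
 have n1: "null rh rh ((p * H) * (F * p) - p)" proof -
  have "null rh rh (p * ((H * F - unt rh) * p))" by (intro null_left[OF pp(1)] null_right[OF pp(1)]
   r)
  moreover have "p * ((H * F - unt rh) * p) = (p * H) * (F * p) - p" using pp homs_left by (simp
   add: ldiff rdiff massoc)
  ultimately show ?thesis by simp
 qed
 have "EX i:I. ~null rh (W (a i)) (g i * (F * p))" proof (rule ccontr)
  assume "~?thesis"
  hence "null rh V (SUM i:I. f i * (g i * (F * p)))" by (intro null_sum null_left[OF sdecdD(4)[OF
   d(1)]]) auto
  hence "null rh V (F * p)" using null_cong[OF sdecd_right[OF d(1) ph(2)]] by simp
  from null_left[OF ph(1) this] null_cong[OF n1] p(2) show False by simp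
 qed
 then obtain i where i: "i : I" "~null rh (W (a i)) (g i * (F * p))" by auto
 define t where "t = a i"
 define aa where "aa = g i * (F * p)"
 have t: "t : T" using i d by (auto simp: t_def)
 have al: "aa : homs rh (W t)" unfolding aa_def t_def by (rule homs_mult[OF ph(2) sdecdD(5)[OF d(1)
  i(1)]])
 have alp: "aa * p = aa" by (simp add: aa_def massoc pp)
 have aH: "aa * (p * H) : homs V (W t)" using homs_mult[OF ph(1) al] .
 \<comment> \<open>The same expansion of the identity of V, now applied on the way back, so that
   \<open>aa\<close> itself would be null if all these composites were.\<close>
 have "EX j:I. ~null (W (a j)) (W t) ((aa * (p * H)) * f j)" proof (rule ccontr)
  assume "~?thesis"
  hence "null V (W t) (SUM j:I. ((aa * (p * H)) * f j) * g j)" by (intro null_sum null_right[OF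
   sdecdD(5)[OF d(1)]]) auto
  hence "null V (W t) (aa * (p * H))" using null_cong[OF sdecd_left[OF d(1) aH]] by simp
  from null_right[OF ph(2) this] have "null rh (W t) (aa * ((p * H) * (F * p)))" by (simp add:
   massoc)
  moreover have "null rh (W t) (aa * ((p * H) * (F * p)) - aa)" using null_left[OF al n1] by (simp
   add: rdiff alp)
  ultimately have "null rh (W t) aa" using null_cong by simp
  thus False by (simp add: i aa_def t_def)
 qed
 then obtain j where j: "j : I" "~null (W (a j)) (W t) ((aa * (p * H)) * f j)" by auto
 define x where "x = (aa * (p * H)) * f j"
 have xh: "x : homs (W (a j)) (W t)" unfolding x_def by (rule homs_mult[OF sdecdD(4)[OF d(1) j(1)]
  aH])
 have "a j = t" proof (rule ccontr)
  assume "a j ~= t"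
  hence "null (W (a j)) (W t) x" using bricksD(4)[OF b _ t _ xh] j d by auto
  thus False by (simp add: j x_def)
 qed
 then obtain y where y: "y : homs (W t) (W t)" "x * y = unt (W t)" using xh j brick_hom_iso[OF b t]
  by (auto simp: x_def)
 \<comment> \<open>Correcting by the inverse y makes \<open>aa * bb\<close> exactly the identity,
   not just stably.\<close>
 define bb where "bb = p * (H * (f j * y))"
 have be: "bb : homs (W t) rh" unfolding bb_def by (intro homs_mult[OF _ pp(1)] homs_mult[OF _ r(3)]
  homs_mult[OF y(1)]) (use sdecdD(4)[OF d(1) j(1)] \<open>a j = t\<close> in simp)
 have ab: "aa * bb = unt (W t)" using y(2) by (simp add: bb_def x_def massoc)
 have pb: "p * bb = bb" by (simp add: bb_def massoc' pp)
 have ba: "bb * aa : homs rh rh" using homs_mult[OF al be] .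
 have "(bb * aa) * (bb * aa) = bb * (aa * bb) * aa" by (simp add: massoc)
 also have "... = bb * aa" by (simp add: ab homs_right[OF be])
 finally have id: "(bb * aa) * (bb * aa) = bb * aa" .
 have "bb * aa = 0 | bb * aa = p" using p(1) ba id pb alp unfolding primitive_def by (metis massoc)
 moreover have "bb * aa ~= 0" proof
  assume "bb * aa = 0"
  hence "unt (W t) * unt (W t) = 0" by (simp add: ab[symmetric] massoc) (simp add: massoc')
  thus False using bricksD(1,2)[OF b t] by simp
 qed
 ultimately show ?thesis using that t al be ab by simp
qed
end

section \<open>Multiplicity functions of stable decompositions into bricks\<close>

context matrix_reps
begin

text \<open>A definition cannot quantify over an index type, so the indices are numbers;
  \<open>decI\<close> renumbers a decomposition indexed by any other type.\<close>

definition dec :: "'t set => ('t => 'g => 'r fm) => ('g => 'r fm) => ('t => nat) => bool" where "dec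
 T W rh m = ((EX (I::nat set) a. sdec rh I (%i. W (a i)) & a ` I <= T & (ALL t. card {i:I. a i = t}
 = m t)))"

lemma decI:
 assumes "sdec rh I (%i. W (a i))" "a ` I <= T" "!!t. card {i:I. a i = t} = m t"
 shows "dec T W rh m" proof -
 have fin: "finite I" using assms(1) sdecdD(1) by (auto simp: sdec_def)
 obtain ff where ff: "bij_betw ff {0..<card I} I" using ex_bij_betw_nat_finite[OF fin] by auto
 have "card {j:{0..<card I}. a (ff j) = t} = m t" for t proof -
  have "{i : ff ` {0..<card I}. a i = t} = ff ` {j:{0..<card I}. a (ff j) = t}" by auto
  hence "{i:I. a i = t} = ff ` {j:{0..<card I}. a (ff j) = t}" by (simp only:
   bij_betw_imp_surj_on[OF ff])
  moreover have "inj_on ff {j:{0..<card I}. a (ff j) = t}" using ff by (auto simp: bij_betw_def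
   intro: inj_on_subset)
  ultimately show ?thesis using assms(3)[of t] by (simp add: card_image)
 qed
 moreover have "(%j. a (ff j)) ` {0..<card I} <= T" using ff assms(2) by (auto simp: bij_betw_def)
 ultimately show ?thesis unfolding dec_def using sdec_reindex[OF assms(1) ff] by (intro exI[of _
  "{0..<card I}"] exI[of _ "%j. a (ff j)"]) simp
qed

lemma dec_rep: "dec T W rh m ==> rep rh" by (auto simp: dec_def sdec_def sdecd_def)

lemma dec_support: "dec T W rh m ==> t ~: T ==> m t = 0" proof -
 assume "dec T W rh m" "t ~: T"
 then obtain I :: "nat set" and a where *: "a ` I <= T" "card {i:I. a i = t} = m t" by (auto simp:
  dec_def)
 hence "{i:I. a i = t} = {}" using \<open>t ~: T\<close> by auto
 thus ?thesis using *(2) by (metis card.empty)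
qed

lemma sdec_count_le:
 assumes b: "bricks T W" and d: "sdec rh I (%i. W (a i))" "a ` I <= T" and d': "sdec rh J (%j. W (b
  j))" "b ` J <= T" and t: "t : T"
 shows "card {j:J. b j = t} <= card {i:I. a i = t}" proof -
 obtain f g where fg: "sdecd rh I (%i. W (a i)) f g" using d by (auto simp: sdec_def)
 obtain f' g' where fg': "sdecd rh J (%j. W (b j)) f' g'" using d' by (auto simp: sdec_def)
 show ?thesis proof (rule brick_count_le[OF b fg d(2) t, of _ f' g'])
  show "finite {j:J. b j = t}" using sdecdD(1)[OF fg'] by simp
  show "f' j : homs (W t) rh" "g' j : homs rh (W t)" if "j : {j:J. b j = t}" for j using
   sdecdD(4,5)[OF fg', of j] that by auto
  show "null (W t) (W t) (g' i * f' j - (if i = j then unt (W t) else 0))" if "i : {j:J. b j = t}"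
   "j : {j:J. b j = t}" for i j using sdecdD(6)[OF fg', of i j] that by auto
qed qed

lemma dec_unique:
 assumes b: "bricks T W" and d: "dec T W rh m" "dec T W rh m'"
 shows "m = m'" proof
 fix t
 obtain I :: "nat set" and a where I: "sdec rh I (%i. W (a i))" "a ` I <= T" "card {i:I. a i = t} =
  m t" using d(1) by (auto simp: dec_def)
 obtain J :: "nat set" and b' where J: "sdec rh J (%i. W (b' i))" "b' ` J <= T" "card {i:J. b' i =
  t} = m' t" using d(2) by (auto simp: dec_def)
 show "m t = m' t" proof (cases "t : T")
  case True
  thus ?thesis using sdec_count_le[OF b I(1,2) J(1,2) True] sdec_count_le[OF b J(1,2) I(1,2) True]
   I(3) J(3) by simp
  next case False
  thus ?thesis using dec_support d by metis
qed qed

lemma dec_concat: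
 assumes "sdec rh I ss" "!!i. i : I ==> dec T W (ss i) (m i)"
 shows "dec T W rh (%t. SUM i:I. m i t)" proof -
 have fin: "finite I" using assms(1) sdecdD(1) by (auto simp: sdec_def)
 have "ALL i:I. EX J a. sdec (ss i) (J::nat set) (%j. W (a j)) & a ` J <= T & (ALL t. card {j:J. a j
  = t} = m i t)" using assms(2) by (auto simp: dec_def)
 from bchoice[OF this] obtain J where "ALL i:I. EX a. sdec (ss i) (J i::nat set) (%j. W (a j)) & a `
  J i <= T & (ALL t. card {j:J i. a j = t} = m i t)" by auto
 from bchoice[OF this] obtain a where J: "!!i. i : I ==> sdec (ss i) (J i::nat set) (%j. W (a i j))"
  "!!i. i : I ==> a i ` J i <= T" "!!i t. i : I ==> card {j:J i. a i j = t} = m i t" by blast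
 have finJ: "finite (J i)" if "i : I" for i using J(1)[OF that] sdecdD(1) by (auto simp: sdec_def)
 have "sdec rh (Sigma I J) (%x. W (case x of (i, j) => a i j))" proof -
  have "(%x. W (case x of (i, j) => a i j)) = (%(i, j). W (a i j))" by auto
  thus ?thesis using sdec_trans[OF assms(1) J(1)] by simp
 qed
 thus ?thesis proof (rule decI)
  show "(%(i, j). a i j) ` Sigma I J <= T" using J(2) by auto
  fix t
  have "{x : Sigma I J. (case x of (i, j) => a i j) = t} = (SIGMA i:I. {j:J i. a i j = t})" by auto
  thus "card {x : Sigma I J. (case x of (i, j) => a i j) = t} = (SUM i:I. m i t)" using fin finJ
   J(3) by simp
qed qed

lemma brick_isor_eq:
 assumes b: "bricks T W" "s : T" "t : T" "isor (W s) (W t)"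
 shows "s = t" by (metis b(4) isor_def bricksD(4) b(1,2,3) null_left bricksD(2))

lemma primitive_subr_isor:
 assumes r: "rep rh" "p : homs rh rh" "p * p = p" and ab: "aa : homs rh ss" "bb : homs ss rh" "aa *
  bb = unt ss" "bb * aa = p"
 shows "isor (subr rh p) ss" proof -
 have up: "unt (subr rh p) = p" using r homs_MK homs_left by simp
 have pb: "p * bb = bb" by (simp add: ab(4)[symmetric] massoc ab(3) homs_right[OF ab(2)])
 have ap: "aa * p = aa" by (simp add: ab(4)[symmetric] massoc' ab(3) homs_left[OF ab(1)])
 have "aa : homs (subr rh p) ss" proof (rule homsI)
  show "ss g * aa = aa * subr rh p g" if g: "g : carrier G" for g by (metis subr_def massoc
   homs_comm ab(1) g ap)
 qed (use ab homs_MK homs_left ap up in auto)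
 moreover have "bb : homs ss (subr rh p)" proof (rule homsI)
  show "subr rh p g * bb = bb * ss g" if g: "g : carrier G" for g by (simp add: subr_def massoc pb
   homs_comm[OF ab(2) g])
 qed (use ab homs_MK homs_right pb up in auto)
 ultimately show ?thesis using ab up by (auto simp: isor_def)
qed

lemma subr_isor_maps:
 assumes "isor (subr rh p) ss" "rep rh" "p : homs rh rh" "p * p = p" obtains aa bb where "aa : homs
  rh ss" "bb : homs ss rh" "aa * bb = unt ss" "bb * aa = p" proof -
 have up: "unt (subr rh p) = p" using assms homs_MK homs_left by simp
 obtain f g where fg: "f : homs (subr rh p) ss" "g : homs ss (subr rh p)" "g * f = p" "f * g = unt
  ss" using assms(1) up by (auto simp: isor_def)
 have fp: "f * p = f" using homs_right[OF fg(1)] up by simp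
 have pg: "p * g = g" using homs_left[OF fg(2)] up by simp
 note s = subr_homs[OF assms(2-4)]
 show ?thesis using that[of f g] homs_mult[OF s(2) fg(1)] homs_mult[OF fg(2) s(1)] fg fp pg by simp
qed

text \<open>The bridge between stable and genuine summands: each non-null member of a primitive
  decomposition is isomorphic to a brick by \<open>brick_summand\<close>, and the null ones are
  stably invisible. So counting true isomorphisms gives a stable multiplicity function.\<close>

lemma dec_retract_count:
 assumes b: "bricks T W" and V: "dec T W V m" and r: "rep rh" "F : homs rh V" "H : homs V rh" "null
  rh rh (H * F - unt rh)" and o: "orthogonal rh J p" "(SUM j:J. p j) = unt rh" "!!j. j : J ==>
  primitive rh (p j)"
 shows "dec T W rh (%t. if t : T then card {j:J. isor (subr rh (p j)) (W t)} else 0)" proof -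
 obtain I :: "nat set" and a f g where I: "sdecd V I (%i. W (a i)) f g" "a ` I <= T" using V by
  (auto simp: dec_def sdec_def)
 have pj: "p j : homs rh rh" "p j * p j = p j" if "j : J" for j using o(3)[OF that] by (auto simp:
  primitive_def)
 let ?J = "{j:J. ~null rh rh (p j)}"
 let ?Q = "%j (t, aa, bb). t : T & aa : homs rh (W t) & bb : homs (W t) rh & aa * bb = unt (W t) &
  bb * aa = p j"
 have "ALL j:?J. EX z. ?Q j z" proof
  fix j assume "j : ?J"
  hence j: "primitive rh (p j)" "~null rh rh (p j)" using o(3) by auto
  show "EX z. ?Q j z" by (rule brick_summand[OF b I r j]) (auto)
 qed
 from bchoice[OF this] obtain z where z: "ALL j:?J. ?Q j (z j)" by auto
 define t where "t j = fst (z j)" for j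
 define aa where "aa j = fst (snd (z j))" for j
 define bb where "bb j = snd (snd (z j))" for j
 have "ALL j:?J. ?Q j (t j, aa j, bb j)" using z by (simp add: t_def aa_def bb_def)
 hence t: "!!j. j : ?J ==> t j : T" "!!j. j : ?J ==> aa j : homs rh (W (t j))" "!!j. j : ?J ==> bb j
  : homs (W (t j)) rh" "!!j. j : ?J ==> aa j * bb j = unt (W (t j))" "!!j. j : ?J ==> bb j * aa j =
  p j" by auto
 have fin: "finite J" and orth: "!!i j. i : J ==> j : J ==> i ~= j ==> p i * p j = 0" using o(1) by
  (auto simp: orthogonal_def)
 have "sdecd rh ?J (%j. W (t j)) bb aa" unfolding sdecd_def proof (intro conjI ballI)
  fix i j assume ij: "i : ?J" "j : ?J"
  have "aa i * bb j = 0" if ne: "i ~= j" proof -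
   have "aa i * bb j = (unt (W (t i)) * aa i) * (bb j * unt (W (t j)))" using homs_left[OF t(2)[OF
    ij(1)]] homs_right[OF t(3)[OF ij(2)]] by simp
   also have "... = aa i * (p i * p j) * bb j" by (simp only: t(4)[OF ij(1), symmetric] t(4)[OF
    ij(2), symmetric] t(5)[OF ij(1), symmetric] t(5)[OF ij(2), symmetric] massoc)
   finally show ?thesis using orth ij ne by simp
  qed
  thus "null (W (t j)) (W (t i)) (aa i * bb j - (if i = j then unt (W (t i)) else 0))" using t(4)[OF
   ij(1)] by auto
  next
  \<comment> \<open>The identity splits into the members that are bricks and a sum of null
    idempotents.\<close>
  have "(SUM j:J. p j) = (SUM j:?J. bb j * aa j) + (SUM j:J - ?J. p j)" using fin t(5) by (subst
   sum.subset_diff[of ?J]) (auto)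
  hence "(SUM j:?J. bb j * aa j) - unt rh = 0 - (SUM j:J - ?J. p j)" by (simp add: o(2)[symmetric])
  moreover have "null rh rh (0 - (SUM j:J - ?J. p j))" by (intro null_diff null_sum) auto
  ultimately show "null rh rh ((SUM j:?J. bb j * aa j) - unt rh)" by simp
 qed (use fin r t bricksD(1)[OF b] in auto)
 hence "sdec rh ?J (%j. W (t j))" by (auto simp: sdec_def)
 thus ?thesis proof (rule decI)
  show "t ` ?J <= T" using t by auto
  fix s
  show "card {j:?J. t j = s} = (if s : T then card {j:J. isor (subr rh (p j)) (W s)} else 0)" proof
   (cases "s : T")
   case True
   have "(j : ?J & t j = s) = isor (subr rh (p j)) (W s)" if j: "j : J" for j proof
    assume "j : ?J & t j = s"
    thus "isor (subr rh (p j)) (W s)" using primitive_subr_isor[OF r(1) pj[OF j] t(2) t(3) t(4)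
     t(5)] by auto
    next assume i: "isor (subr rh (p j)) (W s)"
    have "~null rh rh (p j)" proof
     assume n: "null rh rh (p j)"
     obtain aa' bb' where ab: "aa' : homs rh (W s)" "bb' : homs (W s) rh" "aa' * bb' = unt (W s)"
      "bb' * aa' = p j" by (rule subr_isor_maps[OF i r(1) pj[OF j]])
     have "null (W s) (W s) (aa' * (p j * bb'))" by (intro null_left[OF ab(1)] null_right[OF ab(2)]
      n)
     moreover have "aa' * (p j * bb') = unt (W s)" proof -
      have "aa' * (p j * bb') = (aa' * bb') * (aa' * bb')" by (simp only: ab(4)[symmetric] massoc)
      thus ?thesis using ab(3) bricksD(1)[OF b True] by simp
     qed
     ultimately show False using bricksD(2)[OF b True] by simp
    qed
    hence jj: "j : ?J" using j by simp
    show "j : ?J & t j = s" using primitive_subr_isor[OF r(1) pj[OF j] t(2)[OF jj] t(3)[OF jj]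
     t(4)[OF jj] t(5)[OF jj]] i isor_sym isor_trans brick_isor_eq[OF b t(1)[OF jj] True] jj by blast
   qed
   hence "{j:?J. t j = s} = {j:J. isor (subr rh (p j)) (W s)}" by auto
   thus ?thesis using True by simp
   next case False
   hence "{j:?J. t j = s} = {}" using t(1) by auto
   thus ?thesis using False by (simp only: if_False card.empty)
qed qed qed

lemma dec_retract:
 assumes "bricks T W" "dec T W V m" "rep rh" "F : homs rh V" "H : homs V rh" "null rh rh (H * F -
  unt rh)" obtains m' where "dec T W rh m'" proof -
 obtain M :: nat and p where p: "orthogonal rh {..<M} p" "(SUM i<M. p i) = unt rh" "!!i. i < M ==>
  primitive rh (p i)" using primitive_decomposition[OF assms(3)] by auto
 show ?thesis by (rule that[OF dec_retract_count[OF assms p(1,2)]]) (use p in auto)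
qed

text \<open>Existence of a decomposition passes to stable summands. Together with uniqueness this
  permits subtracting one known summand from a known total in \<open>dec_tens_cg\<close>.\<close>

lemma dec_summand:
 assumes b: "bricks T W" and d: "sdec rh I ss" and V: "dec T W rh m" and i: "i : I" obtains m' where
  "dec T W (ss i) m'" proof -
 obtain f g where fg: "sdecd rh I ss f g" using d by (auto simp: sdec_def)
 have "null (ss i) (ss i) (g i * f i - unt (ss i))" using sdecdD(6)[OF fg i i] by simp
 from dec_retract[OF b V sdecdD(3)[OF fg i] sdecdD(4,5)[OF fg i] this] show ?thesis using that by
  auto
qed

section \<open>Syzygies\<close>

text \<open>A short exact sequence from \<open>om\<close> via \<open>P\<close> to \<open>rh\<close>
 with linear splittings and projective middle term.\<close>

definition syzd where "syzd om rh P io r qi s t = (rep om & rep rh & rep P & io : homs om P & qi :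
 homs P rh & r : MK & s : MK & t : MK & unt om * r = r & s * unt rh = s & r * io = unt om & qi * s =
 unt rh & io * r + s * qi = unt P & qi * io = 0 & tr P P t = unt P)"

definition syz :: "('g => 'r fm) => ('g => 'r fm) => bool" where "syz om rh = (EX P io r qi s t.
 syzd om rh P io r qi s t)"

text \<open>The outer maps of a morphism of two short exact sequences: f on the quotients, f' on the
  kernels, ff on the projective middle terms. Relating f and f' instead of defining f' from f avoids
  choosing a syzygy functor.\<close>

definition lft where "lft P1 io1 qi1 P2 io2 qi2 f f' = (EX ff:homs P1 P2. qi2 * ff = f * qi1 & ff *
 io1 = io2 * f')"

lemma syzdD:
 assumes "syzd om rh P io r qi s t"
 shows "rep om" "rep rh" "rep P" "io : homs om P" "qi : homs P rh" "r : MK" "s : MK" "t : MK" "unt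
  om * r = r" "s * unt rh = s" "r * io = unt om" "qi * s = unt rh" "io * r + s * qi = unt P" "qi *
  io = 0" "tr P P t = unt P" using assms by (auto simp: syzd_def)

lemma ker_factor:
 assumes d: "syzd om rh P io r qi s t" and ff: "ff : homs ta P" "qi * ff = 0"
 shows "r * ff : homs ta om" "io * (r * ff) = ff" proof -
 note D = syzdD[OF d]
 have "(io * r + s * qi) * ff = ff" using D(13) homs_left[OF ff(1)] by simp
 thus eq: "io * (r * ff) = ff" by (simp add: ff(2) distrib_right massoc)
 show "r * ff : homs ta om" proof (rule homsI)
  show "unt om * (r * ff) = r * ff" by (simp add: D(9) massoc')
  show "r * ff * unt ta = r * ff" by (simp add: massoc homs_right[OF ff(1)])
  fix g assume g: "g : carrier G"
  have "io * (om g * (r * ff)) = P g * (io * (r * ff))" by (simp only: massoc' homs_comm[OF D(4) g])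
  also have "... = io * (r * ff) * ta g" by (simp only: eq homs_comm[OF ff(1) g])
  finally have "r * (io * (om g * (r * ff))) = r * (io * (r * ff * ta g))" by (simp only: massoc)
  hence "unt om * (om g * (r * ff)) = unt om * (r * ff * ta g)" by (simp only: massoc' D(11))
  thus "om g * (r * ff) = r * ff * ta g" by (simp add: D(1,9) g massoc')
qed (use D ff homs_MK in auto) qed
context fixes om1 rh1 P1 io1 r1 qi1 s1 t1 om2 rh2 P2 io2 r2 qi2 s2 t2 assumes d1: "syzd om1 rh1 P1
 io1 r1 qi1 s1 t1" and d2: "syzd om2 rh2 P2 io2 r2 qi2 s2 t2"
begin private lemmas D1 = syzdD[OF d1] and D2 = syzdD[OF d2]

text \<open>A linear lift \<open>s2 * f * qi1\<close> is made equivariant by a trace; the element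
  \<open>t1\<close> of trace one ensures that the result still lifts \<open>f * qi1\<close>.\<close>

lemma lft_ex:
 assumes f: "f : homs rh1 rh2" obtains f' where "f' : homs om1 om2" "lft P1 io1 qi1 P2 io2 qi2 f f'"
  proof -
 define ff where "ff = tr P1 P2 (s2 * f * qi1 * t1)"
 have m: "s2 * f * qi1 * t1 : MK" using D1 D2 f homs_MK by auto
 have ff: "ff : homs P1 P2" unfolding ff_def using D1 D2 m by (intro tr_homs)
 have fp: "f * qi1 : homs P1 rh2" using homs_mult[OF D1(5) f] .
 have "qi2 * ff = tr P1 rh2 (qi2 * s2 * f * qi1 * t1)" unfolding ff_def by (subst tr_left[OF D2(5)])
  (simp add: massoc)
 also have "... = tr P1 rh2 (f * qi1 * t1)" by (simp only: D2(12) homs_left[OF f])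
 also have "... = (f * qi1) * tr P1 P1 t1" by (rule tr_left[OF fp, symmetric])
 finally have pf: "qi2 * ff = f * qi1" by (simp add: D1(15) homs_right[OF fp])
 have "qi2 * (ff * io1) = 0" by (simp only: massoc' pf) (simp add: massoc D1(14))
 from ker_factor[OF d2 homs_mult[OF D1(4) ff] this] ff pf show ?thesis using that[of "r2 * (ff *
  io1)"] by (auto simp: lft_def)
qed

text \<open>A null f lifts to a map th into the second middle term. Subtracting
  \<open>th * qi1\<close> from ff leaves f' unchanged but sends the first middle term into the
  kernel, so f' factors through that projective module.\<close>

lemma lft_null:
 assumes l: "lft P1 io1 qi1 P2 io2 qi2 f f'" and n: "null rh1 rh2 f" and f': "f' : homs om1 om2"
 shows "null om1 om2 f'" proof -
 obtain ff where ff: "ff : homs P1 P2" "qi2 * ff = f * qi1" "ff * io1 = io2 * f'" using l by (auto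
  simp: lft_def)
 obtain h where h: "h : MK" "f = tr rh1 rh2 h" using n by (auto simp: null_def)
 define th where "th = tr rh1 P2 (s2 * h)"
 have th: "th : homs rh1 P2" unfolding th_def using D1 D2 h by (intro tr_homs) auto
 have f: "f : homs rh1 rh2" using null_homs n D1 D2 by simp
 have "qi2 * th = tr rh1 rh2 (unt rh2 * h)" unfolding th_def by (subst tr_left[OF D2(5)]) (simp
  only: D2(12) massoc')
 also have "... = unt rh2 * f" unfolding h by (rule tr_left[symmetric]) (use D2 in simp)
 finally have pt: "qi2 * th = f" by (simp add: homs_left[OF f])
 define ff' where "ff' = ff - th * qi1"
 have ff': "ff' : homs P1 P2" unfolding ff'_def by (intro homs_diff ff homs_mult[OF D1(5) th])
 have "qi2 * ff' = 0" by (simp add: ff'_def rdiff ff massoc' pt)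
 note k = ker_factor[OF d2 ff' this]
 have "(r2 * ff') * io1 = (r2 * io2) * f'" by (simp add: ff'_def ldiff ff massoc D1(14))
 hence "(r2 * ff') * (unt P1 * io1) = f'" by (simp add: D2(11) homs_left[OF f'] homs_left[OF D1(4)])
 moreover have "null P1 P1 (unt P1)" unfolding null_def using D1(8,15) by (intro bexI[of _ t1])
  simp_all
 ultimately show ?thesis using null_left[OF k(1) null_right[OF D1(4)]] by auto
qed

text \<open>The self-injectivity of group algebras: the trace-one element of the second middle term
  extends \<open>io2 * f'\<close> along \<open>io1\<close>, and the extension induces a map on
  quotients.\<close>

lemma lft_descend:
 assumes f': "f' : homs om1 om2" obtains f where "f : homs rh1 rh2" "lft P1 io1 qi1 P2 io2 qi2 f f'"
  proof -
 define ff where "ff = tr P1 P2 (t2 * io2 * f' * r1)"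
 have m: "t2 * io2 * f' * r1 : MK" using D1 D2 f' homs_MK by auto
 have ff: "ff : homs P1 P2" unfolding ff_def using D1 D2 m by (intro tr_homs)
 have fi: "io2 * f' : homs om1 P2" using homs_mult[OF f' D2(4)] .
 have "ff * io1 = tr om1 P2 (t2 * (io2 * f'))" unfolding ff_def by (subst tr_right[OF D1(4)]) (simp
  add: massoc D1(11) homs_right[OF f'])
 also have "... = tr P2 P2 t2 * (io2 * f')" by (rule tr_right[OF fi, symmetric])
 finally have pi: "ff * io1 = io2 * f'" by (simp add: D2(15) homs_left[OF fi])
 define f where "f = qi2 * ff * s1"
 have pp: "qi2 * ff : homs P1 rh2" using homs_mult[OF ff D2(5)] .
 have fp: "f * qi1 = qi2 * ff" proof -
  have "s1 * qi1 = unt P1 - io1 * r1" by (simp add: D1(13) algebra_simps)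
  hence "f * qi1 = qi2 * ff * (unt P1 - io1 * r1)" by (simp add: f_def massoc)
  also have "... = qi2 * ff - qi2 * (ff * io1) * r1" by (simp only: rdiff homs_right[OF pp] massoc')
  also have "qi2 * (ff * io1) = 0" by (simp add: pi massoc' D2(14))
  finally show ?thesis by simp
 qed
 have "f : homs rh1 rh2" proof (rule homsI)
  show "unt rh2 * f = f" by (simp add: f_def massoc' homs_left[OF D2(5)])
  show "f * unt rh1 = f" by (simp add: f_def massoc D1(10))
  fix g assume g: "g : carrier G"
  have "(f * rh1 g) * qi1 = (f * qi1) * P1 g" by (simp only: massoc homs_comm[OF D1(5) g])
  also have "... = rh2 g * (f * qi1)" by (simp only: fp homs_comm[OF pp g])
  also have "... = (rh2 g * f) * qi1" by (simp only: massoc)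
  finally have "(f * rh1 g) * (qi1 * s1) = (rh2 g * f) * (qi1 * s1)" by (simp only: massoc')
  thus "rh2 g * f = f * rh1 g" by (simp add: D1(2) g D1(12) massoc f_def D1(10))
 qed (use D1 D2 ff homs_MK in "auto simp: f_def")
 thus ?thesis using that[of f] ff fp pi by (auto simp: lft_def)
qed
end

lemma lft_mult:
 assumes "lft P1 io1 qi1 P2 io2 qi2 f f'" "lft P2 io2 qi2 P3 io3 qi3 g g'"
 shows "lft P1 io1 qi1 P3 io3 qi3 (g * f) (g' * f')" proof -
 obtain ff where ff: "ff : homs P1 P2" "qi2 * ff = f * qi1" "ff * io1 = io2 * f'" using assms by
  (auto simp: lft_def)
 obtain qs where qs: "qs : homs P2 P3" "qi3 * qs = g * qi2" "qs * io2 = io3 * g'" using assms by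
  (auto simp: lft_def)
 have "qi3 * (qs * ff) = g * f * qi1" "qs * ff * io1 = io3 * (g' * f')" using ff qs by (metis
  massoc)+
 thus ?thesis by (auto simp: lft_def homs_mult[OF ff(1) qs(1)])
qed

lemma lft_diff:
 assumes "lft P1 io1 qi1 P2 io2 qi2 f f'" "lft P1 io1 qi1 P2 io2 qi2 g g'"
 shows "lft P1 io1 qi1 P2 io2 qi2 (f - g) (f' - g')" proof -
 obtain ff where ff: "ff : homs P1 P2" "qi2 * ff = f * qi1" "ff * io1 = io2 * f'" using assms by
  (auto simp: lft_def)
 obtain qs where qs: "qs : homs P1 P2" "qi2 * qs = g * qi1" "qs * io1 = io2 * g'" using assms by
  (auto simp: lft_def)
 show ?thesis unfolding lft_def by (rule bexI[of _ "ff - qs"]) (use ff qs in "auto simp: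
  algebra_simps homs_diff")
qed

lemma lft_zero: "lft P1 io1 qi1 P2 io2 qi2 0 0" unfolding lft_def by (rule bexI[of _ 0]) auto

lemma lft_sum:
 assumes "!!i. i : I ==> lft P1 io1 qi1 P2 io2 qi2 (f i) (f' i)"
 shows "lft P1 io1 qi1 P2 io2 qi2 (sum f I) (sum f' I)" using assms proof (induction I rule:
  infinite_finite_induct)
 case (insert i I)
 have "lft P1 io1 qi1 P2 io2 qi2 (f i - (0 - sum f I)) (f' i - (0 - sum f' I))" using insert by
  (intro lft_diff lft_zero) auto
 thus ?case using insert by simp
qed (simp_all add: lft_zero)

lemma lft_unt:
 assumes d: "syzd om rh P io r qi s t" and c: "c : K"
 shows "lft P io qi P io qi (sm c (unt rh)) (sm c (unt om))" unfolding lft_def using syzdD[OF d] c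
  by (intro bexI[of _ "sm c (unt P)"]) (auto simp: sm_mult homs_left homs_right intro!: homs_sm)

text \<open>If om is projective it is also injective, so the inclusion splits; then the quotient is
  a direct summand of the projective middle term.\<close>

lemma syz_null_unt:
 assumes d: "syzd om rh P io r qi s t" and n: "null om om (unt om)"
 shows "null rh rh (unt rh)" proof -
 note D = syzdD[OF d]
 obtain h where h: "h : MK" "unt om = tr om om h" using n by (auto simp: null_def)
 define th where "th = tr P om (h * r)"
 have th: "th : homs P om" unfolding th_def using D h by (intro tr_homs) auto
 have "th * io = tr om om (h * unt om)" unfolding th_def by (subst tr_right[OF D(4)]) (simp add:
  massoc D(11))
 also have "... = unt om * unt om" using tr_right[OF homs_unt[OF D(1)], of om h] h(2) by simp
 finally have ti: "th * io = unt om" using D(1) by simp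
 define x where "x = unt P - io * th"
 have x: "x : homs P P" unfolding x_def by (intro homs_diff homs_unt D homs_mult[OF th D(4)])
 have xi: "x * io = 0" by (simp add: x_def ldiff massoc ti homs_left[OF D(4)] homs_right[OF D(4)])
 define ss where "ss = x * s"
 have sp: "ss * qi = x" proof -
  have "s * qi = unt P - io * r" by (simp add: D(13) algebra_simps)
  hence "ss * qi = x - (x * io) * r" by (simp add: ss_def massoc rdiff homs_right[OF x])
  thus ?thesis by (simp add: xi)
 qed
 have ss: "ss : homs rh P" proof (rule homsI)
  show "unt P * ss = ss" by (simp add: ss_def massoc' homs_left[OF x])
  show "ss * unt rh = ss" by (simp add: ss_def massoc D(10))
  fix g assume g: "g : carrier G"
  have "(ss * rh g) * qi = (ss * qi) * P g" by (simp only: massoc homs_comm[OF D(5) g])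
  also have "... = (P g * ss) * qi" by (simp only: massoc sp homs_comm[OF x g])
  finally have "(ss * rh g) * (qi * s) = (P g * ss) * (qi * s)" by (simp only: massoc')
  thus "P g * ss = ss * rh g" by (simp add: D(2) g D(12) massoc ss_def D(10))
 qed (use x D homs_MK in "auto simp: ss_def")
 have "qi * ss = (qi - (qi * io) * th) * s" by (simp add: ss_def x_def massoc' rdiff homs_right[OF
  D(5)])
 hence ps: "qi * ss = unt rh" by (simp add: D)
 have "null P P (unt P)" unfolding null_def using D(8,15) by (intro bexI[of _ t]) simp_all
 from null_left[OF D(5) null_right[OF ss this]] show ?thesis by (simp add: homs_left[OF ss] ps)
qed

lemma sdec_syz:
 assumes d: "sdec rh I ss" and s: "syz om rh" "!!i. i : I ==> syz (ss' i) (ss i)"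
 shows "sdec om I ss'" proof -
 obtain f g where fg: "sdecd rh I ss f g" using d by (auto simp: sdec_def)
 note Df = sdecdD[OF fg]
 obtain P io r qi s0 t where sd: "syzd om rh P io r qi s0 t" using s(1) by (auto simp: syz_def)
 have "ALL i:I. EX P io r qi s t. syzd (ss' i) (ss i) P io r qi s t" using s(2) by (auto simp:
  syz_def)
 then obtain Q io' r' qi' s' t' where sd': "!!i. i : I ==> syzd (ss' i) (ss i) (Q i) (io' i) (r' i)
  (qi' i) (s' i) (t' i)" by metis
 have "ALL i:I. EX f':homs (ss' i) om. lft (Q i) (io' i) (qi' i) P io qi (f i) f'" using lft_ex[OF
  sd' sd Df(4)] by metis
 then obtain f' where f': "!!i. i : I ==> f' i : homs (ss' i) om" "!!i. i : I ==> lft (Q i) (io' i)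
  (qi' i) P io qi (f i) (f' i)" by metis
 have "ALL i:I. EX g':homs om (ss' i). lft P io qi (Q i) (io' i) (qi' i) (g i) g'" using lft_ex[OF
  sd sd' Df(5)] by metis
 then obtain g' where g': "!!i. i : I ==> g' i : homs om (ss' i)" "!!i. i : I ==> lft P io qi (Q i)
  (io' i) (qi' i) (g i) (g' i)" by metis
 have "sdecd om I ss' f' g'" unfolding sdecd_def proof (intro conjI ballI)
  fix i j assume ij: "i : I" "j : I"
  have "lft (Q j) (io' j) (qi' j) (Q i) (io' i) (qi' i) (g i * f j - (if i = j then unt (ss i) else
   0)) (g' i * f' j - (if i = j then unt (ss' i) else 0))" using lft_unt[OF sd'[OF ij(1)], of u]
   syzdD[OF sd'[OF ij(1)]] by (intro lft_diff lft_mult[OF f'(2)[OF ij(2)] g'(2)[OF ij(1)]]) (auto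
   simp: lft_zero)
  thus "null (ss' j) (ss' i) (g' i * f' j - (if i = j then unt (ss' i) else 0))" by (rule
   lft_null[OF sd'[OF ij(2)] sd'[OF ij(1)] _ Df(6)[OF ij]]) (use f' g' ij syzdD[OF sd'[OF ij(1)]] in
   "auto intro!: homs_diff homs_mult[of _ _ om]")
  next
  have l: "lft P io qi P io qi ((SUM i:I. f i * g i) - unt rh) ((SUM i:I. f' i * g' i) - unt om)"
   using lft_unt[OF sd, of u] syzdD[OF sd] by (intro lft_diff lft_sum lft_mult[OF g'(2) f'(2)]) auto
  have "(SUM i:I. f' i * g' i) - unt om : homs om om" using f' g' syzdD[OF sd] by (auto intro!:
   homs_diff homs_sum homs_mult)
  thus "null om om ((SUM i:I. f' i * g' i) - unt om)" by (rule lft_null[OF sd sd l Df(7)])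
 qed (use Df f' g' syzdD[OF sd] syzdD[OF sd'] in auto)
 thus ?thesis by (auto simp: sdec_def)
qed

text \<open>Homomorphisms of syzygies come from homomorphisms below by \<open>lft_descend\<close>,
  and nullness goes up by \<open>lft_null\<close>. The absence of projective summands cannot be
  transferred, since a syzygy is only determined up to such summands; it is supplied by projective
  covers.\<close>

lemma bricks_syz:
 assumes b: "bricks T W" and s: "!!t. t : T ==> syz (W' t) (W t)" and np: "!!t q. t : T ==> q : homs
  (W' t) (W' t) ==> q * q = q ==> null (W' t) (W' t) q ==> q = 0"
 shows "bricks T W'" unfolding bricks_def proof (intro ballI conjI impI)
 fix t assume t: "t : T"
 obtain P io r qi s0 t0 where sd: "syzd (W' t) (W t) P io r qi s0 t0" using s[OF t] by (auto simp:
  syz_def)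
 show "rep (W' t)" using syzdD[OF sd] by simp
 show "~null (W' t) (W' t) (unt (W' t))" using syz_null_unt[OF sd] bricksD(2)[OF b t] by auto
 show "EX c:K. null (W' t) (W' t) (f - sm c (unt (W' t)))" if f: "f : homs (W' t) (W' t)" for f
  proof -
  obtain f0 where f0: "f0 : homs (W t) (W t)" "lft P io qi P io qi f0 f" using lft_descend[OF sd sd
   f] by auto
  obtain c where c: "c : K" "null (W t) (W t) (f0 - sm c (unt (W t)))" using bricksD(3)[OF b t
   f0(1)] by auto
  have "null (W' t) (W' t) (f - sm c (unt (W' t)))" by (rule lft_null[OF sd sd lft_diff[OF f0(2)
   lft_unt[OF sd c(1)]] c(2)]) (use f syzdD[OF sd] c in "auto intro!: homs_diff homs_sm")
  thus ?thesis using c by auto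
 qed
 show "null (W' t) (W' t') f" if t': "t' : T" "t' ~= t" and f: "f : homs (W' t) (W' t')" for t' f
  proof -
  obtain P' io' r' qi' s0' t0' where sd': "syzd (W' t') (W t') P' io' r' qi' s0' t0'" using s[OF
   t'(1)] by (auto simp: syz_def)
  obtain f0 where f0: "f0 : homs (W t) (W t')" "lft P io qi P' io' qi' f0 f" using lft_descend[OF sd
   sd' f] by auto
  show ?thesis by (rule lft_null[OF sd sd' f0(2) bricksD(4)[OF b t t' f0(1)] f])
 qed
 show "q = 0" if "q : homs (W' t) (W' t)" "q * q = q" "null (W' t) (W' t) q" for q using np[OF t
  that]
 .
qed

lemma dec_syz:
 assumes "dec T W rh m" "syz om rh" "!!t. t : T ==> syz (W' t) (W t)"
 shows "dec T W' om m" proof -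
 obtain I :: "nat set" and a where I: "sdec rh I (%i. W (a i))" "a ` I <= T" "!!t. card {i:I. a i =
  t} = m t" using assms(1) by (auto simp: dec_def)
 have "sdec om I (%i. W' (a i))" by (rule sdec_syz[OF I(1) assms(2)]) (use assms(3) I(2) in auto)
 thus ?thesis using I(2,3) by (rule decI)
qed

text \<open>Tensoring keeps the sequence linearly split, and the trace-one element tensored with the
  identity shows that the middle term stays projective.\<close>

lemma syz_tens_left:
 assumes "syz om rh" "rep ka"
 shows "syz (tens om ka) (tens rh ka)" proof -
 obtain P io r qi s t where sd: "syzd om rh P io r qi s t" using assms(1) by (auto simp: syz_def)
 note D = syzdD[OF sd]
 let ?e = "unt ka"
 have "tr (tens P ka) (tens P ka) (kron t ?e) = unt (tens P ka)" using tr_kron_left[OF assms(2)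
  homs_unt[OF assms(2)], of P P t] D(15) by (simp add: unt_tens)
 moreover have "kron io ?e * kron r ?e + kron s ?e * kron qi ?e = unt (tens P ka)" by (simp add:
  D(13) assms(2) kron_mult kron_add_left[symmetric] unt_tens)
 ultimately have "syzd (tens om ka) (tens rh ka) (tens P ka) (kron io ?e) (kron r ?e) (kron qi ?e)
  (kron s ?e) (kron t ?e)" by (auto simp: syzd_def D assms(2) tens_homs unt_tens kron_mult)
 thus ?thesis unfolding syz_def by blast
qed

lemma syz_tens_right:
 assumes "syz om rh" "rep ka"
 shows "syz (tens ka om) (tens ka rh)" proof -
 obtain P io r qi s t where sd: "syzd om rh P io r qi s t" using assms(1) by (auto simp: syz_def)
 note D = syzdD[OF sd]
 let ?e = "unt ka"
 have "tr (tens ka P) (tens ka P) (kron ?e t) = unt (tens ka P)" using tr_kron_right[OF assms(2)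
  homs_unt[OF assms(2)], of P P t] D(15) by (simp add: unt_tens)
 moreover have "kron ?e io * kron ?e r + kron ?e s * kron ?e qi = unt (tens ka P)" by (simp add:
  D(13) assms(2) kron_mult kron_add_right[symmetric] unt_tens)
 ultimately have "syzd (tens ka om) (tens ka rh) (tens ka P) (kron ?e io) (kron ?e r) (kron ?e qi)
  (kron ?e s) (kron ?e t)" by (auto simp: syzd_def D assms(2) tens_homs unt_tens kron_mult)
 thus ?thesis unfolding syz_def by blast
qed

section \<open>Iterated syzygies and tensor powers\<close>

primrec syzn :: "nat => ('g => 'r fm) => ('g => 'r fm) => bool" where "syzn 0 om rh = (om = rh)" |
 "syzn (Suc n) om rh = (EX om'. syz om om' & syzn n om' rh)"

lemma syz_rep: "syz om rh ==> rep om" by (auto simp: syz_def syzd_def)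

lemma syzn_rep: "syzn n om rh ==> rep rh ==> rep om" by (cases n) (auto simp: syz_rep)

lemma syzn_trans: "syzn a om rh ==> syzn b rh ta ==> syzn (a + b) om ta" by (induction a arbitrary:
 om) auto

lemma syzn_tens_left: "syzn n om rh ==> rep ka ==> syzn n (tens om ka) (tens rh ka)" by (induction n
 arbitrary: om) (auto intro: syz_tens_left)

lemma syzn_tens_right: "syzn n om rh ==> rep ka ==> syzn n (tens ka om) (tens ka rh)" by (induction
 n arbitrary: om) (auto intro: syz_tens_right)

lemma syzn_tens: "syzn a om rh ==> syzn b om' rh' ==> rep rh ==> rep rh' ==> syzn (a + b) (tens om
 om') (tens rh rh')" using syzn_trans[OF syzn_tens_left[of a om rh om'] syzn_tens_right[of b om' rh'
 rh]] syzn_rep by simp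

text \<open>\<open>E00\<close> acts as the identity of a one-dimensional space with the single index
  0.\<close>

definition triv :: "'g => 'r fm" where "triv = (%_. E00)"

lemma triv_rep [simp]: "rep triv" by (simp add: rep_def triv_def)
primrec tpow :: "('g => 'r fm) => nat => 'g => 'r fm" where "tpow rh 0 = triv" | "tpow rh (Suc n) =
 tens (tpow rh n) rh"

lemma tpow_rep: "rep rh ==> rep (tpow rh n)" by (induction n) auto

text \<open>Each tensor factor contributes its own r steps, one factor being shifted at a time; this
  is the source of the exponent n r of the Heller translate in the theorem.\<close>

lemma syzn_tpow: "syzn r om rh ==> rep rh ==> syzn (n * r) (tpow om n) (tpow rh n)" proof (induction
 n)
 case (Suc n)
 thus ?case using syzn_tens[of "n * r" "tpow om n" "tpow rh n" r om rh] by (simp add: tpow_rep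
  add.commute)
qed simp
end

section \<open>Matrix models of modules\<close>

locale modelled = R?: field R + G?: group G for R :: "('a, 'm) ring_scheme" (structure) and G ::
 "('g, 'k) monoid_scheme" + fixes emb :: "'a => 'r::comm_ring_1" assumes finite_G: "finite (carrier
 G)" and emb_inj: "inj_on emb (carrier R)" and emb_add: "x : carrier R ==> y : carrier R ==> emb (x
 \<oplus> y) = emb x + emb y" and emb_mult: "x : carrier R ==> y : carrier R ==> emb (x \<otimes> y)
 = emb x * emb y"
begin
abbreviation "Gmod == group_module R G"
abbreviation "Ghom == gmod_hom R G"
abbreviation "Gsub == gsubmodule R G"
abbreviation "Giso == gmod_iso R G"
abbreviation "Gfd == fd_module R G"

lemma emb_zero [simp]: "emb \<zero> = 0" using emb_add[of \<zero> \<zero>] by simp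

lemma emb_minus: "x : carrier R ==> emb (\<ominus> x) = - emb x" proof -
 assume x: "x : carrier R"
 have "emb (x \<oplus> \<ominus> x) = emb x + emb (\<ominus> x)" by (simp add: x emb_add)
 thus ?thesis by (simp add: x R.r_neg add_eq_0_iff)
qed
sublocale matrix_reps "emb ` carrier R" "emb \<one>" G proof
 show "x + y : emb ` carrier R" if "x : emb ` carrier R" "y : emb ` carrier R" for x y using that by
  (auto simp: emb_add[symmetric])
 show "x * y : emb ` carrier R" if "x : emb ` carrier R" "y : emb ` carrier R" for x y using that by
  (auto simp: emb_mult[symmetric])
 show "- x : emb ` carrier R" if "x : emb ` carrier R" for x using that by (auto simp:
  emb_minus[symmetric])
 show "emb \<one> * x = x" if "x : emb ` carrier R" for x using that by (auto simp:
  emb_mult[symmetric])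
 show "emb \<one> ~= 0" using inj_on_eq_iff[OF emb_inj, of \<one> \<zero>] by simp
 show "EX y:emb ` carrier R. x * y = emb \<one>" if x: "x : emb ` carrier R" "x ~= 0" for x proof -
  obtain a where a: "a : carrier R" "x = emb a" "a ~= \<zero>" using x emb_zero by blast
  have "a : Units R" by (simp add: a field_Units)
  hence "emb (a \<otimes> inv a) = emb \<one>" "inv a : carrier R" by auto
  thus ?thesis using a by (intro bexI[of _ "emb (inv a)"]) (auto simp: emb_mult)
 qed
 show "0 : emb ` carrier R" by (rule image_eqI[of _ _ \<zero>]) auto
qed (use finite_G in auto)

definition dmb :: "'r => 'a" where "dmb = the_inv_into (carrier R) emb"

lemma dmb_emb [simp]: "a : carrier R ==> dmb (emb a) = a" by (simp add: dmb_def the_inv_into_f_f[OF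
 emb_inj])

lemma emb_dmb [simp]: "x : emb ` carrier R ==> emb (dmb x) = x" and dmb_closed [simp]: "x : emb `
 carrier R ==> dmb x : carrier R" by auto

text \<open>Coordinates are a bijection onto the image of the idempotent, so no basis has to be
  chosen even for submodules.\<close>

definition coords :: "('a, 'b, 'g, 'x) gmodule_scheme => ('g => 'r fm) => ('b => 'r fm) => bool"
 where "coords V rh c = (bij_betw c (carrier V) (vecs (unt rh)) & (ALL x:carrier V. ALL y:carrier V.
 c (add V x y) = c x + c y) & (ALL a:carrier R. ALL x:carrier V. c (smult V a x) = sm (emb a) (c x))
 & (ALL g:carrier G. ALL x:carrier V. c (act V g x) = rh g * c x))"

definition mdl :: "('a, 'b, 'g, 'x) gmodule_scheme => ('g => 'r fm) => bool" where "mdl V rh = (Gmod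
 V & rep rh & (EX c. coords V rh c))"

lemma coordsD:
 assumes "coords V rh c"
 shows "bij_betw c (carrier V) (vecs (unt rh))" "inj_on c (carrier V)" "x : carrier V ==> c x : vecs
  (unt rh)" "v : vecs (unt rh) ==> EX x:carrier V. c x = v" "x : carrier V ==> y : carrier V ==> c
  (add V x y) = c x + c y" "a : carrier R ==> x : carrier V ==> c (smult V a x) = sm (emb a) (c x)"
  "g : carrier G ==> x : carrier V ==> c (act V g x) = rh g * c x" using assms unfolding coords_def
  bij_betw_def by (blast | (metis imageE))+

text \<open>All module laws are pulled back along the injective c, so only closure under the
  operations remains to be supplied.\<close>

lemma coords_group_module:
 assumes r: "rep rh" and c: "coords V rh c" and cl: "zero V : carrier V" "c (zero V) = 0" "!!x y. x
  : carrier V ==> y : carrier V ==> add V x y : carrier V" "!!a x. a : carrier R ==> x : carrier V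
  ==> smult V a x : carrier V" "!!g x. g : carrier G ==> x : carrier V ==> act V g x : carrier V"
 shows "Gmod V" proof -
 note C = coordsD[OF c]
 have eq: "x = y" if "x : carrier V" "y : carrier V" "c x = c y" for x y using C(2) that by (simp
  add: inj_on_eq_iff)
 have "abelian_group V" proof (rule abelian_groupI)
  fix x assume x: "x : carrier V"
  obtain y where "y : carrier V" "c y = 0 - c x" using C(3)[OF x] vecs_diff vecs_zero C(4) by blast
  thus "EX y:carrier V. add V y x = zero V" using x cl by (intro bexI[of _ y] eq) (auto simp: C)
 qed (auto intro!: eq simp: cl C algebra_simps)
 moreover have "c x : MK" if "x : carrier V" for x using C(3)[OF that] by simp
 ultimately have "module R V" by (intro moduleI is_cring) (auto intro!: eq simp: cl C emb_add
  emb_mult sm_add sm_add_left)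
 moreover have "group_module_axioms R G V" unfolding group_module_axioms_def using r by (auto
  intro!: eq simp: cl C rep_mult massoc vecs_idem distrib_left sm_mult)
 ultimately show ?thesis by (intro group_module.intro) auto
qed

lemma coords_zero:
 assumes "Gmod V" "coords V rh c"
 shows "c (zero V) = 0" proof -
 interpret V: group_module R G V by (rule assms)
 have "c (add V (zero V) (zero V)) = c (zero V) + c (zero V)" by (rule coordsD(5)[OF assms(2)]) auto
 thus ?thesis by simp
qed

lemma submodule_closedI:
 assumes "Gmod V" "H <= carrier V" "zero V : H" "!!x y. x : H ==> y : H ==> add V x y : H" "!!a x. a
  : carrier R ==> x : H ==> smult V a x : H"
 shows "submodule H R V" proof -
 interpret V: group_module R G V by (rule assms(1))
 show ?thesis proof (rule V.submoduleI)
  fix x assume x: "x : H"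
  thus "a_inv V x : H" using V.smult_l_minus assms(2) assms(5)[of "\<ominus> \<one>", OF _ x] by
   auto
qed (use assms in auto) qed

lemma gsubmodule_equalizer:
 assumes V: "Gmod V" "coords V rh c" and AB: "A : homs rh ta" "B : homs rh ta"
 shows "Gsub V {x:carrier V. A * c x = B * c x}" proof -
 interpret V: group_module R G V by (rule V)
 note C = coordsD[OF V(2)]
 have "A * (rh g * c x) = B * (rh g * c x)" if "g : carrier G" "A * c x = B * c x" for g x using
  homs_comm[OF AB(1) that(1)] homs_comm[OF AB(2) that(1)] that(2) by (metis massoc)
 thus ?thesis unfolding gsubmodule_def by (intro conjI submodule_closedI[OF V(1)]) (auto simp: C
  V.act_closed coords_zero[OF V] distrib_left sm_mult)
qed

lemma coords_rep:
 assumes "Gmod V" and e: "e : MK" "e * e = e" and bij: "bij_betw c (carrier V) (vecs e)" and add: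
  "!!x y. x : carrier V ==> y : carrier V ==> c (add V x y) = c x + c y" and sml: "!!a x. a :
  carrier R ==> x : carrier V ==> c (smult V a x) = sm (emb a) (c x)"
 shows "EX rh. rep rh & unt rh = e & coords V rh c" proof -
 interpret V: group_module R G V by (rule assms)
 define d where "d = the_inv_into (carrier V) c"
 have inj: "inj_on c (carrier V)" and im: "c ` carrier V = vecs e" using bij by (auto simp:
  bij_betw_def)
 have dc: "d (c x) = x" if "x : carrier V" for x by (simp add: inj that d_def the_inv_into_f_f)
 have cv: "c x : vecs e" if "x : carrier V" for x using im that by auto
 have dv: "d v : carrier V" "c (d v) = v" if "v : vecs e" for v using that inj by (auto simp: d_def
  im[symmetric] the_inv_into_f_f)
 have "EX M:MK. M * e = M & (ALL v:vecs e. M * v = c (act V g (d v)))" if g: "g : carrier G" for g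
  proof (rule matrix_of_linear[OF e])
  fix v assume v: "v : vecs e"
  show "c (act V g (d v)) : cols" using cv[OF V.act_closed[OF g dv(1)[OF v]]] by simp
  show "c (act V g (d (v + w))) = c (act V g (d v)) + c (act V g (d w))" if w: "w : vecs e" for w
   proof -
   show ?thesis using dv v w dc[of "add V (d v) (d w)"] g by (simp add: V.act_add V.act_closed add)
  qed
  show "c (act V g (d (sm k v))) = sm k (c (act V g (d v)))" if k: "k : emb ` carrier R" for k proof
   -
   obtain a where a: "a : carrier R" "k = emb a" using k by auto
   show ?thesis using dv v a dc[of "smult V a (d v)"] g by (simp add: V.act_smult V.act_closed sml)
 qed qed
 then obtain M where M: "!!g. g : carrier G ==> M g : MK" "!!g. g : carrier G ==> M g * e = M g"
  "!!g v. g : carrier G ==> v : vecs e ==> M g * v = c (act V g (d v))" by metis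
 have Mv: "M g * v : vecs e" if "g : carrier G" "v : vecs e" for g v using M(3) cv V.act_closed dv
  that by simp
 have unt: "M (one G) = e" by (rule cols_test[of _ _ e]) (use M e dv in "auto simp: V.act_one
  vecs_idem")
 have "M (mult G g h) = M g * M h" if gh: "g : carrier G" "h : carrier G" for g h proof (rule
  cols_test[of _ _ e])
  fix v assume v: "v : vecs e"
  have "M (mult G g h) * v = c (act V g (act V h (d v)))" by (simp add: M v gh dv V.act_mult)
  also have "act V h (d v) = d (M h * v)" using M v gh dv dc V.act_closed by simp
  also have "c (act V g (d (M h * v))) = M g * (M h * v)" using M(3)[OF gh(1) Mv[OF gh(2) v]] by
   simp
  finally show "M (mult G g h) * v = M g * M h * v" by (simp add: massoc)
 qed (use M e gh in "auto simp: massoc")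
 hence "rep M" by (auto simp: M rep_def)
 moreover have "coords V M c" by (auto simp: coords_def unt bij add sml M(3) cv dc)
 ultimately show ?thesis using unt by auto
qed

lemma subspace_image:
 assumes "Gmod V" "coords V rh c" "rep rh" "submodule N R V"
 shows "EX ka:MK. ka * ka = ka & unt rh * ka = ka & ka * unt rh = ka & vecs ka = c ` N" proof -
 interpret V: group_module R G V by (rule assms)
 note C = coordsD[OF assms(2)] and N = V.submoduleE[OF assms(4)]
 have z: "zero V : N" using subgroup.one_closed[OF submodule.axioms(1)[OF assms(4)]] by simp
 show ?thesis proof (rule subspace_projection)
  show "unt rh : MK" "unt rh * unt rh = unt rh" using assms by auto
  show "c ` N <= vecs (unt rh)" using C(3) N(1) by auto
  show "0 : c ` N" using coords_zero[OF assms(1,2)] z by simp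
  show "v + w : c ` N" if vw: "v : c ` N" "w : c ` N" for v w proof -
   obtain x y where "x : N" "v = c x" "y : N" "w = c y" using vw by auto
   thus ?thesis using C(5) subsetD[OF N(1)] N(5) by (intro image_eqI[of _ _ "add V x y"]) auto
  qed
  show "sm k v : c ` N" if kv: "k : emb ` carrier R" "v : c ` N" for k v proof -
   obtain a x where "a : carrier R" "k = emb a" "x : N" "v = c x" using kv by auto
   thus ?thesis using C(6) subsetD[OF N(1)] N(4) by (intro image_eqI[of _ _ "smult V a x"]) auto
qed qed qed

text \<open>The projection ka onto a submodule need not commute with the group. It suffices that
  \<open>rh g\<close> maps its image into itself, i.e.
  \<open>ka * rh g * ka = rh g * ka\<close>.\<close>

lemma coords_sub:
 assumes gm: "Gmod V" and c: "coords V rh c" and r: "rep rh" and ka: "ka : MK" "ka * ka = ka" "unt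
  rh * ka = ka" "vecs ka = c ` N" and N: "Gsub V N"
 shows "rep (subr rh ka)" "coords (V\<lparr>carrier := N\<rparr>) (subr rh ka) c" "Gmod
  (V\<lparr>carrier := N\<rparr>)" "ka : homs (subr rh ka) rh" proof -
 interpret V: group_module R G V by (rule gm)
 note C = coordsD[OF c]
 have sub: "submodule N R V" and act: "!!g x. g : carrier G ==> x : N ==> act V g x : N" using N by
  (auto simp: gsubmodule_def)
 note NE = V.submoduleE[OF sub]
 have NV: "x : N ==> x : carrier V" for x using NE(1) by auto
 have inv: "rh g * v : vecs ka" if g: "g : carrier G" and v: "v : vecs ka" for g v proof -
  obtain x where x: "x : N" "v = c x" using v ka(4) by auto
  have "rh g * v = c (act V g x)" using C(7)[OF g NV[OF x(1)]] x by simp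
  thus ?thesis by (simp add: ka(4) act[OF g x(1)])
 qed
 have kr: "ka * rh g * ka = rh g * ka" if g: "g : carrier G" for g proof (rule cols_test[of _ _ ka])
  fix v assume v: "v : vecs ka"
  show "ka * rh g * ka * v = rh g * ka * v" by (simp add: vecs_idem[OF inv[OF g v]] massoc
   vecs_idem[OF v])
 qed (use ka r g in "auto simp: repD massoc")
 show rep: "rep (subr rh ka)" by (rule subr_rep[OF r ka(1-3) kr])
 show co: "coords (V\<lparr>carrier := N\<rparr>) (subr rh ka) c" unfolding coords_def
  unt_subr[where rh=rh, OF ka(1,3)] proof (intro conjI ballI)
  show "bij_betw c (carrier (V\<lparr>carrier := N\<rparr>)) (vecs ka)" by (simp add:
   inj_on_subset[OF C(2) NE(1)] ka(4) bij_betw_def)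
  fix g x assume g: "g : carrier G" and x: "x : carrier (V\<lparr>carrier := N\<rparr>)"
  have "c x : vecs ka" using x ka(4) by simp
  thus "c (act (V\<lparr>carrier := N\<rparr>) g x) = subr rh ka g * c x" using C(7)[OF g NV] x by
   (simp add: subr_def massoc vecs_idem)
 qed (use C NV in auto)
 show "ka : homs (subr rh ka) rh" by (rule homsI) (use ka r kr unt_subr[where rh=rh, OF ka(1,3)] in
  "simp_all add: subr_def massoc")
 have z: "zero V : N" using subgroup.one_closed[OF submodule.axioms(1)[OF sub]] by simp
 show "Gmod (V\<lparr>carrier := N\<rparr>)" by (rule coords_group_module[OF rep co]) (use z
  coords_zero[OF gm c] NE act in auto)
qed

lemma gsubmodule_of_idempotent:
 assumes gm: "Gmod V" and c: "coords V rh c" and r: "rep rh" and p: "p : homs rh rh"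
 shows "Gsub V {x:carrier V. p * c x = c x}" and "p * p = p ==> vecs p = c ` {x:carrier V. p * c x =
  c x}" proof -
 interpret V: group_module R G V by (rule gm)
 note C = coordsD[OF c]
 let ?N = "{x:carrier V. p * c x = c x}"
 have "?N = {x:carrier V. p * c x = unt rh * c x}" using C(3) by (auto simp: vecs_idem)
 thus "Gsub V ?N" using gsubmodule_equalizer[OF gm c p homs_unt[OF r]] by simp
 show "vecs p = c ` ?N" if "p * p = p" proof
  show "c ` ?N <= vecs p" using vecs_cols[OF C(3)] by (auto intro!: vecsI)
  show "vecs p <= c ` ?N" using C(4)[OF vecs_mono[OF _ homs_left[OF p]]] vecs_idem by (fastforce
   simp: image_iff)
qed qed

lemma hom_matrix:
 assumes V: "Gmod V" "coords V rh c" "rep rh" and W: "Gmod W" "coords W ta d" "rep ta" and f: "f :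
  Ghom V W" obtains M where "M : homs rh ta" "!!x. x : carrier V ==> d (f x) = M * c x" proof -
 interpret V: group_module R G V by (rule V)
 note C = coordsD[OF V(2)] and D = coordsD[OF W(2)]
 have f_cl: "f x : carrier W" if "x : carrier V" for x using f that by (auto simp: gmod_hom_def)
 have f_add: "f (add V x y) = add W (f x) (f y)" if "x : carrier V" "y : carrier V" for x y using f
  that by (auto simp: gmod_hom_def)
 have f_sm: "f (smult V a x) = smult W a (f x)" if "a : carrier R" "x : carrier V" for a x using f
  that by (auto simp: gmod_hom_def)
 have f_act: "f (act V g x) = act W g (f x)" if "g : carrier G" "x : carrier V" for g x using f that
  by (auto simp: gmod_hom_def)
 define c' where "c' = the_inv_into (carrier V) c"
 have c'c: "c' (c x) = x" if "x : carrier V" for x by (simp add: C(2) that c'_def the_inv_into_f_f)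
 have c': "c' v : carrier V" "c (c' v) = v" if "v : vecs (unt rh)" for v using C(4)[OF that] c'c by
  auto
 have "EX M:MK. M * unt rh = M & (ALL v:vecs (unt rh). M * v = d (f (c' v)))" proof (rule
  matrix_of_linear)
  fix v assume v: "v : vecs (unt rh)"
  show "d (f (c' v)) : cols" using D(3)[OF f_cl[OF c'(1)[OF v]]] by simp
  show "d (f (c' (v + w))) = d (f (c' v)) + d (f (c' w))" if w: "w : vecs (unt rh)" for w proof -
   show ?thesis using c' v w C(5) c'c[of "add V (c' v) (c' w)"] by (simp add: f_add f_cl D)
  qed
  show "d (f (c' (sm k v))) = sm k (d (f (c' v)))" if k: "k : emb ` carrier R" for k proof -
   obtain a where a: "a : carrier R" "k = emb a" using k by auto
   show ?thesis using c' v a C(6) c'c[of "smult V a (c' v)"] by (simp add: f_sm f_cl D)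
 qed qed (use V(3) in auto)
 then obtain M where M: "M : MK" "M * unt rh = M" "!!v. v : vecs (unt rh) ==> M * v = d (f (c' v))"
  by auto
 have Mc: "d (f x) = M * c x" if "x : carrier V" for x using M(3)[OF C(3)[OF that]] c'c that by simp
 have "M : homs rh ta" proof (rule homsI)
  show "unt ta * M = M" by (rule cols_test[of _ _ "unt rh"]) (simp_all add: vecs_idem D(3) f_cl
   c'(1) massoc M V(3) W(3))
  fix g assume g: "g : carrier G"
  show "ta g * M = M * rh g" proof (rule cols_test[of _ _ "unt rh"])
   fix v assume "v : vecs (unt rh)"
   then obtain x where x: "x : carrier V" "v = c x" using C(4) by auto
   have "ta g * (M * c x) = d (f (act V g x))" using Mc D(7)[OF g f_cl] f_act g x by simp
   also have "... = M * (rh g * c x)" using Mc V.act_closed g x C(7) by simp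
   finally show "ta g * M * v = M * rh g * v" by (simp add: x massoc)
  qed (use M V(3) W(3) g in "auto simp: massoc repD")
 qed (use M in auto)
 thus ?thesis using that Mc by simp
qed

lemma matrix_hom:
 assumes V: "Gmod V" "coords V rh c" and W: "Gmod W" "coords W ta d" and M: "M : homs rh ta" obtains
  f where "f : Ghom V W" "!!x. x : carrier V ==> d (f x) = M * c x" proof -
 interpret V: group_module R G V by (rule V)
 interpret W: group_module R G W by (rule W)
 note C = coordsD[OF V(2)] and D = coordsD[OF W(2)]
 define f where "f x = the_inv_into (carrier W) d (M * c x)" for x
 have "EX y:carrier W. d y = M * c x" if "x : carrier V" for x using D(4)[OF vecs_mult[OF homs_MK[OF
  M] homs_left[OF M]]] C(3)[OF that] by auto
 hence f: "f x : carrier W" "d (f x) = M * c x" if "x : carrier V" for x using that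
  the_inv_into_f_f[OF D(2)] unfolding f_def by (metis, metis)
 have eq: "y = z" if "y : carrier W" "z : carrier W" "d y = d z" for y z using D(2) that by (simp
  add: inj_on_eq_iff)
 have "f : Ghom V W" unfolding gmod_hom_def proof (intro CollectI conjI ballI)
  fix g x assume g: "g : carrier G" and x: "x : carrier V"
  show "f (act V g x) = act W g (f x)" by (rule eq) (use g x f V.act_closed W.act_closed
   homs_comm[OF M g] in "auto simp: C D massoc'")
 qed (use f in "auto intro!: eq simp: C D distrib_left sm_mult")
 thus ?thesis using that f by simp
qed

lemma gmod_iso_imp_isor:
 assumes V: "Gmod V" "coords V rh c" "rep rh" and W: "Gmod W" "coords W ta d" "rep ta" and i: "Giso
  V W"
 shows "isor rh ta" proof -
 interpret V: group_module R G V by (rule V)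
 note C = coordsD[OF V(2)] and D = coordsD[OF W(2)]
 obtain f where f: "f : Ghom V W" "bij_betw f (carrier V) (carrier W)" using i by (auto simp:
  gmod_iso_def)
 define h where "h = the_inv_into (carrier V) f"
 have fcl: "f x : carrier W" if "x : carrier V" for x using f that by (auto simp: gmod_hom_def)
 have hf: "h (f x) = x" if "x : carrier V" for x using f(2) that by (simp add: h_def bij_betw_def
  the_inv_into_f_f)
 have h: "h y : carrier V" "f (h y) = y" if "y : carrier W" for y proof -
  have "y : f ` carrier V" using that bij_betw_imp_surj_on[OF f(2)] by simp
  then obtain x where "x : carrier V" "y = f x" by auto
  thus "h y : carrier V" "f (h y) = y" by (simp_all add: hf)
 qed
 have "h : Ghom W V" unfolding gmod_hom_def proof (intro CollectI conjI ballI)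
  show "h : carrier W \<rightarrow> carrier V" using h by auto
  fix x assume x: "x : carrier W"
  show "h (add W x y) = add V (h x) (h y)" if y: "y : carrier W" for y using f(1) h x y hf[of "add V
   (h x) (h y)"] by (simp add: gmod_hom_def)
  show "h (smult W a x) = smult V a (h x)" if a: "a : carrier R" for a using f(1) h x a hf[of "smult
   V a (h x)"] by (simp add: gmod_hom_def)
  next fix g x assume g: "g : carrier G" and x: "x : carrier W"
  show "h (act W g x) = act V g (h x)" using f(1) h x g hf[of "act V g (h x)"] V.act_closed by (simp
   add: gmod_hom_def)
 qed
 from hom_matrix[OF W V this] obtain N where N: "N : homs ta rh" "!!y. y : carrier W ==> c (h y) = N
  * d y" by auto
 from hom_matrix[OF V W f(1)] obtain M where M: "M : homs rh ta" "!!x. x : carrier V ==> d (f x) = M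
  * c x" by auto
 have "N * M = unt rh" proof (rule cols_test[of _ _ "unt rh"])
  fix v assume "v : vecs (unt rh)"
  then obtain x where x: "x : carrier V" "v = c x" using C(4) by auto
  thus "N * M * v = unt rh * v" using M(2) N(2)[OF fcl[OF x(1)]] hf C(3) by (simp add: massoc
   vecs_idem)
 qed (use M(1) N(1) V(3) homs_MK homs_right in "auto simp: massoc")
 moreover have "M * N = unt ta" proof (rule cols_test[of _ _ "unt ta"])
  fix v assume "v : vecs (unt ta)"
  then obtain x where x: "x : carrier W" "v = d x" using D(4) by auto
  thus "M * N * v = unt ta * v" using N(2) M(2)[OF h(1)[OF x(1)]] h D(3) by (simp add: massoc
   vecs_idem)
 qed (use M(1) N(1) W(3) homs_MK homs_right in "auto simp: massoc")
 ultimately show ?thesis using M(1) N(1) by (auto simp: isor_def)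
qed

lemma isor_imp_gmod_iso:
 assumes V: "Gmod V" "coords V rh c" and W: "Gmod W" "coords W ta d" and i: "isor rh ta"
 shows "Giso V W" proof -
 note C = coordsD[OF V(2)] and D = coordsD[OF W(2)]
 obtain M N where MN: "M : homs rh ta" "N : homs ta rh" "N * M = unt rh" "M * N = unt ta" using i by
  (auto simp: isor_def)
 from matrix_hom[OF V W MN(1)] obtain f where f: "f : Ghom V W" "!!x. x : carrier V ==> d (f x) = M
  * c x" by auto
 from matrix_hom[OF W V MN(2)] obtain h where h: "h : Ghom W V" "!!x. x : carrier W ==> c (h x) = N
  * d x" by auto
 have cl: "x : carrier V ==> f x : carrier W" "y : carrier W ==> h y : carrier V" for x y using f(1)
  h(1) by (auto simp: gmod_hom_def)
 have "h (f x) = x" if "x : carrier V" for x proof -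
  have "c (h (f x)) = N * M * c x" by (simp add: f h cl that massoc)
  also have "... = c x" using MN vecs_idem[OF C(3)[OF that]] by simp
  finally show ?thesis using C(2) cl that by (simp add: inj_on_eq_iff)
 qed
 moreover have "f (h y) = y" if "y : carrier W" for y proof -
  have "d (f (h y)) = M * N * d y" by (simp add: f h cl that massoc)
  also have "... = d y" using MN vecs_idem[OF D(3)[OF that]] by simp
  finally show ?thesis using D(2) cl that by (simp add: inj_on_eq_iff)
 qed
 ultimately have "bij_betw f (carrier V) (carrier W)" by (intro bij_betw_byWitness[of _ h]) (use cl
  in auto)
 thus ?thesis by (auto simp: f gmod_iso_def)
qed

lemma mdl_iso_iff:
 assumes "mdl V rh" "mdl W ta"
 shows "Giso V W = isor rh ta" using assms gmod_iso_imp_isor isor_imp_gmod_iso by (auto simp: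
  mdl_def)

lemma mdl_transfer:
 assumes V: "mdl V rh" and W: "Gmod W" and i: "Giso V W"
 shows "mdl W rh" proof -
 obtain c where c: "coords V rh c" using V by (auto simp: mdl_def)
 interpret V: group_module R G V using V by (simp add: mdl_def)
 note C = coordsD[OF c]
 obtain f where f: "f : Ghom V W" "bij_betw f (carrier V) (carrier W)" using i by (auto simp:
  gmod_iso_def)
 define h where "h = the_inv_into (carrier V) f"
 have hf: "h (f x) = x" if "x : carrier V" for x using f(2) that by (simp add: h_def bij_betw_def
  the_inv_into_f_f)
 have ex: "EX x:carrier V. f x = y" if "y : carrier W" for y proof -
  have "y : f ` carrier V" using that bij_betw_imp_surj_on[OF f(2)] by simp
  thus ?thesis by auto
 qed
 have hb: "bij_betw h (carrier W) (carrier V)" unfolding h_def by (rule bij_betw_the_inv_into[OF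
  f(2)])
 have "coords W rh (%y. c (h y))" unfolding coords_def proof (intro conjI ballI)
  show "bij_betw (%y. c (h y)) (carrier W) (vecs (unt rh))" using bij_betw_trans[OF hb C(1)] by
   (simp add: comp_def)
  fix y assume "y : carrier W"
  then obtain x where x: "x : carrier V" "y = f x" using ex by auto
  show "c (h (add W y z)) = c (h y) + c (h z)" if "z : carrier W" for z proof -
   obtain x' where x': "x' : carrier V" "z = f x'" using ex \<open>z : carrier W\<close> by auto
   have "add W y z = f (add V x x')" using x x' f(1) by (simp add: gmod_hom_def)
   thus ?thesis by (simp add: x x' hf C)
  qed
  show "c (h (smult W a y)) = sm (emb a) (c (h y))" if a: "a : carrier R" for a proof -
   have "smult W a y = f (smult V a x)" using x a f(1) by (simp add: gmod_hom_def)
   thus ?thesis by (simp add: x a hf C)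
  qed
  next fix g y assume g: "g : carrier G" and "y : carrier W"
  then obtain x where x: "x : carrier V" "y = f x" using ex by auto
  have "act W g y = f (act V g x)" using x g f(1) by (simp add: gmod_hom_def)
  thus "c (h (act W g y)) = rh g * c (h y)" by (simp add: x g hf C V.act_closed)
 qed
 thus ?thesis using V W by (auto simp: mdl_def)
qed

text \<open>A model on the element type \<open>nat => 'a\<close>, obtained by reading off the
  entries of column 0 in the field. It witnesses the choices of modules that are only determined up
  to isomorphism.\<close>

definition std :: "('g => 'r fm) => ('a, 'g) vec_gmodule" where "std rh = (let enc = (%v i. dmb (ent
 v i 0)); cod = the_inv_into (vecs (unt rh)) enc in \<lparr>carrier = enc ` vecs (unt rh), mult =
 undefined, one = undefined, zero = enc 0, add = (%x y. enc (cod x + cod y)), smult = (%a x. enc (sm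
 (emb a) (cod x))), act = (%g x. enc (rh g * cod x))\<rparr>)"

lemma mdl_std:
 assumes r: "rep rh"
 shows "mdl (std rh) rh" proof -
 define enc where "enc = (%v i. dmb (ent (v :: 'r fm) i 0))"
 define cod where "cod = the_inv_into (vecs (unt rh)) enc"
 have inj: "inj_on enc (vecs (unt rh))" proof (rule inj_onI)
  fix v w assume vw: "v : vecs (unt rh)" "w : vecs (unt rh)" "enc v = enc w"
  show "v = w" by (metis cols_eqI enc_def vw emb_dmb MK_ent cols_MK vecs_cols)
 qed
 have ce: "cod (enc v) = v" if "v : vecs (unt rh)" for v by (simp add: that inj cod_def
  the_inv_into_f_f)
 have gv: "rh g * v : vecs (unt rh)" if "g : carrier G" "v : vecs (unt rh)" for g v by (rule
  vecs_mult) (use r that in "auto simp: repD")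
 have bij: "bij_betw cod (enc ` vecs (unt rh)) (vecs (unt rh))" unfolding cod_def by (rule
  bij_betw_the_inv_into) (simp add: bij_betw_def inj)
 have S: "std rh = \<lparr>carrier = enc ` vecs (unt rh), mult = undefined, one = undefined, zero =
  enc 0, add = (%x y. enc (cod x + cod y)), smult = (%a x. enc (sm (emb a) (cod x))), act = (%g x.
  enc (rh g * cod x))\<rparr>" by (simp add: std_def enc_def[symmetric] cod_def[symmetric])
 have co: "coords (std rh) rh cod" by (auto simp: coords_def S bij ce gv)
 have "Gmod (std rh)" by (rule coords_group_module[OF r co]) (auto simp: S ce gv)
 thus ?thesis using r co by (auto simp: mdl_def)
qed

lemma coords_submodule_sum:
 assumes V: "Gmod V" "coords V rh c" and N: "submodule N R V" and "finite J" and "!!j. j : J ==> k j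
  : emb ` carrier R" "!!j. j : J ==> v j : c ` N"
 shows "(SUM j:J. sm (k j) (v j)) : c ` N" proof -
 interpret V: group_module R G V by (rule V)
 note C = coordsD[OF V(2)] and NE = V.submoduleE[OF N]
 have z: "zero V : N" using subgroup.one_closed[OF submodule.axioms(1)[OF N]] by simp
 show ?thesis using assms(4-) proof (induction J rule: finite_induct)
  case empty
  show ?case using coords_zero[OF V] z by (metis image_eqI sum.empty)
  next case (insert j J)
  obtain x where x: "x : N" "(SUM j:J. sm (k j) (v j)) = c x" using insert.IH insert.prems by auto
  obtain y where y: "y : N" "v j = c y" using insert.prems(2) by auto
  obtain a where a: "a : carrier R" "k j = emb a" using insert.prems(1) by auto
  have "add V (smult V a y) x : N" "c (add V (smult V a y) x) = sm (k j) (v j) + (SUM j:J. sm (k j)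
   (v j))" by (simp_all add: NE(4) NE(5) x y a subsetD[OF NE(1)] C)
  hence "sm (k j) (v j) + (SUM j:J. sm (k j) (v j)) : c ` N" by (metis image_eqI)
  thus ?case using insert.hyps by simp
qed qed

lemma coords_expand:
 assumes V: "Gmod V" "coords V rh c" "rep rh" obtains n a where "!!i. i < n ==> a i : carrier V"
  "!!v. v : vecs (unt rh) ==> v = (SUM i<n. sm (ent v i 0) (c (a i)))" proof -
 note C = coordsD[OF V(2)]
 obtain n where n: "bnd (unt rh) n" using bnd_ex by auto
 let ?b = "%j. unt rh * unitm (emb \<one>) j 0"
 have b: "?b j : vecs (unt rh)" for j by (rule vecs_mult) (use V(3) in auto)
 obtain a where a: "!!j. a j : carrier V" "!!j. c (a j) = ?b j" using C(4)[OF b] by metis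
 show ?thesis proof (rule that[of n a])
  fix v assume v: "v : vecs (unt rh)"
  have vv: "ent v i j = ent (unt rh * v) i j" for i j using v by (simp add: vecs_idem)
  show "v = (SUM i<n. sm (ent v i 0) (c (a i)))" proof (rule cols_eqI)
   show "(SUM i<n. sm (ent v i 0) (c (a i))) : cols" proof (rule cols_sum, rule cols_sm)
    show "ent v i 0 : emb ` carrier R" for i by (rule MK_ent) (use v in simp)
    show "c (a i) : cols" for i by (rule vecs_cols[OF C(3)[OF a(1)]])
   qed
   show "ent v i 0 = ent (SUM i<n. sm (ent v i 0) (c (a i))) i 0" for i by (subst vv) (use V(3) in
    "simp add: ent_times_bndl[OF n] a(2) ent_mult_unitm mult.commute")
qed (use v in simp) qed (use a in auto) qed

lemma mdl_fd:
 assumes "mdl V rh"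
 shows "Gfd V" proof -
 obtain c where V: "Gmod V" "coords V rh c" "rep rh" using assms by (auto simp: mdl_def)
 interpret V: group_module R G V by (rule V)
 note C = coordsD[OF V(2)]
 obtain n a where a: "!!i. i < n ==> a i : carrier V" "!!v. v : vecs (unt rh) ==> v = (SUM i<n. sm
  (ent v i 0) (c (a i)))" by (rule coords_expand[OF V]) (rule that)
 have "N = carrier V" if N: "submodule N R V" "a ` {..<n} <= N" for N proof
  show NV: "N <= carrier V" by (rule V.submoduleE(1)[OF N(1)])
  show "carrier V <= N" proof
   fix x assume x: "x : carrier V"
   have "(SUM i<n. sm (ent (c x) i 0) (c (a i))) : c ` N" by (rule coords_submodule_sum[OF V(1,2)
    N(1)]) (use N(2) MK_ent[OF cols_MK[OF vecs_cols[OF C(3)[OF x]]]] in auto)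
   thus "x : N" using a(2)[OF C(3)[OF x]] C(2) x NV by (auto simp: inj_on_def)
 qed qed
 hence "lin_span R V (a ` {..<n}) = carrier V" unfolding lin_span_def using V.carrier_is_submodule
  a(1) by auto
 thus ?thesis using V(1) a(1) by (auto simp: fd_module_def intro!: exI[of _ "a ` {..<n}"])
qed

text \<open>A finite generating family gives a linear map L from a coordinate space onto V.
  Restricted to a complement of its kernel L is bijective, which yields coordinates without
  selecting a basis among the generators.\<close>

lemma fd_mdl:
 assumes "Gfd V" obtains rh where "mdl V rh" proof -
 obtain A where gm: "Gmod V" and A: "finite A" "A <= carrier V" "lin_span R V A = carrier V" using
  assms by (auto simp: fd_module_def)
 interpret V: group_module R G V by (rule gm)
 obtain n a where a: "A = a ` {..<n::nat}" using finite_imp_nat_seg_image_inj_on[OF A(1)] by auto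
 have ac: "a i : carrier V" if "i < n" for i using a A(2) that by auto
 let ?u = "emb \<one>"
 define Id where "Id = (SUM i<n. unitm ?u i i)"
 have Id: "Id : MK" "Id * Id = Id" proof -
  show "Id : MK" by (auto simp: Id_def)
  have "Id * Id = (SUM i<n. SUM j<n. if i = j then unitm ?u i i else 0)" unfolding Id_def lsum rsum
   by (subst sum.swap) (auto simp: unitm_mult)
  also have "... = Id" by (simp add: Id_def)
  finally show "Id * Id = Id" .
 qed
 define L where "L v = finsum V (%i. smult V (dmb (ent v i 0)) (a i)) {..<n}" for v
 have Lcl: "L v : carrier V" if "v : cols" for v by (simp add: L_def ac that)
 have dmb_add: "dmb (x + y) = dmb x \<oplus> dmb y" if "x : emb ` carrier R" "y : emb ` carrier R"
  for x y using that by (auto simp: emb_add[symmetric])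
 have dmb_mult: "dmb (x * y) = dmb x \<otimes> dmb y" if "x : emb ` carrier R" "y : emb ` carrier R"
  for x y using that by (auto simp: emb_mult[symmetric])
 have Ladd: "L (v + w) = add V (L v) (L w)" if "v : cols" "w : cols" for v w proof -
  have "L (v + w) = finsum V (%i. add V (smult V (dmb (ent v i 0)) (a i)) (smult V (dmb (ent w i 0))
   (a i))) {..<n}" unfolding L_def using that ac by (intro V.finsum_cong') (auto simp: dmb_add
   V.smult_l_distr)
  thus ?thesis by (simp add: L_def that ac)
 qed
 have Lsm: "L (sm (emb k) v) = smult V k (L v)" if "k : carrier R" "v : cols" for k v proof -
  have "L (sm (emb k) v) = finsum V (%i. smult V k (smult V (dmb (ent v i 0)) (a i))) {..<n}"
   unfolding L_def using that ac by (intro V.finsum_cong') (auto simp: dmb_mult V.smult_assoc1)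
  thus ?thesis unfolding L_def using that ac by (subst V.finsum_smult_ldistr) auto
 qed
 have L0: "L 0 = zero V" using Lsm[of \<zero> 0] Lcl by simp
 have Lneg: "(L (v - w) = zero V) = (L v = L w)" if "v : cols" "w : cols" for v w proof -
  have "L v = add V (L (v - w)) (L w)" using Ladd[of "v - w" w] that by simp
  moreover have "(add V (L (v - w)) (L w) = add V (zero V) (L w)) = (L (v - w) = zero V)" using Lcl
   that by simp
  ultimately show ?thesis using Lcl[OF that(2)] by simp
 qed
 have sur: "L ` vecs Id = carrier V" proof
  show "L ` vecs Id <= carrier V" using Lcl by auto
  have "submodule (L ` vecs Id) R V" proof (rule submodule_closedI[OF gm])
   show "zero V : L ` vecs Id" using L0 vecs_zero by (metis image_eqI)
   show "smult V k x : L ` vecs Id" if "k : carrier R" "x : L ` vecs Id" for k x proof -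
    obtain v where "v : vecs Id" "x = L v" using \<open>x : L ` vecs Id\<close> by auto
    thus ?thesis using that by (intro image_eqI[of _ _ "sm (emb k) v"]) (auto simp: Lsm)
   qed
   show "add V x y : L ` vecs Id" if xy: "x : L ` vecs Id" "y : L ` vecs Id" for x y proof -
    obtain v w where "v : vecs Id" "x = L v" "w : vecs Id" "y = L w" using xy by auto
    thus ?thesis by (intro image_eqI[of _ _ "v + w"]) (auto simp: Ladd)
  qed qed (use Lcl in auto)
  moreover have "A <= L ` vecs Id" proof
   fix x assume "x : A"
   then obtain i where i: "i < n" "x = a i" using a by auto
   have "Id * unitm ?u i 0 = unitm ?u i 0" by (simp add: i(1) Id_def rsum unitm_mult)
   hence v: "unitm ?u i 0 : vecs Id" by (intro vecsI) auto
   have "L (unitm ?u i 0) = finsum V (%j. if i = j then a j else zero V) {..<n}" unfolding L_def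
    using ac dmb_emb[of \<zero>] dmb_emb by (intro V.finsum_cong') (auto simp: ent_unitm simp del:
    dmb_emb)
   also have "... = a i" using V.finsum_singleton[of i "{..<n}" a] i ac by auto
   finally show "x : L ` vecs Id" using v i by (metis image_eqI)
  qed
  ultimately show "carrier V <= L ` vecs Id" using A(3) by (auto simp: lin_span_def)
 qed
 define U where "U = {v:vecs Id. L v = zero V}"
 obtain ka where ka: "ka : MK" "ka * ka = ka" "Id * ka = ka" "ka * Id = ka" "vecs ka = U" proof -
  have "EX ka:MK. ka * ka = ka & Id * ka = ka & ka * Id = ka & vecs ka = U" by (rule
   subspace_projection[OF Id]) (auto simp: Lsm U_def L0 Ladd)
  thus thesis using that by auto
 qed
 \<comment> \<open>The projection onto a complement of the kernel U of L.\<close>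
 let ?e = "Id - ka"
 have e: "?e : MK" "?e * ?e = ?e" by (auto simp: Id ka algebra_simps)
 have eId: "v : vecs Id" if "v : vecs ?e" for v by (rule vecs_mono[OF that]) (simp add: rdiff Id ka)
 have kv: "ka * v = 0" if "v : vecs ?e" for v proof -
  have "ka * (?e * v) = 0" by (simp add: ka massoc' rdiff)
  thus ?thesis by (simp add: that vecs_idem)
 qed
 have "inj_on L (vecs ?e)" proof (rule inj_onI)
  fix v w assume vw: "v : vecs ?e" "w : vecs ?e" "L v = L w"
  hence "v - w : U" by (simp add: Lneg eId U_def)
  hence "ka * (v - w) = v - w" using ka(5) vecs_idem by simp
  thus "v = w" by (simp add: vw kv)
 qed
 moreover have "L ` vecs ?e = carrier V" proof
  show "L ` vecs ?e <= carrier V" using Lcl by auto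
  show "carrier V <= L ` vecs ?e" proof
   fix x assume "x : carrier V"
   then obtain v where v: "v : vecs Id" "x = L v" using sur by auto
   have "ka * v : U" unfolding ka(5)[symmetric] by (rule vecs_mult) (use ka v in auto)
   hence "L (v - (v - ka * v)) = zero V" by (simp add: U_def)
   hence "L (v - ka * v) = x" using Lneg[of v "v - ka * v"] v ka by simp
   moreover have "v - ka * v : vecs ?e" using v ka by (intro vecsI) (auto simp: algebra_simps
    vecs_idem massoc')
   ultimately show "x : L ` vecs ?e" by auto
 qed qed
 ultimately have bij: "bij_betw L (vecs ?e) (carrier V)" by (simp add: bij_betw_def)
 define c where "c = the_inv_into (vecs ?e) L"
 have cL: "c (L v) = v" if "v : vecs ?e" for v using bij that by (simp add: c_def bij_betw_def
  the_inv_into_f_f)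
 have ex: "EX v:vecs ?e. x = L v" if "x : carrier V" for x using bij that by (auto simp:
  bij_betw_def)
 have "EX rh. rep rh & unt rh = ?e & coords V rh c" proof (rule coords_rep[OF gm e])
  show "bij_betw c (carrier V) (vecs ?e)" unfolding c_def by (rule bij_betw_the_inv_into[OF bij])
  fix x assume "x : carrier V"
  then obtain v where v: "v : vecs ?e" "x = L v" using ex by auto
  show "c (add V x y) = c x + c y" if "y : carrier V" for y proof -
   obtain w where w: "w : vecs ?e" "y = L w" using ex \<open>y : carrier V\<close> by auto
   thus ?thesis using v cL[of "v + w"] by (simp add: Ladd cL)
  qed
  show "c (smult V k x) = sm (emb k) (c x)" if "k : carrier R" for k using v cL[of "sm (emb k) v"]
   that by (simp add: Lsm cL)
 qed
 thus ?thesis using that gm by (auto simp: mdl_def)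
qed

lemma mdl_vec_copy:
 assumes "mdl V rh"
 shows "mdl (vec_copy R G V) rh" proof -
 have r: "rep rh" using assms by (simp add: mdl_def)
 have "Gfd (std rh) & Giso V (std rh)" using mdl_fd[OF mdl_std[OF r]] mdl_iso_iff[OF assms
  mdl_std[OF r]] isor_refl[OF r] by simp
 hence "Gfd (vec_copy R G V) & Giso V (vec_copy R G V)" unfolding vec_copy_def by (rule someI)
 thus ?thesis by (simp add: mdl_transfer[OF assms, of "vec_copy R G V"] fd_module_def)
qed
end
context modelled
begin

section \<open>Permutation modules, quotients and tensor products\<close>

lemma perm_module_group_module:
 assumes ta: "!!g x. g : carrier G ==> x : S ==> ta g x : S" "!!x. x : S ==> ta (one G) x = x" "!!g
  h x. g : carrier G ==> h : carrier G ==> x : S ==> ta (mult G g h) x = ta g (ta h x)"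
 shows "Gmod (perm_module R G S ta)" (is "Gmod ?M") proof -
 have finU: "finite {x. f x \<oplus> f' x ~= \<zero>}" if "finite {x. f x ~= \<zero>}" "finite {x.
  f' x ~= \<zero>}" for f f' :: "'c => 'a" by (rule finite_subset[OF _ finite_UnI[OF that]]) auto
 have finM: "finite {x. a \<otimes> f x ~= \<zero>}" if "finite {x. f x ~= \<zero>}" "a : carrier R"
  for f :: "'c => 'a" and a by (rule finite_subset[OF _ that(1)]) (use that in auto)
 have c: "f x : carrier R" if "f : carrier ?M" for f x using that by (cases "x : S") (auto simp:
  perm_module_def)
 have "abelian_group ?M" proof (rule abelian_groupI)
  fix f assume f: "f : carrier ?M"
  have "(%x. \<ominus> f x) : carrier ?M" proof -
   have "{x. \<ominus> f x ~= \<zero>} <= {x. f x ~= \<zero>}" by auto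
   thus ?thesis using f finite_subset by (auto simp: perm_module_def)
  qed
  thus "EX y:carrier ?M. add ?M y f = zero ?M" using c[OF f] by (intro bexI[of _ "%x. \<ominus> f
   x"]) (auto simp: perm_module_def R.l_neg)
  next fix f h assume fh: "f : carrier ?M" "h : carrier ?M"
  thus "add ?M f h : carrier ?M" using finU by (auto simp: perm_module_def)
  show "add ?M f h = add ?M h f" using c[OF fh(1)] c[OF fh(2)] by (auto simp: perm_module_def
   R.a_comm)
  show "add ?M (add ?M f h) k = add ?M f (add ?M h k)" if k: "k : carrier ?M" for k using c[OF
   fh(1)] c[OF fh(2)] c[OF k] by (auto simp: perm_module_def R.a_assoc)
  next
  show "zero ?M : carrier ?M" by (auto simp: perm_module_def)
  show "add ?M (zero ?M) f = f" if "f : carrier ?M" for f using c[OF that] by (auto simp: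
   perm_module_def)
 qed
 moreover have sm_cl: "smult ?M a f : carrier ?M" if "a : carrier R" "f : carrier ?M" for a f using
  that finM by (auto simp: perm_module_def)
 ultimately have "module R ?M" proof (intro moduleI is_cring)
  fix a b f h
  assume a: "a : carrier R" "b : carrier R" and f: "f : carrier ?M" and h: "h : carrier ?M"
  note cc = c[OF f] c[OF h]
  show "smult ?M (a \<oplus> b) f = add ?M (smult ?M a f) (smult ?M b f)" "smult ?M a (add ?M f h) =
   add ?M (smult ?M a f) (smult ?M a h)" "a \<otimes> b \<odot>\<^bsub>?M\<^esub> f = smult ?M a
   (smult ?M b f)" using a cc by (auto simp: perm_module_def R.l_distr R.r_distr R.m_assoc)
  next fix f assume f: "f : carrier ?M"
  show "smult ?M \<one> f = f" using c[OF f] by (auto simp: perm_module_def)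
 qed (use sm_cl in auto)
 moreover have "group_module_axioms R G ?M" proof
  fix g f assume g: "g : carrier G" and f: "f : carrier ?M"
  have ginv: "ta g (ta (m_inv G g) x) = x" if "x : S" for x using ta(3)[of g "m_inv G g" x] ta(2)[OF
   that] g that by simp
  have sub: "{x. (if x : S then f (ta (m_inv G g) x) else \<zero>) ~= \<zero>} <= ta g ` {x. f x ~=
   \<zero>}" proof
   fix x assume "x : {x. (if x : S then f (ta (m_inv G g) x) else \<zero>) ~= \<zero>}"
   hence "x : S" "f (ta (m_inv G g) x) ~= \<zero>" by (auto split: if_splits)
   thus "x : ta g ` {x. f x ~= \<zero>}" using ginv by (intro image_eqI[of _ _ "ta (m_inv G g) x"])
    auto
  qed
  have "finite {x. (if x : S then f (ta (m_inv G g) x) else \<zero>) ~= \<zero>}" by (rule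
   finite_subset[OF sub], rule finite_imageI) (use f in "simp add: perm_module_def")
  thus "act ?M g f : carrier ?M" using f g ta(1) by (auto simp: perm_module_def)
  show "act ?M g (add ?M f h) = add ?M (act ?M g f) (act ?M g h)" if "h : carrier ?M" for h by (auto
   simp: perm_module_def)
  show "act ?M g (smult ?M a f) = smult ?M a (act ?M g f)" if "a : carrier R" for a using that by
   (auto simp: perm_module_def)
  show "act ?M (mult G g h) f = act ?M g (act ?M h f)" if h: "h : carrier G" for h proof
   fix x
   show "act ?M (mult G g h) f x = act ?M g (act ?M h f) x" proof (cases "x : S")
    case True
    have "ta (m_inv G (mult G g h)) x = ta (m_inv G h) (ta (m_inv G g) x)" using ta(3)[of "m_inv G
     h" "m_inv G g" x] g h True by (simp add: inv_mult_group)
    thus ?thesis using True ta(1)[of "m_inv G g" x] g by (simp add: perm_module_def)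
  qed (simp add: perm_module_def) qed
  next fix f assume "f : carrier ?M"
  thus "act ?M (one G) f = f" using ta(2) by (auto simp: perm_module_def)
 qed
 ultimately show ?thesis by (intro group_module.intro) auto
qed

text \<open>Cosets of the kernel of L are exactly its fibres, and in this form all coset operations
  of the quotient become operations on values of L.\<close>

lemma mdl_quot:
 assumes gm: "Gmod Fr" and r: "rep rh" and L: "L ` carrier Fr = vecs (unt rh)" "!!x y. x : carrier
  Fr ==> y : carrier Fr ==> L (add Fr x y) = L x + L y" "!!a x. a : carrier R ==> x : carrier Fr ==>
  L (smult Fr a x) = sm (emb a) (L x)" "!!g x. g : carrier G ==> x : carrier Fr ==> L (act Fr g x) =
  rh g * L x" and N: "N = {x:carrier Fr. L x = 0}"
 shows "mdl (quot_module Fr N) rh" proof -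
 interpret F: group_module R G Fr by (rule gm)
 have L0: "L (zero Fr) = 0" using L(2)[of "zero Fr" "zero Fr"] by simp
 have Lneg: "L (a_inv Fr x) = - L x" if x: "x : carrier Fr" for x using L(2)[of "a_inv Fr x" x] x L0
  by (simp add: F.l_neg add_eq_0_iff2)
 define cls where "cls x = {y:carrier Fr. L y = L x}" for x
 have cls: "N +>\<^bsub>Fr\<^esub> x = cls x" if x: "x : carrier Fr" for x proof
  show "N +>\<^bsub>Fr\<^esub> x <= cls x" unfolding a_r_coset_def' N using x by (auto simp: cls_def
   L)
  show "cls x <= N +>\<^bsub>Fr\<^esub> x" proof
   fix y assume "y : cls x"
   hence y: "y : carrier Fr" "L y = L x" by (auto simp: cls_def)
   have "add Fr y (a_inv Fr x) : N" using y x by (simp add: N L(2) Lneg)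
   moreover have "y = add Fr (add Fr y (a_inv Fr x)) x" using x y by (simp add: F.a_assoc F.l_neg)
   ultimately show "y : N +>\<^bsub>Fr\<^esub> x" unfolding a_r_coset_def' by auto
 qed qed
 have self: "x : cls x" if "x : carrier Fr" for x using that by (simp add: cls_def)
 let ?Q = "quot_module Fr N"
 have car: "carrier ?Q = cls ` carrier Fr" unfolding quot_module_def by (auto simp: A_RCOSETS_def'
  cls)
 have zero: "zero ?Q = cls (zero Fr)" by (auto simp: quot_module_def N cls_def L0)
 have add: "add ?Q (cls x) (cls y) = cls (add Fr x y)" if x: "x : carrier Fr" and y: "y : carrier
  Fr" for x y proof -
  have "cls x <+>\<^bsub>Fr\<^esub> cls y = cls (add Fr x y)" proof
   show "cls x <+>\<^bsub>Fr\<^esub> cls y <= cls (add Fr x y)" unfolding set_add_def' using x y by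
    (auto simp: cls_def L)
   show "cls (add Fr x y) <= cls x <+>\<^bsub>Fr\<^esub> cls y" proof
    fix z assume "z : cls (add Fr x y)"
    hence z: "z : carrier Fr" "L z = L x + L y" using x y by (auto simp: cls_def L)
    have "add Fr z (a_inv Fr y) : cls x" using z y by (simp add: cls_def L(2) Lneg)
    moreover have "z = add Fr (add Fr z (a_inv Fr y)) y" using z y by (simp add: F.a_assoc F.l_neg)
    ultimately show "z : cls x <+>\<^bsub>Fr\<^esub> cls y" unfolding set_add_def' using self[OF y]
     by auto
  qed qed
  thus ?thesis by (simp add: quot_module_def)
 qed
 have union: "(UN y:cls x. N +>\<^bsub>Fr\<^esub> f y) = cls (f x)" if x: "x : carrier Fr" and f:
  "!!y. y : carrier Fr ==> f y : carrier Fr" "!!y. y : carrier Fr ==> L y = L x ==> L (f y) = L (f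
  x)" for x f proof -
  have "N +>\<^bsub>Fr\<^esub> f y = cls (f x)" if "y : cls x" for y proof -
   have y: "y : carrier Fr" "L y = L x" using that by (auto simp: cls_def)
   have "N +>\<^bsub>Fr\<^esub> f y = cls (f y)" by (rule cls[OF f(1)[OF y(1)]])
   also have "... = cls (f x)" using f(2)[OF y] by (simp add: cls_def)
   finally show ?thesis .
  qed
  thus ?thesis using self[OF x] by auto
 qed
 have smul: "smult ?Q a (cls x) = cls (smult Fr a x)" if "a : carrier R" "x : carrier Fr" for a x
  using union that L(3) by (simp add: quot_module_def)
 have actq: "act ?Q g (cls x) = cls (act Fr g x)" if "g : carrier G" "x : carrier Fr" for g x using
  union that L(4) F.act_closed by (simp add: quot_module_def)
 \<comment> \<open>L is constant on a coset, so the image of a coset is a singleton.\<close>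
 define c where "c A = the_elem (L ` A)" for A
 have c: "c (cls x) = L x" if "x : carrier Fr" for x proof -
  have "L ` cls x = {L x}" using self[OF that] by (auto simp: cls_def)
  thus ?thesis by (simp add: c_def)
 qed
 have co: "coords ?Q rh c" unfolding coords_def car proof (intro conjI ballI)
  show "bij_betw c (cls ` carrier Fr) (vecs (unt rh))" unfolding bij_betw_def proof
   show "inj_on c (cls ` carrier Fr)" by (rule inj_onI) (auto simp: c, auto simp: cls_def)
   show "c ` cls ` carrier Fr = vecs (unt rh)" unfolding L(1)[symmetric] by (force simp: c)
 qed qed (auto simp: add smul actq c L F.act_closed)
 have "Gmod ?Q" by (rule coords_group_module[OF r co]) (auto simp: car zero add smul actq c L0
  F.act_closed)
 thus ?thesis using r co by (auto simp: mdl_def)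
qed

definition fsub :: "('x => 'r) set => bool" where "fsub N = (N ~= {} & (ALL x:N. ALL y:N. (%z. x z +
 y z) : N) & (ALL k:emb ` carrier R. ALL x:N. (%z. k * x z) : N))"

lemma fsub_add: "fsub N ==> x : N ==> y : N ==> (%z. x z + y z) : N" and fsub_sm: "fsub N ==> k :
 emb ` carrier R ==> x : N ==> (%z. k * x z) : N" by (auto simp: fsub_def)

lemma fsub_sum:
 assumes "fsub N" "finite I" "!!i. i : I ==> x i : N"
 shows "(%z. SUM i:I. x i z) : N" using assms(2,3) proof (induction I rule: finite_induct)
 case empty
 obtain y where "y : N" using assms(1) by (auto simp: fsub_def)
 thus ?case using fsub_sm[OF assms(1), of 0 y] by force
qed (auto intro: fsub_add[OF assms(1)])

text \<open>A map that is linear only modulo N respects linear combinations modulo N. It is applied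
  once for each argument of the map (v, w) |-> basis vector at (v, w), modulo the tensor
  relations.\<close>

lemma expand_modulo:
 fixes n :: nat
 assumes V: "Gmod V" "coords V rh c" and N: "fsub N" and h: "!!v v'. v : carrier V ==> v' : carrier
  V ==> (%z. h (add V v v') z - (h v z + h v' z)) : N" "!!k v. k : carrier R ==> v : carrier V ==>
  (%z. h (smult V k v) z - emb k * h v z) : N"
 shows "(!!i. i < n ==> a i : carrier V) ==> (!!i. k i : emb ` carrier R) ==> v : carrier V ==> c v
  = (SUM i<n. sm (k i) (c (a i))) ==> (%z. h v z - (SUM i<n. k i * h (a i) z)) : N" proof (induction
  n arbitrary: v)
 interpret V: group_module R G V by fact
 note C = coordsD[OF V(2)]
 case 0
 hence "v = zero V" using C(2) coords_zero[OF V] by (auto simp: inj_on_def)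
 thus ?case using h(2)[of \<zero> "zero V"] by simp
 next
 interpret V: group_module R G V by fact
 note C = coordsD[OF V(2)]
 case (Suc n)
 obtain q where q: "q : carrier R" "k n = emb q" using Suc.prems(2)[of n] by blast
 have "(SUM i<n. sm (k i) (c (a i))) : vecs (unt rh)" using Suc.prems(1,2) C(3) by (intro vecs_sum
  vecs_sm) auto
 then obtain v' where v': "v' : carrier V" "c v' = (SUM i<n. sm (k i) (c (a i)))" using C(4) by
  blast
 have a: "a n : carrier V" using Suc.prems(1) by simp
 have "c v = c (add V v' (smult V q (a n)))" using Suc.prems(4) v' q a by (simp add: C)
 hence v: "v = add V v' (smult V q (a n))" using C(2) Suc.prems(3) v'(1) q a by (meson
  V.smult_closed V.add.m_closed inj_onD)
 show ?case using fsub_add[OF N fsub_add[OF N Suc.IH[OF Suc.prems(1,2) v'] h(1)[of v' "smult V q (a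
  n)"]] h(2)[OF q(1) a]] v' q a by (simp add: v algebra_simps)
qed

lemma mdl_tensor:
 fixes V :: "('a, 'b, 'g, 'x) gmodule_scheme" and W :: "('a, 'c, 'g, 'y) gmodule_scheme"
 assumes V: "mdl V rh" and W: "mdl W ta"
 shows "mdl (tensor_module R G V W) (tens rh ta)" proof -
 obtain c where c: "coords V rh c" using V by (auto simp: mdl_def)
 obtain d where d: "coords W ta d" using W by (auto simp: mdl_def)
 have gV: "Gmod V" and gW: "Gmod W" and rV: "rep rh" and rW: "rep ta" using V W by (auto simp:
  mdl_def)
 interpret V: group_module R G V by (rule gV)
 interpret W: group_module R G W by (rule gW)
 note C = coordsD[OF c] and D = coordsD[OF d]
 define S where "S = carrier V \<times> carrier W"
 define aa where "aa = (%g (v, w). (act V g v, act W g w))"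
 define Fr where "Fr = perm_module R G S aa"
 have gF: "Gmod Fr" unfolding Fr_def by (rule perm_module_group_module) (auto simp: S_def aa_def
  V.act_closed W.act_closed V.act_one W.act_one V.act_mult W.act_mult)
 interpret F: group_module R G Fr by (rule gF)
 let ?T = "vecs (unt (tens rh ta))"
 let ?K = "emb ` carrier R" and ?u = "emb \<one>"
 define bb where "bb z = kron (c (fst z)) (d (snd z))" for z
 have pe: "prod_encode (0, 0) = 0" by (simp add: prod_encode_def)
 have E0: "kron E00 E00 = E00" by (simp add: E00_def kron_unitm pe)
 have bbv: "bb z : ?T" if "z : S" for z proof -
  have *: "c (fst z) : vecs (unt rh)" "d (snd z) : vecs (unt ta)" using that C(3) D(3) by (auto
   simp: S_def)
  moreover have "bb z * E00 = kron (c (fst z) * E00) (d (snd z) * E00)" by (simp only: bb_def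
   kron_mult[symmetric] E0)
  ultimately show ?thesis by (intro vecsI colsI) (auto simp: bb_def unt_tens kron_mult vecs_idem
   vecs_E00)
 qed
 \<comment> \<open>The bilinear map v, w |-> \<open>kron (c v) (d w)\<close> extended linearly to
   the free module; it remains to see that it is onto and that its kernel is spanned by the
   relations.\<close>
 define L where "L f = (SUM z | f z ~= \<zero>. sm (emb (f z)) (bb z))" for f
 have Fc: "(f : carrier Fr) = ((ALL x:S. f x : carrier R) & (ALL x. x ~: S --> f x = \<zero>) &
  finite {x. f x ~= \<zero>})" for f by (simp add: Fr_def perm_module_def)
 have Fcl: "f z : carrier R" if "f : carrier Fr" for f z using that Fc[of f] R.zero_closed by metis
 have Fadd: "(add Fr f h) z = f z \<oplus> h z" and Fsm: "(smult Fr k f) z = k \<otimes> f z" and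
  Fact: "act Fr g f z = (if z : S then f (aa (m_inv G g) z) else \<zero>)" and Fz: "(zero Fr) z =
  \<zero>" for f h k z g by (simp_all add: Fr_def perm_module_def)
 have Lgen: "L f = (SUM z:Z. sm (emb (f z)) (bb z))" if "finite Z" "{z. f z ~= \<zero>} <= Z" for f
  Z unfolding L_def by (rule sum.mono_neutral_left) (use that in auto)
 have Fsub: "{z. f z ~= \<zero>} <= S" "finite {z. f z ~= \<zero>}" if "f : carrier Fr" for f using
  that Fc[of f] by auto
 have Ladd: "L (add Fr f h) = L f + L h" if f: "f : carrier Fr" and h: "h : carrier Fr" for f h
  proof -
  let ?Z = "{z. f z ~= \<zero>} \<union> {z. h z ~= \<zero>}"
  have Z: "finite ?Z" using Fsub(2) f h by blast
  have "L (add Fr f h) = (SUM z:?Z. sm (emb (f z \<oplus> h z)) (bb z))" by (subst Lgen[OF Z]) (auto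
   simp: Fadd)
  also have "... = L f + L h" by (subst (1 2) Lgen[OF Z]) (auto simp: emb_add Fcl[OF f] Fcl[OF h]
   sm_add_left sum.distrib)
  finally show ?thesis .
 qed
 have Lsm: "L (smult Fr k f) = sm (emb k) (L f)" if f: "f : carrier Fr" and k: "k : carrier R" for f
  k proof -
  have "L (smult Fr k f) = (SUM z | f z ~= \<zero>. sm (emb (k \<otimes> f z)) (bb z))" by (subst
   Lgen[OF Fsub(2)[OF f]]) (use k in "auto simp: Fsm")
  thus ?thesis unfolding L_def using k by (simp add: emb_mult Fcl[OF f] sm_sum)
 qed
 have Lv: "L f : ?T" if f: "f : carrier Fr" for f unfolding L_def by (intro vecs_sum vecs_sm) (use
  Fcl[OF f] bbv Fsub(1)[OF f] in auto)
 have Lact: "L (act Fr g f) = tens rh ta g * L f" if g: "g : carrier G" and f: "f : carrier Fr" for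
  g f proof -
  let ?P = "{z. f z ~= \<zero>}"
  have PS: "z : S" if "z : ?P" for z using that Fsub(1)[OF f] by blast
  have inv1: "aa (m_inv G g) (aa g z) = z" "aa g (aa (m_inv G g) z) = z" "aa g z : S" "aa (m_inv G
   g) z : S" "bb (aa g z) = tens rh ta g * bb z" if "z : S" for z using that g by (auto simp: S_def
   aa_def bb_def tens_def kron_mult C D V.act_mult[symmetric] W.act_mult[symmetric] V.act_one
   W.act_one V.act_closed W.act_closed)
  have "{z. act Fr g f z ~= \<zero>} <= aa g ` ?P" by (auto simp: Fact split: if_splits intro!:
   image_eqI[of _ "aa g", OF inv1(2)[symmetric]])
  hence "L (act Fr g f) = (SUM z:aa g ` ?P. sm (emb (act Fr g f z)) (bb z))" by (intro Lgen) (use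
   Fsub(2)[OF f] in simp)
  also have "... = (SUM z:?P. sm (emb (act Fr g f (aa g z))) (bb (aa g z)))" by (rule
   sum.reindex_cong[OF inj_on_inverseI[of _ "aa (m_inv G g)"]]) (use inv1(1) PS in auto)
  also have "... = (SUM z:?P. tens rh ta g * sm (emb (f z)) (bb z))" by (rule sum.cong[OF refl])
   (use inv1 PS in "simp add: Fact sm_mult")
  finally show ?thesis by (simp add: L_def lsum)
 qed
 define bv where "bv p = (%z. if z = p then ?u else 0)" for p :: "'b \<times> 'c"
 have bc: "basis_vec R p z : carrier R" for p :: "'b \<times> 'c" and z by (simp add: basis_vec_def)
 have bF: "basis_vec R p : carrier Fr" if "p : S" for p using that by (auto simp: Fc basis_vec_def)
 have Lb: "L (basis_vec R p) = bb p" if "p : S" for p using Lgen[of "{p}" "basis_vec R p"] bbv[OF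
  that] by (auto simp: basis_vec_def)
 obtain n a where a: "!!i. i < n ==> a i : carrier V" "!!v. v : vecs (unt rh) ==> v = (SUM i<n. sm
  (ent v i 0) (c (a i)))" by (rule coords_expand[OF gV c rV]) (rule that)
 obtain m b where b: "!!i. i < m ==> b i : carrier W" "!!v. v : vecs (unt ta) ==> v = (SUM i<m. sm
  (ent v i 0) (d (b i)))" by (rule coords_expand[OF gW d rW]) (rule that)
 have sur: "L ` carrier Fr = ?T" proof
  show "L ` carrier Fr <= ?T" using Lv by blast
  show "?T <= L ` carrier Fr" proof
   fix z assume z: "z : ?T"
   obtain N where N: "bnd z N" using bnd_ex by blast
   let ?i = "%k. fst (prod_decode k)" and ?j = "%k. snd (prod_decode k)"
   have dec: "unitm ?u k 0 = kron (unitm ?u (?i k) 0) (unitm ?u (?j k) 0)" for k by (simp add: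
    kron_unitm pe emb_mult[symmetric])
   have inL: "EX f:carrier Fr. L f = unt (tens rh ta) * unitm ?u k 0" for k proof -
    obtain v where v: "v : carrier V" "c v = unt rh * unitm ?u (?i k) 0" using C(4)[OF vecs_mult[of
     "unt rh" "unt rh" "unitm ?u (?i k) 0"]] rV by auto
    obtain w where w: "w : carrier W" "d w = unt ta * unitm ?u (?j k) 0" using D(4)[OF vecs_mult[of
     "unt ta" "unt ta" "unitm ?u (?j k) 0"]] rW by auto
    have S: "(v, w) : S" using v w by (simp add: S_def)
    have "L (basis_vec R (v, w)) = unt (tens rh ta) * unitm ?u k 0" unfolding Lb[OF S] by (subst
     dec) (simp add: bb_def v w unt_tens kron_mult)
    thus ?thesis using bF[OF S] by blast
   qed
   have "EX f:carrier Fr. L f = (SUM k<l. sm (ent z k 0) (unt (tens rh ta) * unitm ?u k 0))" for l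
    proof (induction l)
    case 0
    show ?case using Lsm[of "zero Fr" \<zero>] by (intro bexI[of _ "smult Fr \<zero> (zero Fr)"])
     auto
    next case (Suc l)
    then obtain f where f: "f : carrier Fr" "L f = (SUM k<l. sm (ent z k 0) (unt (tens rh ta) *
     unitm ?u k 0))" by blast
    have "ent z l 0 : ?K" by (rule MK_ent) (use z in simp)
    then obtain q h where "q : carrier R" "ent z l 0 = emb q" "h : carrier Fr" "L h = unt (tens rh
     ta) * unitm ?u l 0" using inL by blast
    thus ?case using f by (intro bexI[of _ "add Fr f (smult Fr q h)"]) (simp_all add: Ladd Lsm)
   qed
   moreover have "(SUM k<N. sm (ent z k 0) (unt (tens rh ta) * unitm ?u k 0)) = z" using ent_col[OF
    vecs_cols[OF z] N, of "unt (tens rh ta)"] vecs_idem[OF z] by simp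
   ultimately show "z : L ` carrier Fr" by (metis image_eqI)
 qed qed
 let ?rel = "tensor_relations R V W"
 have ker: "lin_span R Fr ?rel = {f:carrier Fr. L f = 0}" proof
  have "submodule {f:carrier Fr. L f = 0} R Fr" by (rule submodule_closedI[OF gF]) (auto simp: Ladd
   Lsm, simp add: L_def Fz)
  moreover have "?rel <= {f:carrier Fr. L f = 0}" proof -
   have diff: "(%z. basis_vec R p z \<ominus> (basis_vec R q z \<oplus> basis_vec R q' z)) :
    {f:carrier Fr. L f = 0}" if "p : S" "q : S" "q' : S" "bb p = bb q + bb q'" for p q q' proof -
    have "(%z. basis_vec R p z \<ominus> (basis_vec R q z \<oplus> basis_vec R q' z)) = add Fr
     (basis_vec R p) (smult Fr (\<ominus> \<one>) (add Fr (basis_vec R q) (basis_vec R q')))" by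
     (rule ext) (simp add: Fadd Fsm R.minus_eq R.l_minus bc)
    moreover have "sm ?u (bb q + bb q') = bb q + bb q'" using bbv[OF that(2)] bbv[OF that(3)] by
     simp
    ultimately show ?thesis using that bF by (simp add: Ladd Lsm Lb emb_minus sm_minus_left)
   qed
   have diff2: "(%z. basis_vec R p z \<ominus> k \<otimes> basis_vec R q z) : {f:carrier Fr. L f =
    0}" if "p : S" "q : S" "k : carrier R" "bb p = sm (emb k) (bb q)" for p q k proof -
    have "(%z. basis_vec R p z \<ominus> k \<otimes> basis_vec R q z) = add Fr (basis_vec R p)
     (smult Fr (\<ominus> k) (basis_vec R q))" by (rule ext) (use that in "simp add: Fadd Fsm
     R.minus_eq R.l_minus bc")
    thus ?thesis using that bF by (simp add: Ladd Lsm Lb emb_minus sm_minus_left)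
   qed
   show ?thesis unfolding tensor_relations_def by (intro Un_least subsetI; elim CollectE exE conjE;
    hypsubst) ((rule diff diff2; simp add: S_def bb_def C D kron_add_left kron_add_right
    kron_sm_left kron_sm_right)+)
  qed
  ultimately show "lin_span R Fr ?rel <= {f:carrier Fr. L f = 0}" unfolding lin_span_def by blast
  show "{f:carrier Fr. L f = 0} <= lin_span R Fr ?rel" unfolding lin_span_def proof (intro
   Inter_greatest subsetI)
   fix N f assume "N : {N. submodule N R Fr & ?rel <= N}" and "f : {f:carrier Fr. L f = 0}"
   hence N: "submodule N R Fr" "?rel <= N" and f: "f : carrier Fr" "L f = 0" by auto
   note NE = F.submoduleE[OF N(1)]
   \<comment> \<open>N is moved entrywise into the ring, where finite sums are those of the type
     class.\<close>
   define Nh where "Nh = (%f z. emb (f z)) ` N"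
   have Nc: "h z : carrier R" if "h : N" for h z using Fcl NE(1) that by blast
   have Nh: "fsub Nh" unfolding fsub_def proof (intro conjI ballI)
    show "Nh ~= {}" using NE(2) by (auto simp: Nh_def)
    show "(%z. x z + y z) : Nh" if xy: "x : Nh" "y : Nh" for x y proof -
     obtain f h where fh: "f : N" "h : N" "x = (%z. emb (f z))" "y = (%z. emb (h z))" using xy by
      (auto simp: Nh_def)
     hence "(%z. x z + y z) = (%z. emb ((add Fr f h) z))" using Nc by (auto simp: Fadd emb_add)
     thus ?thesis using NE(5) fh unfolding Nh_def by blast
    qed
    show "(%z. k * x z) : Nh" if kx: "k : ?K" "x : Nh" for k x proof -
     obtain q f where fh: "f : N" "q : carrier R" "x = (%z. emb (f z))" "k = emb q" using kx by
      (auto simp: Nh_def)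
     hence "(%z. k * x z) = (%z. emb ((smult Fr q f) z))" using Nc by (auto simp: Fsm emb_mult)
     thus ?thesis using NE(4) fh unfolding Nh_def by blast
   qed qed
   have be: "emb (basis_vec R p z) = bv p z" for p z by (simp add: basis_vec_def bv_def)
   have relN: "(%z. emb (h z)) : Nh" if "h : ?rel" for h using that N(2) by (auto simp: Nh_def)
   have R: "(%z. bv p z - (bv q z + bv q' z)) : Nh" if "(%z. basis_vec R p z \<ominus> (basis_vec R
    q z \<oplus> basis_vec R q' z)) : ?rel" for p q q' using relN[OF that] bc by (simp add:
    R.minus_eq emb_add emb_minus be algebra_simps)
   have R': "(%z. bv p z - emb k * bv q z) : Nh" if "k : carrier R" "(%z. basis_vec R p z \<ominus>
    k \<otimes> basis_vec R q z) : ?rel" for p q k using relN[OF that(2)] bc that(1) by (simp add: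
    R.minus_eq emb_add emb_minus emb_mult be)
   have K: "ent x i 0 : ?K" if "x : vecs g" for x g i by (rule MK_ent[OF cols_MK[OF vecs_cols[OF
    that]]])
   let ?e = "%i j. prod_encode (i, j)"
   \<comment> \<open>Modulo the relations, the basis vector at (v, w) is a combination of those at
     the pairs of generators, with coefficients read off from \<open>bb (v, w)\<close>. These
     coefficients depend linearly on \<open>bb\<close>, so for \<open>L f = 0\<close> everything
     cancels.\<close>
   have both: "(%z. bv p z - (SUM i<n. SUM j<m. ent (bb p) (?e i j) 0 * bv (a i, b j) z)) : Nh" if
    "p : S" for p proof -
    obtain v w where p: "p = (v, w)" and vw: "v : carrier V" "w : carrier W" using \<open>p :
     S\<close> by (auto simp: S_def)
    have 1: "(%z. bv (v, w) z - (SUM i<n. ent (c v) i 0 * bv (a i, w) z)) : Nh" by (rule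
     expand_modulo[OF gV c Nh _ _ a(1) K[OF C(3)[OF vw(1)]] vw(1) a(2)[OF C(3)[OF vw(1)]]]) ((rule R
     R', assumption?; unfold tensor_relations_def; use vw in blast)+)
    have 2: "(%z. bv (v, w) z - (SUM j<m. ent (d w) j 0 * bv (v, b j) z)) : Nh" if "v : carrier V"
     for v by (rule expand_modulo[OF gW d Nh _ _ b(1) K[OF D(3)[OF vw(2)]] vw(2) b(2)[OF D(3)[OF
     vw(2)]]]) ((rule R R', assumption?; unfold tensor_relations_def; use that in blast)+)
    have 3: "(%z. SUM i<n. ent (c v) i 0 * (bv (a i, w) z - (SUM j<m. ent (d w) j 0 * bv (a i, b j)
     z))) : Nh" by (intro fsub_sum[OF Nh] fsub_sm[OF Nh] K[OF C(3)[OF vw(1)]] 2 a(1)) auto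
    have "ent (bb p) (?e i j) 0 = ent (c v) i 0 * ent (d w) j 0" for i j using ent_kron'[of "c v" "d
     w" i j 0 0] by (simp add: bb_def pe p)
    thus ?thesis using fsub_add[OF Nh 1 3] by (simp add: p rdiff sum_subtractf lsum massoc)
   qed
   let ?P = "{z. f z ~= \<zero>}"
   have "(%z. SUM p:?P. emb (f p) * (bv p z - (SUM i<n. SUM j<m. ent (bb p) (?e i j) 0 * bv (a i, b
    j) z))) : Nh" by (intro fsub_sum[OF Nh] fsub_sm[OF Nh] both) (use Fsub[OF f(1)] Fcl[OF f(1)] in
    auto)
   moreover have "(SUM p:?P. emb (f p) * bv p z) = emb (f z)" for z proof -
    have "(SUM p:?P. emb (f p) * bv p z) = (SUM p:?P. if p = z then emb (f p) else 0)" using Fcl[OF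
     f(1)] by (intro sum.cong) (auto simp: bv_def emb_mult[symmetric])
    thus ?thesis using Fsub(2)[OF f(1)] by (simp add: sum.delta)
   qed
   moreover have "(SUM p:?P. emb (f p) * (SUM i<n. SUM j<m. ent (bb p) (?e i j) 0 * bv (a i, b j)
    z)) = 0" for z proof -
    have "(SUM p:?P. emb (f p) * (SUM i<n. SUM j<m. ent (bb p) (?e i j) 0 * bv (a i, b j) z)) = (SUM
     i<n. SUM j<m. ent (L f) (?e i j) 0 * bv (a i, b j) z)" unfolding L_def lsum ent_sum rsum by
     (subst sum.swap, rule sum.cong[OF refl], subst sum.swap) (simp add: massoc)
    thus ?thesis using f(2) by simp
   qed
   ultimately have "(%z. emb (f z)) : Nh" by (simp add: rdiff sum_subtractf)
   then obtain h where h: "h : N" "!!z. emb (f z) = emb (h z)" by (auto simp: Nh_def fun_eq_iff)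
   thus "f : N" by (metis emb_inj Fcl[OF f(1)] Nc[OF h(1)] h(1) inj_on_def fun_eq_iff)
 qed qed
 have "mdl (quot_module Fr (lin_span R Fr ?rel)) (tens rh ta)" by (rule mdl_quot[OF gF tens_rep[OF
  rV rW] sur Ladd Lsm Lact ker])
 thus ?thesis by (simp add: tensor_module_def Let_def Fr_def S_def aa_def)
qed

lemma mdl_trivial: "mdl (trivial_module R) triv" proof -
 let ?c = "%x. unitm (emb x) 0 0"
 have v: "vecs E00 = ?c ` carrier R" proof
  show "?c ` carrier R <= vecs E00" by (auto intro!: vecsI simp: E00_def unitm_mult)
  show "vecs E00 <= ?c ` carrier R" proof
   fix v assume v: "v : vecs E00"
   have K: "ent v 0 0 : emb ` carrier R" by (rule MK_ent) (use v in simp)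
   have "v = ?c (dmb (ent v 0 0))" proof (rule cols_eqI)
    fix i
    have "ent v i 0 = ent (E00 * v) i 0" using v by (simp add: vecs_idem)
    thus "ent v i 0 = ent (?c (dmb (ent v 0 0))) i 0" using K by (simp add: E00_def ent_unitm_mult
     ent_unitm)
   qed (use v K in auto)
   thus "v : ?c ` carrier R" using K by (metis dmb_closed image_eqI)
 qed qed
 have inj: "inj_on ?c (carrier R)" proof (rule inj_onI)
  fix x y assume xy: "x : carrier R" "y : carrier R" "?c x = ?c y"
  have "emb x = ent (?c x) 0 0" by (simp add: ent_unitm)
  also have "... = emb y" unfolding xy(3) by (simp add: ent_unitm)
  finally show "x = y" using xy emb_inj by (simp add: inj_on_eq_iff)
 qed
 have add: "unitm (a + b) 0 0 = unitm a 0 0 + unitm b 0 0" for a b :: 'r by (rule fm_eqI) (simp add: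
  ent_unitm)
 have sml: "unitm (a * b) 0 0 = sm a (unitm b 0 0)" for a b :: 'r by (rule fm_eqI) (simp add:
  ent_unitm)
 have co: "coords (trivial_module R :: ('a, 'a, 'g) gmodule) triv ?c" unfolding coords_def using v
  inj by (auto simp: trivial_module_def bij_betw_def emb_add emb_mult add sml triv_def E00_def
  unitm_mult)
 have "Gmod (trivial_module R :: ('a, 'a, 'g) gmodule)" by (rule coords_group_module[OF triv_rep
  co]) (auto simp: trivial_module_def intro!: fm_eqI simp: ent_unitm)
 thus ?thesis using co by (auto simp: mdl_def)
qed

lemma mdl_tensor_power: "mdl V rh ==> mdl (tensor_power R G V n) (tpow rh n)" by (induction n) (auto
 intro: mdl_vec_copy mdl_trivial mdl_tensor)
end
context matrix_reps
begin

section \<open>Change of index sets and free covers\<close>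

text \<open>Up to isomorphism a representation does not depend on the numbering of its coordinates;
  this supplies the unit and associativity isomorphisms of the coded tensor product.\<close>

lemma isor_reindex:
 assumes r: "rep rh" "rep rh'" and ff: "inj ff" and e: "!!g i j. g : carrier G ==> ent (rh' g) (ff
  i) (ff j) = ent (rh g) i j" and z: "!!g a b. g : carrier G ==> a ~: range ff | b ~: range ff ==>
  ent (rh' g) a b = 0"
 shows "isor rh rh'" proof -
 obtain N where N: "!!g. g : carrier G ==> bnd (rh g) N" using bnd_finite[of "rh ` carrier G"] by
  auto
 \<comment> \<open>The permutation matrix of ff, cut off at N: the full one would not have finite
   support, and beyond N all \<open>rh g\<close> vanish.\<close>
 define Q where "Q = (SUM i<N. unitm u (ff i) i)"
 define Q' where "Q' = (SUM i<N. unitm u i (ff i))"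
 have Q: "Q : MK" "Q' : MK" by (auto simp: Q_def Q'_def)
 have QA: "ent (Q * A) a b = (SUM i<N. if a = ff i then ent A i b else 0)" if "A : MK" for A a b by
  (simp add: that Q_def rsum ent_unitm_mult cong: if_cong)
 have AQ: "ent (A * Q') a b = (SUM j<N. if b = ff j then ent A a j else 0)" if "A : MK" for A a b by
  (simp add: that Q'_def lsum ent_mult_unitm cong: if_cong)
 have QQ: "Q' * (Q * A) = A" if A: "bnd A N" "A : MK" for A proof (rule fm_eqI)
  fix a b
  have "ent (Q' * (Q * A)) a b = (SUM i<N. if a = i then ent (Q * A) (ff i) b else 0)" by (simp add:
   A(2) Q Q'_def rsum ent_unitm_mult cong: if_cong)
  also have "... = (if a < N then (SUM i<N. if a = i then ent A i b else 0) else 0)" by (simp add: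
   A(2) ff QA inj_eq cong: if_cong)
  also have "... = ent A a b" using bnd_zero[OF A(1), of a b] by auto
  finally show "ent (Q' * (Q * A)) a b = ent A a b" .
 qed
 have QAQ: "Q * rh g * Q' = rh' g" if g: "g : carrier G" for g proof (rule fm_eqI)
  fix a b
  have MK: "rh g : MK" by (simp add: r g repD)
  have "ent (Q * rh g * Q') a b = (SUM j<N. if b = ff j then (SUM i<N. if a = ff i then ent (rh g) i
   j else 0) else 0)" by (simp add: MK Q AQ QA cong: if_cong)
  also have "... = (SUM j<N. SUM i<N. if a = ff i & b = ff j then ent (rh g) i j else 0)" by (intro
   sum.cong refl) auto
  also have "... = (SUM i<N. SUM j<N. if a = ff i & b = ff j then ent (rh g) i j else 0)" by (rule
   sum.swap)
  finally have eq: "ent (Q * rh g * Q') a b = (SUM i<N. SUM j<N. if a = ff i & b = ff j then ent (rh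
   g) i j else 0)"
  .
  show "ent (Q * rh g * Q') a b = ent (rh' g) a b" proof (cases "a : range ff & b : range ff")
   case True
   then obtain i0 j0 where ab: "a = ff i0" "b = ff j0" by auto
   have "(SUM i<N. SUM j<N. if a = ff i & b = ff j then ent (rh g) i j else 0) = (SUM i<N. if i = i0
    then (SUM j<N. if j = j0 then ent (rh g) i j else 0) else 0)" using ff by (intro sum.cong refl)
    (auto simp: ab inj_eq)
   also have "... = ent (rh g) i0 j0" using bnd_zero[OF N[OF g], of i0 j0] by auto
   finally show ?thesis unfolding eq using e[OF g] ab by simp
   next case False
   hence "(SUM i<N. SUM j<N. if a = ff i & b = ff j then ent (rh g) i j else 0) = 0" by (intro
    sum.neutral ballI) auto
   thus ?thesis using z[OF g, of a b] False by (auto simp: eq)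
 qed qed
 let ?f = "Q * unt rh" and ?g = "unt rh * Q'"
 have one: "one G : carrier G" by simp
 have QQr: "Q' * (Q * rh g) = rh g" if "g : carrier G" for g by (rule QQ) (use N r that repD in
  auto)
 have f: "rh' g * ?f = Q * rh g" "?f * rh g = Q * rh g" if g: "g : carrier G" for g proof -
  have "rh' g * ?f = Q * rh g * (Q' * (Q * unt rh))" by (simp only: QAQ[OF g, symmetric] massoc)
  thus "rh' g * ?f = Q * rh g" by (simp add: QQr r g massoc)
  show "?f * rh g = Q * rh g" by (simp add: r g massoc)
 qed
 have h: "rh g * ?g = rh g * Q'" "?g * rh' g = rh g * Q'" if g: "g : carrier G" for g proof -
  show "rh g * ?g = rh g * Q'" by (simp add: r g massoc')
  have "?g * rh' g = unt rh * (Q' * (Q * rh g)) * Q'" by (simp only: QAQ[OF g, symmetric] massoc)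
  thus "?g * rh' g = rh g * Q'" using QQr r g by simp
 qed
 have "?f : homs rh rh'" by (rule homsI) (use f f[OF one] Q r in "auto")
 moreover have "?g : homs rh' rh" by (rule homsI) (use h h[OF one] Q r in "auto")
 moreover have "?g * ?f = unt rh" by (simp add: QQr r massoc)
 moreover have "?f * ?g = unt rh'" using QAQ r by (simp add: massoc) (simp add: massoc')
 ultimately show ?thesis by (auto simp: isor_def)
qed

lemma isor_runit: "rep rh ==> isor rh (tens rh triv)" proof (rule isor_reindex[of _ _ "%i.
 prod_encode (i, 0)"])
 show "inj (%i. prod_encode (i, 0))" by (auto intro: injI)
 fix g assume r: "rep rh" and g: "g : carrier G"
 show "ent (tens rh triv g) (prod_encode (i, 0)) (prod_encode (j, 0)) = ent (rh g) i j" for i j by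
  (simp add: repD[OF r g] tens_def triv_def ent_kron' E00_def ent_unitm)
 show "ent (tens rh triv g) a b = 0" if "a ~: range (%i. prod_encode (i, 0)) | b ~: range (%i.
  prod_encode (i, 0))" for a b proof -
  obtain i k j l where "a = prod_encode (i, k)" "b = prod_encode (j, l)" by (metis prod.collapse
   prod_decode_inverse)
  moreover from this that have "k ~= 0 | l ~= 0" by auto
  ultimately show ?thesis by (auto simp: tens_def triv_def ent_kron' E00_def ent_unitm)
qed qed auto

lemma isor_lunit: "rep rh ==> isor rh (tens triv rh)" proof (rule isor_reindex[of _ _ "%i.
 prod_encode (0, i)"])
 show "inj (%i. prod_encode (0, i))" by (auto intro: injI)
 fix g assume r: "rep rh" and g: "g : carrier G"
 show "ent (tens triv rh g) (prod_encode (0, i)) (prod_encode (0, j)) = ent (rh g) i j" for i j by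
  (simp add: repD[OF r g] tens_def triv_def ent_kron' E00_def ent_unitm)
 show "ent (tens triv rh g) a b = 0" if "a ~: range (%i. prod_encode (0, i)) | b ~: range (%i.
  prod_encode (0, i))" for a b proof -
  obtain i k j l where "a = prod_encode (i, k)" "b = prod_encode (j, l)" by (metis prod.collapse
   prod_decode_inverse)
  moreover from this that have "i ~= 0 | j ~= 0" by auto
  ultimately show ?thesis by (auto simp: tens_def triv_def ent_kron' E00_def ent_unitm)
qed qed auto

lemma isor_assoc:
 assumes r: "rep rh" "rep ss" "rep ta"
 shows "isor (tens (tens rh ss) ta) (tens rh (tens ss ta))" proof -
 define ff where "ff i = (case prod_decode i of (x, c) => case prod_decode x of (a, b) =>
  prod_encode (a, prod_encode (b, c)))" for i
 have ff: "ff (prod_encode (prod_encode (a, b), c)) = prod_encode (a, prod_encode (b, c))" for a b c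
  by (simp add: ff_def)
 have ex: "EX a b c. i = prod_encode (prod_encode (a, b), c)" for i by (metis prod.collapse
  prod_decode_inverse)
 have ex': "EX a b c. i = prod_encode (a, prod_encode (b, c))" for i by (metis prod.collapse
  prod_decode_inverse)
 show ?thesis proof (rule isor_reindex[of _ _ ff])
  show "inj ff" proof (rule injI)
   fix x y assume "ff x = ff y"
   moreover obtain a b c a' b' c' where "x = prod_encode (prod_encode (a, b), c)" "y = prod_encode
    (prod_encode (a', b'), c')" using ex by metis
   ultimately show "x = y" by (simp add: ff prod_encode_eq)
  qed
  fix g
  show "ent (tens rh (tens ss ta) g) (ff i) (ff j) = ent (tens (tens rh ss) ta g) i j" for i j proof
   -
   obtain a b c a' b' c' where "i = prod_encode (prod_encode (a, b), c)" "j = prod_encode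
    (prod_encode (a', b'), c')" using ex by metis
   thus ?thesis by (simp add: ff tens_def ent_kron' massoc)
  qed
  have "a : range ff" for a using ex'[of a] ff by (metis rangeI)
  thus "ent (tens rh (tens ss ta) g) a b = 0" if "a ~: range ff | b ~: range ff" for a b using that
   by simp
qed (use r in auto) qed

text \<open>P is the regular representation tensored with rh, mapped to rh by the augmentation. The
  matrix unit at the neutral element has trace one, because its conjugates are the matrix units at
  all group elements.\<close>

lemma free_cover:
 assumes r: "rep rh" obtains P t qi s where "rep P" "t : MK" "tr P P t = unt P" "qi : homs P rh" "s
  : MK" "qi * s = unt rh" proof -
 obtain n :: "'g => nat" where n: "inj_on n (carrier G)" using finite_imp_inj_to_nat_seg[OF fin_G]
  by auto
 define reg where "reg g = (SUM x:carrier G. unitm u (n (mult G g x)) (n x))" for g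
 have reg_MK: "reg g : MK" for g by (auto simp: reg_def)
 have reg_unit: "reg g * unitm u (n x) b = unitm u (n (mult G g x)) b" if "x : carrier G" for g x b
  proof -
  have "reg g * unitm u (n x) b = (SUM y:carrier G. if y = x then unitm u (n (mult G g x)) b else
   0)" unfolding reg_def rsum using n that by (intro sum.cong) (auto simp: unitm_mult inj_on_eq_iff)
  thus ?thesis using that by simp
 qed
 have reg_mult: "reg (mult G g h) = reg g * reg h" if "g : carrier G" "h : carrier G" for g h
  unfolding reg_def[of h] lsum using that by (subst reg_def) (intro sum.cong refl, simp add:
  reg_unit m_assoc)
 have rreg: "rep reg" by (auto simp: reg_MK reg_mult rep_def)
 let ?P = "tens reg rh"
 let ?e1 = "unitm u (n (one G)) (n (one G))"
 have unit_reg: "unitm u a (n x) * reg g = unitm u a (n (mult G (m_inv G g) x))" if "x : carrier G"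
  "g : carrier G" for g x a proof -
  have "unitm u a (n x) * reg g = (SUM y:carrier G. if y = mult G (m_inv G g) x then unitm u a (n
   (mult G (m_inv G g) x)) else 0)" unfolding reg_def lsum proof (intro sum.cong refl)
   fix y assume y: "y : carrier G"
   have "(n x = n (mult G g y)) = (y = mult G (m_inv G g) x)" using n that y by (metis inj_on_eq_iff
    inv_solve_left m_closed)
   thus "unitm u a (n x) * unitm u (n (mult G g y)) (n y) = (if y = mult G (m_inv G g) x then unitm
    u a (n (mult G (m_inv G g) x)) else 0)" by (auto simp: unitm_mult)
  qed
  thus ?thesis using that by simp
 qed
 have trP: "tr ?P ?P (kron ?e1 (unt rh)) = unt ?P" proof -
  have "tr reg reg ?e1 = unt reg" unfolding tr_def reg_def[of "one G"] by (intro sum.cong refl)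
   (simp add: reg_unit unit_reg)
  thus ?thesis using tr_kron_left[OF r homs_unt[OF r], of reg reg ?e1] by (simp add: unt_tens)
 qed
 define aug where "aug = (SUM x:carrier G. unitm u 0 (n x))"
 have aug_reg: "aug * reg g = aug" if g: "g : carrier G" for g proof -
  have "aug * reg g = (SUM x:carrier G. unitm u 0 (n (mult G (m_inv G g) x)))" unfolding aug_def
   rsum using g by (intro sum.cong) (auto simp: unit_reg)
  also have "... = aug" unfolding aug_def by (rule sum.reindex_bij_witness[of _ "%x. mult G g x"
   "%x. mult G (m_inv G g) x"]) (use g in "auto simp: m_assoc[symmetric]")
  finally show ?thesis .
 qed
 have E: "E00 * aug = aug" by (simp add: aug_def E00_def lsum unitm_mult)
 have aug: "aug : homs reg triv" by (rule homsI) (auto simp: aug_reg E triv_def, auto simp: aug_def)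
 have augs: "aug * unitm u (n (one G)) 0 = E00" proof -
  have "aug * unitm u (n (one G)) 0 = (SUM x:carrier G. if x = one G then E00 else 0)" unfolding
   aug_def rsum using n by (intro sum.cong) (auto simp: unitm_mult E00_def inj_on_eq_iff)
  thus ?thesis by simp
 qed
 obtain f g where fg: "f : homs rh (tens triv rh)" "g : homs (tens triv rh) rh" "g * f = unt rh"
  using isor_lunit[OF r] by (auto simp: isor_def)
 have k: "kron aug (unt rh) : homs ?P (tens triv rh)" by (rule tens_homs[OF aug homs_unt[OF r]])
 show ?thesis proof (rule that[of ?P "kron ?e1 (unt rh)" "g * kron aug (unt rh)" "kron (unitm u (n
  (one G)) 0) (unt rh) * f"])
  show "g * kron aug (unt rh) : homs ?P rh" by (rule homs_mult[OF k fg(2)])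
  have "g * kron aug (unt rh) * (kron (unitm u (n (one G)) 0) (unt rh) * f) = g * (kron aug (unt rh)
   * kron (unitm u (n (one G)) 0) (unt rh)) * f" by (simp only: massoc)
  also have "... = g * (unt (tens triv rh) * f)" by (simp add: r kron_mult augs unt_tens triv_def
   massoc)
  finally show "g * kron aug (unt rh) * (kron (unitm u (n (one G)) 0) (unt rh) * f) = unt rh" using
   fg homs_left by simp
qed (use r rreg trP fg homs_MK in auto) qed

text \<open>If B is a generalized inverse of qi, then \<open>qi * B\<close> fixes every value of qi;
  surjectivity makes it the identity of the target.\<close>

lemma linear_section:
 assumes qi: "qi : MK" "qi * e = qi" "e : MK" "e * e = e" and e': "e' : MK" "e' * e' = e'" and sur:
  "!!w. w : vecs e' ==> EX v:cols. qi * v = w" obtains S where "S : MK" "qi * S = e'" "S * e' = S"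
  "e * S = S" proof -
 obtain B where B: "B : MK" "qi * B * qi = qi" using generalized_inverse[OF qi(1)] by auto
 have "qi * B * e' = e'" proof (rule cols_test[of _ _ e'])
  fix w assume w: "w : vecs e'"
  then obtain v where "v : cols" "qi * v = w" using sur by auto
  thus "qi * B * e' * w = e' * w" using B(2) vecs_idem[OF w] by (metis massoc)
 qed (use qi B e' in "auto simp: massoc")
 thus ?thesis using qi B e' by (intro that[of "e * B * e'"]) (auto simp: massoc, simp_all add:
  massoc')
qed

lemma homs_subr_iff:
 assumes "rep rh" "p : homs rh rh" "p * p = p"
 shows "(q : homs (subr rh p) (subr rh p)) = (q : homs rh rh & p * q = q & q * p = q)" proof
 note s = subr_homs[OF assms]
 have up: "unt (subr rh p) = p" using assms homs_MK homs_left by simp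
 {
 assume q: "q : homs (subr rh p) (subr rh p)"
 hence "p * q = q" "q * p = q" using homs_left homs_right up by metis+
 thus "q : homs rh rh & p * q = q & q * p = q" using homs_mult[OF homs_mult[OF s(2) q] s(1)] by simp
 }
 assume "q : homs rh rh & p * q = q & q * p = q"
 thus "q : homs (subr rh p) (subr rh p)" using homs_mult[OF homs_mult[OF s(1), of q rh] s(2)] by
  simp
qed
end
context modelled
begin

section \<open>Heller translates\<close>

lemma hom_surj_section:
 assumes V: "Gmod V" "coords V rh c" "rep rh" and W: "Gmod W" "coords W ta d" "rep ta" and f: "f `
  carrier V = carrier W" and M: "M : homs rh ta" "ALL x:carrier V. d (f x) = M * c x" obtains S
  where "S : MK" "M * S = unt ta" "S * unt ta = S" "unt rh * S = S" proof (rule linear_section[of M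
  "unt rh" "unt ta"])
 fix w assume "w : vecs (unt ta)"
 then obtain y where y: "y : carrier W" "d y = w" using coordsD(4)[OF W(2)] by auto
 then obtain x where x: "x : carrier V" "y = f x" using f by auto
 thus "EX v:cols. M * v = w" using bspec[OF M(2) x(1)] y vecs_cols[OF coordsD(3)[OF V(2) x(1)]] by
  auto
qed (use M V(3) W(3) homs_MK homs_right that in auto)

lemma hom_surjI:
 assumes V: "coords V rh c" "rep rh" and W: "coords W ta d" and f: "f : Ghom V W" "!!x. x : carrier
  V ==> d (f x) = M * c x" and M: "M : homs rh ta" "S : MK" "M * S = unt ta"
 shows "f ` carrier V = carrier W" proof
 show "f ` carrier V <= carrier W" using f(1) by (auto simp: gmod_hom_def)
 show "carrier W <= f ` carrier V" proof
  fix y assume y: "y : carrier W"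
  have "unt rh * (S * d y) : vecs (unt rh)" using V(2) M(2) coordsD(3)[OF W y] by (intro vecs_mult)
   auto
  then obtain x where x: "x : carrier V" "c x = unt rh * (S * d y)" using coordsD(4)[OF V(1)] by
   auto
  have "d (f x) = (M * unt rh) * S * d y" by (simp add: f(2)[OF x(1)] x(2) massoc)
  also have "... = d y" by (simp add: vecs_idem[OF coordsD(3)[OF W y]] homs_right[OF M(1)] M(3))
  finally have "f x = y" using coordsD(2)[OF W] f(1) x(1) y by (auto simp: gmod_hom_def inj_on_def)
  thus "y : f ` carrier V" using x by auto
qed qed

text \<open>The lifting property splits the free cover, and the trace-one element of the cover is
  compressed to the resulting summand.\<close>

lemma projective_imp_trace:
 fixes P :: "('a, 'g) vec_gmodule"
 assumes P: "mdl P rh" and pr: "projective_module R G P"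
 shows "EX t:MK. tr rh rh t = unt rh" proof -
 obtain c where c: "Gmod P" "coords P rh c" "rep rh" using P by (auto simp: mdl_def)
 obtain F t qi s where F: "rep F" "t : MK" "tr F F t = unt F" "qi : homs F rh" "s : MK" "qi * s =
  unt rh" using free_cover[OF c(3)] by metis
 obtain d where d: "Gmod (std F)" "coords (std F) F d" using mdl_std[OF F(1)] by (auto simp:
  mdl_def)
 obtain f where f: "f : Ghom (std F) P" "!!x. x : carrier (std F) ==> c (f x) = qi * d x" using
  matrix_hom[OF d c(1,2) F(4)] by auto
 have "f ` carrier (std F) = carrier P" by (rule hom_surjI[OF d(2) F(1) c(2) f(1) _ F(4-6)]) (rule
  f(2))
 hence "f : gmod_epi R G (std F) P" by (simp add: f gmod_epi_def)
 moreover have "(%x. x) : Ghom P P" by (auto simp: gmod_hom_def)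
 moreover have "Gfd (std F)" "Gfd P" using mdl_fd mdl_std[OF F(1)] P by auto
 ultimately obtain k where k: "k : Ghom P (std F)" "ALL x:carrier P. f (k x) = x" using pr[unfolded
  projective_module_def, rule_format, of "std F" P f "%x. x"] by auto
 obtain M where M: "M : homs rh F" "!!x. x : carrier P ==> d (k x) = M * c x" using hom_matrix[OF c
  d F(1) k(1)] by auto
 have "qi * M = unt rh" proof (rule cols_test[of _ _ "unt rh"])
  fix v assume "v : vecs (unt rh)"
  then obtain x where x: "x : carrier P" "c x = v" using coordsD(4)[OF c(2)] by auto
  have "k x : carrier (std F)" using k(1) x by (auto simp: gmod_hom_def)
  hence "c (f (k x)) = qi * (M * c x)" using f(2) M(2) x by simp
  thus "qi * M * v = unt rh * v" using k(2) x coordsD(3)[OF c(2) x(1)] by (simp add: massoc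
   vecs_idem)
 qed (use F M c homs_MK homs_right in "auto simp: massoc")
 moreover have "qi * tr F F t * M = tr rh rh (qi * t * M)" by (simp add: tr_left[OF F(4)]
  tr_right[OF M(1)])
 ultimately have "tr rh rh (qi * t * M) = unt rh" using F(3) homs_right[OF F(4)] by simp
 thus ?thesis using F M homs_MK by auto
qed

text \<open>A linear section of the surjection gives a linear lift; inserting the trace-one element
  t and taking the trace makes it equivariant and still a lift.\<close>

lemma trace_imp_projective:
 assumes P: "mdl P rh" and t: "t : MK" "tr rh rh t = unt rh"
 shows "projective_module R G P" unfolding projective_module_def proof (intro allI impI ballI)
 fix M N :: "('a, 'g) vec_gmodule" and f h
 assume M: "Gfd M" and N: "Gfd N" and f: "f : gmod_epi R G M N" and h: "h : Ghom P N"
 obtain c where c: "Gmod P" "coords P rh c" "rep rh" using P by (auto simp: mdl_def)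
 obtain mm where "mdl M mm" using fd_mdl[OF M] .
 then obtain m where m: "Gmod M" "coords M mm m" "rep mm" by (auto simp: mdl_def)
 obtain nn where "mdl N nn" using fd_mdl[OF N] .
 then obtain n where n: "Gmod N" "coords N nn n" "rep nn" by (auto simp: mdl_def)
 have f': "f : Ghom M N" "f ` carrier M = carrier N" using f by (auto simp: gmod_epi_def)
 obtain A where A: "A : homs mm nn" "!!x. x : carrier M ==> n (f x) = A * m x" using hom_matrix[OF m
  n f'(1)] by auto
 obtain B where B: "B : homs rh nn" "!!x. x : carrier P ==> n (h x) = B * c x" using hom_matrix[OF c
  n h] by auto
 obtain S where S: "S : MK" "A * S = unt nn" using hom_surj_section[OF m n f'(2) A(1)] A(2) by blast
 define k where "k = tr rh mm (S * B * t)"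
 have k: "k : homs rh mm" unfolding k_def using c m S B t homs_MK by (intro tr_homs) auto
 have "A * k = tr rh nn (B * t)" by (simp add: k_def tr_left[OF A(1)] massoc' S(2) homs_left[OF
  B(1)])
 also have "... = B" by (simp add: tr_left[OF B(1), symmetric] t(2) homs_right[OF B(1)])
 finally have Ak: "A * k = B" .
 obtain k' where k': "k' : Ghom P M" "!!x. x : carrier P ==> m (k' x) = k * c x" using matrix_hom[OF
  c(1,2) m(1,2) k] by auto
 have "f (k' x) = h x" if x: "x : carrier P" for x proof -
  have kx: "k' x : carrier M" using k'(1) x by (auto simp: gmod_hom_def)
  have "n (f (k' x)) = n (h x)" by (simp add: A(2)[OF kx] k'(2)[OF x] B(2)[OF x] Ak massoc')
  thus ?thesis using coordsD(2)[OF n(2)] f'(1) h kx x by (auto simp: gmod_hom_def inj_on_def)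
 qed
 thus "EX k:Ghom P M. ALL x:carrier P. f (k x) = h x" using k' by auto
qed

text \<open>Minimality of the cover is what gives the last conclusion: a projective summand of the
  kernel would split off the cover itself, and its complement would still map onto V.\<close>

lemma projective_cover_kernel:
 fixes P V :: "('a, 'g) vec_gmodule"
 assumes V: "mdl V rh" and pc: "projective_cover R G P V f" obtains om where "mdl (P\<lparr>carrier
  := a_kernel P V f\<rparr>) om" "syz om rh" "!!q. q : homs om om ==> q * q = q ==> null om om q ==>
  q = 0" proof -
 obtain d where d: "Gmod V" "coords V rh d" "rep rh" using V by (auto simp: mdl_def)
 have fP: "Gfd P" and prP: "projective_module R G P" and f: "f : Ghom P V" "f ` carrier P = carrier
  V" and ess: "!!U. Gsub P U ==> f ` U = carrier V ==> U = carrier P" using pc by (auto simp: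
  projective_cover_def gmod_epi_def)
 obtain P' where mP: "mdl P P'" using fd_mdl[OF fP] .
 then obtain c where c: "Gmod P" "coords P P' c" "rep P'" by (auto simp: mdl_def)
 interpret P: group_module R G P by (rule c)
 interpret V: group_module R G V by (rule d)
 note C = coordsD[OF c(2)] and D = coordsD[OF d(2)]
 obtain t where t: "t : MK" "tr P' P' t = unt P'" using projective_imp_trace[OF mP prP] by auto
 obtain qi where qi: "qi : homs P' rh" "!!x. x : carrier P ==> d (f x) = qi * c x" using
  hom_matrix[OF c d f(1)] by auto
 obtain S where S: "S : MK" "qi * S = unt rh" "S * unt rh = S" "unt P' * S = S" using
  hom_surj_section[OF c d f(2) qi(1)] qi(2) by auto
 define ka where "ka = unt P' - S * qi"
 have qika: "qi * ka = 0" by (simp add: ka_def rdiff homs_right[OF qi(1)] massoc' S(2) homs_left[OF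
  qi(1)])
 have ka: "ka : MK" "unt P' * ka = ka" "ka * unt P' = ka" using c(3) S qi homs_MK by (auto simp:
  ka_def rdiff ldiff massoc') (simp add: massoc homs_right[OF qi(1)])
 have kk: "ka * ka = ka" by (subst ka_def) (simp add: ldiff ka(2) massoc qika)
 define N where "N = a_kernel P V f"
 have N: "N = {x:carrier P. f x = zero V}" by (simp add: N_def a_kernel_def kernel_def)
 have fcl: "f x : carrier V" if "x : carrier P" for x using f that by auto
 have d0: "d (zero V) = 0" by (rule coords_zero[OF d(1,2)])
 have N': "N = {x:carrier P. qi * c x = 0}" proof -
  have "(f x = zero V) = (d (f x) = d (zero V))" if "x : carrier P" for x using D(2) fcl[OF that] by
   (auto simp: inj_on_def)
  thus ?thesis by (auto simp: qi(2) d0 N)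
 qed
 have c0: "c (zero P) = 0" by (rule coords_zero[OF c(1,2)])
 have gN: "Gsub P N" using gsubmodule_equalizer[OF c(1,2) qi(1) homs_zero] by (simp add: N')
 have vk: "vecs ka = c ` N" proof
  show "c ` N <= vecs ka" proof
   fix v assume "v : c ` N"
   then obtain x where x: "x : carrier P" "qi * c x = 0" "v = c x" by (auto simp: N')
   thus "v : vecs ka" using C(3)[OF x(1)] by (intro vecsI) (auto simp: ka_def ldiff massoc
    vecs_idem)
  qed
  show "vecs ka <= c ` N" proof
   fix v assume v: "v : vecs ka"
   have "v : vecs (unt P')" by (rule vecs_mono[OF v ka(2)])
   then obtain x where x: "x : carrier P" "c x = v" using C(4) by auto
   have "qi * v = qi * ka * v" by (simp add: vecs_idem[OF v] massoc)
   thus "v : c ` N" using x qika by (auto simp: N')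
 qed qed
 note sub = coords_sub[OF c(1,2,3) ka(1) kk ka(2) vk gN]
 define om where "om = subr P' ka"
 have uom: "unt om = ka" by (simp add: ka om_def)
 have rom: "rep om" by (simp add: sub(1) om_def)
 have io: "ka : homs om P'" using sub(4) by (simp add: om_def)
 have sd: "syzd om rh P' ka ka qi S t" unfolding syzd_def using rom d c io qi ka kk uom S t qika by
  (auto simp: ka_def)
 have "q = 0" if q: "q : homs om om" "q * q = q" "null om om q" for q proof -
  obtain h where h: "h : MK" "q = tr om om h" using q(3) by (auto simp: null_def)
  \<comment> \<open>As q is a trace, it extends from the kernel to a map th on the whole cover;
    \<open>q * th\<close> is then an idempotent of the cover with the same image as q.\<close>
  define th where "th = tr P' om (h * ka)"
  have th: "th : homs P' om" unfolding th_def using c rom h ka by (intro tr_homs) auto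
  have kaq: "ka * q = q" using homs_left[OF q(1)] uom by simp
  have thka: "th * ka = q" proof -
   have "th * ka = tr om om (h * unt om)" by (simp add: th_def tr_right[OF io] uom massoc kk)
   also have "... = q * unt om" by (simp add: tr_right[OF homs_unt[OF rom], symmetric] h(2))
   finally show ?thesis by (simp add: homs_right[OF q(1)])
  qed
  define Q where "Q = q * th"
  have Q1: "Q : homs P' P'" using homs_mult[OF homs_mult[OF th q(1)] io] by (simp add: Q_def massoc'
   kaq)
  have qiQ: "qi * Q = 0" proof -
   have "qi * Q = (qi * ka) * q * th" by (simp add: Q_def massoc) (simp add: massoc' kaq)
   thus ?thesis by (simp add: qika)
  qed
  \<comment> \<open>The complement of that image. It still maps onto V, so it is everything and the
    idempotent is zero.\<close>
  define N' where "N' = {x:carrier P. (unt P' - Q) * c x = c x}"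
  have eQ: "unt P' - Q : homs P' P'" by (simp add: Q1 c(3) homs_diff)
  have QQ: "Q * Q = Q" proof -
   have "Q * Q = q * (th * ka) * q * th" by (simp add: Q_def massoc) (simp add: massoc' kaq)
   thus ?thesis by (simp add: q(2) thka Q_def)
  qed
  have "f ` N' = carrier V" proof
   show "f ` N' <= carrier V" by (auto simp: fcl N'_def)
   show "carrier V <= f ` N'" proof
    fix y assume "y : carrier V"
    then obtain x where x: "x : carrier P" "y = f x" using f(2) by auto
    have "(unt P' - Q) * c x : vecs (unt P')" using homs_left[OF eQ] homs_MK[OF eQ] C(3)[OF x(1)] by
     (intro vecs_mult) auto
    then obtain x' where x': "x' : carrier P" "c x' = (unt P' - Q) * c x" using C(4) by auto
    have "d (f x') = qi * (unt P' - Q) * c x" by (simp add: qi(2)[OF x'(1)] x'(2) massoc)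
    also have "... = d (f x)" by (simp add: qi(2)[OF x(1)] rdiff homs_right[OF qi(1)] qiQ)
    finally have "f x' = y" using D(2) fcl x x' by (auto simp: inj_on_def)
    moreover have "(unt P' - Q) * (unt P' - Q) = unt P' - Q" by (simp add: QQ c(3) homs_left[OF Q1]
     homs_right[OF Q1] algebra_simps)
    hence "x' : N'" by (simp add: x' N'_def massoc')
    ultimately show "y : f ` N'" by auto
  qed qed
  moreover have "Gsub P N'" unfolding N'_def by (rule gsubmodule_of_idempotent[OF c eQ])
  ultimately have full: "N' = carrier P" using ess by simp
  have "Q = 0" proof (rule cols_test[of _ _ "unt P'"])
   fix v assume "v : vecs (unt P')"
   then obtain x where x: "x : carrier P" "c x = v" using C(4) by auto
   hence "(unt P' - Q) * v = v" using full by (auto simp: N'_def)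
   thus "Q * v = 0 * v" using vecs_idem[OF C(3)[OF x(1)]] x by (simp add: ldiff)
  qed (use Q1 c homs_MK homs_right in auto)
  moreover have "Q * ka = q" by (simp add: q(2) Q_def massoc thka)
  ultimately show "q = 0" by simp
 qed
 moreover have "mdl (P\<lparr>carrier := a_kernel P V f\<rparr>) om" using sub by (auto simp:
  mdl_def om_def N_def)
 moreover have "syz om rh" unfolding syz_def using sd by blast
 ultimately show ?thesis using that by simp
qed

text \<open>From the free cover a largest family of orthogonal idempotents killed by qi is removed.
  If a submodule U of the rest still maps onto V, a lift of qi into U has a Fitting idempotent q'
  with \<open>qi * q' = qi\<close>, and maximality forces q' to be the identity.\<close>

lemma projective_cover_exists:
 fixes V :: "('a, 'g) vec_gmodule"
 assumes V: "mdl V rh" obtains P :: "('a, 'g) vec_gmodule" and f where "projective_cover R G P V f"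
  proof -
 obtain d where d: "Gmod V" "coords V rh d" "rep rh" using V by (auto simp: mdl_def)
 note D = coordsD[OF d(2)]
 obtain F t0 qi s where F: "rep F" "t0 : MK" "tr F F t0 = unt F" "qi : homs F rh" "s : MK" "qi * s =
  unt rh" using free_cover[OF d(3)] by metis
 let ?R = "%(m::nat) p. ALL i<m. qi * p i = 0"
 have ex: "EX (m::nat) p. orthogonal F {..<m} p & ?R m p" by (intro exI[of _ 0]) (simp add:
  orthogonal_def)
 obtain m p where mp: "orthogonal F {..<m::nat} p" "?R m p" "!!m' p'. orthogonal F {..<m'} p' ==> ?R
  m' p' ==> m' <= m" using orthogonal_max[OF F(1), of ?R, OF ex] by auto
 have pp: "p i : homs F F" "p i ~= 0" "j < m ==> p i * p j = (if i = j then p i else 0)" if "i < m"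
  for i j using mp(1) that by (auto simp: orthogonal_def)
 define p0 where "p0 = (SUM i<m. p i)"
 define q where "q = unt F - p0"
 have p0: "p0 : homs F F" unfolding p0_def using pp by (intro homs_sum) auto
 have q: "q : homs F F" by (simp add: F p0 q_def homs_diff)
 have p0p: "p0 * p i = p i" "p i * p0 = p i" if "i < m" for i by (simp_all add: that pp(3) p0_def
  lsum rsum)
 have p00: "p0 * p0 = p0" proof -
  have "p0 * p0 = (SUM i<m. p0 * p i)" by (subst (2) p0_def) (rule lsum)
  also have "... = (SUM i<m. p i)" by (rule sum.cong) (auto simp: p0p)
  finally show ?thesis by (simp add: p0_def)
 qed
 have qp: "q * p i = 0" "p i * q = 0" if "i < m" for i by (simp_all add: that p0p homs_left[OF
  pp(1)] homs_right[OF pp(1)] q_def algebra_simps)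
 have qq: "q * q = q" by (simp add: F p00 homs_left[OF p0] homs_right[OF p0] q_def algebra_simps)
 have qq2: "q * (q * z) = q * z" for z by (simp add: massoc' qq)
 have qiq: "qi * q = qi" by (simp add: mp(2) homs_right[OF F(4)] q_def rdiff p0_def lsum)
 define P where "P = subr F q"
 have rP: "rep P" unfolding P_def by (rule subr_rep_hom[OF F(1) q qq])
 have uP: "unt P = q" by (simp add: homs_MK[OF q] homs_left[OF q] P_def)
 note sq = subr_homs[OF F(1) q qq]
 define t where "t = q * t0 * q"
 have "tr P P t = q * tr F F t0 * q" by (simp add: t_def P_def tr_left[OF sq(2)] tr_right[OF sq(1)])
 hence t: "t : MK" "tr P P t = unt P" using homs_MK[OF q] F homs_right[OF q] uP qq by (simp_all add:
  t_def)
 have qiP: "qi : homs P rh" using homs_mult[OF sq(1) F(4)] qiq by (simp add: P_def)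
 have mS: "mdl (std P) P" by (rule mdl_std[OF rP])
 then obtain c where c: "Gmod (std P)" "coords (std P) P c" by (auto simp: mdl_def)
 note C = coordsD[OF c(2)]
 obtain f where f: "f : Ghom (std P) V" "!!x. x : carrier (std P) ==> d (f x) = qi * c x" using
  matrix_hom[OF c d(1,2) qiP] by auto
 have fcl: "f x : carrier V" if "x : carrier (std P)" for x using f(1) that by (auto simp:
  gmod_hom_def)
 have "qi * (q * s) = unt rh" using qiq F(6) by (metis massoc)
 hence sur: "f ` carrier (std P) = carrier V" by (intro hom_surjI[OF c(2) rP d(2) f(1) _ qiP, of "q
  * s"]) (use f(2) homs_MK[OF q] F(5) in auto)
 have "U = carrier (std P)" if U: "Gsub (std P) U" "f ` U = carrier V" for U proof -
  have subU: "submodule U R (std P)" using U by (simp add: gsubmodule_def)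
  obtain ka where ka: "ka : MK" "ka * ka = ka" "unt P * ka = ka" "ka * unt P = ka" "vecs ka = c ` U"
   using subspace_image[OF c rP subU] by auto
  note sub = coords_sub[OF c rP ka(1-3,5) U(1)]
  define T where "T = subr P ka"
  have uT: "unt T = ka" by (simp add: ka T_def)
  have rT: "rep T" by (simp add: sub(1) T_def)
  have kah: "ka : homs T P" using sub(4) by (simp add: T_def)
  have qika: "qi * ka : homs T rh" by (rule homs_mult[OF kah qiP])
  have UP: "U <= carrier (std P)" using module.submoduleE(1)[OF _ subU] c(1) by (simp add:
   group_module_def)
  obtain S where S: "S : MK" "qi * ka * S = unt rh" proof (rule linear_section[of "qi * ka" ka "unt
   rh"])
   fix w assume "w : vecs (unt rh)"
   then obtain y where y: "y : carrier V" "d y = w" using D(4) by auto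
   then obtain x where x: "x : U" "y = f x" using U(2) by auto
   have "c x : vecs ka" using ka(5) x by simp
   thus "EX v:cols. qi * ka * v = w" using x y f(2) UP by (intro bexI[of _ "c x"]) (auto simp:
    massoc vecs_idem)
  qed (use ka qiP homs_MK d(3) that in "auto simp: massoc")
  \<comment> \<open>A lift of qi through the surjection from U, from the linear section S and the
    trace-one element t.\<close>
  define k where "k = tr P T (ka * S * qi * t)"
  have k: "k : homs P T" unfolding k_def using rP rT ka S qiP t homs_MK by (intro tr_homs) auto
  have kak: "ka * k = k" using homs_left[OF k] uT by simp
  have qik: "qi * k = qi" proof -
   have "qi * k = (qi * ka) * k" by (simp add: massoc kak)
   also have "... = tr P rh (qi * ka * (ka * S * qi * t))" unfolding k_def by (rule tr_left[OF
    qika])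
   also have "qi * ka * (ka * S * qi * t) = (qi * (ka * ka) * S) * qi * t" by (simp only: massoc)
   also have "... = qi * t" by (simp add: ka(2) S(2) homs_left[OF qiP])
   also have "tr P rh (qi * t) = qi * unt P" by (simp add: tr_left[OF qiP, symmetric] t(2))
   finally show ?thesis by (simp add: uP qiq)
  qed
  have kP: "k : homs P P" using homs_mult[OF k kah] kak by simp
  obtain q' h M where q': "q' : homs P P" "h : homs P P" "q' * q' = q'" "q' = k * h" "q' = h * k"
   "!!x. x * k = x ==> x * q' = x" by (rule fitting[of "homs P P" "unt P" k]) (auto simp: homs_MK rP
   kP homs_add homs_mult homs_sm homs_left homs_right)
  have q'q: "q' : homs F F" "q * q' = q'" "q' * q = q'" using q'(1) homs_subr_iff[OF F(1) q qq] by
   (auto simp: P_def)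
  have "q - q' = 0" proof (rule ccontr)
   assume ne: "q - q' ~= 0"
   let ?p = "%i. if i = m then q - q' else p i"
   have rp: "(q - q') * p i = 0" "p i * (q - q') = 0" if "i < m" for i proof -
    have "(q - q') * p i = q * p i - q' * (q * p i)" "p i * (q - q') = p i * q - p i * q * q'" using
     q'q by (simp_all add: ldiff rdiff massoc') (simp add: massoc)
    thus "(q - q') * p i = 0" "p i * (q - q') = 0" using qp[OF that] by auto
   qed
   have "orthogonal F {..<Suc m} ?p" unfolding orthogonal_def proof (intro conjI ballI)
    fix i j assume "i : {..<Suc m}" "j : {..<Suc m}"
    thus "?p i * ?p j = (if i = j then ?p i else 0)" using pp rp q'q q'(3) qq by (auto simp:
     algebra_simps)
    next fix i assume "i : {..<Suc m}"
    thus "?p i : homs F F" "?p i ~= 0" using pp q q'q ne by (auto intro: homs_diff)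
   qed simp
   moreover have "ALL i<Suc m. qi * ?p i = 0" by (auto simp: mp(2) qiq q'(6)[OF qik] rdiff)
   ultimately show False using mp(3)[of "Suc m" ?p] by simp
  qed
  hence qk: "q = k * h" using q'(4) by simp
  have "carrier (std P) <= U" proof
   fix x assume x: "x : carrier (std P)"
   have "ka * c x = c x" using vecs_idem[OF C(3)[OF x]] uP by (metis qk kak massoc)
   hence "c x : vecs ka" using C(3)[OF x] by (intro vecsI) auto
   then obtain y where "y : U" "c y = c x" using ka(5) by auto
   thus "x : U" using C(2) x UP by (auto simp: inj_on_def)
  qed
  thus ?thesis using UP by simp
 qed
 moreover have "projective_module R G (std P)" by (rule trace_imp_projective[OF mS t])
 moreover have "Gfd (std P)" by (rule mdl_fd[OF mS])
 ultimately have "projective_cover R G (std P) V f" by (auto simp: f(1) sur projective_cover_def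
  gmod_epi_def)
 thus ?thesis using that by simp
qed

text \<open>The choice in \<open>heller\<close> only guarantees some projective cover, so the syzygy
  is read off from the cover that the chosen module comes with; the constructed one merely shows
  that a choice is possible.\<close>

lemma mdl_heller:
 assumes V: "mdl V rh" obtains om where "mdl (heller R G V) om" "syz om rh" "!!q. q : homs om om ==>
  q * q = q ==> null om om q ==> q = 0" proof -
 let ?Q = "%W. Gfd W & (EX (P :: ('a, 'g) vec_gmodule) f. projective_cover R G P V f & Giso
  (P\<lparr>carrier := a_kernel P V f\<rparr>) W)"
 obtain P :: "('a, 'g) vec_gmodule" and f where P: "projective_cover R G P V f" using
  projective_cover_exists[OF V]
 .
 obtain om where om: "mdl (P\<lparr>carrier := a_kernel P V f\<rparr>) om" using
  projective_cover_kernel[OF V P] by metis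
 have r: "rep om" using om by (simp add: mdl_def)
 have "?Q (std om)" using P mdl_fd[OF mdl_std[OF r]] mdl_iso_iff[OF om mdl_std[OF r]] isor_refl[OF
  r] by auto
 hence "?Q (heller R G V)" unfolding heller_def by (rule someI)
 then obtain P' :: "('a, 'g) vec_gmodule" and f' where P': "projective_cover R G P' V f'" and iso:
  "Giso (P'\<lparr>carrier := a_kernel P' V f'\<rparr>) (heller R G V)" and fd: "Gfd (heller R G V)"
  by auto
 show ?thesis proof (rule projective_cover_kernel[OF V P'])
  fix om'
  assume *: "mdl (P'\<lparr>carrier := a_kernel P' V f'\<rparr>) om'" "syz om' rh" "!!q. q : homs
   om' om' ==> q * q = q ==> null om' om' q ==> q = 0"
  have "mdl (heller R G V) om'" by (rule mdl_transfer[OF *(1) _ iso]) (use fd in "simp add: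
   fd_module_def")
  thus thesis using that * by simp
qed qed
end
context modelled
begin

section \<open>Multiplicities\<close>

lemma bij_betw_iff_ex1:
 assumes "f ` A <= B"
 shows "bij_betw f A B = (ALL z:B. EX! x. x : A & f x = z)" proof
 assume "bij_betw f A B"
 thus "ALL z:B. EX! x. x : A & f x = z" by (auto simp: bij_betw_def inj_on_def)
 next assume *: "ALL z:B. EX! x. x : A & f x = z"
 hence "inj_on f A" using assms by (intro inj_onI) (metis image_subset_iff)
 thus "bij_betw f A B" using * assms by (auto simp: bij_betw_def)
qed

text \<open>In coordinates the unique decomposition of elements becomes a statement about ordinary
  sums of matrices.\<close>

lemma finsum_bij_iff:
 fixes N :: nat
 assumes V: "Gmod V" "coords V rh c" and U: "ALL i<N. U i <= carrier V"
 shows "bij_betw (%x. finsum V x {..<N}) (PiE {..<N} U) (carrier V) \<longleftrightarrow> (ALL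
  z:carrier V. EX! x. x : PiE {..<N} U & c z = (SUM i<N. c (x i)))" proof -
 interpret V: group_module R G V by (rule V)
 note C = coordsD[OF V(2)]
 have csum: "finsum V y A : carrier V & c (finsum V y A) = (SUM i:A. c (y i))" if "finite A" "y : A
  \<rightarrow> carrier V" for y and A :: "nat set" using that by (induction A rule: finite_induct)
  (simp_all add: C coords_zero[OF V])
 let ?f = "%x. finsum V x {..<N}" and ?D = "PiE {..<N} U"
 have f: "?f x : carrier V" "c (?f x) = (SUM i<N. c (x i))" if "x : ?D" for x proof -
  have "x : {..<N} \<rightarrow> carrier V" using PiE_mem[OF that] U by auto
  thus "?f x : carrier V" "c (?f x) = (SUM i<N. c (x i))" using csum by auto
 qed
 have "(x : ?D & c z = (SUM i<N. c (x i))) = (x : ?D & ?f x = z)" if "z : carrier V" for x z using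
  f[of x] C(2) that by (auto simp: inj_on_def)
 thus ?thesis using f(1) by (subst bij_betw_iff_ex1) auto
qed

text \<open>The components of an element depend linearly and equivariantly on it by uniqueness, so
  they are given by matrices, which form a complete orthogonal family of idempotents.\<close>

lemma decomposition_projections:
 fixes V :: "('a, 'b, 'g, 'x) gmodule_scheme" and N :: nat and U :: "nat => 'b set"
 assumes V: "Gmod V" "coords V rh c" "rep rh" and U: "!!i. i < N ==> Gsub V (U i)" and ex1: "ALL
  z:carrier V. EX! x. x : PiE {..<N} U & c z = (SUM i<N. c (x i))" obtains p where "!!i. i < N ==> p
  i : homs rh rh" "!!i j. i < N ==> j < N ==> p i * p j = (if i = j then p i else 0)" "(SUM i<N. p
  i) = unt rh" "!!i. i < N ==> vecs (p i) = c ` U i" proof -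
 interpret V: group_module R G V by (rule V)
 note C = coordsD[OF V(2)]
 have sub: "submodule (U i) R V" and Uact: "!!g x. g : carrier G ==> x : U i ==> act V g x : U i" if
  "i < N" for i using U[OF that] by (auto simp: gsubmodule_def)
 note UE = V.submoduleE[OF sub]
 have UV: "x : carrier V" if "i < N" "x : U i" for i x using UE(1)[OF that(1)] that(2) by auto
 have U0: "zero V : U i" if "i < N" for i using subgroup.one_closed[OF submodule.axioms(1)[OF sub[OF
  that]]] by simp
 have c0: "c (zero V) = 0" by (rule coords_zero[OF V(1,2)])
 let ?D = "PiE {..<N} U"
 define cmp where "cmp z = (THE x. x : ?D & c z = (SUM i<N. c (x i)))" for z
 have cmp: "cmp z : ?D" "c z = (SUM i<N. c (cmp z i))" if "z : carrier V" for z using theI'[OF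
  bspec[OF ex1 that]] by (simp_all add: cmp_def)
 have cmpI: "cmp z i = x i" if "z : carrier V" "!!i. i < N ==> x i : U i" "c z = (SUM i<N. c (x i))"
  "i < N" for z x i proof -
  have "cmp z = restrict x {..<N}" unfolding cmp_def by (rule the1_equality[OF bspec[OF ex1
   that(1)]]) (use that in simp)
  thus ?thesis using that(4) by simp
 qed
 have cmpU: "cmp x i : U i" "cmp x i : carrier V" if "x : carrier V" "i < N" for x i using
  PiE_mem[OF cmp(1)[OF that(1)], of i] UV that(2) by auto
 have hom: "(%x. cmp x i) : Ghom V V" if i: "i < N" for i unfolding gmod_hom_def proof (intro
  CollectI conjI ballI Pi_I)
  fix x assume x: "x : carrier V"
  show "cmp x i : carrier V" by (rule cmpU[OF x i])
  show "cmp (add V x y) i = add V (cmp x i) (cmp y i)" if y: "y : carrier V" for y by (rule cmpI)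
   (use x y i cmpU UE(5) in "simp_all add: C", simp add: cmp(2) sum.distrib)
  show "cmp (smult V a x) i = smult V a (cmp x i)" if a: "a : carrier R" for a by (rule cmpI) (use x
   a i cmpU UE(4) in "simp_all add: C cmp(2)[symmetric] flip: sm_sum")
  show "cmp (act V g x) i = act V g (cmp x i)" if g: "g : carrier G" for g by (rule cmpI) (use x g i
   cmpU Uact V.act_closed in "simp_all add: C cmp(2)[symmetric] flip: lsum")
 qed
 have "ALL i:{..<N}. EX p. p : homs rh rh & (ALL x:carrier V. c (cmp x i) = p * c x)" using
  hom_matrix[OF V V hom] by (metis lessThan_iff)
 from bchoice[OF this] obtain p where p0: "ALL i:{..<N}. p i : homs rh rh & (ALL x:carrier V. c (cmp
  x i) = p i * c x)"
 ..
 hence p: "p i : homs rh rh" "!!x. x : carrier V ==> c (cmp x i) = p i * c x" if "i < N" for i using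
  that by auto
 have single: "cmp x j = (if i = j then x else zero V)" if i: "i < N" and x: "x : U i" and j: "j <
  N" for i j x by (rule cmpI) (use UV[OF i x] x U0 i j in "auto simp: if_distrib[of c] c0 cong:
  if_cong")
 have vecsp: "vecs (p i) = c ` U i" if i: "i < N" for i proof
  show "c ` U i <= vecs (p i)" using p(2)[OF i UV[OF i]] single[OF i _ i] C(3)[OF UV[OF i]] by (auto
   intro!: vecsI dest: vecs_cols)
  show "vecs (p i) <= c ` U i" proof
   fix v assume v: "v : vecs (p i)"
   obtain x where x: "x : carrier V" "c x = v" using C(4)[OF vecs_mono[OF v homs_left[OF p(1)[OF
    i]]]] by auto
   thus "v : c ` U i" using p(2)[OF i x(1)] vecs_idem[OF v] cmpU(1)[OF x(1) i] by (metis image_eqI)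
 qed qed
 have "p i * p j = (if i = j then p i else 0)" if i: "i < N" and j: "j < N" for i j proof (rule
  cols_test[of _ _ "unt rh"])
  fix v assume "v : vecs (unt rh)"
  then obtain x where x: "x : carrier V" "c x = v" using C(4) by auto
  show "p i * p j * v = (if i = j then p i else 0) * v" using p(2)[OF j x(1)] p(2)[OF i cmpU(2)[OF
   x(1) j]] single[OF j cmpU(1)[OF x(1) j] i] x(2) c0 by (auto simp: massoc)
 qed (use V(3) homs_MK[OF p(1)] homs_right[OF p(1)] i j in "auto simp: massoc")
 moreover have "(SUM i<N. p i) = unt rh" proof (rule cols_test[of _ _ "unt rh"])
  fix v assume "v : vecs (unt rh)"
  then obtain x where x: "x : carrier V" "c x = v" using C(4) by auto
  hence "(SUM i<N. p i) * v = (SUM i<N. c (cmp x i))" by (simp add: p(2) rsum)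
  thus "(SUM i<N. p i) * v = unt rh * v" using cmp(2)[OF x(1)] C(3)[OF x(1)] x(2) by (metis
   vecs_idem)
 qed (use V(3) homs_MK[OF p(1)] homs_right[OF p(1)] in "auto simp: rsum intro: MK_sum")
 ultimately show ?thesis using that p(1) vecsp by auto
qed

text \<open>An idempotent q below p splits the submodule into the fixed spaces of q and p -
  q.\<close>

lemma indecomposable_imp_primitive:
 assumes V: "Gmod V" "coords V rh c" "rep rh" and p: "p : homs rh rh" "p * p = p" "vecs p = c ` N"
  and N: "Gsub V N" and ind: "indecomposable_module R G (V\<lparr>carrier := N\<rparr>)"
 shows "primitive rh p" proof -
 have pMK: "p : MK" "unt rh * p = p" using p(1) homs_MK homs_left by auto
 note sub = coords_sub[OF V pMK(1) p(2) pMK(2) p(3) N]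
 let ?V = "V\<lparr>carrier := N\<rparr>" and ?rh = "subr rh p"
 interpret S: group_module R G ?V by (rule sub(3))
 note C = coordsD[OF sub(2)]
 have up: "unt ?rh = p" using pMK by simp
 have c0: "c (zero V) = 0" using coords_zero[OF sub(3,2)] by simp
 have z: "zero V : N" using S.zero_closed by simp
 have px: "p * c x = c x" if "x : N" for x using vecs_idem[OF C(3)[of x]] that up by simp
 have inj: "x = y" if "c x = c y" "x : N" "y : N" for x y using C(2) that by (simp add: inj_on_def)
 have zero: "r = 0" if r: "r : homs ?rh ?rh" "r * r = r" "{x:N. r * c x = c x} = {zero V}" for r
  proof (rule cols_test[of _ _ r])
  fix v assume "v : vecs r"
  thus "r * v = 0 * v" using gsubmodule_of_idempotent(2)[OF sub(3,2,1) r(1,2)] r(3) c0 by simp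
 qed (use r homs_MK in auto)
 have "p ~= 0" proof
  assume "p = 0"
  hence "x = zero V" if "x : N" for x using inj[OF _ that z] px[OF that] c0 by simp
  hence "N = {zero V}" using z by blast
  thus False using ind by (simp add: indecomposable_module_def)
 qed
 moreover have "q = 0 | q = p" if q: "q : homs rh rh" "q * q = q" "p * q = q" "q * p = q" for q
  proof -
  have qs: "q : homs ?rh ?rh" using q homs_subr_iff[OF V(3) p(1,2)] by simp
  have ps: "p - q : homs ?rh ?rh" using homs_diff[OF homs_unt[OF sub(1)] qs] up by simp
  have pq: "(p - q) * (p - q) = p - q" "q * (p - q) = 0" by (simp_all add: q p algebra_simps)
  let ?U = "{x:N. q * c x = c x}" and ?W = "{x:N. (p - q) * c x = c x}"
  have g: "Gsub ?V ?U" "Gsub ?V ?W" using gsubmodule_of_idempotent(1)[OF sub(3,2,1) qs]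
   gsubmodule_of_idempotent(1)[OF sub(3,2,1) ps] by auto
  have "x = zero V" if "x : ?U \<inter> ?W" for x using inj[OF _ _ z, of x] that px c0 by (auto
   simp: ldiff)
  hence "?U \<inter> ?W = {zero V}" using z c0 by auto
  moreover have "x : ?U <+>\<^bsub>?V\<^esub> ?W" if x: "x : N" for x proof -
   have cx: "c x : cols" using C(3)[of x] x by auto
   have "q * c x : vecs p" "(p - q) * c x : vecs p" by (intro vecs_mult; use homs_MK q p cx in "simp
    add: rdiff")+
   then obtain a b where a: "a : N" "c a = q * c x" and b: "b : N" "c b = (p - q) * c x" using p(3)
    by auto
   have "x = add V a b" by (rule inj) (use C(5)[of a b] S.a_closed[of a b] a b x px[OF x] in
    "simp_all add: ldiff")
   moreover have "a : ?U" "b : ?W" by (simp_all add: a b q(2) pq massoc')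
   ultimately show ?thesis by (auto simp: set_add_def')
  qed
  hence "?U <+>\<^bsub>?V\<^esub> ?W = carrier ?V" using S.a_closed by (auto simp: set_add_def')
  ultimately have "?U = {zero V} | ?W = {zero V}" using ind g by (auto simp:
   indecomposable_module_def)
  thus ?thesis using zero[OF qs q(2)] zero[OF ps pq(1)] by auto
 qed
 ultimately show ?thesis by (auto simp: p primitive_def)
qed

lemma primitive_imp_indecomposable:
 assumes V: "Gmod V" "coords V rh c" "rep rh" and p: "primitive rh p" "vecs p = c ` N" and N: "Gsub
  V N"
 shows "indecomposable_module R G (V\<lparr>carrier := N\<rparr>)" proof -
 have ph: "p : homs rh rh" "p * p = p" "p ~= 0" using p by (auto simp: primitive_def)
 have pMK: "p : MK" "unt rh * p = p" using ph homs_MK homs_left by auto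
 note sub = coords_sub[OF V pMK(1) ph(2) pMK(2) p(2) N]
 let ?V = "V\<lparr>carrier := N\<rparr>" and ?rh = "subr rh p"
 interpret S: group_module R G ?V by (rule sub(3))
 note C = coordsD[OF sub(2)]
 have up: "unt ?rh = p" using pMK by simp
 have c0: "c (zero V) = 0" using coords_zero[OF sub(3,2)] by simp
 have inj: "x = y" if "c x = c y" "x : N" "y : N" for x y using C(2) that by (simp add: inj_on_def)
 have "N ~= {zero V}" using c0 cols_test p ph pMK by fastforce
 moreover have "U = {zero V} | W = {zero V}" if UW: "Gsub ?V U" "Gsub ?V W" "U \<inter> W = {zero
  V}" "U <+>\<^bsub>?V\<^esub> W = N" for U W proof -
  have sU: "submodule U R ?V" and sW: "submodule W R ?V" using UW by (auto simp: gsubmodule_def)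
  note UE = S.submoduleE[OF sU] and WE = S.submoduleE[OF sW]
  \<comment> \<open>A decomposition into two submodules is treated as a family over {0, 1}, so that
    \<open>decomposition_projections\<close> returns an idempotent below p.\<close>
  let ?F = "%i::nat. if i = 0 then U else W"
  have two: "{..<2::nat} = {0, 1}" by auto
  have UN: "x : U ==> x : N" "x : W ==> x : N" for x using UE(1) WE(1) by auto
  have cneg: "c (a_inv ?V z) = - c z" if "z : N" for z using C(5)[of "a_inv ?V z" z] S.l_neg
   S.a_inv_closed that c0 by (simp add: add_eq_0_iff2)
  have uniq: "a = a' & b = b'" if ab: "a : U" "b : W" "a' : U" "b' : W" and eq: "c a + c b = c a' +
   c b'" for a b a' b' proof -
   have d: "add V a (a_inv ?V a') : U" "add V b' (a_inv ?V b) : W" "a_inv ?V a' : N" "a_inv ?V b :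
    N" using UE(3,5) WE(3,5) UN ab by auto
   have c: "c (add V a (a_inv ?V a')) = c a - c a'" "c (add V b' (a_inv ?V b)) = c b' - c b" using
    C(5) d ab UN cneg by auto
   have "add V a (a_inv ?V a') = add V b' (a_inv ?V b)" by (rule inj) (use d UN eq in "simp_all add:
    c algebra_simps")
   hence "add V a (a_inv ?V a') = zero V" using d UW(3) by auto
   thus ?thesis using c(1) c0 eq inj UN ab by simp
  qed
  have ex1: "ALL z:carrier ?V. EX! x. x : PiE {..<2} ?F & c z = (SUM i<2. c (x i))" proof (intro
   ballI ex_ex1I)
   fix z assume "z : carrier ?V"
   hence "z : U <+>\<^bsub>?V\<^esub> W" using UW(4) by simp
   then obtain a b where ab: "a : U" "b : W" "z = add V a b" by (auto simp: set_add_def')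
   thus "EX x. x : PiE {..<2} ?F & c z = (SUM i<2. c (x i))" using C(5) UN by (intro exI[of _
    "\<lambda>i\<in>{..<2}. if i = (0::nat) then a else b"]) (auto simp: two)
   next fix z x y
   assume x: "x : PiE {..<2} ?F & c z = (SUM i<2. c (x i))" and y: "y : PiE {..<2} ?F & c z = (SUM
    i<2. c (y i))"
   have "x 0 = y 0 & x 1 = y 1" by (rule uniq) (use PiE_mem[OF conjunct1[OF x]] PiE_mem[OF
    conjunct1[OF y]] x y in "fastforce simp: two")+
   thus "x = y" by (intro PiE_ext[OF conjunct1[OF x] conjunct1[OF y]]) (auto simp: less_2_cases_iff)
  qed
  have gF: "Gsub ?V (?F i)" for i using UW by simp
  obtain q where q: "!!i. i < 2 ==> q i : homs ?rh ?rh" "!!i j. i < 2 ==> j < 2 ==> q i * q j = (if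
   i = j then q i else 0)" "(SUM i<2::nat. q i) = unt ?rh" "!!i. i < 2 ==> vecs (q i) = c ` ?F i"
   using decomposition_projections[OF sub(3,2,1) gF ex1] by auto
  have q0: "q 0 : homs rh rh" "p * q 0 = q 0" "q 0 * p = q 0" "q 0 * q 0 = q 0" using q(1) q(2)
   homs_subr_iff[OF V(3) ph(1,2)] by auto
  have q01: "q 0 + q 1 = p" using q(3) up by (simp add: two)
  have z: "zero V : U" "zero V : W" using UW(3) by auto
  have trivial: "Y = {zero V}" if "vecs 0 = c ` Y" "Y <= N" "zero V : Y" for Y proof -
   have "c x = c (zero V)" if "x : Y" for x using that \<open>vecs 0 = c ` Y\<close> vecs_idem[of "c
    x" 0] c0 by auto
   thus ?thesis using inj that by blast
  qed
  have "q 0 = 0 | q 0 = p" using p(1) q0 by (simp add: primitive_def)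
  thus ?thesis using trivial[OF _ subsetI[OF UN(1)] z(1)] trivial[OF _ subsetI[OF UN(2)] z(2)]
   q(4)[of 0] q(4)[of 1] q01 by auto
 qed
 ultimately show ?thesis by (auto simp: indecomposable_module_def)
qed

lemma indec_decomposition_exists:
 assumes V: "Gmod V" "coords V rh c" "rep rh"
 shows "EX N U. indec_decomposition R G V N U" proof -
 note C = coordsD[OF V(2)]
 obtain N :: nat and p where p: "orthogonal rh {..<N} p" "(SUM i<N. p i) = unt rh" "!!i. i < N ==>
  primitive rh (p i)" using primitive_decomposition[OF V(3)] by auto
 have ph: "p i : homs rh rh" "p i * p i = p i" if "i < N" for i using p(3)[OF that] by (auto simp:
  primitive_def)
 define U where "U i = {x:carrier V. p i * c x = c x}" for i
 have gU: "Gsub V (U i)" and vU: "vecs (p i) = c ` U i" if "i < N" for i by (auto simp: U_def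
  gsubmodule_of_idempotent[OF V ph(1)[OF that]] ph(2)[OF that])
 have ind: "indecomposable_module R G (V\<lparr>carrier := U i\<rparr>)" if "i < N" for i by (rule
  primitive_imp_indecomposable[OF V p(3)[OF that] vU[OF that] gU[OF that]])
 have "EX! x. x : PiE {..<N} U & c z = (SUM i<N. c (x i))" if z: "z : carrier V" for z proof (rule
  ex_ex1I)
  have "ALL i:{..<N}. EX x. x : U i & c x = p i * c z" proof
   fix i assume "i : {..<N}"
   hence i: "i < N" by simp
   have "p i * c z : vecs (p i)" using ph[OF i] homs_MK C(3)[OF z] by (intro vecs_mult) auto
   thus "EX x. x : U i & c x = p i * c z" using vU[OF i] by auto
  qed
  then obtain x where "ALL i:{..<N}. x i : U i & c (x i) = p i * c z" by (rule bchoice[THEN exE])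
  thus "EX x. x : PiE {..<N} U & c z = (SUM i<N. c (x i))" using vecs_idem[OF C(3)[OF z]] by (intro
   exI[of _ "restrict x {..<N}"]) (simp add: rsum[symmetric] p(2))
  next
  have pc: "c (x j) = p j * c z" "x j : carrier V" if x: "x : PiE {..<N} U & c z = (SUM i<N. c (x
   i))" and j: "j < N" for x j proof -
   have U: "x i : carrier V" "p i * c (x i) = c (x i)" if "i < N" for i using PiE_mem[OF
    conjunct1[OF x], of i] that by (auto simp: U_def)
   have "p j * c z = (SUM i<N. p j * p i * c (x i))" by (simp add: x U lsum massoc)
   also have "... = (SUM i<N. if j = i then c (x j) else 0)" by (rule sum.cong) (use p(1) j U in
    "auto simp: orthogonal_def")
   finally show "c (x j) = p j * c z" "x j : carrier V" using j U by auto
  qed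
  fix x y
  assume x: "x : PiE {..<N} U & c z = (SUM i<N. c (x i))" and y: "y : PiE {..<N} U & c z = (SUM i<N.
   c (y i))"
  show "x = y" by (rule PiE_ext[OF conjunct1[OF x] conjunct1[OF y]]) (use pc[OF x] pc[OF y] C(2) in
   "auto simp: inj_on_def")
 qed
 hence "bij_betw (%x. finsum V x {..<N}) (PiE {..<N} U) (carrier V)" by (subst finsum_bij_iff[OF
  V(1,2)]) (auto simp: U_def)
 thus ?thesis using gU ind by (auto simp: indec_decomposition_def)
qed

text \<open>Every decomposition into indecomposables comes from a primitive decomposition of the
  identity, for which counting isomorphic members gives a stable multiplicity function. Its
  uniqueness also justifies the definite description in \<open>summand_mult\<close>.\<close>

theorem summand_mult_eq:
 fixes V :: "('a, 'b, 'g, 'x) gmodule_scheme" and W :: "('a, 'c, 'g, 'y) gmodule_scheme"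
 assumes V: "mdl V rh" and b: "bricks T B" and d: "dec T B rh m" and t: "t : T" and W: "mdl W (B t)"
 shows "summand_mult R G V W = m t" proof -
 obtain c where c: "Gmod V" "coords V rh c" "rep rh" using V by (auto simp: mdl_def)
 have count: "card {i. i < N & Giso (V\<lparr>carrier := U i\<rparr>) W} = m t" if dc:
  "indec_decomposition R G V N U" for N U proof -
  have gU: "!!i. i < N ==> Gsub V (U i)" and iU: "!!i. i < N ==> indecomposable_module R G
   (V\<lparr>carrier := U i\<rparr>)" and bij: "bij_betw (%x. finsum V x {..<N}) (PiE {..<N} U)
   (carrier V)" using dc by (auto simp: indec_decomposition_def)
  have UV: "ALL i<N. U i <= carrier V" using gU module.submoduleE(1)[of R V] c(1) by (auto simp:
   gsubmodule_def group_module_def)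
  obtain p where p: "!!i. i < N ==> p i : homs rh rh" "!!i j. i < N ==> j < N ==> p i * p j = (if i
   = j then p i else 0)" "(SUM i<N. p i) = unt rh" "!!i. i < N ==> vecs (p i) = c ` U i" using
   decomposition_projections[OF c gU bij[unfolded finsum_bij_iff[OF c(1,2) UV]]] by auto
  have pr: "primitive rh (p i)" if "i < N" for i using indecomposable_imp_primitive[OF c p(1)[OF
   that] _ p(4)[OF that] gU[OF that] iU[OF that]] p(2)[OF that that] by simp
  have o: "orthogonal rh {..<N} p" using p(1,2) pr by (auto simp: orthogonal_def primitive_def)
  have e: "unt rh : homs rh rh" "null rh rh (unt rh * unt rh - unt rh)" using c(3) by auto
  have "dec T B rh (%t. if t : T then card {j:{..<N}. isor (subr rh (p j)) (B t)} else 0)" by (rule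
   dec_retract_count[OF b d c(3) e(1) e(1) e(2) o p(3)]) (use pr in simp)
  hence "m = (%t. if t : T then card {j:{..<N}. isor (subr rh (p j)) (B t)} else 0)" by (rule
   dec_unique[OF b d])
  hence "m t = card {j:{..<N}. isor (subr rh (p j)) (B t)}" using t by simp
  also have "{j:{..<N}. isor (subr rh (p j)) (B t)} = {i. i < N & Giso (V\<lparr>carrier := U
   i\<rparr>) W}" proof -
   have "Giso (V\<lparr>carrier := U i\<rparr>) W = isor (subr rh (p i)) (B t)" if i: "i < N" for i
    proof (rule mdl_iso_iff[OF _ W])
    show "mdl (V\<lparr>carrier := U i\<rparr>) (subr rh (p i))" using coords_sub[OF c homs_MK[OF
     p(1)[OF i]] _ homs_left[OF p(1)[OF i]] p(4)[OF i] gU[OF i]] p(2)[OF i i] by (auto simp: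
     mdl_def)
   qed
   thus ?thesis by auto
  qed
  finally show ?thesis by simp
 qed
 obtain N U where NU: "indec_decomposition R G V N U" using indec_decomposition_exists[OF c] by auto
 show ?thesis unfolding summand_mult_def proof (rule the_equality)
  show "EX N U. indec_decomposition R G V N U & m t = card {i. i < N & Giso (V\<lparr>carrier := U
   i\<rparr>) W}" using NU count[OF NU, symmetric] by auto
  next fix k
  assume "EX N U. indec_decomposition R G V N U & k = card {i. i < N & Giso (V\<lparr>carrier := U
   i\<rparr>) W}"
  thus "k = m t" using count by auto
qed qed
end

section \<open>The exterior algebra of the natural permutation module\<close>
text \<open>Exterior multiplication by the basis vector b, acting on functions on lists whose length
  is the degree: the alternating sum over all ways to delete an entry b. Its counterpart,
  contraction, simply prepends b to the argument.\<close>

primrec ad :: "nat => (nat list => 'r::comm_ring_1) => nat list => 'r" where "ad b f [] = 0" | "ad b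
 f (x # xs) = (if x = b then f xs else 0) - ad b (%ys. f (x # ys)) xs"

definition alternating :: "(nat list => 'r::comm_ring_1) => bool" where "alternating f = (ALL xs y z
 ys. f (xs @ y # z # ys) = - f (xs @ z # y # ys))"

lemma alternatingD: "alternating f ==> f (xs @ y # z # ys) = - f (xs @ z # y # ys)" unfolding
 alternating_def by blast

lemma alternating_head: "alternating f ==> f (y # z # ys) = - f (z # y # ys)" using alternatingD[of
 f "[]" y z ys] by simp

lemma alternatingI: "(!!xs y z ys. f (xs @ y # z # ys) = - f (xs @ z # y # ys)) ==> alternating f"
 unfolding alternating_def by blast

lemma alternating_Cons: "alternating f ==> alternating (%ys. f (x # ys))" by (metis alternatingI
 alternatingD append_Cons)

lemma alternating_add: "alternating f ==> alternating g ==> alternating (%xs. f xs + g xs)" proof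
 (rule alternatingI)
 fix xs y z ys assume "alternating f" "alternating g"
 from this[THEN alternatingD, of xs y z ys] show "f (xs @ y # z # ys) + g (xs @ y # z # ys) = - (f
  (xs @ z # y # ys) + g (xs @ z # y # ys))" by simp
qed

lemma alternating_smult: "alternating f ==> alternating (%xs. c * f xs)" proof (rule alternatingI)
 fix xs y z ys assume "alternating f"
 from alternatingD[OF this, of xs y z ys] show "c * f (xs @ y # z # ys) = - (c * f (xs @ z # y #
  ys))" by simp
qed

lemma alternating_map: "alternating f ==> alternating (%xs. f (map h xs))" by (rule alternatingI)
 (use alternatingI alternatingD in auto)

lemma alternating_len: "alternating f ==> alternating (%xs. if length xs = k then f xs else 0)" by
 (rule alternatingI) (use alternatingI alternatingD in auto)

lemma ad_add: "ad b (%xs. f xs + g xs) xs = ad b f xs + ad b g xs" by (induction xs arbitrary: f g)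
 (simp_all)

lemma ad_smult: "ad b (%xs. c * f xs) xs = c * ad b f xs" by (induction xs arbitrary: f) (simp_all
 add: algebra_simps)

lemma ad_zero: "ad b (%xs. 0) xs = 0" by (induction xs) simp_all

lemma ad_uminus: "ad b (%xs. - f xs) xs = - ad b f xs" using ad_smult[of b "- 1" f xs] by simp

lemma ad_diff: "ad b (%xs. f xs - g xs) xs = ad b f xs - ad b g xs" using ad_add[of b f "%xs. - g
 xs" xs] by (simp add: ad_uminus)

lemma ad_ad: "ad b (ad d f) xs = - ad d (ad b f) xs" by (induction xs arbitrary: f) (simp_all add:
 ad_diff, simp_all add: ad_zero)

lemma ad_alternating:
 assumes "alternating f"
 shows "alternating (ad b f)" proof -
 have "ad b f (xs @ y # z # ys) = - ad b f (xs @ z # y # ys)" for xs y z ys using assms proof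
  (induction xs arbitrary: f)
  case Nil
  have "(%w. f (y # z # w)) = (%w. - f (z # y # w))" by (intro ext) (rule alternating_head[OF Nil])
  hence "ad b (%w. f (y # z # w)) ys = - ad b (%w. f (z # y # w)) ys" by (simp only: ad_uminus)
  thus ?case by simp
  next case (Cons x xs)
  have "f (xs @ y # z # ys) = - f (xs @ z # y # ys)" by (rule alternatingD[OF Cons.prems])
  moreover have "ad b (%ys. f (x # ys)) (xs @ y # z # ys) = - ad b (%ys. f (x # ys)) (xs @ z # y #
   ys)" by (rule Cons.IH[OF alternating_Cons[OF Cons.prems]])
  ultimately show ?case by simp
 qed
 thus ?thesis unfolding alternating_def by blast
qed

lemma ad_support:
 assumes "ad b f xs ~= 0"
 shows "EX ys. f ys ~= 0 & length xs = Suc (length ys) & set xs <= insert b (set ys)" using assms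
  proof (induction xs arbitrary: f)
 case (Cons x xs)
 show ?case proof (cases "x = b & f xs ~= 0")
  case False
  hence "ad b (%ys. f (x # ys)) xs ~= 0" using Cons.prems by (auto split: if_splits)
  from Cons.IH[OF this] obtain ys where "f (x # ys) ~= 0" "length xs = Suc (length ys)" "set xs <=
   insert b (set ys)" by auto
  thus ?thesis by (intro exI[of _ "x # ys"]) auto
qed auto qed simp

lemma ad_map:
 assumes "inj h"
 shows "ad (h b) f (map h xs) = ad b (%ys. f (map h ys)) xs" using assms by (induction xs arbitrary:
  f) (simp_all add: inj_eq)

text \<open>Contraction followed by multiplication, summed over all letters, counts every entry of
  the list once: the number operator.\<close>

lemma ad_number:
 assumes "finite N" "alternating f" "set xs <= N"
 shows "(SUM b:N. ad b (%ys. f (b # ys)) xs) = of_nat (length xs) * f xs" using assms(2,3) proof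
  (induction xs arbitrary: f)
 case (Cons x xs)
 have "ad b (%ys. f (b # ys)) (x # xs) = (if x = b then f (x # xs) else 0) + ad b (%ys. f (x # b #
  ys)) xs" for b proof -
  have "(%ys. f (b # x # ys)) = (%ys. - f (x # b # ys))" by (intro ext) (rule alternating_head[OF
   Cons.prems(1)])
  hence "ad b (%ys. f (b # x # ys)) xs = - ad b (%ys. f (x # b # ys)) xs" by (simp only: ad_uminus)
  thus ?thesis by simp
 qed
 hence "(SUM b:N. ad b (%ys. f (b # ys)) (x # xs)) = f (x # xs) + (SUM b:N. ad b (%ys. f (x # b #
  ys)) xs)" using Cons.prems(2) assms(1) by (simp add: sum.distrib)
 also have "(SUM b:N. ad b (%ys. f (x # b # ys)) xs) = of_nat (length xs) * f (x # xs)" using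
  Cons.IH[OF alternating_Cons[OF Cons.prems(1)]] Cons.prems(2) by simp
 finally show ?case by (simp add: algebra_simps)
qed (simp add: ad_zero)

text \<open>A transposition acts on the natural module as the reflection in the difference of two
  basis vectors, and on the exterior algebra as 1 minus multiplication by that difference after
  contraction with it.\<close>

lemma alternating_transpose:
 assumes "alternating f" "!!xs. ~distinct xs ==> f xs = 0" "b ~= d"
 shows "f (map (transpose b d) xs) = f xs - (ad b (%ys. f (b # ys) - f (d # ys)) xs - ad d (%ys. f
  (b # ys) - f (d # ys)) xs)" using assms(1,2) proof (induction xs arbitrary: f)
 case (Cons x xs)
 note h = alternating_head[OF Cons.prems(1)]
 let ?D = "%f xs. ad b (%ys. f (b # ys) - f (d # ys)) xs - ad d (%ys. f (b # ys) - f (d # ys)) xs"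
 have IH: "f (y # map (transpose b d) xs) = f (y # xs) - ?D (%ys. f (y # ys)) xs" for y by (rule
  Cons.IH[OF alternating_Cons[OF Cons.prems(1)]]) (use Cons.prems(2) in auto)
 have zero: "f (y # y # ys) = 0" for y ys by (rule Cons.prems(2)) simp
 have eq: "?D (%ys. f (b # ys)) xs = ?D (%ys. f (d # ys)) xs" proof -
  have *: "(%ys. f (b # b # ys) - f (b # d # ys)) = (%ys. f (d # b # ys) - f (d # d # ys))" by
   (intro ext) (simp add: zero h[of d b])
  show ?thesis unfolding * ..
 qed
 have sh: "?D f (x # xs) = (if x = b then f (b # xs) - f (d # xs) else if x = d then f (d # xs) - f
  (b # xs) else 0) + ?D (%ys. f (x # ys)) xs" proof -
  have *: "(%ys. f (b # x # ys) - f (d # x # ys)) = (%ys. - (f (x # b # ys) - f (x # d # ys)))" by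
   (intro ext) (subst h[of b x], subst h[of d x], simp)
  show ?thesis unfolding ad.simps * ad_uminus by simp
 qed
 consider "x = b" | "x = d" | "x ~= b" "x ~= d" by auto
 thus ?case using sh IH eq by auto
qed simp

lemma alternating_not_distinct:
 assumes "alternating f" "!!xs. f xs = - f xs ==> f xs = 0" "~distinct xs"
 shows "f xs = 0" proof -
 obtain as x bs cs where xs: "xs = as @ x # bs @ x # cs" using not_distinct_decomp[OF assms(3)] by
  auto
 have "f (as @ x # bs @ x # cs) = 0" for as proof (induction bs arbitrary: as)
  case Nil
  show ?case using alternatingD[OF assms(1), of as x x cs] assms(2) by simp
  next case (Cons b bs)
  show ?case using alternatingD[OF assms(1), of as x b "bs @ x # cs"] Cons.IH[of "as @ [b]"] by simp
 qed
 thus ?thesis using xs by simp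
qed

section \<open>Creation and annihilation operators on alternating functions\<close>

locale hooks = matrix_reps K u "sym_group p" for K :: "'r::comm_ring_1 set" and u p + assumes
 p_prime: "prime p" and p_ge: "3 <= p" and char_p: "(of_nat m * u = 0) = (p dvd m)"
begin

lemma of_nat_cancel: "x : K ==> ~p dvd m ==> of_nat m * x = 0 ==> x = 0" using K_mult_eq_0[of
 "of_nat m * u" x] char_p by (simp add: massoc)

definition N :: "nat set" where "N = {1..p}"

lemma N_finite [simp]: "finite N" and N_card [simp]: "card N = p" by (simp_all add: N_def)

lemma N_mem: "1 : N" "2 : N" using p_ge by (auto simp: N_def)

lemma carrier_sym: "carrier (sym_group p) = {g. g permutes N}" by (simp add: sym_group_def N_def)

definition Alt :: "(nat list => 'r) set" where "Alt = {f. range f <= K & (ALL xs. f xs ~= 0 --> set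
 xs <= N) & alternating f}"

lemma AltD: "f : Alt ==> f xs : K" "f : Alt ==> ~set xs <= N ==> f xs = 0" "f : Alt ==> alternating
 f" by (auto simp: Alt_def)

lemma AltI: "(!!xs. f xs : K) ==> (!!xs. ~set xs <= N ==> f xs = 0) ==> alternating f ==> f : Alt"
 by (auto simp: Alt_def)

lemma Alt_distinct:
 assumes f: "f : Alt" and "~distinct xs"
 shows "f xs = 0" proof (rule alternating_not_distinct[OF AltD(3)[OF f] _ assms(2)])
 fix xs assume "f xs = - f xs"
 hence "of_nat 2 * f xs = 0" by simp
 moreover have "~p dvd 2" using p_ge by (auto dest: dvd_imp_le)
 ultimately show "f xs = 0" using of_nat_cancel[OF AltD(1)[OF f]] by simp
qed

lemma Alt_zero [simp]: "(%xs. 0) : Alt" by (rule AltI) (simp_all add: alternating_def)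

lemma Alt_add: "f : Alt ==> g : Alt ==> (%xs. f xs + g xs) : Alt" by (rule AltI) (auto simp: AltD
 intro: alternating_add)

lemma Alt_smult: "c : K ==> f : Alt ==> (%xs. c * f xs) : Alt" by (rule AltI) (auto simp: AltD
 intro: alternating_smult)

lemma Alt_ad: "f : Alt ==> b : N ==> ad b f : Alt" proof (rule AltI)
 fix xs assume f: "f : Alt" and b: "b : N"
 show "alternating (ad b f)" by (rule ad_alternating[OF AltD(3)[OF f]])
 have "ad b g xs : K" if "!!xs. g xs : K" for g using that by (induction xs arbitrary: g) auto
 thus "ad b f xs : K" using AltD(1)[OF f] by simp
 show "ad b f xs = 0" if "~set xs <= N" proof (rule ccontr)
  assume "ad b f xs ~= 0"
  then obtain ys where "f ys ~= 0" "set xs <= insert b (set ys)" using ad_support by blast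
  thus False using AltD(2)[OF f, of ys] b that by auto
qed qed

lemma Alt_an: "f : Alt ==> (%xs. f (b # xs)) : Alt" by (rule AltI) (auto simp: AltD intro:
 alternating_Cons)

lemma Alt_map: "f : Alt ==> h permutes N ==> (%xs. f (map h xs)) : Alt" proof (rule AltI)
 fix xs assume f: "f : Alt" and h: "h permutes N"
 show "f (map h xs) : K" by (rule AltD(1)[OF f])
 show "f (map h xs) = 0" if "~set xs <= N" using that permutes_in_image[OF h] by (intro AltD(2)[OF
  f]) auto
 show "alternating (%xs. f (map h xs))" by (rule alternating_map[OF AltD(3)[OF f]])
qed

lemma Alt_len: "f : Alt ==> (%xs. if length xs = k then f xs else 0) : Alt" by (rule AltI) (auto
 simp: AltD intro: alternating_len)

text \<open>Lists are numbered by \<open>list_encode\<close>, under which the empty list is 0; so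
  the vacuum vector is \<open>E00\<close>.\<close>

definition vec :: "(nat list => 'r) => 'r fm" where "vec f = Abs_fm (%i j. if j = 0 then f
 (list_decode i) else 0)"

definition Ls :: "nat list set" where "Ls = {xs. set xs <= N & distinct xs}"

lemma Ls_finite: "finite Ls" proof -
 have "Ls <= {xs. set xs <= N & length xs <= p}" using card_mono[of N "set _"] by (auto simp: Ls_def
  distinct_card[symmetric])
 thus ?thesis using finite_lists_length_le[of N p] finite_subset by auto
qed

lemma Alt_Ls: "f : Alt ==> xs ~: Ls ==> f xs = 0" using AltD(2) Alt_distinct by (auto simp: Ls_def)

lemma ent_vec: "f : Alt ==> ent (vec f) i j = (if j = 0 then f (list_decode i) else 0)" proof -
 assume f: "f : Alt"
 obtain n where n: "!!xs. xs : Ls ==> list_encode xs < n" using Ls_finite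
  finite_nat_set_iff_bounded[of "list_encode ` Ls"] by auto
 have *: "(if j = 0 then f (list_decode i) else 0) ~= 0 ==> i < Suc n & j < Suc n" for i j using n
  Alt_Ls[OF f] by (fastforce split: if_splits)
 show ?thesis unfolding vec_def by (subst ent_Abs[of _ "Suc n"]) (rule *, simp_all)
qed

lemma vec_inj: "f : Alt ==> g : Alt ==> vec f = vec g ==> f = g" proof (rule ext)
 fix xs assume "f : Alt" "g : Alt" "vec f = vec g"
 thus "f xs = g xs" using ent_vec[of f "list_encode xs" 0] ent_vec by simp
qed

lemma vec_cols: "f : Alt ==> vec f : cols" proof (rule colsI)
 assume f: "f : Alt"
 show "vec f : MK" unfolding MK_def ent_vec[OF f] mem_Collect_eq using AltD(1)[OF f] by simp
 show "vec f * E00 = vec f" by (rule fm_eqI) (simp add: ent_vec[OF f] AltD(1)[OF f] E00_def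
  ent_mult_unitm)
qed

lemma vec_add: "f : Alt ==> g : Alt ==> vec (%xs. f xs + g xs) = vec f + vec g" by (rule fm_eqI)
 (simp add: ent_vec Alt_add)

lemma vec_smult: "c : K ==> f : Alt ==> vec (%xs. c * f xs) = sm c (vec f)" by (rule fm_eqI) (simp
 add: ent_vec Alt_smult)

lemma vec_zero [simp]: "vec (%xs. 0) = 0" by (intro fm_eqI) (simp add: ent_vec)

lemma eA_exists: "EX e:MK. e * e = e & vecs e = vec ` Alt" proof -
 let ?B = "SUM xs:Ls. unitm u (list_encode xs) (list_encode xs)"
 have 1: "?B * v = v" if v: "v : vec ` Alt" for v proof (rule fm_eqI)
  fix i j
  obtain f where f: "f : Alt" "v = vec f" using v by auto
  have "ent (?B * v) i j = (SUM xs:Ls. if list_decode i = xs then u * ent v i j else 0)" unfolding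
   sum_fm_mult_left ent_sum by (intro sum.cong refl) (auto simp: ent_unitm_mult)
  also have "... = ent v i j" by (auto simp: Ls_finite f Alt_Ls AltD(1) ent_vec)
  finally show "ent (?B * v) i j = ent v i j" .
 qed
 have B: "?B : MK" by simp
 have BB: "?B * ?B = ?B" proof -
  have "?B * ?B = (SUM xs:Ls. SUM ys:Ls. if xs = ys then unitm u (list_encode xs) (list_encode xs)
   else 0)" unfolding sum_fm_mult_left lsum by (intro sum.cong refl) (auto simp: unitm_mult dest:
   list_encode_eq[THEN iffD1])
  thus ?thesis using Ls_finite by simp
 qed
 have sub: "vec ` Alt <= vecs ?B" using 1 vec_cols by (auto intro!: vecsI)
 have "EX ka:MK. ka * ka = ka & ?B * ka = ka & ka * ?B = ka & vecs ka = vec ` Alt" proof (rule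
  subspace_projection[OF B BB sub])
  show "0 : vec ` Alt" using Alt_zero vec_zero by (metis image_eqI)
  show "v + w : vec ` Alt" if "v : vec ` Alt" "w : vec ` Alt" for v w using that by (auto simp flip:
   vec_add intro!: Alt_add)
  show "sm c v : vec ` Alt" if "c : K" "v : vec ` Alt" for c v using that by (auto simp:
   vec_smult[symmetric] intro!: Alt_smult)
 qed
 thus ?thesis by auto
qed

definition eA :: "'r fm" where "eA = (SOME e. e : MK & e * e = e & vecs e = vec ` Alt)"

lemma eA: "eA : MK" "eA * eA = eA" "vecs eA = vec ` Alt" by (auto simp: someI_ex[OF
 eA_exists[unfolded Bex_def]] eA_def)

definition Op :: "'r fm set" where "Op = {M : MK. eA * M = M & M * eA = M}"

lemma OpD: "M : Op ==> M : MK" "M : Op ==> eA * M = M" "M : Op ==> M * eA = M" by (auto simp: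
 Op_def)

lemma Op_closed [simp]: "eA : Op" "0 : Op" "M : Op ==> M' : Op ==> M + M' : Op" "M : Op ==> M' : Op
 ==> M - M' : Op" "M : Op ==> - M : Op" "M : Op ==> M' : Op ==> M * M' : Op" "c : K ==> M : Op ==>
 sm c M : Op" by (auto simp: Op_def eA algebra_simps sm_mult) (simp_all add: massoc')

lemma Op_sum [simp]: "(!!x. x : S ==> M x : Op) ==> sum M S : Op" by (induction S rule:
 infinite_finite_induct) auto

lemma vec_vecs: "f : Alt ==> vec f : vecs eA" using eA(3) by simp

lemma Op_eqI:
 assumes "M : Op" "M' : Op" "!!f. f : Alt ==> M * vec f = M' * vec f"
 shows "M = M'" by (rule cols_test[of _ _ eA]) (use assms eA in "auto simp: OpD")

text \<open>Operators are specified by their effect on functions; \<open>Op_eqI\<close> then reduces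
  identities between them to identities of alternating functions.\<close>

definition op :: "((nat list => 'r) => nat list => 'r) => 'r fm" where "op ff = (SOME M. M : Op &
 (ALL f:Alt. M * vec f = vec (ff f)))"

lemma op:
 assumes cl: "!!f. f : Alt ==> ff f : Alt" and add: "!!f g. f : Alt ==> g : Alt ==> ff (%xs. f xs +
  g xs) = (%xs. ff f xs + ff g xs)" and smu: "!!c f. c : K ==> f : Alt ==> ff (%xs. c * f xs) =
  (%xs. c * ff f xs)"
 shows "op ff : Op" "f : Alt ==> op ff * vec f = vec (ff f)" proof -
 define qs where "qs v = vec (ff (the_inv_into Alt vec v))" for v
 have inj: "inj_on vec Alt" by (auto intro!: inj_onI vec_inj)
 have qs: "qs (vec f) = vec (ff f)" if "f : Alt" for f by (simp add: qs_def the_inv_into_f_f[OF inj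
  that])
 have "EX M:MK. M * eA = M & (ALL v:vecs eA. M * v = qs v)" proof (rule matrix_of_linear[OF
  eA(1,2)])
  show "qs v : cols" if "v : vecs eA" for v using that qs cl vec_cols by (auto simp: eA(3))
  show "qs (v + w) = qs v + qs w" if vw: "v : vecs eA" "w : vecs eA" for v w proof -
   obtain f g where fg: "f : Alt" "g : Alt" "v = vec f" "w = vec g" using vw[unfolded eA(3)] by auto
   have "qs (v + w) = vec (ff (%xs. f xs + g xs))" using qs[OF Alt_add[OF fg(1,2)]] fg by (simp add:
    vec_add)
   thus ?thesis by (simp add: fg cl qs add[OF fg(1,2)] vec_add)
  qed
  show "qs (sm c v) = sm c (qs v)" if cv: "c : K" "v : vecs eA" for c v proof -
   obtain f where f: "f : Alt" "v = vec f" using cv(2)[unfolded eA(3)] by auto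
   have "qs (sm c v) = vec (ff (%xs. c * f xs))" using qs[OF Alt_smult[OF cv(1) f(1)]] f cv by (simp
    add: vec_smult)
   thus ?thesis by (simp add: f cl qs smu[OF cv(1) f(1)] cv vec_smult)
 qed qed
 then obtain M where M: "M : MK" "M * eA = M" "!!v. v : vecs eA ==> M * v = qs v" by auto
 have "eA * M = M" proof (rule cols_test[of _ _ eA])
  fix v assume v: "v : vecs eA"
  have "qs v : vecs eA" using v qs cl vec_vecs by (auto simp: eA(3))
  thus "eA * M * v = M * v" by (simp add: M(3)[OF v] vecs_idem massoc)
 qed (use M eA in "auto simp: massoc")
 hence "M : Op" by (simp add: M Op_def)
 moreover have "ALL f:Alt. M * vec f = vec (ff f)" using M(3) vec_vecs qs by simp
 ultimately have "EX M. M : Op & (ALL f:Alt. M * vec f = vec (ff f))" by auto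
 from someI_ex[OF this] show "op ff : Op" "f : Alt ==> op ff * vec f = vec (ff f)" by (auto simp:
  op_def)
qed

definition cr :: "nat => 'r fm" where "cr b = op (ad b)"

definition an :: "nat => 'r fm" where "an b = op (%f xs. f (b # xs))"

definition Pm :: "(nat => nat) => 'r fm" where "Pm g = op (%f xs. f (map (inv' g) xs))"

definition Qd :: "nat => 'r fm" where "Qd k = op (%f xs. if length xs = k then f xs else 0)"

lemma cr:
 assumes "b : N"
 shows cr_Op [simp]: "cr b : Op" and cr_vec: "f : Alt ==> cr b * vec f = vec (ad b f)" unfolding
  cr_def by (atomize (full), intro conjI impI op) (auto simp: Alt_ad assms ad_add ad_smult)

lemma an_Op [simp]: "an b : Op" and an_vec: "f : Alt ==> an b * vec f = vec (%xs. f (b # xs))"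
 unfolding an_def by (rule op; auto simp: Alt_an)+

lemma Pm:
 assumes "g permutes N"
 shows Pm_Op [simp]: "Pm g : Op" and Pm_vec: "f : Alt ==> Pm g * vec f = vec (%xs. f (map (inv' g)
  xs))" unfolding Pm_def by (atomize (full), intro conjI impI op) (auto simp: Alt_map
  permutes_inv[OF assms])

lemma Qd_Op [simp]: "Qd k : Op" and Qd_vec: "f : Alt ==> Qd k * vec f = vec (%xs. if length xs = k
 then f xs else 0)" unfolding Qd_def by (rule op; auto simp: Alt_len)+

text \<open>With \<open>cr_cr\<close> and \<open>an_an\<close> these are the canonical
  anticommutation relations, the basis of most later computations.\<close>

lemma an_cr: "b : N ==> an z * cr b = (if z = b then eA else 0) - cr b * an z" proof (rule Op_eqI)
 fix f assume b: "b : N" and f: "f : Alt"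
 have "vec f = vec (%xs. ad b f (z # xs)) + vec (ad b (%ys. f (z # ys)))" if "z = b" using that f b
  by (simp add: vec_add[symmetric] Alt_ad Alt_an del: ad.simps) simp
 moreover have "0 = vec (%xs. ad b f (z # xs)) + vec (ad b (%ys. f (z # ys)))" if "z ~= b" using
  that f b by (simp add: vec_add[symmetric] Alt_ad Alt_an del: ad.simps) simp
 ultimately show "an z * cr b * vec f = ((if z = b then eA else 0) - cr b * an z) * vec f" using f b
  vecs_idem[OF vec_vecs[OF f]] by (auto simp: cr_vec an_vec Alt_ad Alt_an algebra_simps)
qed auto

lemma cr_cr: "b : N ==> d : N ==> cr b * cr d = - (cr d * cr b)" proof (rule Op_eqI)
 fix f assume b: "b : N" "d : N" and f: "f : Alt"
 have "vec (ad b (ad d f)) + vec (ad d (ad b f)) = 0" by (simp add: ad_ad[of b d f] b f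
  vec_add[symmetric] Alt_ad)
 thus "cr b * cr d * vec f = - (cr d * cr b) * vec f" by (simp add: f b massoc cr_vec Alt_ad
  add_eq_0_iff)
qed auto

lemma an_an: "an b * an d = - (an d * an b)" proof (rule Op_eqI)
 fix f assume f: "f : Alt"
 have "vec (%xs. f (b # d # xs)) + vec (%xs. f (d # b # xs)) = 0" unfolding vec_add[OF Alt_an[OF
  Alt_an[OF f]] Alt_an[OF Alt_an[OF f]], symmetric] using alternating_head[OF AltD(3)[OF f], of b d]
  by simp
 thus "an b * an d * vec f = - (an d * an b) * vec f" by (simp add: f massoc an_vec Alt_an
  add_eq_0_iff)
qed auto

lemma number: "(SUM b:N. cr b * an b) * Qd k = sm (of_nat k * u) (Qd k)" proof (rule Op_eqI)
 fix f assume f0: "f : Alt"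
 define g where "g = (%xs. if length xs = k then f xs else 0)"
 have g: "g : Alt" unfolding g_def by (rule Alt_len[OF f0])
 have len: "g xs ~= 0 ==> length xs = k" for xs by (auto simp: g_def split: if_splits)
 have vs: "(SUM b:S. vec (h b)) = vec (%xs. SUM b:S. h b xs) & (%xs. SUM b:S. h b xs) : Alt" if
  "finite S" "!!b. b : S ==> h b : Alt" for S and h :: "nat => nat list => 'r" using that by
  (induction S) (auto simp: vec_add Alt_add)
 have "(SUM b:N. cr b * an b) * vec g = (SUM b:N. vec (ad b (%ys. g (b # ys))))" unfolding
  sum_fm_mult_left by (intro sum.cong refl) (simp add: massoc an_vec cr_vec g Alt_an)
 also have "... = vec (%xs. SUM b:N. ad b (%ys. g (b # ys)) xs)" by (simp add: vs g Alt_ad Alt_an)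
 also have "(%xs. SUM b:N. ad b (%ys. g (b # ys)) xs) = (%xs. (of_nat k * u) * g xs)" proof
  fix xs
  show "(SUM b:N. ad b (%ys. g (b # ys)) xs) = (of_nat k * u) * g xs" proof (cases "set xs <= N")
   case True
   thus ?thesis using ad_number[OF _ AltD(3)[OF g] True] len AltD(1)[OF g, of xs] by (cases "g xs =
    0") (auto simp: massoc)
   next case False
   thus ?thesis using AltD(2)[OF Alt_ad[OF Alt_an[OF g]] False] AltD(2)[OF g False] by simp
 qed qed
 also have "vec (%xs. (of_nat k * u) * g xs) = sm (of_nat k * u) (vec g)" by (rule vec_smult) (use g
  in auto)
 finally show "(SUM b:N. cr b * an b) * Qd k * vec f = sm (of_nat k * u) (Qd k) * vec f" by (simp
  add: Qd_vec[OF f0, of k] massoc sm_mult g_def)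
qed auto

lemma Qd_Qd: "Qd k * Qd l = (if k = l then Qd k else 0)" proof (rule Op_eqI)
 fix f assume f: "f : Alt"
 have "Qd k * Qd l * vec f = vec (%xs. if length xs = k then if length xs = l then f xs else 0 else
  0)" by (simp add: f massoc Qd_vec Alt_len)
 also have "... = (if k = l then Qd k else 0) * vec f" by (auto simp: f Qd_vec cong: if_cong)
 finally show "Qd k * Qd l * vec f = (if k = l then Qd k else 0) * vec f" .
qed auto

lemma ad_len: "ad b (%xs. if length xs = k then f xs else 0) xs = (if length xs = Suc k then ad b f
 xs else 0)" proof (induction xs arbitrary: f k)
 case (Cons x xs)
 show ?case by (cases k) (simp_all add: ad_zero Cons.IH)
qed simp

lemma cr_Qd: "b : N ==> cr b * Qd k = Qd (Suc k) * cr b" proof (rule Op_eqI)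
 fix f assume "b : N" "f : Alt"
 thus "cr b * Qd k * vec f = Qd (Suc k) * cr b * vec f" by (simp add: massoc Qd_vec cr_vec Alt_len
  Alt_ad) (simp add: ad_len[abs_def])
qed auto

lemma an_Qd: "an b * Qd (Suc k) = Qd k * an b" by (simp add: Op_eqI massoc Qd_vec an_vec Alt_len
 Alt_an)

lemma an_Qd_0: "an b * Qd 0 = 0" proof (rule Op_eqI)
 fix f assume f: "f : Alt"
 thus "an b * Qd 0 * vec f = 0 * vec f" using an_vec[OF Alt_len[OF f, of 0], of b] by (simp add:
  massoc Qd_vec)
qed auto

text \<open>The empty list has number 0, so the part of degree zero is spanned by \<open>E00\<close>
  and its projection is \<open>E00 * eA\<close>.\<close>

lemma vacuum: "Qd 0 = E00 * eA" "eA * E00 = E00" "h permutes N ==> Pm h * E00 = E00" proof -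
 define g :: "nat list => 'r" where "g = (%xs. if xs = [] then u else 0)"
 have g: "g : Alt" by (rule AltI) (auto simp: g_def alternating_def)
 have dec: "(list_decode i = []) = (i = 0)" for i by (cases i) (auto split: prod.split)
 have vg: "vec g = E00" by (rule fm_eqI) (unfold ent_vec[OF g], simp add: g_def E00_def ent_unitm
  dec)
 show "Pm h * E00 = E00" if h: "h permutes N" using Pm_vec[OF h g] by (simp add: vg) (simp add:
  g_def vg[unfolded g_def])
 show eE: "eA * E00 = E00" using vecs_idem[OF vec_vecs[OF g]] by (simp add: vg)
 have EeA: "E00 * eA : Op" by (simp add: eA Op_def massoc) (simp add: massoc' eE)
 show "Qd 0 = E00 * eA" proof (rule Op_eqI[OF Qd_Op EeA])
  fix f assume f: "f : Alt"
  have "Qd 0 * vec f = E00 * vec f" unfolding Qd_vec[OF f] by (rule fm_eqI) (unfold ent_vec[OF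
   Alt_len[OF f]] E00_def ent_unitm_mult ent_vec[OF f], use AltD(1)[OF f] in "auto simp: dec")
  thus "Qd 0 * vec f = E00 * eA * vec f" by (simp add: vecs_idem[OF vec_vecs[OF f]] massoc)
qed qed

lemma Pm_mult: "g permutes N ==> h permutes N ==> Pm g * Pm h = Pm (g o h)" by (simp add: Op_eqI
 permutes_bij o_inv_distrib permutes_compose Alt_map permutes_inv massoc Pm_vec)

lemma Pm_id: "Pm id = eA" by (simp add: Op_eqI Pm_vec vecs_idem vec_vecs)

lemma Pm_cr: "g permutes N ==> b : N ==> Pm g * cr b = cr (g b) * Pm g" proof (rule Op_eqI)
 fix f assume g: "g permutes N" and b: "b : N" and f: "f : Alt"
 have gb: "g b : N" using b permutes_in_image[OF g] by simp
 have "ad b f (map (inv' g) xs) = ad (g b) (%ys. f (map (inv' g) ys)) xs" for xs using ad_map[of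
  "inv' g" "g b" f xs] permutes_inj[OF permutes_inv[OF g]] permutes_inverses[OF g] by simp
 thus "Pm g * cr b * vec f = cr (g b) * Pm g * vec f" by (simp add: g b gb f Alt_map[OF f
  permutes_inv[OF g]] massoc Pm_vec cr_vec Alt_ad)
qed (auto simp: permutes_in_image)

lemma Pm_an: "g permutes N ==> Pm g * an b = an (g b) * Pm g" by (simp add: Op_eqI Alt_map
 permutes_inv Alt_an permutes_inverses massoc Pm_vec an_vec)

lemma Pm_Qd: "g permutes N ==> Pm g * Qd k = Qd k * Pm g" by (simp add: Op_eqI Alt_map permutes_inv
 Alt_len massoc Pm_vec Qd_vec)

lemma Pm_transpose:
 assumes "b : N" "d : N"
 shows "Pm (transpose b d) = eA - (cr b - cr d) * (an b - an d)" proof (rule Op_eqI)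
 note tp = permutes_swap_id[OF assms]
 fix f assume f: "f : Alt"
 show "Pm (transpose b d) * vec f = (eA - (cr b - cr d) * (an b - an d)) * vec f" proof (cases "b =
  d")
  case True
  thus ?thesis by (simp add: Pm_id)
  next case False
  define g where "g = (%ys. f (b # ys) - f (d # ys))"
  have g: "g = (%ys. f (b # ys) + (- u) * f (d # ys))" by (auto simp: AltD(1)[OF f] g_def)
  have gA: "g : Alt" unfolding g by (intro Alt_add Alt_smult Alt_an f) simp
  have dg: "(an b - an d) * vec f = vec g" using vec_add[OF Alt_an[OF f, of b] Alt_smult[OF _
   Alt_an[OF f, of d], of "- u"]] vec_smult[OF _ Alt_an[OF f], of "- u" d] by (simp add: g ldiff
   an_vec f sm_minus_left vec_cols Alt_an)
  have "vec f = vec (%xs. f (map (transpose b d) xs)) + (vec (ad b g) - vec (ad d g))" proof (rule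
   fm_eqI)
   fix i j
   show "ent (vec f) i j = ent (vec (%xs. f (map (transpose b d) xs)) + (vec (ad b g) - vec (ad d
    g))) i j" using alternating_transpose[OF AltD(3)[OF f] Alt_distinct[OF f] False, of "list_decode
    i", folded g_def] by (simp add: ent_vec f gA Alt_ad assms Alt_map tp)
  qed
  thus ?thesis using Pm_vec[OF tp f] cr_vec[OF assms(1) gA] cr_vec[OF assms(2) gA] dg vecs_idem[OF
   vec_vecs[OF f]] by (simp add: ldiff massoc)
qed qed (auto simp: assms permutes_swap_id)
end
context hooks
begin

section \<open>The simple hook modules\<close>

lemma OpL: "M : Op ==> eA * M = M" by (auto simp: Op_def)

lemma OpL': "M : Op ==> eA * (M * Y) = M * Y" by (simp_all add: Op_def massoc')

lemma sm_of_nat_eq_0: "M : MK ==> p dvd m ==> sm (of_nat m) M = 0" using char_p[of m] sm_sm[of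
 "of_nat m" u M] by simp

lemma sm_of_nat_cancel: "M : MK ==> ~p dvd m ==> sm (of_nat m) M = 0 ==> M = 0" proof (rule fm_eqI)
 fix i j assume "M : MK" "~p dvd m" "sm (of_nat m) M = 0"
 thus "ent M i j = ent 0 i j" using of_nat_cancel ent_sm[of "of_nat m" M i j] by simp
qed

lemma of_nat_inverse:
 assumes "~p dvd m" obtains c where "c : K" "c * (of_nat m * u) = u" "c ~= 0" proof -
 obtain c where "c : K" "of_nat m * u * c = u" using char_p assms K_inverse[of "of_nat m * u"] by
  auto
 hence "c * (of_nat m * u) = u" "c ~= 0" by (simp_all only: mult.commute[of c]) auto
 thus ?thesis using that \<open>c : K\<close> by simp
qed

lemma eq_uminus_MK: "M : MK ==> M = - M ==> M = 0" proof -
 assume M: "M : MK" "M = - M"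
 have "sm (of_nat 2) M = M + M" by (rule fm_eqI) simp
 also have "... = 0" using M(2) by (metis add.right_inverse)
 finally show "M = 0" using p_ge by (intro sm_of_nat_cancel[OF M(1), of 2]) (auto dest: dvd_imp_le)
qed

lemma sum_const_sm: "(SUM x:S. M) = sm (of_nat (card S)) M" by (induction S rule:
 infinite_finite_induct) (simp_all add: sm_add_left)

definition Cr :: "'r fm" where "Cr = (SUM b:N. cr b)"

definition An :: "'r fm" where "An = (SUM b:N. an b)"

lemma Cr_Op [simp]: "Cr : Op" and An_Op [simp]: "An : Op" by (auto simp: Cr_def An_def)

lemma an_Cr: "z : N ==> an z * Cr = eA - Cr * an z" by (simp add: Cr_def lsum sum_fm_mult_left an_cr
 sum_subtractf)

lemma An_cr: "b : N ==> An * cr b = eA - cr b * An" by (simp add: An_def lsum sum_fm_mult_left an_cr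
 sum_subtractf)

text \<open>The anticommutator is p times the identity: the sum e of the basis vectors lies in the
  sum-zero submodule exactly because p vanishes in K.\<close>

lemma An_Cr: "An * Cr = - (Cr * An)" proof -
 have "An * Cr = (SUM z:N. eA - Cr * an z)" unfolding An_def sum_fm_mult_left by (intro sum.cong
  refl) (rule an_Cr)
 also have "... = sm (of_nat p) eA - Cr * An" by (simp add: sum_subtractf sum_const_sm An_def lsum)
 finally show ?thesis using sm_of_nat_eq_0[OF eA(1), of p] by simp
qed

lemma Cr_cr: "b : N ==> Cr * cr b = - (cr b * Cr)" unfolding Cr_def lsum sum_fm_mult_left
 sum_negf[symmetric] by (intro sum.cong refl cr_cr)

lemma An_an: "An * an b = - (an b * An)" unfolding An_def lsum sum_fm_mult_left sum_negf[symmetric]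
 by (intro sum.cong refl an_an)

lemma Cr_Cr: "Cr * Cr = 0" proof (rule eq_uminus_MK)
 have "Cr * Cr = (SUM b:N. Cr * cr b)" by (simp add: Cr_def lsum)
 also have "... = - (Cr * Cr)" by (simp add: Cr_cr sum_negf) (simp add: Cr_def sum_fm_mult_left)
 finally show "Cr * Cr = - (Cr * Cr)" .
qed (auto intro!: OpD(1) Op_closed(6))

lemma An_An: "An * An = 0" proof (rule eq_uminus_MK)
 have "An * An = (SUM b:N. An * an b)" by (simp add: An_def lsum)
 also have "... = - (An * An)" by (simp add: An_an sum_negf) (simp add: An_def sum_fm_mult_left)
 finally show "An * An = - (An * An)" .
qed (auto intro!: OpD(1) Op_closed(6))

lemma Cr_Qd: "Cr * Qd k = Qd (Suc k) * Cr" unfolding Cr_def sum_fm_mult_left lsum by (intro sum.cong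
 refl cr_Qd)

lemma An_Qd: "An * Qd (Suc k) = Qd k * An" unfolding An_def sum_fm_mult_left lsum by (intro sum.cong
 refl an_Qd)

lemma An_Qd_0: "An * Qd 0 = 0" unfolding An_def sum_fm_mult_left by (intro sum.neutral ballI
 an_Qd_0)

lemma Pm_Cr: "g permutes N ==> Pm g * Cr = Cr * Pm g" proof -
 assume g: "g permutes N"
 have "Pm g * Cr = (SUM b:N. cr (g b) * Pm g)" unfolding Cr_def lsum by (intro sum.cong refl Pm_cr
  g)
 also have "... = Cr * Pm g" unfolding Cr_def sum_fm_mult_left by (rule sum.permute[OF g, symmetric,
  unfolded comp_def])
 finally show ?thesis .
qed

lemma Pm_An: "g permutes N ==> Pm g * An = An * Pm g" proof -
 assume g: "g permutes N"
 have "Pm g * An = (SUM b:N. an (g b) * Pm g)" unfolding An_def lsum by (intro sum.cong refl Pm_an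
  g)
 also have "... = An * Pm g" unfolding An_def sum_fm_mult_left by (rule sum.permute[OF g, symmetric,
  unfolded comp_def])
 finally show ?thesis .
qed

text \<open>\<open>Cr\<close> is wedging with e and \<open>An\<close> is contraction with the
  coordinate sum. Elements of the kernel of \<open>Cr\<close> are multiples of e, so the common
  kernel in degree k + 1 is e times the k-th exterior power of the heart. Admitting matrices rather
  than vectors covers operators with values in that space as well.\<close>

definition Ek :: "nat => 'r fm set" where "Ek k = {M : MK. eA * M = M & Cr * M = 0 & An * M = 0 & Qd
 (Suc k) * M = M}"

text \<open>\<open>Cr * an 1\<close> and \<open>An * cr 2\<close> fix the kernels of
  \<open>Cr\<close> and \<open>An\<close>, by the relations with a single letter. The product
  projects onto the common kernel; it singles out two letters and need not be equivariant, whence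
  the use of \<open>subr\<close> in \<open>hk\<close>.\<close>

definition kap :: "nat => 'r fm" where "kap k = Cr * (an 1 * (An * (cr 2 * Qd (Suc k))))"

lemma EkD: "M : Ek k ==> M : MK" "M : Ek k ==> eA * M = M" "M : Ek k ==> Cr * M = 0" "M : Ek k ==>
 An * M = 0" "M : Ek k ==> Qd (Suc k) * M = M" by (auto simp: Ek_def)

lemma kap_Op [simp]: "kap k : Op" by (simp add: kap_def N_mem)

lemma shift: "L * R = S ==> L * (R * Y) = S * (Y :: 'r fm)" by (simp add: massoc')

lemma kap_fix:
 assumes M: "M : Ek k"
 shows "kap k * M = M" proof -
 note m = EkD[OF M]
 have "An * (cr 2 * M) = M" by (simp add: shift[OF An_cr[OF N_mem(2)], of M] m ldiff massoc)
 moreover have "Cr * (an 1 * M) = M" using shift[OF an_Cr[OF N_mem(1)], of M] m by (simp add: ldiff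
  massoc)
 ultimately show ?thesis by (simp add: m(5) kap_def massoc)
qed

lemma kap_Ek: "kap k : Ek k" proof -
 have "Qd (Suc k) * kap k = Cr * (Qd k * (an 1 * (An * (cr 2 * Qd (Suc k)))))" by (simp add: kap_def
  massoc' Cr_Qd)
 also have "Qd k * (an 1 * (An * (cr 2 * Qd (Suc k)))) = an 1 * (Qd (Suc k) * (An * (cr 2 * Qd (Suc
  k))))" by (simp add: massoc' an_Qd)
 also have "Qd (Suc k) * (An * (cr 2 * Qd (Suc k))) = An * (Qd (Suc (Suc k)) * (cr 2 * Qd (Suc k)))"
  by (simp add: massoc' An_Qd)
 also have "Qd (Suc (Suc k)) * (cr 2 * Qd (Suc k)) = cr 2 * (Qd (Suc k) * Qd (Suc k))" by (simp add:
  cr_Qd N_mem Qd_Qd shift[OF Qd_Qd])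
 finally have "Qd (Suc k) * kap k = kap k" by (simp add: Qd_Qd kap_def)
 moreover have "Cr * kap k = 0" by (simp add: kap_def shift[OF Cr_Cr])
 moreover have "An * kap k = 0" by (simp add: kap_def shift[OF An_Cr] shift[OF An_an] shift[OF
  An_An] massoc)
 ultimately show ?thesis using kap_Op by (simp add: Ek_def Op_def)
qed

lemma Ek_mult: "M : Ek k ==> Y : MK ==> M * Y : Ek k" by (simp add: Ek_def massoc')

lemma Ek_iff: "(M : Ek k) = (M : MK & kap k * M = M)" using kap_fix EkD(1) Ek_mult[OF kap_Ek, of M
 k] by auto

lemma Ek_closed [simp]: "0 : Ek k" "M : Ek k ==> M' : Ek k ==> M + M' : Ek k" "M : Ek k ==> M' : Ek
 k ==> M - M' : Ek k" "c : K ==> M : Ek k ==> sm c M : Ek k" "M : Ek k ==> - M : Ek k" by (auto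
 simp: Ek_def algebra_simps sm_mult)

lemma Ek_sum: "(!!x. x : S ==> M x : Ek k) ==> sum M S : Ek k" by (induction S rule:
 infinite_finite_induct) auto

lemma kap_idem: "kap k * kap k = kap k" by (rule kap_fix[OF kap_Ek])

lemma Ek_Pm: "M : Ek k ==> g permutes N ==> Pm g * M : Ek k" using shift[OF Pm_Cr[symmetric], of g
 M] shift[OF Pm_An[symmetric], of g M] shift[OF Pm_Qd[symmetric], of g "Suc k" M] by (simp add:
 Ek_def OpL' OpD(1) massoc)

lemma Pm_rep: "rep Pm" and unt_Pm: "unt Pm = eA" by (simp_all add: rep_def carrier_sym
 sym_group_mult sym_group_one Pm_mult Pm_id OpD(1))

definition hk :: "nat => (nat => nat) => 'r fm" where "hk k = subr Pm (kap k)"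

lemma unt_hk [simp]: "unt (hk k) = kap k" by (simp add: hk_def subr_def unt_Pm OpL)

lemma hk_rep [simp]: "rep (hk k)" unfolding hk_def by (rule subr_rep) (auto simp: Pm_rep unt_Pm OpL
 OpD(1) carrier_sym massoc kap_fix Ek_Pm kap_Ek)

text \<open>Differences with the letter 1 anticommute with both \<open>Cr\<close> and
  \<open>An\<close>. Hence \<open>al\<close> and \<open>ga\<close> act between the spaces
  \<open>Ek\<close> as the creation and annihilation operators of the heart.\<close>

definition al :: "nat => 'r fm" where "al b = cr b - cr 1"

definition ga :: "nat => 'r fm" where "ga b = an b - an 1"

text \<open>The Gram matrix of the vectors e_b - e_1, and by \<open>ga_al\<close> the anticommutator
  of \<open>ga b\<close> with \<open>al d\<close>.\<close>

definition sc :: "nat => nat => 'r" where "sc b d = (if b = d then 1 else 0) - (if b = 1 then 1 else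
 0) - (if d = 1 then 1 else 0) + 1"

lemma sc_sym: "sc b d = sc d b" by (simp add: sc_def)

lemma al_Op [simp]: "b : N ==> al b : Op" using N_mem by (simp add: al_def)

lemma ga_Op [simp]: "ga b : Op" by (simp add: ga_def)

lemma ga_al: "d : N ==> ga b * al d = sm (sc b d) eA - al d * ga b" using N_mem(1) by (simp add:
 ga_def al_def sc_def algebra_simps an_cr sm_add_left)

lemma al_al: "b : N ==> d : N ==> al b * al d = - (al d * al b)" proof -
 assume bd: "b : N" "d : N"
 have z: "cr x * cr y + cr y * cr x = 0" if "x : N" "y : N" for x y using cr_cr[OF that] by simp
 have "al b * al d + al d * al b = (cr b * cr d + cr d * cr b) - (cr b * cr 1 + cr 1 * cr b) - (cr 1
  * cr d + cr d * cr 1) + (cr 1 * cr 1 + cr 1 * cr 1)" by (simp add: al_def algebra_simps)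
 hence "al b * al d + al d * al b = 0" using bd N_mem(1) by (simp only: z) simp
 thus ?thesis by (simp add: add_eq_0_iff)
qed

lemma ga_ga: "ga b * ga d = - (ga d * ga b)" proof -
 have z: "an x * an y + an y * an x = 0" for x y using an_an[of x y] by simp
 have "ga b * ga d + ga d * ga b = (an b * an d + an d * an b) - (an b * an 1 + an 1 * an b) - (an 1
  * an d + an d * an 1) + (an 1 * an 1 + an 1 * an 1)" by (simp add: ga_def algebra_simps)
 hence "ga b * ga d + ga d * ga b = 0" by (simp only: z) simp
 thus ?thesis by (simp add: add_eq_0_iff)
qed

lemma Cr_al: "b : N ==> Cr * al b = - (al b * Cr)" using N_mem(1) by (simp add: al_def algebra_simps
 Cr_cr)

lemma An_ga: "An * ga b = - (ga b * An)" by (simp add: ga_def algebra_simps An_an)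

lemma An_al: "b : N ==> An * al b = - (al b * An)" using N_mem(1) by (simp add: al_def algebra_simps
 An_cr)

lemma Cr_ga: "b : N ==> Cr * ga b = - (ga b * Cr)" using N_mem(1) by (simp add: ga_def algebra_simps
 an_Cr)

lemma al_Qd: "b : N ==> al b * Qd k = Qd (Suc k) * al b" using N_mem(1) by (simp add: al_def
 algebra_simps cr_Qd)

lemma ga_Qd: "ga b * Qd (Suc k) = Qd k * ga b" by (simp add: ga_def algebra_simps an_Qd)

lemma Ek_al: "M : Ek k ==> b : N ==> al b * M : Ek (Suc k)" using shift[OF Cr_al, of b M] shift[OF
 An_al, of b M] shift[OF al_Qd[symmetric], of b "Suc k" M] by (simp add: Ek_def OpL' OpD(1) massoc)

lemma Ek_ga: "M : Ek (Suc k) ==> b : N ==> ga b * M : Ek k" using shift[OF Cr_ga, of b M] shift[OF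
 An_ga, of b M] shift[OF ga_Qd[symmetric], of "Suc k" b M] by (simp add: Ek_def OpL' OpD(1) massoc)

lemma Ek_0_ga:
 assumes M: "M : Ek 0" and b: "b : N"
 shows "ga b * M = 0" proof -
 have q: "Qd 0 * (ga b * M) = ga b * M" by (simp add: shift[OF ga_Qd[symmetric], of 0 b M] EkD(5)[OF
  M] massoc)
 have c: "Cr * (ga b * M) = 0" by (simp add: shift[OF Cr_ga[OF b], of M] EkD(3)[OF M] massoc)
 show ?thesis using shift[OF an_Qd_0[of 1], of "ga b * M"] q shift[OF an_Cr[OF N_mem(1)], of "ga b *
  M"] c by (simp add: ldiff massoc OpL')
qed

text \<open>The number operator counts degree k + 1, and the mixed term \<open>Cr * an 1\<close>,
  which is the identity on the kernel of \<open>Cr\<close>, takes away the factor e. The remaining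
  term occurs p times and vanishes.\<close>

lemma Ek_number:
 assumes M: "M : Ek k"
 shows "(SUM b:N. al b * (ga b * M)) = sm (of_nat k) M" proof -
 note m = EkD[OF M]
 have "(SUM b:N. al b * (ga b * M)) = (SUM b:N. cr b * an b) * M - Cr * (an 1 * M) - cr 1 * (An * M)
  + (SUM b:N. cr 1 * (an 1 * M))" unfolding al_def ga_def Cr_def An_def sum_fm_mult_left lsum
  sum_subtractf[symmetric] sum.distrib[symmetric] by (intro sum.cong refl) (simp add: algebra_simps)
 also have "(SUM b:N. cr 1 * (an 1 * M)) = 0" using m(1) N_mem OpD(1) by (simp add: sum_const_sm
  sm_of_nat_eq_0)
 also have "(SUM b:N. cr b * an b) * M = sm (of_nat (Suc k)) M" proof -
  have "(SUM b:N. cr b * an b) * M = (SUM b:N. cr b * an b) * Qd (Suc k) * M" by (simp add: m(5)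
   massoc)
  also have "... = sm (of_nat (Suc k) * u) M" unfolding number sm_mult_left m(5) ..
  also have "... = sm (of_nat (Suc k)) (sm u M)" by simp
  finally show ?thesis using m(1) by simp
 qed
 also have "Cr * (an 1 * M) = M" using shift[OF an_Cr[OF N_mem(1)], of M] m by (simp add: ldiff
  massoc)
 finally show ?thesis by (simp add: m(4) sm_add_left)
qed

lemma sc_sum: "(SUM b:N. sm (sc b b) M) = sm (- 2) M" if "M : MK" for M proof -
 have "(SUM b:N. sm (sc b b) M) = (SUM b:N. sm 2 M - (if b = 1 then sm 2 M else 0))" by (intro
  sum.cong refl) (auto simp: sc_def)
 also have "... = sm (of_nat p) (sm 2 M) - sm 2 M" using N_mem(1) by (simp add: sum_subtractf
  sum_const_sm)
 also have "sm (of_nat p) (sm 2 M) = sm 2 (sm (of_nat p) M)" by (simp add: mult.commute)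
 finally show ?thesis by (simp add: sm_of_nat_eq_0[OF that, of p] sm_minus_left)
qed

text \<open>Reversing the order adds the trace of the Gram matrix, which is -2, the dimension p - 2
  of the heart read in K.\<close>

lemma Ek_number':
 assumes M: "M : Ek k"
 shows "(SUM b:N. ga b * (al b * M)) = - sm (of_nat (k + 2)) M" proof -
 have "(SUM b:N. ga b * (al b * M)) = (SUM b:N. sm (sc b b) M - al b * (ga b * M))" by (intro
  sum.cong refl) (simp add: shift[OF ga_al] ldiff sm_mult EkD[OF M] massoc)
 thus ?thesis by (simp add: sc_sum[OF EkD(1)[OF M]] Ek_number[OF M] sum_subtractf sm_add_left
  sm_minus_left)
qed

text \<open>The vectors e_b - e_1 only span. Since the \<open>ga b\<close> sum to zero on
  \<open>Ek k\<close> and \<open>ga 1 = 0\<close>, the Gram matrix acts on them as the identity,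
  which replaces a dual basis.\<close>

lemma Ek_dual_ga:
 assumes M: "M : Ek k" and d: "d : N"
 shows "(SUM b:N. sm (sc b d) (ga b * M)) = ga d * M" proof -
 note m = EkD[OF M]
 have s: "(SUM b:N. ga b * M) = 0" by (simp add: ga_def sum_subtractf sum_const_sm
  sum_fm_mult_left[symmetric] An_def[symmetric] m OpD(1) sm_of_nat_eq_0)
 have "(SUM b:N. sm (sc b d) (ga b * M)) = (SUM b:N. (if b = d then ga b * M else 0) - (if b = 1
  then ga b * M else 0) + sm (if d = 1 then 0 else 1) (ga b * M))" by (intro sum.cong refl) (auto
  simp: sc_def sm_add_left sm_diff_left)
 also have "... = ga d * M" by (simp add: d s sum.distrib sum_subtractf) (simp add: ga_def)
 finally show ?thesis .
qed

lemma Ek_dual_al: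
 assumes M: "M : Ek k" and d: "d : N"
 shows "(SUM b:N. sm (sc b d) (al b * M)) = al d * M" proof -
 note m = EkD[OF M]
 have s: "(SUM b:N. al b * M) = 0" using m OpD(1) N_mem by (simp add: al_def sum_subtractf
  sum_const_sm sum_fm_mult_left[symmetric] Cr_def[symmetric] sm_of_nat_eq_0)
 have "(SUM b:N. sm (sc b d) (al b * M)) = (SUM b:N. (if b = d then al b * M else 0) - (if b = 1
  then al b * M else 0) + sm (if d = 1 then 0 else 1) (al b * M))" by (intro sum.cong refl) (auto
  simp: sc_def sm_add_left sm_diff_left)
 also have "... = al d * M" by (simp add: d s sum.distrib sum_subtractf) (simp add: al_def)
 finally show ?thesis .
qed

lemma Ek_al_ga: "M : Ek k ==> b : N ==> d : N ==> al b * (ga d * M) : Ek k" by (cases k) (simp_all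
 add: Ek_0_ga Ek_al Ek_ga)

text \<open>The transpositions act by reflections, whose products yield all
 \<open>al b * ga d\<close>.\<close>

lemma al_ga_closure:
 assumes S: "S <= Op" "eA : S" "!!g. g permutes N ==> Pm g : S" "!!Q Q'. Q : S ==> Q' : S ==> Q + Q'
  : S" "!!Q Q'. Q : S ==> Q' : S ==> Q - Q' : S" "!!Q Q'. Q : S ==> Q' : S ==> Q * Q' : S" "!!c Q. c
  : K ==> Q : S ==> sm c Q : S" and b: "b : N" and d: "d : N"
 shows "al b * ga d : S" proof -
 have r: "(al x - al y) * (ga x - ga y) : S" if "x : N" "y : N" for x y proof -
  have "eA - Pm (transpose x y) : S" using S permutes_swap_id[OF that] by simp
  thus ?thesis by (simp add: Pm_transpose[OF that] al_def ga_def)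
 qed
 have one: "al 1 = 0" "ga 1 = 0" by (simp_all add: al_def ga_def)
 have rb: "al x * ga x : S" if "x : N" for x using r[OF that N_mem(1)] one by simp
 consider "b = d" | "b = 1 | d = 1" | "b ~= d" "b ~= 1" "d ~= 1" by auto
 thus ?thesis proof cases
  case 1
  thus ?thesis using rb[OF b] by simp
  next case 2
  have "0 : S" using S(5)[OF S(2) S(2)] by simp
  thus ?thesis using 2 one by auto
  next case 3
  have r12: "al b * (ga b * (al d * ga d)) = al b * ga d - al b * (al d * (ga b * ga d))" using 3
   OpL[OF ga_Op] by (simp add: shift[OF ga_al[OF d]] sc_def algebra_simps)
  have "al d * (ga d * (al b * ga b)) = al d * ga b - al d * (al b * (ga d * ga b))" using 3 OpL[OF
   ga_Op] by (simp add: shift[OF ga_al[OF b]] sc_def algebra_simps)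
  moreover have "al d * (al b * (ga d * ga b)) = al b * (al d * (ga b * ga d))" using shift[OF
   al_al[OF d b], of "ga d * ga b"] ga_ga[of d b] by (simp add: massoc)
  ultimately have r21: "al d * (ga d * (al b * ga b)) = al d * ga b - al b * (al d * (ga b * ga d))"
   by simp
  \<comment> \<open>The reflections give the symmetric combination
    \<open>al b * ga d + al d * ga b\<close>, and the commutator of two of them gives the
    antisymmetric one; as 2 is invertible, their sum isolates the single term.\<close>
  have "al b * ga d + al b * ga d = al b * ga b + al d * ga d - (al b - al d) * (ga b - ga d) + (al
   b * ga b * (al d * ga d) - al d * ga d * (al b * ga b))" by (simp only: massoc r12 r21) (simp
   add: algebra_simps)
  also have "... : S" by (intro S(4-6) rb r b d)
  also have "al b * ga d + al b * ga d = sm (of_nat 2) (al b * ga d)" by (rule fm_eqI) simp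
  finally have two: "sm (of_nat 2) (al b * ga d) : S" .
  have "~p dvd 2" using p_ge by (auto dest: dvd_imp_le)
  then obtain c where c: "c : K" "c * (of_nat 2 * u) = u" using of_nat_inverse by metis
  have MK: "al b * ga d : MK" using b OpD(1) by simp
  have "sm c (sm (of_nat 2) (al b * ga d)) = sm (c * (of_nat 2 * u)) (al b * ga d)" by (simp add: MK
   sm_sm[symmetric] del: sm_sm)
  also have "... = al b * ga d" using MK c by simp
  finally show ?thesis using S(7)[OF c(1) two] by simp
qed qed

text \<open>By \<open>al_ga_closure\<close> the operators \<open>al b * ga d\<close> are generated
  by the group action, so homomorphisms of hook modules commute with them.\<close>

lemma hk_homs_al_ga:
 assumes f: "f : homs (hk k) (hk l)" and b: "b : N" and d: "d : N"
 shows "al b * (ga d * f) = f * (al b * (ga d * kap k))" proof -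
 let ?S = "{Q : Op. Q * f = f * (Q * kap k) & kap k * (Q * kap k) = Q * kap k}"
 have fk: "f * kap k = f" "kap l * f = f" using homs_right[OF f] homs_left[OF f] by auto
 have P: "Pm g * f = f * (Pm g * kap k)" if "g permutes N" for g using homs_comm[OF f, of g] that fk
  by (simp add: hk_def subr_def carrier_sym massoc)
 have "al b * ga d : ?S" proof (rule al_ga_closure[OF _ _ _ _ _ _ _ b d])
  show "Pm g : ?S" if "g permutes N" for g using P kap_fix[OF Ek_Pm[OF kap_Ek that]] that by simp
  show "eA : ?S" using OpL OpL'[OF kap_Op[of l], of f] fk kap_idem by simp
  show "Q * Q' : ?S" if Q: "Q : ?S" "Q' : ?S" for Q Q' proof -
   have "Q * (Q' * f) = f * (Q * kap k) * (Q' * kap k)" using Q by (simp add: massoc')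
   also have "... = f * (Q * (kap k * (Q' * kap k)))" by (simp add: massoc)
   finally have 1: "Q * (Q' * f) = f * (Q * (Q' * kap k))" using Q by simp
   have "kap k * (Q * (Q' * kap k)) = kap k * (Q * kap k) * (Q' * kap k)" using Q(2) by (simp add:
    massoc)
   also have "... = Q * kap k * (Q' * kap k)" using Q(1) by simp
   finally show ?thesis using 1 Q by (simp add: massoc)
 qed qed (auto simp: algebra_simps sm_mult)
 thus ?thesis by (simp add: massoc)
qed

text \<open>A homomorphism commutes with the number operator, which is k on the source and l on the
  target.\<close>

lemma hk_homs_zero:
 assumes f: "f : homs (hk k) (hk l)" and kl: "k ~= l" "k < p" "l < p"
 shows "f = 0" proof -
 have fk: "f * kap k = f" "kap l * f = f" "f : MK" using homs_right[OF f] homs_left[OF f] homs_MK[OF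
  f] by auto
 hence fE: "f : Ek l" by (simp add: Ek_iff)
 have "sm (of_nat l) f = (SUM b:N. f * (al b * (ga b * kap k)))" unfolding Ek_number[OF fE,
  symmetric] by (intro sum.cong refl hk_homs_al_ga[OF f])
 also have "... = sm (of_nat k) f" by (simp add: lsum[symmetric] Ek_number[OF kap_Ek] sm_mult fk)
 finally have e: "sm (of_nat l) f = sm (of_nat k) f" .
 have "sm (of_nat (l - k)) f = 0" "sm (of_nat (k - l)) f = 0" using e by (cases "k <= l"; simp add:
  sm_diff_left)+
 moreover have "~p dvd (l - k) | ~p dvd (k - l)" using kl by (auto dest!: dvd_imp_le)
 ultimately show ?thesis using sm_of_nat_cancel[OF fk(3)] by auto
qed

lemma E00_scalar: "M : MK ==> E00 * (M * E00) = sm (ent M 0 0) E00" by (rule fm_eqI) (simp add: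
 E00_def ent_unitm_mult ent_mult_unitm ent_unitm)

lemma Qd_0_scalar: "M : MK ==> EX c:K. Qd 0 * M * Qd 0 = sm c (Qd 0)" proof (intro bexI[of _ "ent
 (eA * M) 0 0"])
 assume M: "M : MK"
 hence eM: "eA * M : MK" using eA(1) by simp
 have "Qd 0 * M * Qd 0 = E00 * (eA * M * E00) * eA" by (simp add: vacuum(1) massoc)
 thus "Qd 0 * M * Qd 0 = sm (ent (eA * M) 0 0) (Qd 0)" by (simp add: E00_scalar[OF eM] sm_mult
  vacuum(1))
 show "ent (eA * M) 0 0 : K" using eM by simp
qed

lemma Cr_an_Ek: "M : Ek k ==> Cr * (an 1 * M) = M" using shift[OF an_Cr[OF N_mem(1)], of M] EkD by
 (simp add: ldiff massoc)

lemma kap_0: "kap 0 = Cr * (Qd 0 * (an 1 * kap 0))" using Cr_an_Ek[OF kap_Ek[of 0]] shift[OF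
 an_Qd[symmetric], of 0 1 "kap 0"] EkD(5)[OF kap_Ek[of 0]] by (simp add: massoc)

text \<open>By induction on the degree: the contraction of f over the \<open>al\<close> and
  \<open>ga\<close> is an endomorphism one degree lower that still commutes with all
  \<open>al b * ga d\<close>, hence a scalar. The hypothesis is stated in terms of these operators
  and not of the group, so that it survives the contraction.\<close>

lemma scalar_kap:
 assumes "f : MK" "kap k * f = f" "f * kap k = f" "k + 2 <= p" "!!b d. b : N ==> d : N ==> al b *
  (ga d * f) = f * (al b * (ga d * kap k))"
 shows "EX c:K. f = sm c (kap k)" using assms proof (induction k arbitrary: f)
 case 0
 obtain c where c: "c : K" "Qd 0 * (an 1 * (0 + f * Cr)) * Qd 0 = sm c (Qd 0)" using Qd_0_scalar[of
  "an 1 * (0 + f * Cr)"] 0 OpD(1) by auto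
 have "f = kap 0 * f * kap 0" using 0 by simp
 also have "... = Cr * (Qd 0 * (an 1 * (f * (Cr * (Qd 0 * (an 1 * kap 0))))))" by (subst (1 2)
  kap_0) (simp add: massoc 0(2))
 also have "... = Cr * (sm c (Qd 0) * (an 1 * kap 0))" by (simp add: c(2)[symmetric] massoc)
 also have "... = sm c (kap 0)" by (subst (2) kap_0) (simp add: sm_mult)
 finally show ?case using c(1) by auto
 next case (Suc j)
 let ?k = "Suc j"
 have fE: "f : Ek ?k" by (simp add: Suc.prems Ek_iff)
 \<comment> \<open>The partial trace of f over one exterior factor.\<close>
 define qs where "qs = (SUM b:N. ga b * (f * (al b * kap j)))"
 have fa: "f * (al b * kap j) : Ek ?k" if "b : N" for b using that by (intro Ek_mult[OF fE]) (simp
  add: OpD(1))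
 have qsE: "qs : Ek j" unfolding qs_def by (intro Ek_sum Ek_ga fa)
 have ex: "f * (al v * (ga w * M)) = al v * (ga w * (f * M))" if "v : N" "w : N" "M : Ek ?k" for v w
  M proof -
  have "f * (al v * (ga w * M)) = f * (al v * (ga w * kap ?k)) * M" by (simp add: kap_fix[OF
   that(3)] massoc)
  also have "... = al v * (ga w * (f * M))" using Suc.prems(5)[OF that(1,2)] by (simp add: massoc')
  finally show ?thesis .
 qed
 have "EX c:K. qs = sm c (kap j)" proof (rule Suc.IH)
  show "qs * kap j = qs" by (simp add: qs_def sum_fm_mult_left massoc kap_idem)
  show "kap j * qs = qs" "qs : MK" using qsE by (auto simp: Ek_iff)
  fix v w assume v: "v : N" and w: "w : N"
  have "qs * (al v * (ga w * kap j)) = (SUM b:N. ga b * (f * (al b * (al v * (ga w * kap j)))))" by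
   (simp add: kap_fix[OF Ek_al_ga[OF kap_Ek v w]] qs_def sum_fm_mult_left massoc)
  also have "... = (SUM b:N. ga b * (al v * (ga w * (f * (al b * kap j)))) - sm (sc b w) (ga b * (f
   * (al v * kap j))))" proof (intro sum.cong refl)
   fix b assume b: "b : N"
   have "al v * (ga w * (al b * kap j)) = sm (sc b w) (al v * kap j) + al b * (al v * (ga w * kap
    j))" proof -
    have "ga w * (al b * kap j) = sm (sc b w) (kap j) - al b * (ga w * kap j)" using shift[OF
     ga_al[OF b], of w "kap j"] OpL by (simp add: ldiff sm_mult massoc sc_sym[of w b])
    thus ?thesis using shift[OF al_al[OF v b], of "ga w * kap j"] by (simp add: rdiff sm_mult
     massoc)
   qed
   hence "al b * (al v * (ga w * kap j)) = al v * (ga w * (al b * kap j)) - sm (sc b w) (al v * kap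
    j)" by simp
   thus "ga b * (f * (al b * (al v * (ga w * kap j)))) = ga b * (al v * (ga w * (f * (al b * kap
    j)))) - sm (sc b w) (ga b * (f * (al v * kap j)))" by (simp add: ex[OF v w Ek_al[OF kap_Ek b]]
    rdiff sm_mult)
  qed
  also have "... = (SUM b:N. ga b * (al v * (ga w * (f * (al b * kap j))))) - ga w * (f * (al v *
   kap j))" by (simp add: sum_subtractf Ek_dual_ga[OF fa[OF v] w])
  also have "(SUM b:N. ga b * (al v * (ga w * (f * (al b * kap j))))) = (SUM b:N. sm (sc b v) (ga w
   * (f * (al b * kap j))) + al v * (ga w * (ga b * (f * (al b * kap j)))))" proof (intro sum.cong
   refl)
   fix b assume b: "b : N"
   show "ga b * (al v * (ga w * (f * (al b * kap j)))) = sm (sc b v) (ga w * (f * (al b * kap j))) +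
    al v * (ga w * (ga b * (f * (al b * kap j))))" using shift[OF ga_al[OF v], of b "ga w * (f * (al
    b * kap j))"] shift[OF ga_ga[of b w], of "f * (al b * kap j)"] OpL' by (simp add: algebra_simps
    sm_mult)
  qed
  also have "... = ga w * (f * (SUM b:N. sm (sc b v) (al b * kap j))) + al v * (ga w * qs)" by (simp
   add: qs_def sum.distrib lsum sm_mult)
  finally show "al v * (ga w * qs) = qs * (al v * (ga w * kap j))" using Ek_dual_al[OF kap_Ek v] by
   simp
 qed (use Suc.prems in simp)
 then obtain c where c: "c : K" "qs = sm c (kap j)" by auto
 have kg: "kap j * (ga d * kap ?k) = ga d * kap ?k" if "d : N" for d by (rule kap_fix[OF Ek_ga[OF
  kap_Ek that]])
 have "(SUM d:N. al d * (qs * (ga d * kap ?k))) = sm c (SUM d:N. al d * (ga d * kap ?k))" unfolding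
  c(2) sm_sum by (intro sum.cong refl) (simp add: sm_mult kg)
 also have "... = sm (c * of_nat ?k) (kap ?k)" unfolding Ek_number[OF kap_Ek] sm_sm ..
 finally have 1: "(SUM d:N. al d * (qs * (ga d * kap ?k))) = sm (c * of_nat ?k) (kap ?k)" .
 \<comment> \<open>The same sum with the definition of qs inserted: commuting f past
   \<open>al b * ga d\<close> leaves the number operators, which return a multiple of f.\<close>
 have "(SUM d:N. al d * (qs * (ga d * kap ?k))) = (SUM d:N. al d * (- sm (of_nat (j + 2)) (ga d *
  f)))" proof (intro sum.cong refl)
  fix d assume d: "d : N"
  have "qs * (ga d * kap ?k) = (SUM b:N. ga b * (f * (al b * (ga d * kap ?k))))" by (simp add:
   qs_def sum_fm_mult_left massoc kg[OF d])
  also have "... = (SUM b:N. ga b * (al b * (ga d * f)))" using Suc.prems(5) d by simp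
  also have "... = - sm (of_nat (j + 2)) (ga d * f)" by (rule Ek_number'[OF Ek_ga[OF fE d]])
  finally show "al d * (qs * (ga d * kap ?k)) = al d * (- sm (of_nat (j + 2)) (ga d * f))" by simp
 qed
 also have "... = - sm (of_nat (j + 2)) (SUM d:N. al d * (ga d * f))" by (simp add: sum_negf sm_sum
  sm_mult)
 also have "... = - sm (of_nat ((j + 2) * ?k)) f" unfolding Ek_number[OF fE] sm_sm of_nat_mult ..
 finally have 2: "sm (of_nat ((j + 2) * ?k)) f = sm (- c * of_nat ?k) (kap ?k)" by (simp add: 1
  sm_minus_left)
 \<comment> \<open>Both factors lie strictly between 0 and p.\<close>
 have "~p dvd (j + 2) * ?k" unfolding prime_dvd_mult_iff[OF p_prime] using Suc.prems(4) by (auto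
  dest!: dvd_imp_le)
 then obtain c' where c': "c' : K" "c' * (of_nat ((j + 2) * ?k) * u) = u" using of_nat_inverse by
  metis
 have "f = sm (c' * (of_nat ((j + 2) * ?k) * u)) f" using c' Suc.prems(1) by simp
 also have "... = sm c' (sm (of_nat ((j + 2) * ?k)) (sm u f))" by simp
 also have "... = sm (c' * (- (c * of_nat ?k))) (kap ?k)" using 2 Suc.prems(1) by simp
 finally have "f = sm (c' * (- (of_nat ?k * c))) (kap ?k)" by (simp only: mult.commute)
 moreover have "c' * (- (of_nat ?k * c)) : K" by (intro K_mult K_uminus K_of_nat c c')
 ultimately show ?case by auto
qed

lemma E00_Ek: "Cr * E00 : Ek 0" "an 1 * (Cr * E00) = E00" "ga b * E00 = 0" "Qd 0 * E00 = E00" proof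
 -
 show q: "Qd 0 * E00 = E00" by (simp add: vacuum massoc)
 have a: "An * E00 = 0" "an 1 * E00 = 0" "an b * E00 = 0" using shift[OF An_Qd_0, of E00] shift[OF
  an_Qd_0, of _ E00] by (simp_all add: q)
 thus "ga b * E00 = 0" by (simp add: ga_def ldiff)
 show "an 1 * (Cr * E00) = E00" using shift[OF an_Cr[OF N_mem(1)], of E00] a by (simp add: ldiff
  massoc vacuum)
 show "Cr * E00 : Ek 0" by (simp add: shift[OF An_Cr, of E00] shift[OF Cr_Cr, of E00] shift[OF
  Cr_Qd[symmetric], of 0 E00] OpD(1) OpL' Ek_def a q massoc)
qed

text \<open>\<open>Ek 0\<close> is spanned by e itself, which is invariant; the inverse map
  contracts e back to the vacuum.\<close>

lemma triv_hk: "isor triv (hk 0)" unfolding isor_def proof (intro bexI conjI)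
 let ?f = "Cr * E00" and ?g = "Qd 0 * (an 1 * kap 0)"
 have EQ: "E00 * Qd 0 = Qd 0" by (simp add: vacuum(1) massoc')
 have fk: "kap 0 * ?f = ?f" by (rule kap_fix[OF E00_Ek(1)])
 have fg: "?f * ?g = kap 0" using kap_0 shift[OF EQ] by (simp add: massoc)
 have gf: "?g * ?f = E00" using fk E00_Ek(2,4) by (simp add: massoc)
 have Pf: "Pm g * ?f = ?f" if "g permutes N" for g by (simp add: shift[OF Pm_Cr[OF that], of E00]
  vacuum(3)[OF that] massoc)
 have Pk: "Pm g * kap 0 = kap 0" if "g permutes N" for g using arg_cong[OF Pf[OF that], of "%M. M *
  ?g"] fg by (simp add: massoc)
 show "?g * ?f = unt triv" using gf by (simp add: triv_def)
 show "?f * ?g = unt (hk 0)" using fg by simp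
 show "?f : homs triv (hk 0)" by (rule homsI) (use fk Pf OpD(1)[OF Cr_Op] in "auto simp: triv_def
  hk_def subr_def carrier_sym massoc unt_Pm OpL'")
 show "?g : homs (hk 0) triv" by (rule homsI) (use Pk kap_idem OpD(1) shift[OF EQ] in "auto simp:
  triv_def hk_def subr_def carrier_sym massoc unt_Pm OpL")
qed

lemma card_sym: "card (carrier (sym_group p)) = fact p" by (simp add: card_permutations[of N p]
 carrier_sym)

text \<open>A trace on the trivial module is multiplication by the group order p!, which vanishes in
  K.\<close>

lemma triv_not_null: "~null triv triv (unt triv)" proof
 assume "null triv triv (unt triv)"
 then obtain h where h: "h : MK" "E00 = tr triv triv h" by (auto simp: null_def triv_def)
 have "E00 = sm (of_nat (fact p)) (E00 * h * E00)" using h(2) by (simp add: tr_def triv_def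
  sum_const_sm card_sym)
 also have "... = 0" using sm_of_nat_eq_0 h(1) p_ge dvd_fact by auto
 finally have "ent (E00 :: 'r fm) 0 0 = 0" by simp
 thus False by (simp add: E00_def ent_unitm)
qed
end
declare One_nat_def [simp del]
context hooks
begin

section \<open>Tensoring with the heart of the natural permutation module\<close>

text \<open>Pure tensors span the image of \<open>kron e e'\<close>, because unit vectors with coded
  indices are pure tensors.\<close>

lemma kron_test:
 assumes "A * kron e e' = A" "B * kron e e' = B" "A : MK" "B : MK" "e : MK" "e' : MK" "e * e = e"
  "e' * e' = e'" and eq: "!!v w. v : vecs e ==> w : vecs e' ==> A * kron v w = B * kron v w"
 shows "A = B" proof (rule fm_eqI)
 fix i c
 obtain a b where c: "c = prod_encode (a, b)" by (metis surj_prod_encode surj_pair rangeE UNIV_I)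
 have 0: "prod_encode (0, 0) = 0" by (simp add: prod_encode_def)
 have v: "e * unitm u a 0 : vecs e" "e' * unitm u b 0 : vecs e'" by (rule vecs_mult; use assms in
  simp)+
 have k: "M * unitm u c 0 = M * kron (e * unitm u a 0) (e' * unitm u b 0)" if "M * kron e e' = M"
  for M proof -
  have "kron (e * unitm u a 0) (e' * unitm u b 0) = kron e e' * unitm u c 0" by (simp add:
   kron_mult[symmetric] kron_unitm c 0)
  thus ?thesis by (simp add: that massoc')
 qed
 have "A * unitm u c 0 = B * unitm u c 0" unfolding k[OF assms(1)] k[OF assms(2)] by (rule eq[OF v])
 hence "ent (A * unitm u c 0) i 0 = ent (B * unitm u c 0) i 0" by simp
 thus "ent A i c = ent B i c" by (simp add: assms ent_mult_unitm)
qed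

lemma prod_encode_00: "prod_encode (0, 0) = 0" by (simp add: prod_encode_def)

text \<open>Inserting and deleting a trivial tensor factor on the right.\<close>

definition Ins :: "'r fm" where "Ins = (SUM i<(SOME n. bnd eA n). unitm u (prod_encode (i, 0)) i)"

definition Del :: "'r fm" where "Del = (SUM i<(SOME n. bnd eA n). unitm u i (prod_encode (i, 0)))"

lemma Ins_Del:
 assumes a: "a : cols" "eA * a = a"
 shows "Ins * a = kron a E00" "Del * kron a E00 = a" proof -
 define n where "n = (SOME n. bnd eA n)"
 have n: "bnd eA n" unfolding n_def by (rule someI_ex[OF bnd_ex])
 have z: "ent a i j = 0" if "~i < n" for i j proof -
  have "ent (eA * a) i j = 0" unfolding ent_times_bndl[OF n] using that by (intro sum.neutral) (simp
   add: bnd_zero[OF n])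
  thus ?thesis using a by simp
 qed
 have K: "ent a i j : K" for i j using cols_MK[OF a(1)] by simp
 have k: "ent (kron a E00) (prod_encode (i, l)) j = (if l = 0 & j = 0 then ent a i 0 else 0)" for i
  l j proof -
  obtain j1 j2 where j: "j = prod_encode (j1, j2)" by (metis surj_prod_encode surj_pair rangeE
   UNIV_I)
  have "(j = 0) = (j1 = 0 & j2 = 0)" using prod_encode_eq[of "(j1, j2)" "(0, 0)"] by (simp add: j
   prod_encode_00)
  thus ?thesis by (auto simp: cols_ent[OF a(1), of j1 i] K j ent_kron' E00_def ent_unitm)
 qed
 show "Ins * a = kron a E00" proof (rule fm_eqI)
  fix m j
  obtain i l where m: "m = prod_encode (i, l)" by (metis surj_prod_encode surj_pair rangeE UNIV_I)
  have "ent (Ins * a) m j = (SUM i'<n. if i' = i then (if l = 0 then ent a i j else 0) else 0)" by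
   (simp add: Ins_def n_def[symmetric] sum_fm_mult_left ent_sum ent_unitm_mult m K)
  thus "ent (Ins * a) m j = ent (kron a E00) m j" by (auto simp: m k z cols_ent[OF a(1), of j i])
 qed
 show "Del * kron a E00 = a" proof (rule fm_eqI)
  fix i j
  have "ent (Del * kron a E00) i j = (SUM i'<n. if i' = i then (if j = 0 then ent a i 0 else 0) else
   0)" by (simp add: Del_def n_def[symmetric] sum_fm_mult_left ent_sum ent_unitm_mult k K)
  thus "ent (Del * kron a E00) i j = ent a i j" using z cols_ent[OF a(1), of j i] by auto
qed qed

lemma Ins_MK [simp]: "Ins : MK" and Del_MK [simp]: "Del : MK" by (auto simp: Ins_def Del_def)

text \<open>The spanning family e wedge (e_b - e_1) of \<open>hk 1\<close>.\<close>

definition yy :: "nat => 'r fm" where "yy b = Cr * (al b * E00)"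

text \<open>Coordinates with respect to the family \<open>yy\<close>: x is the sum of
  \<open>vv b x\<close> times \<open>yy b\<close>. The sign compensates for the anticommutation of
  \<open>Cr\<close> with \<open>al b\<close>.\<close>

definition vv :: "nat => 'r fm => 'r" where "vv b x = - ent (an 1 * (ga b * x)) 0 0"

lemma yy: "yy b = - (al b * (Cr * E00))" if "b : N" by (simp add: shift[OF Cr_al[OF that], of E00]
 yy_def massoc)

lemma yy_vecs: "b : N ==> yy b : vecs (kap 1)" proof -
 assume b: "b : N"
 have E: "yy b : Ek 1" by (simp add: Ek_al[OF E00_Ek(1) b] yy[OF b] One_nat_def)
 hence "yy b * E00 = yy b" by (simp add: yy_def massoc)
 thus ?thesis using E by (intro vecsI colsI) (auto simp: Ek_iff)
qed

lemma vecs_Ek: "(v : vecs (kap k)) = (v : Ek k & v * E00 = v)" by (auto simp: Ek_iff intro!: vecsI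
 colsI dest: vecs_idem vecs_E00)

lemma yy_sum: "(SUM b:N. yy b) = 0" proof -
 have "(SUM b:N. al b * E00) = Cr * E00 - sm (of_nat p) (cr 1 * E00)" by (simp add: al_def ldiff
  sum_subtractf sum_const_sm Cr_def sum_fm_mult_left)
 also have "... = Cr * E00" by (simp add: N_mem OpD(1) sm_of_nat_eq_0)
 finally show ?thesis by (simp add: yy_def lsum[symmetric] shift[OF Cr_Cr])
qed

lemma vv_yy: "b : N ==> d : N ==> vv d (yy b) = sc d b * u" proof -
 assume b: "b : N" and d: "d : N"
 have "ga d * yy b = - sm (sc d b) (Cr * E00)" using shift[OF ga_al[OF b], of d "Cr * E00"]
  Ek_0_ga[OF E00_Ek(1) d] EkD(2)[OF E00_Ek(1)] by (simp add: yy[OF b] ldiff sm_mult massoc)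
 thus ?thesis using E00_Ek(2) by (simp add: vv_def sm_mult E00_def ent_unitm)
qed

lemma vv_K: "x : MK ==> b : N ==> vv b x : K" by (simp add: vv_def OpD(1))

lemma vv_ga:
 assumes x: "x : vecs (kap 1)" and b: "b : N"
 shows "ga b * x = - sm (vv b x) (Cr * E00)" proof -
 have xE: "x : Ek (Suc 0)" "x * E00 = x" "x : MK" using x EkD(1) by (auto simp: vecs_Ek One_nat_def)
 have g: "ga b * x : Ek 0" by (rule Ek_ga[OF xE(1) b])
 have "an 1 * (ga b * x) = E00 * (an 1 * (ga b * x) * E00)" proof -
  have "an 1 * (ga b * x) = Qd 0 * (an 1 * (ga b * x))" using shift[OF an_Qd[symmetric], of 0 1 "ga
   b * x"] EkD(5)[OF g] by (simp add: massoc)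
  also have "... = E00 * (an 1 * (ga b * x))" by (simp add: vacuum(1) massoc OpL')
  finally show ?thesis by (simp add: xE(2) massoc)
 qed
 also have "... = sm (- vv b x) E00" unfolding vv_def using xE(3) OpD(1) by (subst E00_scalar) auto
 finally have "Cr * (an 1 * (ga b * x)) = Cr * sm (- vv b x) E00" by simp
 thus ?thesis by (simp add: Cr_an_Ek[OF g] sm_mult sm_minus_left)
qed

lemma vv_expand:
 assumes x: "x : vecs (kap 1)"
 shows "x = (SUM b:N. sm (vv b x) (yy b))" proof -
 have xE: "x : Ek 1" using x by (auto simp: vecs_Ek)
 have "x = (SUM b:N. al b * (ga b * x))" using Ek_number[OF xE] by simp
 also have "... = (SUM b:N. sm (vv b x) (yy b))" by (intro sum.cong refl) (simp add: vv_ga[OF x] yy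
  sm_mult sm_minus)
 finally show ?thesis .
qed

lemma vv_sum:
 assumes x: "x : vecs (kap 1)"
 shows "(SUM b:N. vv b x) = 0" proof -
 have xE: "x : Ek 1" using x by (auto simp: vecs_Ek)
 have "(SUM b:N. ga b * x) = 0" by (simp add: ga_def sum_subtractf sum_const_sm
  sum_fm_mult_left[symmetric] An_def[symmetric] EkD[OF xE] OpD(1) sm_of_nat_eq_0)
 hence "ent (an 1 * (SUM b:N. ga b * x)) 0 0 = 0" by simp
 thus ?thesis by (simp add: vv_def sum_negf lsum)
qed

lemma Pm_al: "g permutes N ==> b : N ==> Pm g * al b = (al (g b) - al (g 1)) * Pm g" by (simp add:
 N_mem(1) al_def algebra_simps Pm_cr)

lemma Pm_ga: "g permutes N ==> Pm g * ga b = (ga (g b) - ga (g 1)) * Pm g" by (simp add: ga_def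
 algebra_simps Pm_an)

lemma Pm_yy: "g permutes N ==> b : N ==> Pm g * yy b = yy (g b) - yy (g 1)" using shift[OF Pm_Cr, of
 g "al b * E00"] shift[OF Pm_al, of g b E00] vacuum(3) by (simp add: yy_def algebra_simps)

lemma vecs_Pm: "v : vecs (kap k) ==> g permutes N ==> Pm g * v : vecs (kap k)" by (auto simp:
 vecs_Ek Ek_Pm massoc)

lemma Pm_vv:
 assumes x: "x : vecs (kap 1)" and g: "g permutes N" and b: "b : N"
 shows "vv (g b) (Pm g * x) - vv (g 1) (Pm g * x) = vv b x" proof -
 have "(ga (g b) - ga (g 1)) * (Pm g * x) = - sm (vv b x) (Cr * E00)" using shift[OF Pm_ga[OF g], of
  b x] vv_ga[OF x b] shift[OF Pm_Cr[OF g], of E00] vacuum(3)[OF g] by (simp add: massoc sm_mult)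
 from arg_cong[OF this, of "%M. an 1 * M"] have "an 1 * (ga (g b) * (Pm g * x)) - an 1 * (ga (g 1) *
  (Pm g * x)) = - sm (vv b x) E00" by (simp add: E00_Ek(2) ldiff rdiff sm_mult)
 from arg_cong[OF this, of "%M. ent M 0 0"] have "ent (an 1 * (ga (g b) * (Pm g * x))) 0 0 - ent (an
  1 * (ga (g 1) * (Pm g * x))) 0 0 = - (vv b x * u)" by (simp add: E00_def ent_unitm)
 hence "- (- vv (g b) (Pm g * x) + vv (g 1) (Pm g * x)) = - (- (vv b x * u))" by (simp only:
  vv_def[of "g _"]) simp
 thus ?thesis using vv_K[OF _ b, of x] x by simp
qed

text \<open>The contraction of two families that sum to zero only sees differences, because
 \<open>p = 0\<close> in \<open>K\<close>.\<close>

lemma perm_sum: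
 fixes B :: "'x::ab_group_add => 'y::ab_group_add => 'r fm"
 assumes g: "g permutes N" and B: "!!x x' y. B (x - x') y = B x y - B x' y" "!!x y y'. B x (y - y')
  = B x y - B x y'" "!!f y. (SUM b:N. B (f b) y) = B (sum f N) y" "!!f x. (SUM b:N. B x (f b)) = B x
  (sum f N)" and z: "sum ff N = 0" "sum qs N = 0" "B (ff (g 1)) (qs (g 1)) : MK"
 shows "(SUM b:N. B (ff (g b) - ff (g 1)) (qs (g b) - qs (g 1))) = (SUM b:N. B (ff b) (qs b))" proof
  -
 have s: "(SUM b:N. ff (g b)) = 0" "(SUM b:N. qs (g b)) = 0" using z sum.permute[OF g, of ff]
  sum.permute[OF g, of qs] by auto
 have B0: "B 0 y = 0" "B x 0 = 0" for x y using B(1)[of 0 0 y] B(2)[of x 0 0] by auto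
 have "(SUM b:N. B (ff (g b) - ff (g 1)) (qs (g b) - qs (g 1))) = (SUM b:N. B (ff (g b)) (qs (g b)))
  - (SUM b:N. B (ff (g b)) (qs (g 1))) - (SUM b:N. B (ff (g 1)) (qs (g b))) + (SUM b:N. B (ff (g 1))
  (qs (g 1)))" unfolding sum_subtractf[symmetric] sum.distrib[symmetric] by (intro sum.cong refl)
  (simp add: B(1,2))
 also have "... = (SUM b:N. B (ff (g b)) (qs (g b)))" by (simp add: sm_of_nat_eq_0[OF z(3), of p]
  B(3,4) s B0 sum_const_sm)
 also have "... = (SUM b:N. B (ff b) (qs b))" by (rule sum.permute[OF g, symmetric, unfolded
  comp_def])
 finally show ?thesis .
qed

text \<open>On a tensor x this is the sum over b of \<open>vv b x\<close> times
  \<open>Q b * a\<close>: multiplication into the exterior power for Q = \<open>al\<close>,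
  contraction for Q = \<open>ga\<close>. The scalar \<open>vv b x\<close> first appears as a
  multiple of \<open>E00\<close> in the second tensor factor, which \<open>Del\<close> then removes.
  \<open>bmap\<close> is the transposed construction.\<close>

definition amap :: "(nat => 'r fm) => nat => 'r fm" where "amap Q k = (SUM b:N. Q b * (Del * kron
 (kap k) (E00 * (- (an 1 * (ga b * kap 1))))))"

definition bmap :: "(nat => 'r fm) => nat => 'r fm" where "bmap Q k = (SUM b:N. kron (Q b) (yy b) *
 (Ins * kap k))"

lemma amap_kron:
 assumes a: "a : vecs (kap k)" and x: "x : vecs (kap 1)"
 shows "amap Q k * kron a x = (SUM b:N. sm (vv b x) (Q b * a))" unfolding amap_def sum_fm_mult_left
  proof (intro sum.cong refl)
 fix b assume b: "b : N"
 have xE: "x : Ek 1" "x * E00 = x" "x : MK" using x EkD(1) by (auto simp: vecs_Ek)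
 note aE = vecs_cols[OF a] EkD(2)[OF vecs_Ek[THEN iffD1, OF a, THEN conjunct1]] vecs_idem[OF a]
 have "E00 * (- (an 1 * (ga b * kap 1))) * x = - (E00 * ((an 1 * (ga b * x)) * E00))" by (simp add:
  kap_fix[OF xE(1)] xE(2) massoc)
 also have "... = sm (vv b x) E00" unfolding vv_def using xE(3) OpD(1) by (subst E00_scalar) (auto
  simp: sm_minus_left)
 finally have "kron (kap k) (E00 * (- (an 1 * (ga b * kap 1)))) * kron a x = sm (vv b x) (kron a
  E00)" by (simp add: aE(3) kron_mult kron_sm_right)
 thus "Q b * (Del * kron (kap k) (E00 * (- (an 1 * (ga b * kap 1))))) * kron a x = sm (vv b x) (Q b
  * a)" by (simp add: Ins_Del(2)[OF aE(1,2)] massoc sm_mult)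
qed

lemma bmap_vec:
 assumes a: "a : vecs (kap k)"
 shows "bmap Q k * a = (SUM b:N. kron (Q b * a) (yy b))" unfolding bmap_def sum_fm_mult_left proof
  (intro sum.cong refl)
 fix b assume b: "b : N"
 note aE = vecs_cols[OF a] EkD(2)[OF vecs_Ek[THEN iffD1, OF a, THEN conjunct1]] vecs_idem[OF a]
 show "kron (Q b) (yy b) * (Ins * kap k) * a = kron (Q b * a) (yy b)" by (simp add: Ins_Del(1)[OF
  aE(1,2)] aE(3) vecs_E00[OF yy_vecs[OF b]] massoc kron_mult)
qed

text \<open>Each ordered pair of distinct letters is the image of (1, 2) under (p - 2)!
  permutations; the pairs on the diagonal contribute nothing.\<close>

lemma sum_permute_pairs:
 fixes H :: "nat => nat => 'r fm"
 assumes H: "!!c. H c c = 0"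
 shows "(SUM g:carrier (sym_group p). H (g 1) (g 2)) = sm (of_nat (fact (p - 2))) (SUM c:N. SUM d:N.
  H c d)" proof -
 let ?G = "carrier (sym_group p)" and ?S = "{(c, d). c : N & d : N & c ~= d}"
 let ?F = "%c d. {g : ?G. g 1 = c & g 2 = d}"
 have SN: "?S <= N \<times> N" by auto
 hence S: "finite ?S" by (rule finite_subset) simp
 have G: "finite ?G" by simp
 have img: "(%g. (g 1, g 2)) ` ?G <= ?S" proof clarify
  fix g assume "g : ?G"
  hence g: "g permutes N" by (simp add: carrier_sym)
  have "g 1 ~= g 2" using injD[OF permutes_inj[OF g], of 1 2] by auto
  thus "g 1 : N & g 2 : N & g 1 ~= g 2" by (simp add: permutes_in_image[OF g] N_mem)
 qed
 have fib: "card (?F c d) = card (?F 1 2)" if cd: "(c, d) : ?S" for c d proof -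
  obtain h where h: "h permutes N" "h 1 = c" "h 2 = d" proof -
   let ?t = "transpose 1 c"
   let ?h = "transpose (?t 2) d o ?t"
   have t: "?t permutes N" using cd N_mem by (intro permutes_swap_id) auto
   have t2: "?t 2 : N" using t N_mem permutes_in_image by metis
   have h: "?h permutes N" using cd t2 by (intro permutes_compose[OF t] permutes_swap_id) auto
   show ?thesis using cd that h by (auto simp: transpose_def)
  qed
  have "bij_betw (%g. h o g) (?F 1 2) (?F c d)" proof (rule bij_betw_byWitness[where f' = "%g. inv'
   h o g"])
   have i: "inv' h c = 1" "inv' h d = 2" using h permutes_inverses by auto
   show "(%g. h o g) ` ?F 1 2 <= ?F c d" by (auto simp: h carrier_sym permutes_compose)
   show "(%g. inv' h o g) ` ?F c d <= ?F 1 2" using i permutes_inv[OF h(1)] by (auto simp: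
    carrier_sym permutes_compose)
  qed (use permutes_inv_o[OF h(1)] in "auto simp: o_assoc")
  thus ?thesis by (rule bij_betw_same_card[symmetric])
 qed
 have "card ?G = (SUM z:?S. card {g : ?G. (g 1, g 2) = z})" using sum.group[OF G S img, of "%_.
  1::nat"] by simp
 also have "... = (SUM z:?S. card (?F 1 2))" by (intro sum.cong refl) (use fib in "auto")
 also have "... = p * (p - 1) * card (?F 1 2)" proof -
  have "?S = (SIGMA c:N. N - {c})" by auto
  thus ?thesis by simp
 qed
 finally have "fact p = p * (p - 1) * card (?F 1 2)" by (simp add: card_sym)
 moreover have "fact p = p * (p - 1) * (fact (p - 2) :: nat)" proof -
  obtain m where "p = 2 + m" using le_Suc_ex[of 2 p] p_ge by auto
  thus ?thesis by (simp add: algebra_simps)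
 qed
 ultimately have "p * (p - 1) * card (?F 1 2) = p * (p - 1) * fact (p - 2)" by auto
 moreover have "p * (p - 1) ~= 0" using p_ge by simp
 ultimately have n: "card (?F 1 2) = fact (p - 2)" by simp
 have "(SUM g:?G. H (g 1) (g 2)) = (SUM z:?S. SUM g:{g : ?G. (g 1, g 2) = z}. H (g 1) (g 2))" by
  (rule sum.group[OF G S img, symmetric])
 also have "... = (SUM z:?S. sm (of_nat (fact (p - 2))) (H (fst z) (snd z)))" proof (intro sum.cong
  refl)
  fix z assume z: "z : ?S"
  have "(SUM g:{g : ?G. (g 1, g 2) = z}. H (g 1) (g 2)) = (SUM g:?F (fst z) (snd z). H (fst z) (snd
   z))" by (intro sum.cong) auto
  also have "... = sm (of_nat (fact (p - 2))) (H (fst z) (snd z))" using fib z n by (auto simp: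
   sum_const_sm)
  finally show "(SUM g:{g : ?G. (g 1, g 2) = z}. H (g 1) (g 2)) = sm (of_nat (fact (p - 2))) (H (fst
   z) (snd z))"
  .
 qed
 also have "... = sm (of_nat (fact (p - 2))) (SUM z:N \<times> N. H (fst z) (snd z))" unfolding
  sm_sum[symmetric] by (intro arg_cong[of _ _ "sm _"] sum.mono_neutral_left) (use SN H in auto)
 finally show ?thesis by (simp add: sum.cartesian_product split_def)
qed

lemma hk_apply: "v : vecs (kap l) ==> hk l g * v = Pm g * v" by (simp add: hk_def subr_def massoc
 vecs_idem)

lemma unt_hk_hk: "unt (tens (hk k) (hk l)) = kron (kap k) (kap l)" by (simp add: unt_tens)

lemma kap_MK [simp]: "kap l : MK" using OpD(1) by simp
text \<open>The common properties of \<open>al\<close> and \<open>ga\<close>. The transformation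
  rule contains the letter \<open>g 1\<close> because both are differences with the letter 1, and
  the vanishing sum makes these extra terms cancel.\<close>

context fixes Q :: "nat => 'r fm" and k k' :: nat assumes Q_Op: "!!b. b : N ==> Q b : Op" and Q_Ek:
 "!!M b. M : Ek k ==> b : N ==> Q b * M : Ek k'" and Q_Pm: "!!g b. g permutes N ==> b : N ==> Pm g *
 Q b = (Q (g b) - Q (g 1)) * Pm g" and Q_sum: "!!M. M : Ek k ==> (SUM b:N. Q b * M) = 0"
begin

lemma amap_MK: "amap Q k : MK" by (simp add: amap_def Q_Op OpD(1))

lemma bmap_MK: "bmap Q k : MK" proof -
 have "yy b : MK" if "b : N" for b using cols_MK[OF vecs_cols[OF yy_vecs[OF that]]] .
 thus ?thesis by (simp add: bmap_def Q_Op OpD(1))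
qed

lemma amap_right: "amap Q k * kron (kap k) (kap 1) = amap Q k" unfolding amap_def sum_fm_mult_left
 by (intro sum.cong refl) (simp add: massoc kron_mult kap_idem)

lemma Q_vecs: "a : vecs (kap k) ==> b : N ==> Q b * a : vecs (kap k')" by (auto simp: vecs_Ek Q_Ek
 massoc)

lemma amap_vecs: "a : vecs (kap k) ==> x : vecs (kap 1) ==> amap Q k * kron a x : vecs (kap k')" by
 (simp add: amap_kron vv_K Q_vecs)

lemma bmap_left: "kron (kap k') (kap 1) * bmap Q k = bmap Q k" proof -
 have "kron (kap k') (kap 1) * (kron (Q b) (yy b) * (Ins * kap k)) = kron (Q b) (yy b) * (Ins * kap
  k)" if b: "b : N" for b proof (rule cols_test[of _ _ "kap k"])
  fix a assume a: "a : vecs (kap k)"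
  note aE = vecs_cols[OF a] EkD(2)[OF vecs_Ek[THEN iffD1, OF a, THEN conjunct1]] vecs_idem[OF a]
  show "kron (kap k') (kap 1) * (kron (Q b) (yy b) * (Ins * kap k)) * a = kron (Q b) (yy b) * (Ins *
   kap k) * a" using Ins_Del(1)[OF aE(1,2)] aE(3) vecs_E00[OF yy_vecs[OF b]] vecs_idem[OF Q_vecs[OF
   a b]] vecs_idem[OF yy_vecs[OF b]] by (simp only: massoc kron_mult)
  next
  have yb: "yy b : MK" by (rule cols_MK[OF vecs_cols[OF yy_vecs[OF b]]])
  show "kron (kap k') (kap 1) * (kron (Q b) (yy b) * (Ins * kap k)) : MK" "kron (Q b) (yy b) * (Ins
   * kap k) : MK" using OpD(1)[OF Q_Op[OF b]] yb by auto
 qed (use kap_MK in "auto simp: massoc kap_idem")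
 thus ?thesis by (simp add: bmap_def lsum)
qed

lemma bmap_right: "bmap Q k * kap k = bmap Q k" unfolding bmap_def sum_fm_mult_left by (intro
 sum.cong refl) (simp add: massoc kap_idem)

lemma amap_left: "kap k' * amap Q k = amap Q k" by (rule kron_test[of _ "kap k" "kap 1"]) (simp_all
 add: vecs_idem amap_vecs massoc amap_MK amap_right kap_idem)

lemma amap_homs: "amap Q k : homs (tens (hk k) (hk 1)) (hk k')" proof (rule homsI)
 fix g assume "g : carrier (sym_group p)"
 hence g: "g permutes N" by (simp add: carrier_sym)
 have gG: "g : carrier (sym_group p)" by fact
 show "hk k' g * amap Q k = amap Q k * tens (hk k) (hk 1) g" proof (rule kron_test[of _ "kap k" "kap
  1"])
  fix a x assume a: "a : vecs (kap k)" and x: "x : vecs (kap 1)"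
  have gx: "Pm g * x : vecs (kap 1)" and ga: "Pm g * a : vecs (kap k)" using vecs_Pm a x g by auto
  have "hk k' g * (amap Q k * kron a x) = Pm g * (amap Q k * kron a x)" by (rule hk_apply[OF
   amap_vecs[OF a x]])
  also have "... = (SUM b:N. sm (vv b x) (Pm g * (Q b * a)))" by (simp add: amap_kron[OF a x] lsum
   sm_mult)
  also have "... = (SUM b:N. sm (vv (g b) (Pm g * x) - vv (g 1) (Pm g * x)) (Q (g b) * (Pm g * a) -
   Q (g 1) * (Pm g * a)))" proof (intro sum.cong refl)
   fix b assume b: "b : N"
   show "sm (vv b x) (Pm g * (Q b * a)) = sm (vv (g b) (Pm g * x) - vv (g 1) (Pm g * x)) (Q (g b) *
    (Pm g * a) - Q (g 1) * (Pm g * a))" by (simp add: Pm_vv[OF x g b] shift[OF Q_Pm[OF g b]] ldiff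
    massoc)
  qed
  \<comment> \<open>Both families sum to zero, so by \<open>perm_sum\<close> the contraction does
    not notice the terms with \<open>g 1\<close>.\<close>
  also have "... = (SUM b:N. sm (vv b (Pm g * x)) (Q b * (Pm g * a)))" proof (rule perm_sum[OF g])
   show "(SUM b:N. vv b (Pm g * x)) = 0" by (rule vv_sum[OF gx])
   show "(SUM b:N. Q b * (Pm g * a)) = 0" using Q_sum ga by (simp add: vecs_Ek)
   show "sm (vv (g 1) (Pm g * x)) (Q (g 1) * (Pm g * a)) : MK" using permutes_in_image[OF g] N_mem
    vv_K[OF cols_MK[OF vecs_cols[OF gx]]] cols_MK[OF vecs_cols[OF Q_vecs[OF ga]]] by simp
   next
   show "(SUM b:N. sm (f b) y) = sm (sum f N) y" for f :: "nat => 'r" and y by (rule fm_eqI) (simp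
    add: rsum)
  qed (simp_all add: sm_diff_left sm_diff sm_sum)
  also have "... = amap Q k * (tens (hk k) (hk 1) g * kron a x)" by (simp add: amap_kron[OF ga gx,
   symmetric] tens_def kron_mult hk_apply[OF a] hk_apply[OF x])
  finally show "hk k' g * amap Q k * kron a x = amap Q k * tens (hk k) (hk 1) g * kron a x" by (simp
   add: massoc)
 qed (use amap_MK kap_MK amap_right kap_idem gG in "auto simp: massoc unt_hk_hk[symmetric] repD")
qed (use amap_MK amap_left amap_right in "auto simp: unt_hk_hk")

lemma bmap_homs: "bmap Q k : homs (hk k) (tens (hk k') (hk 1))" proof (rule homsI)
 fix g assume "g : carrier (sym_group p)"
 hence g: "g permutes N" by (simp add: carrier_sym)
 have gG: "g : carrier (sym_group p)" by fact
 show "tens (hk k') (hk 1) g * bmap Q k = bmap Q k * hk k g" proof (rule cols_test[of _ _ "kap k"])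
  fix a assume a: "a : vecs (kap k)"
  have ga: "Pm g * a : vecs (kap k)" using vecs_Pm a g by auto
  have "tens (hk k') (hk 1) g * (bmap Q k * a) = (SUM b:N. kron (Pm g * (Q b * a)) (Pm g * yy b))"
   unfolding bmap_vec[OF a] lsum tens_def using hk_apply[OF Q_vecs[OF a]] hk_apply[OF yy_vecs] by
   (intro sum.cong refl) (simp add: kron_mult)
  also have "... = (SUM b:N. kron (Q (g b) * (Pm g * a) - Q (g 1) * (Pm g * a)) (yy (g b) - yy (g
   1)))" proof (intro sum.cong refl)
   fix b assume b: "b : N"
   show "kron (Pm g * (Q b * a)) (Pm g * yy b) = kron (Q (g b) * (Pm g * a) - Q (g 1) * (Pm g * a))
    (yy (g b) - yy (g 1))" by (simp add: Pm_yy[OF g b] shift[OF Q_Pm[OF g b]] ldiff massoc)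
  qed
  also have "... = (SUM b:N. kron (Q b * (Pm g * a)) (yy b))" proof (rule perm_sum[OF g])
   show "(SUM b:N. Q b * (Pm g * a)) = 0" using Q_sum ga by (simp add: vecs_Ek)
   show "sum yy N = 0" by (rule yy_sum)
   show "kron (Q (g 1) * (Pm g * a)) (yy (g 1)) : MK" using permutes_in_image[OF g] N_mem cols_MK[OF
    vecs_cols[OF Q_vecs[OF ga]]] cols_MK[OF vecs_cols[OF yy_vecs]] by simp
  qed (simp_all add: kron_diff_left kron_diff_right kron_sum_left kron_sum_right)
  also have "... = bmap Q k * (hk k g * a)" unfolding hk_apply[OF a] bmap_vec[OF ga] ..
  finally show "tens (hk k') (hk 1) g * bmap Q k * a = bmap Q k * hk k g * a" by (simp add: massoc)
  next
  show "tens (hk k') (hk 1) g * bmap Q k : MK" using repD[OF tens_rep[OF hk_rep hk_rep] gG] bmap_MK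
   by simp
  show "bmap Q k * hk k g : MK" using repD[OF hk_rep gG] bmap_MK by simp
  show "tens (hk k') (hk 1) g * bmap Q k * kap k = tens (hk k') (hk 1) g * bmap Q k" by (simp add:
   massoc bmap_right)
  show "bmap Q k * hk k g * kap k = bmap Q k * hk k g" using unt_right[OF hk_rep gG, of k] by (simp
   add: massoc)
 qed (use kap_MK kap_idem in auto)
qed (use bmap_MK bmap_left bmap_right in "auto simp: unt_hk_hk unt_tens")
end

lemma Ek_al_sum: "M : Ek k ==> (SUM b:N. al b * M) = 0" by (simp add: al_def sum_subtractf
 sum_const_sm sum_fm_mult_left[symmetric] Cr_def[symmetric] EkD OpD(1) N_mem sm_of_nat_eq_0)

lemma Ek_ga_sum: "M : Ek k ==> (SUM b:N. ga b * M) = 0" by (simp add: ga_def sum_subtractf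
 sum_const_sm sum_fm_mult_left[symmetric] An_def[symmetric] EkD OpD(1) sm_of_nat_eq_0)

lemma amap_al: "amap al k : homs (tens (hk k) (hk 1)) (hk (Suc k))" and bmap_al: "bmap al k : homs
 (hk k) (tens (hk (Suc k)) (hk 1))" by (rule amap_homs bmap_homs; simp add: Ek_al Pm_al Ek_al_sum)+

lemma amap_ga: "amap ga (Suc k) : homs (tens (hk (Suc k)) (hk 1)) (hk k)" and bmap_ga: "bmap ga (Suc
 k) : homs (hk (Suc k)) (tens (hk k) (hk 1))" by (rule amap_homs bmap_homs; simp add: Ek_ga Pm_ga
 Ek_ga_sum)+

text \<open>The Gram matrix produced by pairing \<open>yy\<close> with \<open>vv\<close> is absorbed
  by the duality relation, leaving a diagonal sum.\<close>

lemma amap_bmap: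
 assumes cl: "!!b a. b : N ==> a : vecs (kap k) ==> Q b * a : vecs (kap l)" and dual: "!!M d. M : Ek
  l ==> d : N ==> (SUM b:N. sm (sc b d) (Q' b * M)) = Q' d * M" and Q'_MK: "!!b. b : N ==> Q' b :
  MK" and a: "a : vecs (kap k)"
 shows "amap Q' l * (bmap Q k * a) = (SUM b:N. Q' b * (Q b * a))" unfolding bmap_vec[OF a] lsum
  proof (intro sum.cong refl)
 fix b assume b: "b : N"
 have c: "Q b * a : Ek l" "Q b * a : MK" using cl[OF b a] EkD(1) by (auto simp: vecs_Ek)
 have "amap Q' l * kron (Q b * a) (yy b) = (SUM d:N. sm (sc d b) (Q' d * (Q b * a)))" unfolding
  amap_kron[OF cl[OF b a] yy_vecs[OF b]] proof (intro sum.cong refl)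
  fix d assume d: "d : N"
  have "sm (sc d b * u) (Q' d * (Q b * a)) = sm (sc d b) (sm u (Q' d * (Q b * a)))" by simp
  thus "sm (vv d (yy b)) (Q' d * (Q b * a)) = sm (sc d b) (Q' d * (Q b * a))" using vv_yy[OF b d]
   Q'_MK[OF d] c by simp
 qed
 thus "amap Q' l * kron (Q b * a) (yy b) = Q' b * (Q b * a)" using dual[OF c(1) b] by simp
qed

lemma al_vecs: "b : N ==> a : vecs (kap k) ==> al b * a : vecs (kap (Suc k))" and ga_vecs: "b : N
 ==> a : vecs (kap (Suc k)) ==> ga b * a : vecs (kap k)" by (auto simp: vecs_Ek Ek_al Ek_ga massoc)

lemma homs_hk_eqI:
 assumes "f : homs (hk k) rh" "f' : homs (hk k) rh" "!!a. a : vecs (kap k) ==> f * a = f' * a"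
 shows "f = f'" using assms homs_MK homs_right[OF assms(1)] homs_right[OF assms(2)] by (intro
  cols_test[of f f' "kap k"]) (auto simp: kap_idem)

lemma homs_kap: "kap k : homs (hk k) (hk k)" using homs_unt[OF hk_rep[of k]] by simp

lemma Q_sq:
 assumes "!!b. b : N ==> Q b : Op" "!!b. b : N ==> Q b * Q b = - (Q b * Q b)"
 shows "(SUM b:N. Q b * (Q b * a)) = 0" using eq_uminus_MK[OF OpD(1) assms(2)] assms(1) by (intro
  sum.neutral) (auto simp: massoc')

text \<open>The diagonal sums are number operators for opposite kinds of operators, and vanish for
  equal kinds because each \<open>al b\<close> and \<open>ga b\<close> has square zero.\<close>

lemma hk_compositions:
 shows "amap al k * bmap ga (Suc k) = sm (of_nat (Suc k) * u) (kap (Suc k))" and "amap ga (Suc k) *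
  bmap al k = - sm (of_nat (k + 2) * u) (kap k)" and "amap al (Suc k) * bmap al k = 0" and "amap ga
  (Suc k) * bmap ga (Suc (Suc k)) = 0" proof -
 have s: "sm (of_nat m) a = sm (of_nat m * u) a" if "a : vecs e" for m a e by (simp add: cols_MK[OF
  vecs_cols[OF that]] sm_sm[symmetric])
 show "amap al k * bmap ga (Suc k) = sm (of_nat (Suc k) * u) (kap (Suc k))" proof (rule
  homs_hk_eqI[OF homs_mult[OF bmap_ga amap_al] homs_sm[OF _ homs_kap]])
  fix a assume a: "a : vecs (kap (Suc k))"
  show "amap al k * bmap ga (Suc k) * a = sm (of_nat (Suc k) * u) (kap (Suc k)) * a" using
   amap_bmap[OF ga_vecs Ek_dual_al _ a] Ek_number[of a "Suc k"] a OpD(1) vecs_idem s[OF a, of "Suc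
   k"] by (simp add: massoc sm_mult vecs_Ek)
 qed (intro K_of_nat K_unit)
 show "amap ga (Suc k) * bmap al k = - sm (of_nat (k + 2) * u) (kap k)" unfolding
  sm_minus_left[symmetric] proof (rule homs_hk_eqI[OF homs_mult[OF bmap_al amap_ga] homs_sm[OF _
  homs_kap]])
  fix a assume a: "a : vecs (kap k)"
  show "amap ga (Suc k) * bmap al k * a = sm (- (of_nat (k + 2) * u)) (kap k) * a" using
   amap_bmap[OF al_vecs Ek_dual_ga _ a] Ek_number'[of a k] a OpD(1) vecs_idem s[OF a, of "k + 2"] by
   (simp add: massoc sm_mult vecs_Ek sm_minus_left)
 qed (intro K_uminus K_of_nat K_unit)
 show "amap al (Suc k) * bmap al k = 0" proof (rule homs_hk_eqI[OF homs_mult[OF bmap_al amap_al]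
  homs_zero])
  fix a assume a: "a : vecs (kap k)"
  have "(SUM b:N. al b * (al b * a)) = 0" by (rule Q_sq) (simp_all add: al_al[symmetric])
  thus "amap al (Suc k) * bmap al k * a = 0 * a" by (simp add: amap_bmap[OF al_vecs Ek_dual_al _ a]
   OpD(1) massoc)
 qed
 show "amap ga (Suc k) * bmap ga (Suc (Suc k)) = 0" proof (rule homs_hk_eqI[OF homs_mult[OF bmap_ga
  amap_ga] homs_zero])
  fix a assume a: "a : vecs (kap (Suc (Suc k)))"
  have "(SUM b:N. ga b * (ga b * a)) = 0" by (rule Q_sq) (simp_all add: ga_ga[symmetric])
  thus "amap ga (Suc k) * bmap ga (Suc (Suc k)) * a = 0 * a" by (simp add: amap_bmap[OF ga_vecs
   Ek_dual_ga _ a] OpD(1) massoc)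
qed qed
end
declare One_nat_def [simp]
declare One_nat_def [simp del]
context hooks
begin

lemma yy_dual: "d : N ==> (SUM b:N. sm (sc b d) (yy b)) = yy d" by (simp add: Ek_dual_al[OF
 E00_Ek(1), of d] yy sm_minus sum_negf cong: sum.cong)

section \<open>The identity of the tensor product as two projections modulo a trace\<close>

context fixes k :: nat and a x :: "'r fm" assumes a: "a : vecs (kap (Suc k))" and x: "x : vecs (kap
 1)"
begin

text \<open>This is (a - ta) tensor (x - tx) for the transposition t of c and d, written out by the
  reflection formula.\<close>

definition H0 :: "nat => nat => 'r fm" where "H0 c d = sm (vv d x - vv c x) (kron ((al d - al c) *
 ((ga d - ga c) * a)) (yy d - yy c))"

text \<open>The part of the traces below that is not a multiple of the identity. It occurs in
  \<open>H0_sum\<close> and \<open>bmap_amap\<close> with opposite signs and cancels in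
  \<open>sdec_hk_tens\<close>.\<close>

definition Y0 :: "'r fm" where "Y0 = (SUM d:N. kron (al d * (SUM c:N. sm (vv c x) (ga c * a)) + (SUM
 c:N. sm (vv c x) (al c * (ga d * a)))) (yy d))"

lemma aE: "a : Ek (Suc k)" "a : MK" using a EkD(1) by (auto simp: vecs_Ek)

lemma sum_sm_left: "(SUM c:S. sm (f c) M) = sm (SUM c:S. f c) M" by (rule fm_eqI) (simp add: rsum)

text \<open>H0 is symmetric in c and d, whence the factor 2. After expansion, sums over a free
  letter vanish, either because p = 0 or because \<open>al\<close>, \<open>ga\<close>,
  \<open>vv\<close> and \<open>yy\<close> sum to zero; the diagonal sum of
  \<open>al c * ga c\<close> is the number operator k + 1.\<close>

lemma H0_sum: "(SUM c:N. SUM d:N. H0 c d) = sm 2 (sm (of_nat (Suc k)) (kron a x) + Y0)" proof -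
 define E where "E c d = al c * (ga d * a)" for c d
 define G where "G c d = E d d - E d c - E c d + E c c" for c d
 define iv where "iv = (SUM c:N. sm (vv c x) (ga c * a))"
 define W where "W = (SUM c:N. sm (vv c x) (E c c))"
 have H: "H0 c d = sm (vv d x - vv c x) (kron (G c d) (yy d)) + sm (vv c x - vv d x) (kron (G d c)
  (yy c))" for c d by (simp add: G_def E_def algebra_simps H0_def kron_diff_right sm_diff
  sm_diff_left)
 have "(SUM c:N. SUM d:N. H0 c d) = (SUM c:N. SUM d:N. sm (vv d x - vv c x) (kron (G c d) (yy d))) +
  (SUM d:N. SUM c:N. sm (vv c x - vv d x) (kron (G d c) (yy c)))" unfolding H sum.distrib by (subst
  (4) sum.swap) rule
 also have "... = sm 2 (SUM c:N. SUM d:N. sm (vv d x - vv c x) (kron (G c d) (yy d)))" by (rule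
  fm_eqI) simp
 also have "(SUM c:N. SUM d:N. sm (vv d x - vv c x) (kron (G c d) (yy d))) = (SUM d:N. kron (SUM
  c:N. sm (vv d x - vv c x) (G c d)) (yy d))" by (subst sum.swap) (simp add: kron_sum_left
  kron_sm_left)
 also have "... = (SUM d:N. kron (sm (vv d x) (sm (of_nat (Suc k)) a) + (al d * iv + (SUM c:N. sm
  (vv c x) (al c * (ga d * a)))) - W) (yy d))" proof (intro sum.cong refl)
  fix d assume d: "d : N"
  have g: "(SUM c:N. G c d) = sm (of_nat (Suc k)) a" proof -
   have "(SUM c:N. E d d) = 0" by (simp add: sum_const_sm E_def OpD(1) d aE(2) sm_of_nat_eq_0)
   moreover have "(SUM c:N. E d c) = 0" by (simp add: E_def lsum[symmetric] Ek_ga_sum[OF aE(1)])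
   moreover have "(SUM c:N. E c d) = 0" unfolding E_def using Ek_al_sum[OF Ek_ga[OF aE(1) d]] .
   moreover have "(SUM c:N. E c c) = sm (of_nat (Suc k)) a" unfolding E_def by (rule Ek_number[OF
    aE(1)])
   ultimately show ?thesis by (simp add: G_def sum.distrib sum_subtractf)
  qed
  have "(SUM c:N. sm (vv d x - vv c x) (G c d)) = sm (vv d x) (SUM c:N. G c d) - (SUM c:N. sm (vv c
   x) (G c d))" by (simp add: sm_diff_left sum_subtractf sm_sum)
  also have "(SUM c:N. sm (vv c x) (G c d)) = sm (SUM c:N. vv c x) (E d d) - al d * iv - (SUM c:N.
   sm (vv c x) (al c * (ga d * a))) + W" by (simp add: G_def E_def iv_def W_def
   sum_sm_left[symmetric] sm_add sm_diff sum.distrib sum_subtractf lsum sm_mult)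
  finally have e: "(SUM c:N. sm (vv d x - vv c x) (G c d)) = sm (vv d x) (SUM c:N. G c d) - (sm (SUM
   c:N. vv c x) (E d d) - al d * iv - (SUM c:N. sm (vv c x) (al c * (ga d * a))) + W)"
  .
  have *: "s - (0 - A - B + W) = s + (A + B) - W" for s A B W :: "'r fm" by simp
  show "kron (SUM c:N. sm (vv d x - vv c x) (G c d)) (yy d) = kron (sm (vv d x) (sm (of_nat (Suc k))
   a) + (al d * iv + (SUM c:N. sm (vv c x) (al c * (ga d * a)))) - W) (yy d)" by (simp only: e g
   vv_sum[OF x] sm_zero_left *)
 qed
 also have "... = (SUM d:N. sm (of_nat (Suc k)) (kron a (sm (vv d x) (yy d)))) + Y0 - kron W (SUM
  d:N. yy d)" unfolding Y0_def iv_def kron_sum_right by (simp only: kron_diff_left kron_add_left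
  sum.distrib sum_subtractf kron_sm_left kron_sm_right sm_sm mult.commute[of "of_nat (Suc k)"])
 also have "(SUM d:N. sm (of_nat (Suc k)) (kron a (sm (vv d x) (yy d)))) = sm (of_nat (Suc k)) (kron
  a x)" unfolding sm_sum[symmetric] kron_sum_right[symmetric] vv_expand[OF x, symmetric]
 ..
 finally show ?thesis by (simp add: yy_sum)
qed

lemma bmap_amap: "bmap ga (Suc (Suc k)) * (amap al (Suc k) * kron a x) - bmap al k * (amap ga (Suc
 k) * kron a x) = kron a x - Y0" proof -
 define iv where "iv = (SUM c:N. sm (vv c x) (ga c * a))"
 define ev where "ev d = (SUM c:N. sm (vv c x) (al c * (ga d * a)))" for d
 have xMK: "x : MK" using x by simp
 have "(SUM c:N. sm (vv c x) (al c * a)) : vecs (kap (Suc (Suc k)))" using vv_K[OF xMK] al_vecs[OF _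
  a] by simp
 hence "bmap ga (Suc (Suc k)) * (amap al (Suc k) * kron a x) = (SUM d:N. kron (ga d * (SUM c:N. sm
  (vv c x) (al c * a))) (yy d))" unfolding amap_kron[OF a x] by (rule bmap_vec)
 also have "... = (SUM d:N. kron ((SUM c:N. sm (vv c x) (sm (sc d c) a)) - ev d) (yy d))" proof
  (intro sum.cong refl)
  fix d
  have "ga d * (SUM c:N. sm (vv c x) (al c * a)) = (SUM c:N. sm (vv c x) (sm (sc d c) a) - sm (vv c
   x) (al c * (ga d * a)))" unfolding lsum by (intro sum.cong refl) (simp only: sm_mult shift[OF
   ga_al] ldiff sm_diff EkD(2)[OF aE(1)] massoc)
  thus "kron (ga d * (SUM c:N. sm (vv c x) (al c * a))) (yy d) = kron ((SUM c:N. sm (vv c x) (sm (sc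
   d c) a)) - ev d) (yy d)" by (simp only: sum_subtractf ev_def)
 qed
 also have "... = (SUM d:N. SUM c:N. kron a (sm (vv c x) (sm (sc d c) (yy d)))) - (SUM d:N. kron (ev
  d) (yy d))" by (simp only: kron_diff_left sum_subtractf kron_sum_left kron_sm_left kron_sm_right)
 also have "(SUM d:N. SUM c:N. kron a (sm (vv c x) (sm (sc d c) (yy d)))) = kron a x" proof -
  have "(SUM d:N. SUM c:N. kron a (sm (vv c x) (sm (sc d c) (yy d)))) = kron a (SUM c:N. sm (vv c x)
   (SUM d:N. sm (sc d c) (yy d)))" by (subst sum.swap) (simp only: kron_sum_right sm_sum)
  also have "(SUM c:N. sm (vv c x) (SUM d:N. sm (sc d c) (yy d))) = x" using vv_expand[OF x] by
   (simp add: yy_dual cong: sum.cong)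
  finally show ?thesis .
 qed
 finally have 1: "bmap ga (Suc (Suc k)) * (amap al (Suc k) * kron a x) = kron a x - (SUM d:N. kron
  (ev d) (yy d))"
 .
 have "iv : vecs (kap k)" by (simp add: iv_def vv_K[OF xMK] ga_vecs[OF _ a])
 hence 2: "bmap al k * (amap ga (Suc k) * kron a x) = (SUM d:N. kron (al d * iv) (yy d))" unfolding
  amap_kron[OF a x] iv_def[symmetric] by (rule bmap_vec)
 have "Y0 = (SUM d:N. kron (al d * iv) (yy d)) + (SUM d:N. kron (ev d) (yy d))" unfolding Y0_def
  iv_def ev_def by (simp only: kron_add_left sum.distrib)
 thus ?thesis using 1 2 by simp
qed
end

text \<open>The linear map (1 - t) tensor (1 - t) for t the transposition of 1 and 2;
  \<open>al 1\<close> and \<open>ga 1\<close> are zero and do not appear.\<close>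

definition htr :: "nat => 'r fm" where "htr k = kron (al 2 * (ga 2 * kap k)) (yy 2 * (E00 * (- (an 1
 * (ga 2 * kap 1)))))"

lemma htr_MK: "htr k : MK" by (simp add: htr_def N_mem OpD(1) cols_MK[OF vecs_cols[OF yy_vecs[OF
 N_mem(2)]]])

lemma htr_kron:
 assumes a: "a : vecs (kap k)" and x: "x : vecs (kap 1)"
 shows "htr k * kron a x = kron (al 2 * (ga 2 * a)) (sm (vv 2 x) (yy 2))" proof -
 have xE: "x : Ek 1" "x * E00 = x" "x : MK" using x EkD(1) by (auto simp: vecs_Ek)
 have "E00 * (- (an 1 * (ga 2 * kap 1))) * x = - (E00 * ((an 1 * (ga 2 * x)) * E00))" by (simp add:
  kap_fix[OF xE(1)] xE(2) massoc)
 also have "... = sm (vv 2 x) E00" unfolding vv_def using xE(3) OpD(1) by (subst E00_scalar) (auto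
  simp: sm_minus_left)
 finally have "yy 2 * (E00 * (- (an 1 * (ga 2 * kap 1)))) * x = sm (vv 2 x) (yy 2)" using
  vecs_E00[OF yy_vecs[OF N_mem(2)]] by (simp only: massoc sm_mult)
 thus ?thesis unfolding htr_def kron_mult using vecs_idem[OF a] by (simp only: massoc)
qed

text \<open>Conjugating by g replaces 1 and 2 by \<open>g 1\<close> and \<open>g 2\<close>, so the
  trace is the sum of the H0 over all pairs, each counted (p - 2)! times.\<close>

lemma tr_htr:
 assumes a: "a : vecs (kap (Suc k))" and x: "x : vecs (kap 1)"
 shows "tr (tens (hk (Suc k)) (hk 1)) (tens (hk (Suc k)) (hk 1)) (htr (Suc k)) * kron a x = sm
  (of_nat (fact (p - 2))) (sm 2 (sm (of_nat (Suc k)) (kron a x) + Y0 a x))" proof -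
 let ?rh = "tens (hk (Suc k)) (hk 1)"
 have "tr ?rh ?rh (htr (Suc k)) * kron a x = (SUM g:carrier (sym_group p). H0 a x (g 1) (g 2))"
  unfolding tr_def sum_fm_mult_left proof (intro sum.cong refl)
  fix g assume gG: "g : carrier (sym_group p)"
  hence g: "g permutes N" by (simp add: carrier_sym)
  let ?i = "inv' g"
  have ip: "?i permutes N" by (rule permutes_inv[OF g])
  have PP: "Pm g * (Pm ?i * w) = w" if "w : vecs (kap l)" for w l using Pm_mult[OF g ip]
   permutes_inv_o(1)[OF g] EkD(2)[of w l] that by (simp add: massoc' Pm_id vecs_Ek)
  have a': "Pm ?i * a : vecs (kap (Suc k))" and x': "Pm ?i * x : vecs (kap 1)" using vecs_Pm a x ip
   by auto
  have v: "vv 2 (Pm ?i * x) = vv (g 2) x - vv (g 1) x" using Pm_vv[OF x' g N_mem(2)] PP[OF x] by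
   simp
  have A: "Pm g * (al 2 * (ga 2 * (Pm ?i * a))) = (al (g 2) - al (g 1)) * ((ga (g 2) - ga (g 1)) *
   a)" using shift[OF Pm_al[OF g N_mem(2)], of "ga 2 * (Pm ?i * a)"] shift[OF Pm_ga[OF g], of 2 "Pm
   ?i * a"] PP[OF a] by (simp add: massoc)
  have "?rh g * htr (Suc k) * ?rh (inv\<^bsub>sym_group p\<^esub> g) * kron a x = ?rh g * (htr (Suc
   k) * (?rh ?i * kron a x))" by (simp add: gG massoc)
  also have "?rh ?i * kron a x = kron (Pm ?i * a) (Pm ?i * x)" by (simp add: tens_def kron_mult
   hk_apply[OF a] hk_apply[OF x])
  also have "htr (Suc k) * ... = kron (al 2 * (ga 2 * (Pm ?i * a))) (sm (vv 2 (Pm ?i * x)) (yy 2))"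
   by (rule htr_kron[OF a' x'])
  also have "?rh g * ... = kron (Pm g * (al 2 * (ga 2 * (Pm ?i * a)))) (sm (vv 2 (Pm ?i * x)) (Pm g
   * yy 2))" by (simp add: hk_apply[OF al_vecs[OF N_mem(2) ga_vecs[OF N_mem(2) a']], of g]
   hk_apply[OF yy_vecs[OF N_mem(2)], of g] tens_def kron_mult sm_mult)
  also have "... = H0 a x (g 1) (g 2)" unfolding A v Pm_yy[OF g N_mem(2)] H0_def[OF a x]
   kron_sm_right
  ..
  finally show "?rh g * htr (Suc k) * ?rh (inv\<^bsub>sym_group p\<^esub> g) * kron a x = H0 a x (g
   1) (g 2)"
  .
 qed
 also have "... = sm (of_nat (fact (p - 2))) (SUM c:N. SUM d:N. H0 a x c d)" by (rule
  sum_permute_pairs) (simp add: H0_def[OF a x])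
 finally show ?thesis unfolding H0_sum[OF a x] .
qed

text \<open>The maps through degrees k + 2 and k compose to k + 2 and -(k + 2) and are orthogonal to
  each other; after division by these numbers their projections add up to the identity modulo the
  trace of \<open>htr\<close>.\<close>

theorem sdec_hk_tens:
 assumes k: "k + 2 < p"
 shows "sdec (tens (hk (Suc k)) (hk 1)) {0, 1::nat} (%i. if i = 0 then hk (Suc (Suc k)) else hk k)"
  proof -
 let ?rh = "tens (hk (Suc k)) (hk 1)"
 let ?A = "bmap ga (Suc (Suc k)) * amap al (Suc k) - bmap al k * amap ga (Suc k)"
 let ?F = "fact (p - 2) :: nat"
 have rep: "rep ?rh" by simp
 have u: "unt ?rh = kron (kap (Suc k)) (kap 1)" by (simp add: unt_tens)
 have Ah: "?A : homs ?rh ?rh" by (intro homs_diff homs_mult[OF amap_al bmap_ga] homs_mult[OF amap_ga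
  bmap_al])
 have Th: "tr ?rh ?rh (htr (Suc k)) : homs ?rh ?rh" by (rule tr_homs[OF rep rep htr_MK])
 \<comment> \<open>The terms Y0 cancel, and the coefficients 1 from A and k + 1 from the trace add
   up to k + 2.\<close>
 have "sm (of_nat (2 * ?F) * u) ?A + tr ?rh ?rh (htr (Suc k)) = sm (of_nat (2 * ?F) * (of_nat (k +
  2) * u)) (unt ?rh)" unfolding u proof (rule kron_test[of _ "kap (Suc k)" "kap 1"])
  fix a x assume a: "a : vecs (kap (Suc k))" and x: "x : vecs (kap 1)"
  have K: "kron a x : MK" using a x by simp
  have Y: "?A * kron a x = kron a x - Y0 a x" by (simp add: bmap_amap[OF a x] ldiff massoc)
  have su: "sm u (?A * kron a x) = ?A * kron a x" using homs_MK[OF Ah] K by simp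
  have "(sm (of_nat (2 * ?F) * u) ?A + tr ?rh ?rh (htr (Suc k))) * kron a x = sm (of_nat (2 * ?F))
   (sm u (?A * kron a x)) + sm (of_nat ?F) (sm 2 (sm (of_nat (Suc k)) (kron a x) + Y0 a x))" by
   (simp add: tr_htr[OF a x] distrib_right sm_mult)
  also have "... = sm (of_nat (2 * ?F)) (sm (of_nat (k + 2)) (kron a x))" unfolding su unfolding Y
   by (rule fm_eqI) (simp add: algebra_simps)
  also have "... = sm (of_nat (2 * ?F) * (of_nat (k + 2) * u)) (kron a x)" using K by (simp only:
   sm_sm[symmetric] sm_unit)
  finally show "(sm (of_nat (2 * ?F) * u) ?A + tr ?rh ?rh (htr (Suc k))) * kron a x = sm (of_nat (2
   * ?F) * (of_nat (k + 2) * u)) (kron (kap (Suc k)) (kap 1)) * kron a x" using vecs_idem[OF a]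
   vecs_idem[OF x] by (simp only: sm_mult kron_mult)
  next
  have "of_nat (2 * ?F) * (of_nat (k + 2) * u) : K" "of_nat (2 * ?F) * u : K" by (intro K_of_nat
   K_unit)+
  thus "sm (of_nat (2 * ?F) * (of_nat (k + 2) * u)) (kron (kap (Suc k)) (kap 1)) : MK" "sm (of_nat
   (2 * ?F) * u) ?A + tr ?rh ?rh (htr (Suc k)) : MK" using homs_MK[OF Ah] homs_MK[OF Th] by auto
  show "(sm (of_nat (2 * ?F) * u) ?A + tr ?rh ?rh (htr (Suc k))) * kron (kap (Suc k)) (kap 1) = sm
   (of_nat (2 * ?F) * u) ?A + tr ?rh ?rh (htr (Suc k))" using homs_right[OF Ah] homs_right[OF Th] by
   (simp only: distrib_right sm_mult u)
  show "sm (of_nat (2 * ?F) * (of_nat (k + 2) * u)) (kron (kap (Suc k)) (kap 1)) * kron (kap (Suc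
   k)) (kap 1) = sm (of_nat (2 * ?F) * (of_nat (k + 2) * u)) (kron (kap (Suc k)) (kap 1))" by (simp
   only: sm_mult kron_mult kap_idem)
 qed (simp_all add: kap_idem)
 note key = this
 have "~p dvd (k + 2)" using k by auto
 then obtain c where c: "c : K" "c * (of_nat (k + 2) * u) = u" using of_nat_inverse by metis
 \<comment> \<open>p is odd and does not divide (p - 2)!, so the factor in front of A can be
   cancelled.\<close>
 have "~p dvd 2 * ?F" unfolding prime_dvd_mult_iff[OF p_prime] prime_dvd_fact_iff[OF p_prime] using
  p_ge by (auto dest: dvd_imp_le)
 hence F0: "of_nat (2 * ?F) * u ~= 0" using char_p by blast
 define f where "f i = (if i = (0::nat) then sm c (bmap ga (Suc (Suc k))) else sm (- c) (bmap al
  k))" for i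
 define g where "g i = (if i = (0::nat) then amap al (Suc k) else amap ga (Suc k))" for i
 have n: "null ?rh ?rh (sm c ?A - unt ?rh)" proof (rule null_sm_unt)
  show "of_nat (2 * ?F) * u : K" by (intro K_of_nat K_unit)
  show "of_nat (2 * ?F) * u ~= 0" by (rule F0)
  show "sm c ?A - unt ?rh : MK" using c homs_MK[OF Ah] by simp
  have "sm (of_nat (2 * ?F) * u) (sm c ?A - unt ?rh) = sm c (sm (of_nat (2 * ?F) * u) ?A) - sm
   (of_nat (2 * ?F) * (c * (of_nat (k + 2) * u))) (unt ?rh)" unfolding c(2) by (simp only: sm_diff
   sm_sm mult.commute)
  also have "... = sm c (sm (of_nat (2 * ?F) * u) ?A - sm (of_nat (2 * ?F) * (of_nat (k + 2) * u))
   (unt ?rh))" by (simp only: sm_diff sm_sm mult.left_commute)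
  also have "... = sm (- c) (tr ?rh ?rh (htr (Suc k)))" unfolding key[symmetric] by (simp add:
   sm_minus sm_minus_left)
  finally show "null ?rh ?rh (sm (of_nat (2 * ?F) * u) (sm c ?A - unt ?rh))" using null_sm[of "- c"
   ?rh ?rh "tr ?rh ?rh (htr (Suc k))"] c(1) htr_MK by (auto simp: null_def)
 qed
 have comp: "g i * f j - (if i = j then unt (if i = 0 then hk (Suc (Suc k)) else hk k) else 0) = 0"
  if "i : {0,1}" "j : {0,1}" for i j proof -
  have c1: "sm c (sm (of_nat (Suc (Suc k)) * u) (kap (Suc (Suc k)))) = kap (Suc (Suc k))" using c(2)
   by simp
  have c2: "sm (- c) (- sm (of_nat (k + 2) * u) (kap k)) = kap k" using c(2) by (simp add: sm_minus
   sm_minus_left)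
  show ?thesis using that hk_compositions(1) hk_compositions(2) hk_compositions(3)
   hk_compositions(4) c1 c2 by (auto simp: f_def g_def sm_mult)
 qed
 have "sdecd ?rh {0, 1::nat} (%i. if i = 0 then hk (Suc (Suc k)) else hk k) f g" unfolding sdecd_def
  proof (intro conjI ballI)
  show "null ?rh ?rh ((SUM i:{0, 1}. f i * g i) - unt ?rh)" using n by (simp add: f_def g_def
   sm_mult sm_diff sm_minus_left)
 qed (use comp c(1) in "auto simp: f_def g_def intro!: homs_sm amap_al amap_ga bmap_al bmap_ga")
 thus ?thesis by (auto simp: sdec_def)
qed
end
declare One_nat_def [simp]

section \<open>Tensor powers of the hook modules\<close>

definition cg_step :: "(nat => nat) => nat => nat" where "cg_step m t = m (Suc t) + (if t = 0 then 0
 else m (t - 1))"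

text \<open>The effect of tensoring with \<open>hk k\<close> on multiplicities, by the three-term
  recursion of the Chebyshev polynomials of the second kind. The subtraction is truncated, but
  \<open>dec_tens_cg\<close> shows that in its range the subtrahend belongs to an actual
  summand.\<close>

fun cg :: "nat => (nat => nat) => nat => nat" where "cg 0 m = m" | "cg (Suc 0) m = cg_step m" | "cg
 (Suc (Suc k)) m = (%t. cg_step (cg (Suc k) m) t - cg k m t)"
primrec hook_mult :: "nat => nat => nat => nat" where "hook_mult k 0 = (%t. if t = 0 then 1 else 0)"
 | "hook_mult k (Suc n) = cg k (hook_mult k n)"

lemma cg_support: "(!!t. s < t ==> m t = 0) ==> s + k < t ==> cg k m t = 0" by (induction k m
 arbitrary: t rule: cg.induct) (auto simp: cg_step_def)

lemma hook_mult_support: "n * k < t ==> hook_mult k n t = 0" proof (induction n arbitrary: t)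
 case (Suc n)
 show ?case using cg_support[of "n * k" "hook_mult k n" k t] Suc by (simp add: add.commute)
qed simp
context hooks
begin

text \<open>Going down by contraction: were \<open>hk (j + 1)\<close> projective, so would be its
  tensor product with \<open>hk 1\<close>, through which the nonzero scalar -(j + 2) on
  \<open>hk j\<close> factors. At the bottom is the trivial module.\<close>

lemma null_hk: "t + 2 <= p ==> ~null (hk t) (hk t) (kap t)" proof (induction t)
 case 0
 show ?case proof
  assume n: "null (hk 0) (hk 0) (kap 0)"
  obtain f g where f: "f : homs triv (hk 0)" "g : homs (hk 0) triv" "g * f = unt triv" using triv_hk
   by (auto simp: isor_def)
  have "null triv triv (g * (kap 0 * f))" by (rule null_left[OF f(2) null_right[OF f(1) n]])
  moreover have "kap 0 * f = f" using homs_left[OF f(1)] by simp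
  ultimately show False using f(3) triv_not_null by simp
 qed
 next case (Suc j)
 show ?case proof
  let ?rh = "tens (hk (Suc j)) (hk 1)"
  assume n: "null (hk (Suc j)) (hk (Suc j)) (kap (Suc j))"
  have nu: "null ?rh ?rh (kron (kap (Suc j)) (kap 1))" by (rule null_kron_left[OF hk_rep homs_kap
   n])
  have "null (hk j) (hk j) (amap ga (Suc j) * (kron (kap (Suc j)) (kap 1) * bmap al j))" by (rule
   null_left[OF amap_ga null_right[OF bmap_al nu]])
  moreover have "kron (kap (Suc j)) (kap 1) * bmap al j = bmap al j" using homs_left[OF bmap_al[of
   j]] by (simp add: unt_tens)
  ultimately have "null (hk j) (hk j) (sm (- (of_nat (j + 2) * u)) (kap j))" by (simp add:
   hk_compositions(2)[of j] sm_minus_left)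
  moreover have "~p dvd (j + 2)" using Suc.prems by (auto dest: dvd_imp_le)
  hence "- (of_nat (j + 2) * u) ~= 0" using char_p[of "j + 2"] by (simp only: neg_equal_0_iff_equal)
   simp
  moreover have "- (of_nat (j + 2) * u) : K" by (intro K_uminus K_of_nat K_unit)
  ultimately have "null (hk j) (hk j) (kap j)" using null_sm_unt kap_MK by blast
  thus False using Suc by simp
qed qed

lemma hk_end:
 assumes f: "f : homs (hk t) (hk t)" and t: "t + 2 <= p" obtains c where "c : K" "f = sm c (kap t)"
  using scalar_kap[OF homs_MK[OF f] _ _ t hk_homs_al_ga[OF f]] homs_left[OF f] homs_right[OF f] by
  auto

text \<open>Endomorphisms are scalars and maps between different hooks are zero even before passing
  to the stable category, so non-projectivity is the only stable input.\<close>

theorem bricks_hk: "bricks {..p - 2} hk" unfolding bricks_def proof (intro ballI conjI impI)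
 fix t assume "t : {..p - 2}"
 hence t: "t + 2 <= p" using p_ge by auto
 show "rep (hk t)" by simp
 show nn: "~null (hk t) (hk t) (unt (hk t))" using null_hk[OF t] by simp
 show "EX c:K. null (hk t) (hk t) (f - sm c (unt (hk t)))" if "f : homs (hk t) (hk t)" for f using
  hk_end[OF that t] by (metis diff_self null_zero unt_hk)
 show "null (hk t) (hk s) f" if "s : {..p - 2}" "s ~= t" "f : homs (hk t) (hk s)" for s f using
  hk_homs_zero[OF that(3)] that t p_ge by simp
 show "q = 0" if q: "q : homs (hk t) (hk t)" "q * q = q" "null (hk t) (hk t) q" for q proof -
  obtain c where c: "c : K" "q = sm c (kap t)" using hk_end[OF q(1) t] by blast
  show ?thesis proof (cases "c = 0")
   case False
   thus ?thesis using null_sm_unt[OF c(1) False kap_MK] q(3) c(2) null_hk[OF t] by simp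
qed (use c in simp) qed qed
abbreviation decT :: "((nat => nat) => 'r fm) => (nat => nat) => bool" where "decT == dec {..p - 2}
 hk"

lemma dec_isor:
 assumes "isor rh ss" "rep rh" "decT ss m"
 shows "decT rh m" using dec_concat[OF sdec_isor[OF assms(1,2) dec_rep[OF assms(3)], of "0::nat"],
  of "{..p - 2}" hk "%_. m"] assms(3) by simp

lemma dec_single: "t <= p - 2 ==> decT (hk t) (%s. if s = t then 1 else 0)" proof (rule decI[where a
 = "%_. t"])
 show "sdec (hk t) {0::nat} (%i. hk t)" by (rule sdec_isor[OF isor_refl]) simp_all
 show "card {i : {0::nat}. t = s} = (if s = t then 1 else 0)" for s by (cases "s = t") auto
qed simp

lemma isor_tens_triv: "rep rh ==> isor (tens rh (hk 0)) rh" proof -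
 assume r: "rep rh"
 obtain f g where f: "f : homs triv (hk 0)" "g : homs (hk 0) triv" "g * f = unt triv" "f * g = kap
  0" using triv_hk by (auto simp: isor_def)
 have "isor (tens rh triv) (tens rh (hk 0))" unfolding isor_def by (intro bexI[of _ "kron (unt rh)
  f"] bexI[of _ "kron (unt rh) g"] conjI tens_homs homs_unt r f) (simp_all add: kron_mult f r
  unt_tens)
 from isor_sym[OF isor_trans[OF isor_runit[OF r] this]] show ?thesis .
qed

lemma isor_triv_tens: "rep rh ==> isor (tens (hk 0) rh) rh" proof -
 assume r: "rep rh"
 obtain f g where f: "f : homs triv (hk 0)" "g : homs (hk 0) triv" "g * f = unt triv" "f * g = kap
  0" using triv_hk by (auto simp: isor_def)
 have "isor (tens triv rh) (tens (hk 0) rh)" unfolding isor_def by (intro bexI[of _ "kron f (unt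
  rh)"] bexI[of _ "kron g (unt rh)"] conjI tens_homs homs_unt r f) (simp_all add: kron_mult f r
  unt_tens)
 from isor_sym[OF isor_trans[OF isor_lunit[OF r] this]] show ?thesis .
qed

lemma dec_hk_tens:
 assumes t: "t + 1 <= p - 2"
 shows "decT (tens (hk t) (hk 1)) (%s. (if t + 1 = s then 1 else 0) + (if t = s + 1 then 1 else 0))"
  proof (cases t)
 case 0
 have "decT (hk 1) (%s. if s = 1 then 1 else 0)" by (rule dec_single) (use t 0 in simp)
 from dec_isor[OF isor_triv_tens[OF hk_rep] _ this] have "decT (tens (hk 0) (hk 1)) (%s. if s = 1
  then 1 else 0)" by simp
 also have "(%s. if s = 1 then 1 else 0) = (%s. (if t + 1 = s then 1 else 0) + (if t = s + 1 then 1
  else 0::nat))" using 0 by (intro ext) simp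
 finally show ?thesis using 0 by simp
 next case (Suc k)
 have "decT (tens (hk t) (hk 1)) (%s. SUM i:{0, 1::nat}. if s = (if i = 0 then Suc (Suc k) else k)
  then 1 else 0)" unfolding Suc by (rule dec_concat[OF sdec_hk_tens]) (use dec_concat sdec_hk_tens t
  Suc dec_single in auto)
 also have "(%s. SUM i:{0, 1::nat}. if s = (if i = 0 then Suc (Suc k) else k) then 1 else 0) = (%s.
  (if t + 1 = s then 1 else 0) + (if t = s + 1 then 1 else 0::nat))" using Suc by (intro ext) auto
 finally show ?thesis .
qed

lemma dec_tens_step:
 assumes d: "decT rh m" and s: "!!t. s < t ==> m t = 0" "s + 1 <= p - 2"
 shows "decT (tens rh (hk 1)) (cg_step m)" proof -
 obtain I :: "nat set" and a where I: "sdec rh I (%i. hk (a i))" "a ` I <= {..p - 2}" "!!t. card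
  {i:I. a i = t} = m t" using d by (auto simp: dec_def)
 have fin: "finite I" using I(1) by (auto simp: sdec_def sdecd_def)
 have "decT (tens rh (hk 1)) (%s. SUM i:I. (if a i + 1 = s then 1 else 0) + (if a i = s + 1 then 1
  else 0))" proof (rule dec_concat[OF sdec_tens_left[OF I(1) hk_rep]])
  fix i assume i: "i : I"
  \<comment> \<open>The support bound keeps every summand away from the last hook, where tensoring
    with \<open>hk 1\<close> is not covered by \<open>dec_hk_tens\<close>.\<close>
  have "a i <= s" using i fin I(3)[of "a i"] s(1)[of "a i"] by (cases "a i <= s") auto
  thus "decT (tens (hk (a i)) (hk 1)) (%s. (if a i + 1 = s then 1 else 0) + (if a i = s + 1 then 1
   else 0))" using s(2) by (intro dec_hk_tens) simp
 qed
 also have "(%s. SUM i:I. (if a i + 1 = s then 1 else 0) + (if a i = s + 1 then 1 else 0)) = cg_step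
  m" proof
  fix t
  have c: "(SUM i:I. if P i then 1 else 0) = card {i:I. P i}" for P using sum.inter_filter[OF fin,
   of "%_. 1::nat" P] by simp
  have "{i:I. a i + 1 = t} = (if t = 0 then {} else {i:I. a i = t - 1})" by auto
  thus "(SUM i:I. (if a i + 1 = t then 1 else 0) + (if a i = t + 1 then 1 else 0)) = cg_step m t" by
   (auto simp: sum.distrib c cg_step_def I(3))
 qed
 finally show ?thesis .
qed

text \<open>Tensoring rh with \<open>hk (j + 1)\<close> and then \<open>hk 1\<close> is computed in
  two ways, with the brackets moved by \<open>isor_assoc\<close>; comparison gives the recursion of
  \<open>cg\<close>.\<close>

lemma dec_tens_cg:
 assumes d: "decT rh m" and s: "!!t. s < t ==> m t = 0" and k: "s + k <= p - 2"
 shows "decT (tens rh (hk k)) (cg k m)" using k proof (induction k rule: less_induct)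
 case (less k)
 note r = dec_rep[OF d]
 consider "k = 0" | "k = 1" | j where "k = Suc (Suc j)" by (metis One_nat_def not0_implies_Suc)
 thus ?case proof cases
  case 1
  thus ?thesis using dec_isor[OF isor_tens_triv[OF r] _ d] r by simp
  next case 2
  thus ?thesis using dec_tens_step[OF d s] less.prems by simp
  next case (3 j)
  have d1: "decT (tens rh (hk (Suc j))) (cg (Suc j) m)" and d0: "decT (tens rh (hk j)) (cg j m)"
   using less 3 by auto
  have d2: "decT (tens (tens rh (hk (Suc j))) (hk 1)) (cg_step (cg (Suc j) m))" by (rule
   dec_tens_step[OF d1 cg_support[OF s]]) (use less.prems 3 in auto)
  have d3: "decT (tens rh (tens (hk (Suc j)) (hk 1))) (cg_step (cg (Suc j) m))" by (rule dec_isor[OF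
   isor_sym[OF isor_assoc[OF r hk_rep hk_rep]] _ d2]) (use r in simp)
  have sd: "sdec (tens rh (tens (hk (Suc j)) (hk 1))) {0, 1::nat} (%i. tens rh (if i = 0 then hk
   (Suc (Suc j)) else hk j))" by (rule sdec_tens_right[OF sdec_hk_tens r]) (use less.prems 3 p_ge in
   auto)
  \<comment> \<open>A decomposition of the new summand must exist before uniqueness can determine
    its multiplicities.\<close>
  obtain m' where m': "decT (tens rh (hk (Suc (Suc j)))) m'" using dec_summand[OF bricks_hk sd d3,
   of 0] by auto
  have "decT (tens rh (tens (hk (Suc j)) (hk 1))) (%t. SUM i:{0, 1::nat}. (if i = 0 then m' else cg
   j m) t)" by (rule dec_concat[OF sd]) (use m' d0 in auto)
  from dec_unique[OF bricks_hk d3 this] have "m' = cg k m" by (auto simp: 3 fun_eq_iff)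
  thus ?thesis using m' 3 by simp
qed qed

theorem dec_tpow_hk: "n * k <= p - 2 ==> decT (tpow (hk k) n) (hook_mult k n)" proof (induction n)
 case 0
 have "isor triv (hk 0)" by (rule triv_hk)
 from dec_isor[OF this triv_rep dec_single[of 0]] show ?case by simp
 next case (Suc n)
 hence "decT (tpow (hk k) n) (hook_mult k n)" by simp
 from dec_tens_cg[OF this hook_mult_support] show ?case using Suc.prems by (simp add: add.commute)
qed
end

section \<open>Specht modules of hooks\<close>
context hooks
begin

text \<open>The k-th exterior power of the sum-zero submodule, which is the model of the Specht
  module of the hook; see \<open>phi_surj\<close>.\<close>

definition Zk :: "nat => 'r fm set" where "Zk k = {v : vecs eA. Qd k * v = v & An * v = 0}"

lemma ZkD: "v : Zk k ==> v : cols" "v : Zk k ==> eA * v = v" "v : Zk k ==> Qd k * v = v" "v : Zk k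
 ==> An * v = 0" "v : Zk k ==> v : MK" using vecs_idem by (fastforce simp: Zk_def)+

lemma ZkI: "v : cols ==> eA * v = v ==> Qd k * v = v ==> An * v = 0 ==> v : Zk k" by (auto simp:
 Zk_def intro: vecsI)

lemma Zk_ga: "v : Zk (Suc k) ==> ga b * v : Zk k" using shift[OF ga_Qd[symmetric], of k b v]
 shift[OF An_ga, of b v] ZkD OpD(1) by (intro ZkI) (auto simp: OpL' massoc)

lemma Zk_an: "v : Zk (Suc k) ==> an b * v : Zk k" using shift[OF an_Qd[symmetric], of k b v]
 shift[OF An_an, of b v] ZkD OpD(1) by (intro ZkI) (auto simp: OpL' massoc)

text \<open>Wedging with e is the quotient map from the Specht model to the hook module.
  \<open>Cr_Zk\<close> shows that it is onto, with contraction by the letter 1 as a linear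
  section.\<close>

lemma Zk_Cr: "v : Zk k ==> Cr * v : vecs (kap k)" by (auto simp: shift[OF Cr_Qd[symmetric], of k v]
 shift[OF An_Cr, of v] shift[OF Cr_Cr, of v] ZkD OpD(1) cols_E00 vecs_Ek Ek_def OpL' massoc)

lemma Cr_Zk:
 assumes v: "v : vecs (kap k)"
 shows "an 1 * v : Zk k" "Cr * (an 1 * v) = v" proof -
 have E: "v : Ek k" using v by (simp add: vecs_Ek)
 show "Cr * (an 1 * v) = v" by (rule Cr_an_Ek[OF E])
 show "an 1 * v : Zk k" using shift[OF an_Qd[symmetric], of k 1 v] shift[OF An_an, of 1 v] EkD[OF E]
  OpD(1) vecs_cols[OF v] by (intro ZkI) (auto simp: OpL' massoc)
qed

text \<open>James' argument: contracting with the \<open>ga b\<close> reduces the degree, so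
 \<open>Zk k\<close> has the unique maximal submodule \<open>Zk k\<close> intersected with the
 kernel of \<open>Cr\<close>.\<close>

lemma Zk_maximal:
 assumes "U <= Zk k" "0 : U" "!!v w. v : U ==> w : U ==> v + w : U" "!!c v. c : K ==> v : U ==> sm c
  v : U" "!!b d v. b : N ==> d : N ==> v : U ==> al b * (ga d * v) : U" "f : U" "Cr * f ~= 0" "k + 2
  <= p"
 shows "Zk k <= U" using assms proof (induction k arbitrary: U f)
 case 0
 have Z: "EX c:K. v = sm c E00" if v: "v : Zk 0" for v proof -
  have "v = sm (ent v 0 0) E00" using ZkD[OF v] cols_E00 E00_scalar[OF ZkD(5)[OF v]] by (simp add:
   vacuum(1) massoc)
  thus ?thesis using ZkD(5)[OF v] by auto
 qed
 obtain c where c: "c : K" "f = sm c E00" using Z 0 by auto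
 hence "c ~= 0" using 0 by auto
 then obtain c' where c': "c' : K" "c * c' = u" using K_inverse[OF c(1)] by auto
 have "sm c' f = E00" using c c' by (simp add: mult.commute)
 hence "E00 : U" using 0(4)[OF c'(1) 0(6)] by simp
 thus ?case using Z 0(4) by auto
 next case (Suc j)
 note U = Suc.prems
 have Usum: "sum g S : U" if "!!x. x : S ==> g x : U" for g and S :: "nat set" using that by
  (induction S rule: infinite_finite_induct) (auto intro: U(2,3))
 \<comment> \<open>The contractions of U, one degree lower; they inherit the closure properties, the
   commutators of \<open>al b * ga d\<close> with \<open>ga c\<close> being contractions
   again.\<close>
 define U' where "U' = {SUM b:N. ga b * w b |w. ALL b:N. w b : U}"
 have U'I: "(SUM b:N. ga b * w b) : U'" if "!!b. b : N ==> w b : U" for w by (auto simp: that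
  U'_def)
 have gaU: "ga b * v : U'" if "b : N" "v : U" for b v proof -
  have "(SUM d:N. ga d * (if d = b then v else 0)) = (SUM d:N. if d = b then ga b * v else 0)" by
   (intro sum.cong) auto
  thus ?thesis using U'I[of "%d. if d = b then v else 0"] that U(2) by auto
 qed
 have U'add: "v + w : U'" if vw: "v : U'" "w : U'" for v w proof -
  obtain f g where "ALL b:N. f b : U" "ALL b:N. g b : U" "v = (SUM b:N. ga b * f b)" "w = (SUM b:N.
   ga b * g b)" using vw by (auto simp: U'_def)
  thus ?thesis using U'I[of "%b. f b + g b"] U(3) by (simp add: distrib_left sum.distrib)
 qed
 have U'sum: "sum g N : U'" if "!!x. x : N ==> g x : U'" for g proof -
  have z: "0 : U'" using gaU[OF N_mem(1) U(2)] by simp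
  have "sum g S : U'" if "finite S" "S <= N" for S using that \<open>!!x. x : N ==> g x : U'\<close>
   by (induction S) (auto intro: U'add z)
  thus ?thesis by simp
 qed
 have fE: "Cr * f : Ek (Suc j)" using Zk_Cr U(1,6) by (auto simp: vecs_Ek)
 \<comment> \<open>The number operator on \<open>Cr * f\<close> is the nonzero scalar j + 1, so some
   contraction of f still lies outside the kernel of \<open>Cr\<close>.\<close>
 have "EX b:N. ga b * (Cr * f) ~= 0" proof (rule ccontr)
  assume "~?thesis"
  hence "sm (of_nat (Suc j)) (Cr * f) = 0" using Ek_number[OF fE] by simp
  moreover have "~p dvd Suc j" using U(8) by (auto dest: dvd_imp_le)
  ultimately show False using sm_of_nat_cancel[OF EkD(1)[OF fE]] U(7) by blast
 qed
 then obtain b0 where b0: "b0 : N" "Cr * (ga b0 * f) ~= 0" by (auto simp: shift[OF Cr_ga, of _ f]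
  massoc)
 have sub: "Zk j <= U'" proof (rule Suc.IH)
  have "v : Zk j" if v: "v : U'" for v proof -
   obtain w where w: "ALL b:N. w b : U" "v = (SUM b:N. ga b * w b)" using v by (auto simp: U'_def)
   have "ga b * w b : Zk j" if "b : N" for b using Zk_ga w(1) U(1) that by auto
   note z = ZkD[OF this]
   show ?thesis unfolding w(2) by (intro ZkI cols_sum) (simp_all add: z lsum)
  qed
  thus "U' <= Zk j" by auto
  show "0 : U'" using gaU[OF N_mem(1) U(2)] by simp
  show "sm c v : U'" if c: "c : K" and v: "v : U'" for c v proof -
   obtain w where w: "ALL b:N. w b : U" "v = (SUM b:N. ga b * w b)" using v by (auto simp: U'_def)
   thus ?thesis using U'I[of "%b. sm c (w b)"] U(4)[OF c] by (simp add: sm_sum sm_mult)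
  qed
  show "al b * (ga d * v) : U'" if b: "b : N" and d: "d : N" and v: "v : U'" for b d v proof -
   obtain w where w: "ALL b:N. w b : U" "v = (SUM b:N. ga b * w b)" using v by (auto simp: U'_def)
   have "al b * (ga d * (ga c * w c)) : U'" if c: "c : N" for c proof -
    have wc: "w c : U" using w c by simp
    have eg: "eA * (ga d * w c) = ga d * w c" by (simp add: OpL')
    have "al b * (ga d * (ga c * w c)) = - (al b * (ga c * (ga d * w c)))" using shift[OF ga_ga[of d
     c], of "w c"] by (simp add: massoc)
    also have "al b * (ga c * (ga d * w c)) = sm (sc c b) (ga d * w c) - ga c * (al b * (ga d * w
     c))" using shift[OF ga_al[OF b], of c "ga d * w c"] by (simp add: ldiff sm_mult eg massoc)
    also have "- ... = ga c * (al b * (ga d * w c)) + ga d * sm (- (sc c b * u)) (w c)" proof -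
     have "w c : MK" using ZkD(5) U(1) wc by auto
     hence "sm (sc c b * u) (w c) = sm (sc c b) (w c)" by (simp add: sm_sm[symmetric])
     thus ?thesis by (simp add: sm_mult sm_minus_left)
    qed
    also have "... : U'" by (simp add: U'add gaU U(4,5) sc_def distrib_right b c d wc)
    finally show ?thesis .
   qed
   thus ?thesis unfolding w(2) lsum by (rule U'sum)
  qed
  show "ga b0 * f : U'" "Cr * (ga b0 * f) ~= 0" using b0 gaU[OF b0(1) U(6)] by auto
  show "j + 2 <= p" using U(8) by simp
 qed (rule U'add)
 show ?case proof
  fix v assume v: "v : Zk (Suc j)"
  \<comment> \<open>Every v is recovered from its contractions up to the invertible factor j + 1.
    These lie in U', and multiplying them by \<open>al b\<close> leads back into U.\<close>
  have "(SUM b:N. al b * (an b * v)) = (SUM b:N. cr b * an b) * v - cr 1 * (An * v)" unfolding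
   al_def An_def sum_fm_mult_left lsum sum_subtractf[symmetric] by (intro sum.cong refl) (simp add:
   algebra_simps)
  also have "(SUM b:N. cr b * an b) * v = (SUM b:N. cr b * an b) * Qd (Suc j) * v" by (simp add:
   ZkD(3)[OF v] massoc)
  also have "... = sm (of_nat (Suc j) * u) v" unfolding number sm_mult_left ZkD(3)[OF v] ..
  finally have e: "(SUM b:N. al b * (an b * v)) = sm (of_nat (Suc j) * u) v" using ZkD(4)[OF v] by
   simp
  have "al b * (an b * v) : U" if b: "b : N" for b proof -
   obtain w where w: "ALL d:N. w d : U" "an b * v = (SUM d:N. ga d * w d)" using sub Zk_an[OF v, of
    b] by (auto simp: U'_def)
   show ?thesis unfolding w(2) lsum by (rule Usum) (use w U(5) b in blast)
  qed
  hence "sm (of_nat (Suc j) * u) v : U" unfolding e[symmetric] by (rule Usum)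
  moreover have "~p dvd Suc j" using U(8) by (auto dest: dvd_imp_le)
  then obtain c where c: "c : K" "c * (of_nat (Suc j) * u) = u" using of_nat_inverse by metis
  ultimately have "sm c (sm (of_nat (Suc j) * u) v) : U" using U(4) by blast
  thus "v : U" unfolding sm_sm c(2) using ZkD(5)[OF v] by simp
qed qed

text \<open>The operators preserving U form an algebra that contains the group, so
  \<open>al_ga_closure\<close> puts all \<open>al b * ga d\<close> into it.\<close>

lemma Zk_maximal_group:
 assumes U: "U <= Zk k" "0 : U" "!!v w. v : U ==> w : U ==> v + w : U" "!!c v. c : K ==> v : U ==>
  sm c v : U" "!!g v. g permutes N ==> v : U ==> Pm g * v : U" and f: "f : U" "Cr * f ~= 0" "k + 2
  <= p"
 shows "Zk k <= U" proof (rule Zk_maximal[OF U(1-4) _ f])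
 fix b d v assume b: "b : N" and d: "d : N" and v: "v : U"
 let ?S = "{Q : Op. ALL v:U. Q * v : U}"
 have neg: "v - w : U" if "v : U" "w : U" for v w proof -
  show ?thesis using ZkD(5) U(1) that(2) U(3)[OF that(1) U(4)[of "- u", OF _ that(2)]] by (auto
   simp: sm_minus_left)
 qed
 have "al b * ga d : ?S" by (rule al_ga_closure[OF _ _ _ _ _ _ _ b d]) (use U neg ZkD(2) in "auto
  simp: distrib_right ldiff massoc sm_mult_left")
 thus "al b * (ga d * v) : U" by (simp add: v massoc)
qed

text \<open>The polytabloid of a hook as a function on lists: C is the set of letters of the first
  column and cs the list of those below the corner.\<close>

definition polyfun :: "nat set => nat list => nat list => 'r" where "polyfun C cs xs = (SUM qi | qi
 permutes C. of_int (sign qi) * (if map qi cs = xs then u else 0))"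
context fixes C :: "nat set" and c0 :: nat and cs :: "nat list" assumes C: "C = insert c0 (set cs)"
 "distinct (c0 # cs)" "C <= N"
begin

lemma sign_K: "of_int (sign qi) * (if P then u else 0) : K" by (cases qi rule: sign_cases) auto

lemma map_C: "qi permutes C ==> set (map qi cs) <= C" using permutes_in_image C(1) by fastforce

lemma C_fin: "finite C" using C(1) by simp

lemma polyfun_K: "polyfun C cs xs : K" unfolding polyfun_def by (rule K_sum) (rule sign_K)

lemma polyfun_transpose:
 assumes "x : C" "y : C" "x ~= y"
 shows "polyfun C cs xs = - polyfun C (map (transpose x y) cs) xs" proof -
 have t: "transpose x y permutes C" using assms by (intro permutes_swap_id)
 have "polyfun C cs xs = (SUM qi | qi permutes C. of_int (sign (qi o transpose x y)) * (if map (qi o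
  transpose x y) cs = xs then u else 0))" unfolding polyfun_def by (rule
  sum_permutations_compose_right[OF t])
 also have "... = - polyfun C (map (transpose x y) cs) xs" unfolding polyfun_def sum_negf[symmetric]
  proof (intro sum.cong refl)
  fix qi assume "qi : {qi. qi permutes C}"
  hence "permutation qi" using C_fin by (auto simp: permutation_permutes)
  thus "of_int (sign (qi o transpose x y)) * (if map (qi o transpose x y) cs = xs then u else 0) = -
   (of_int (sign qi) * (if map qi (map (transpose x y) cs) = xs then u else 0))" by (simp add:
   assms(3) sign_compose permutation_swap_id sign_swap_id)
 qed
 finally show ?thesis .
qed

lemma polyfun_len: "length xs ~= length cs ==> polyfun C cs xs = 0" unfolding polyfun_def by (intro
 sum.neutral) auto

lemma polyfun_Alt: "polyfun C cs : Alt" proof (rule AltI)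
 show "polyfun C cs xs = 0" if "~set xs <= N" for xs unfolding polyfun_def proof (intro sum.neutral
  ballI)
  fix qi assume "qi : {qi. qi permutes C}"
  hence "map qi cs ~= xs" using map_C C(3) that by blast
  thus "of_int (sign qi) * (if map qi cs = xs then u else 0) = 0" by simp
 qed
 show "alternating (polyfun C cs)" proof (rule alternatingI)
  fix as y z bs
  show "polyfun C cs (as @ y # z # bs) = - polyfun C cs (as @ z # y # bs)" proof (cases "length cs =
   length (as @ y # z # bs)")
   case True
   define a y' z' b where "a = take (length as) cs" "y' = cs ! length as" "z' = cs ! Suc (length
    as)" "b = drop (Suc (Suc (length as))) cs"
   have cs: "cs = a @ y' # z' # b" by (simp add: a_y'_z'_b_def True Cons_nth_drop_Suc)
   have la: "length a = length as" by (simp add: True a_y'_z'_b_def)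
   have "transpose y' z' w = w" if "w : set a | w : set b" for w using that C(2) by (auto simp: cs
    transpose_def)
   hence ma: "map (transpose y' z') a = a" "map (transpose y' z') b = b" by (simp_all add: map_idI)
   have mt: "map (transpose y' z') cs = a @ z' # y' # b" by (simp add: cs ma)
   have "(map qi (a @ z' # y' # b) = as @ y # z # bs) = (map qi cs = as @ z # y # bs)" for qi by
    (auto simp: cs la)
   hence "polyfun C (map (transpose y' z') cs) (as @ y # z # bs) = polyfun C cs (as @ z # y # bs)"
    by (simp add: mt polyfun_def)
   moreover have "y' : C" "z' : C" "y' ~= z'" using C by (auto simp: cs)
   ultimately show ?thesis using polyfun_transpose by simp
qed (simp add: polyfun_len) qed qed (rule polyfun_K)

text \<open>A permutation of C that fixes the letters of cs also fixes the only remaining letter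
  \<open>c0\<close>, so just the identity contributes.\<close>

lemma polyfun_self: "polyfun C cs cs = u" proof -
 have "polyfun C cs cs = (SUM qi | qi permutes C. if qi = id then u else 0)" unfolding polyfun_def
  proof (intro sum.cong refl)
  fix qi assume "qi : {qi. qi permutes C}"
  hence p: "qi permutes C" by simp
  have "qi = id" if "map qi cs = cs" proof -
   have f: "qi x = x" if "x : set cs" for x using \<open>map qi cs = cs\<close> that by (metis
    map_eq_conv map_ident)
   have "qi c0 : C" using permutes_in_image[OF p] C(1) by simp
   moreover have "qi c0 ~: set cs" proof
    assume a: "qi c0 : set cs"
    thus False using injD[OF permutes_inj[OF p], of "qi c0" c0] f C(2) by simp
   qed
   ultimately have "qi c0 = c0" using C(1) by simp
   hence "qi x = x" for x using f permutes_not_in[OF p, of x] C(1) by auto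
   thus "qi = id" by auto
  qed
  thus "of_int (sign qi) * (if map qi cs = cs then u else 0) = (if qi = id then u else 0)" by auto
 qed
 also have "... = u" using finite_permutations[OF C_fin] by simp
 finally show ?thesis .
qed

text \<open>Summing over the first entry forgets where the letter c1 goes. The result is invariant
  under exchanging c0 and c1 but also changes sign, hence is zero as p is odd.\<close>

lemma polyfun_Zk: "vec (polyfun C cs) : Zk (length cs)" proof (rule ZkI)
 let ?f = "polyfun C cs"
 show "vec ?f : cols" by (rule vec_cols[OF polyfun_Alt])
 show "eA * vec ?f = vec ?f" by (rule vecs_idem[OF vec_vecs[OF polyfun_Alt]])
 have "(%xs. if length xs = length cs then ?f xs else 0) = ?f" using polyfun_len by auto
 thus "Qd (length cs) * vec ?f = vec ?f" using Qd_vec[OF polyfun_Alt, of "length cs"] by simp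
 have vs: "(SUM b:S. vec (h b)) = vec (%xs. SUM b:S. h b xs) & (%xs. SUM b:S. h b xs) : Alt" if
  "finite S" "!!b. b : S ==> h b : Alt" for S and h :: "nat => nat list => 'r" using that by
  (induction S) (auto simp: vec_add Alt_add)
 have "An * vec ?f = (SUM b:N. vec (%xs. ?f (b # xs)))" unfolding An_def sum_fm_mult_left by (intro
  sum.cong refl an_vec polyfun_Alt)
 also have "... = vec (%xs. SUM b:N. ?f (b # xs))" using vs Alt_an[OF polyfun_Alt] by simp
 also have "(%xs. SUM b:N. ?f (b # xs)) = (%xs. 0)" proof
  fix xs
  show "(SUM b:N. ?f (b # xs)) = 0" proof (cases cs)
   case Nil
   thus ?thesis by (simp add: polyfun_def)
   next case (Cons c1 ds)
   let ?g = "%ds xs. SUM qi | qi permutes C. of_int (sign qi) * (if map qi ds = xs then u else 0)"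
   have "(SUM b:N. ?f (b # xs)) = (SUM qi | qi permutes C. SUM b:N. of_int (sign qi) * (if map qi cs
    = b # xs then u else 0))" unfolding polyfun_def by (rule sum.swap)
   also have "... = polyfun C ds xs" unfolding polyfun_def proof (intro sum.cong refl)
    fix qi assume "qi : {qi. qi permutes C}"
    hence p: "qi c1 : N" using C Cons permutes_in_image by fastforce
    have "(SUM b:N. of_int (sign qi) * (if map qi cs = b # xs then u else 0)) = (SUM b:N. if b = qi
     c1 then of_int (sign qi) * (if map qi ds = xs then u else 0) else 0)" by (intro sum.cong refl)
     (auto simp: Cons)
    thus "(SUM b:N. of_int (sign qi) * (if map qi cs = b # xs then u else 0)) = of_int (sign qi) *
     (if map qi ds = xs then u else 0)" using p by simp
   qed
   finally have e: "(SUM b:N. ?f (b # xs)) = polyfun C ds xs" .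
   have t: "transpose c0 c1 permutes C" using C Cons by (intro permutes_swap_id) auto
   have md: "map (transpose c0 c1) ds = ds" using C(2) Cons by (intro map_idI) (auto simp:
    transpose_def)
   have "polyfun C ds xs = (SUM qi | qi permutes C. of_int (sign (qi o transpose c0 c1)) * (if map
    (qi o transpose c0 c1) ds = xs then u else 0))" unfolding polyfun_def by (rule
    sum_permutations_compose_right[OF t])
   also have "... = - polyfun C ds xs" unfolding polyfun_def sum_negf[symmetric] proof (intro
    sum.cong refl)
    fix qi assume "qi : {qi. qi permutes C}"
    hence "permutation qi" using C_fin by (auto simp: permutation_permutes)
    hence sg: "sign (qi o transpose c0 c1) = - sign qi" using C(2) Cons by (simp add: sign_compose
     permutation_swap_id sign_swap_id)
    have mm: "map (qi o transpose c0 c1) ds = map qi ds" unfolding map_map[symmetric] md ..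
    show "of_int (sign (qi o transpose c0 c1)) * (if map (qi o transpose c0 c1) ds = xs then u else
     0) = - (of_int (sign qi) * (if map qi ds = xs then u else 0))" by (simp only: sg mm
     of_int_minus mult_minus_left)
   qed
   finally have "of_nat 2 * polyfun C ds xs = 0" by simp
   moreover have "polyfun C ds xs : K" unfolding polyfun_def by (rule K_sum) (rule sign_K)
   moreover have "~p dvd 2" using p_ge by (auto dest: dvd_imp_le)
   ultimately show ?thesis using of_nat_cancel e by simp
 qed qed
 finally show "An * vec ?f = 0" by simp
qed

text \<open>C has k + 1 < p letters, so some letter b lies outside C and contraction with it kills
  the polytabloid. Were \<open>Cr\<close> to kill it too, the relation of \<open>an b\<close> with
  \<open>Cr\<close> would make it zero.\<close>

lemma polyfun_Cr:
 assumes "length cs + 2 <= p"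
 shows "Cr * vec (polyfun C cs) ~= 0" proof
 let ?v = "vec (polyfun C cs)"
 assume z: "Cr * ?v = 0"
 have "card C = Suc (length cs)" using C by (simp add: distinct_card)
 hence "C ~= N" using assms by auto
 then obtain b where b: "b : N" "b ~: C" using C(3) by auto
 have "polyfun C cs (b # xs) = 0" for xs unfolding polyfun_def by (intro sum.neutral ballI) (use
  sum.neutral ballI map_C b in auto)
 thus False using an_vec[OF polyfun_Alt, of b] shift[OF an_Cr[OF b(1)], of ?v] z ZkD(2)[OF
  polyfun_Zk] vec_inj[OF polyfun_Alt Alt_zero] polyfun_self by (simp add: ldiff massoc)
qed
end
end

text \<open>Below the first row all rows of a hook are single cells, so a tabloid is a list of k
  distinct letters. Positions are shifted by one because row 0 is the long row.\<close>

definition tab :: "nat => nat list => nat => nat" where "tab p xs = (\<lambda>x\<in>{1..p}. if x :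
 set xs then Suc (the_inv_into {..<length xs} ((!) xs) x) else 0)"

definition inj_lists :: "nat => nat => nat list set" where "inj_lists p k = {xs. length xs = k &
 distinct xs & set xs <= {1..p}}"

lemma inj_listsD: "xs : inj_lists p k ==> length xs = k" "xs : inj_lists p k ==> distinct xs" "xs :
 inj_lists p k ==> set xs <= {1..p}" by (auto simp: inj_lists_def)

lemma inj_lists_nth: "xs : inj_lists p k ==> i < k ==> xs ! i : {1..p}" using inj_listsD nth_mem by
 blast

lemma tab_nth: "xs : inj_lists p k ==> i < k ==> tab p xs (xs ! i) = Suc i" using inj_listsD
 the_inv_into_f_f[OF inj_on_nth[of xs "{..<k}"], of i] inj_lists_nth by (simp add: tab_def)

lemma tab_zero: "x : {1..p} ==> x ~: set xs ==> tab p xs x = 0" by (simp add: tab_def)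

lemma tab_eqI:
 assumes xs: "xs : inj_lists p k" and e: "ta : extensional {1..p}" "!!i. i < k ==> ta (xs ! i) = Suc
  i" "!!x. x : {1..p} ==> x ~: set xs ==> ta x = 0"
 shows "ta = tab p xs" proof (rule extensionalityI[OF e(1)])
 show "tab p xs : extensional {1..p}" by (simp add: tab_def)
 fix x assume x: "x : {1..p}"
 show "ta x = tab p xs x" by (metis inj_listsD(1) xs in_set_conv_nth e(2) tab_nth x e(3) tab_zero)
qed

lemma tab_inj:
 assumes xs: "xs : inj_lists p k" and ys: "ys : inj_lists p k" and e: "tab p xs = tab p ys"
 shows "xs = ys" proof (rule nth_equalityI)
 show "length xs = length ys" using inj_listsD(1)[OF xs] inj_listsD(1)[OF ys] by simp
 fix i assume "i < length xs"
 hence i: "i < k" "xs ! i : {1..p}" using inj_listsD(1)[OF xs] inj_lists_nth[OF xs, of i] by auto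
 have t: "tab p ys (xs ! i) = Suc i" using tab_nth[OF xs i(1)] e by simp
 hence "xs ! i : set ys" using tab_zero[OF i(2), of ys] by auto
 then obtain j where j: "j < k" "xs ! i = ys ! j" by (auto simp: inj_listsD(1)[OF ys]
  in_set_conv_nth)
 thus "xs ! i = ys ! i" using t tab_nth[OF ys j(1)] by simp
qed

lemma map_inj_lists: "g permutes {1..p} ==> (map g xs : inj_lists p k) = (xs : inj_lists p k)" using
 permutes_inj_on permutes_in_image[of g "{1..p}"] by (auto simp: inj_lists_def distinct_map)

lemma tab_act:
 assumes g: "g permutes {1..p}" and xs: "xs : inj_lists p k"
 shows "tabloid_act g (tab p xs) = tab p (map g xs)" proof (rule tab_eqI)
 show "map g xs : inj_lists p k" using map_inj_lists[OF g] xs by simp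
 show "tabloid_act g (tab p xs) : extensional {1..p}" by (auto simp: permutes_not_in[OF
  permutes_inv[OF g]] tabloid_act_def tab_def extensional_def)
 show "tabloid_act g (tab p xs) (map g xs ! i) = Suc i" if "i < k" for i by (simp add: that
  tab_nth[OF xs that] inj_listsD(1)[OF xs] permutes_inverses(2)[OF g] tabloid_act_def)
 show "tabloid_act g (tab p xs) x = 0" if "x : {1..p}" "x ~: set (map g xs)" for x proof -
  have "inv' g x : {1..p}" using permutes_in_image[OF permutes_inv[OF g]] that(1) by simp
  moreover have "inv' g x ~: set xs" using that(2) permutes_inverses(1)[OF g] by (metis imageI
   set_map)
  ultimately show ?thesis by (simp add: tabloid_act_def tab_zero)
qed qed

lemma tab_tabloid:
 assumes xs: "xs : inj_lists p k"
 shows "tab p xs : tabloids ((p - k) # replicate k 1) p" unfolding tabloids_def proof (intro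
  CollectI conjI allI impI)
 note x = inj_listsD[OF xs]
 have le: "tab p xs x <= k" if "x : {1..p}" for x using tab_zero[OF that, of xs] tab_nth[OF xs] x(1)
  by (cases "x : set xs") (auto simp: in_set_conv_nth)
 show "tab p xs : {1..p} \<rightarrow>\<^sub>E {..<length ((p - k) # replicate k 1)}" by (auto simp:
  le PiE_iff less_Suc_eq_le) (simp add: tab_def)
 fix i assume i: "i < length ((p - k) # replicate k 1)"
 show "card {x : {1..p}. tab p xs x = i} = ((p - k) # replicate k 1) ! i" proof (cases i)
  case 0
  have "{x : {1..p}. tab p xs x = 0} = {1..p} - set xs" by (auto simp: tab_nth[OF xs] x(1)
   in_set_conv_nth tab_zero)
  thus ?thesis using 0 x card_Diff_subset[of "set xs" "{1..p}"] by (simp add: distinct_card)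
  next case (Suc j)
  hence j: "j < k" using i by simp
  have "{x : {1..p}. tab p xs x = Suc j} = {xs ! j}" proof
   show "{xs ! j} <= {x : {1..p}. tab p xs x = Suc j}" using tab_nth[OF xs j] inj_lists_nth[OF xs j]
    by simp
   show "{x : {1..p}. tab p xs x = Suc j} <= {xs ! j}" proof
    fix y assume y: "y : {x : {1..p}. tab p xs x = Suc j}"
    then obtain l where "l < k" "y = xs ! l" using tab_zero[of y p xs] x(1) by (auto simp:
     in_set_conv_nth)
    thus "y : {xs ! j}" using y tab_nth[OF xs] by auto
  qed qed
  thus ?thesis using Suc j by simp
qed qed

lemma tabloid_tab:
 assumes ta: "ta : tabloids ((p - k) # replicate k 1) p" obtains xs where "xs : inj_lists p k" "ta =
  tab p xs" proof -
 have E: "ta : {1..p} \<rightarrow>\<^sub>E {..<Suc k}" and c: "!!i. i < Suc k ==> card {x : {1..p}.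
  ta x = i} = ((p - k) # replicate k 1) ! i" using ta by (auto simp: tabloids_def)
 have "ALL i:{..<k}. EX x. {x : {1..p}. ta x = Suc i} = {x}" proof
  fix i assume "i : {..<k}"
  thus "EX x. {x : {1..p}. ta x = Suc i} = {x}" using c[of "Suc i"] by (simp add:
   card_1_singleton_iff)
 qed
 from bchoice[OF this] obtain y where y: "ALL i:{..<k}. {x : {1..p}. ta x = Suc i} = {y i}" by auto
 have yi: "y i : {1..p}" "ta (y i) = Suc i" if "i < k" for i using y that by auto
 let ?xs = "map y [0..<k]"
 have "inj_on y {0..<k}" by (rule inj_onI) (use yi(2) in "metis atLeastLessThan_iff nat.inject")
 hence xs: "?xs : inj_lists p k" using yi(1) by (auto simp: inj_lists_def distinct_map)
 have "ta = tab p ?xs" proof (rule tab_eqI[OF xs])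
  show "ta : extensional {1..p}" using E by (auto simp: PiE_iff)
  show "ta (?xs ! i) = Suc i" if "i < k" for i using yi(2) that by simp
  fix x assume x: "x : {1..p}" "x ~: set ?xs"
  have "ta x < Suc k" using E x(1) by blast
  show "ta x = 0" proof (cases "ta x")
   case (Suc i)
   hence "x = y i" "i < k" using y x(1) \<open>ta x < Suc k\<close> by auto
   thus ?thesis using x(2) by auto
 qed qed
 thus ?thesis using that xs by simp
qed

text \<open>Apart from the first column all columns of a hook have one cell, so the column
  stabilizer is the full symmetric group on the letters of the first column; c0 is the letter in the
  corner.\<close>

lemma hook_tableau:
 assumes T: "T : tableaux ((p - k) # replicate k 1) p" and k: "k < p" obtains c0 cs where "cs :
  inj_lists p k" "distinct (c0 # cs)" "c0 : {1..p}" "tabloid_of p T = tab p cs" "column_stabilizer p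
  T = {qi. qi permutes insert c0 (set cs)}" proof -
 let ?cells = "{(r, c). r < length ((p - k) # replicate k 1) & c < ((p - k) # replicate k 1) ! r}"
 have T: "bij_betw T {1..p} ?cells" using T by (simp add: tableaux_def)
 have cell: "((r, c) : ?cells) = ((r = 0 & c < p - k) | (EX i<k. r = Suc i & c = 0))" for r c by
  (cases r) auto
 define iT where "iT = the_inv_into {1..p} T"
 have iT: "iT z : {1..p}" "T (iT z) = z" if "z : ?cells" for z using that T
  f_the_inv_into_f_bij_betw[OF T] the_inv_into_into[of T "{1..p}" z "{1..p}"] by (auto simp: iT_def
  bij_betw_def)
 have inj: "x = y" if "x : {1..p}" "y : {1..p}" "T x = T y" for x y by (rule inj_onD[OF
  bij_betw_imp_inj_on[OF T] that(3) that(1,2)])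
 define c0 where "c0 = iT (0, 0)"
 define cs where "cs = map (%i. iT (Suc i, 0)) [0..<k]"
 have c0: "c0 : {1..p}" "T c0 = (0, 0)" using iT k by (auto simp: c0_def)
 have csi: "cs ! i : {1..p}" "T (cs ! i) = (Suc i, 0)" if "i < k" for i using iT that by (auto simp:
  cs_def)
 have len: "length cs = k" by (simp add: cs_def)
 have "distinct cs" unfolding distinct_conv_nth len using allI csi(2) by fastforce
 moreover have "set cs <= {1..p}" using csi(1) len by (auto simp: in_set_conv_nth)
 ultimately have csL: "cs : inj_lists p k" by (simp add: len inj_lists_def)
 have d: "distinct (c0 # cs)" using c0(2) csi(2) len \<open>distinct cs\<close> by (auto simp:
  in_set_conv_nth)
 have Tx: "T x : ?cells" if "x : {1..p}" for x by (rule bspec[OF bij_betwE[OF T] that])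
 have row: "fst (T x) = 0" if x: "x : {1..p}" "x ~: set cs" for x proof (rule ccontr)
  obtain r c where rc: "T x = (r, c)" by (cases "T x")
  assume "fst (T x) ~= 0"
  then obtain i where "i < k" "r = Suc i" "c = 0" using Tx[OF x(1)] cell[of r c] rc by auto
  thus False using inj[OF x(1) csi(1)] csi(2) rc x(2) len by simp
 qed
 have col: "(x : insert c0 (set cs)) = (snd (T x) = 0)" if x: "x : {1..p}" for x proof
  show "snd (T x) = 0" if "x : insert c0 (set cs)" using that c0(2) csi(2) len by (auto simp:
   in_set_conv_nth)
  assume s: "snd (T x) = 0"
  show "x : insert c0 (set cs)" proof (cases "x : set cs")
   case False
   thus ?thesis using row[OF x] s inj[OF x c0(1)] c0(2) by (simp add: prod_eq_iff)
 qed simp qed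
 have "tabloid_of p T = tab p cs" by (rule tab_eqI[OF csL]) (use csi row in "auto simp:
  tabloid_of_def")
 moreover have "column_stabilizer p T = {qi. qi permutes insert c0 (set cs)}" proof
  let ?C = "insert c0 (set cs)"
  have CN: "?C <= {1..p}" using c0(1) csL by (auto simp: inj_lists_def)
  show "column_stabilizer p T <= {qi. qi permutes ?C}" proof
   fix qi assume "qi : column_stabilizer p T"
   hence qi: "qi permutes {1..p}" "!!x. x : {1..p} ==> snd (T (qi x)) = snd (T x)" by (auto simp:
    column_stabilizer_def sym_group_def)
   have "qi x = x" if "x : {1..p} - ?C" for x proof -
    have x: "x : {1..p}" "x ~: ?C" and px: "qi x : {1..p}" using that permutes_in_image[OF qi(1)] by
     auto
    hence "qi x ~: ?C" using col[OF x(1)] col[OF px] qi(2)[OF x(1)] by simp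
    hence "T (qi x) = T x" using row[OF px] row[OF x(1)] x(2) qi(2)[OF x(1)] by (simp add:
     prod_eq_iff)
    thus ?thesis using inj[OF px x(1)] by simp
   qed
   thus "qi : {qi. qi permutes ?C}" using permutes_superset[OF qi(1)] by blast
  qed
  show "{qi. qi permutes ?C} <= column_stabilizer p T" proof
   fix qi assume "qi : {qi. qi permutes ?C}"
   hence qi: "qi permutes ?C" by simp
   have "snd (T (qi x)) = snd (T x)" if x: "x : {1..p}" for x proof (cases "x : ?C")
    case True
    hence "qi x : ?C" using permutes_in_image[OF qi] by simp
    thus ?thesis using True col[OF x] col[of "qi x"] CN by auto
   qed (use permutes_not_in[OF qi] in simp)
   thus "qi : column_stabilizer p T" using permutes_subset[OF qi CN] by (simp add:
    column_stabilizer_def sym_group_def)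
 qed qed
 ultimately show ?thesis using that csL d c0(1) by auto
qed

lemma hook_tableau_exists: "k < p ==> EX T. T : tableaux ((p - k) # replicate k 1) p" proof -
 assume k: "k < p"
 let ?l = "(p - k) # replicate k (1::nat)"
 have e: "{(r, c). r < length ?l & c < ?l ! r} = (SIGMA r:{..<Suc k}. {..<?l ! r})" by auto
 have "card (SIGMA r:{..<Suc k}. {..<?l ! r}) = (SUM r<Suc k. ?l ! r)" by simp
 also have "... = p" using k by (simp only: sum.lessThan_Suc_shift) simp
 finally have "card {1..p} = card (SIGMA r:{..<Suc k}. {..<?l ! r})" by simp
 then obtain T where "bij_betw T {1..p} (SIGMA r:{..<Suc k}. {..<?l ! r})" using
  finite_same_card_bij[of "{1..p}" "SIGMA r:{..<Suc k}. {..<?l ! r}"] by auto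
 thus ?thesis unfolding tableaux_def e by auto
qed
declare One_nat_def [simp del]

lemma (in modelled) lin_span_submodule:
 assumes "group_module R G V" "A <= carrier V"
 shows "submodule (lin_span R V A) R V" "A <= lin_span R V A" "!!H. submodule H R V ==> A <= H ==>
  lin_span R V A <= H" proof -
 interpret V: group_module R G V by (rule assms(1))
 have z: "zero V : H" if "submodule H R V" for H using subgroup.one_closed[OF submodule.axioms(1)[OF
  that]] by simp
 have c: "submodule (carrier V) R V" by (rule V.carrier_is_submodule)
 show "submodule (lin_span R V A) R V" by (rule submodule_closedI[OF assms(1)]) (auto simp: c
  assms(2) lin_span_def z V.submoduleE)
 show "A <= lin_span R V A" "!!H. submodule H R V ==> A <= H ==> lin_span R V A <= H" by (auto simp:
  lin_span_def)
qed

section \<open>Identification of the Specht module and of its simple quotient\<close>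

locale hooked = modelled R "sym_group p" emb for R :: "('a, 'm) ring_scheme" (structure) and p ::
 nat and emb :: "'a => 'r::comm_ring_1" + assumes hooked_prime: "prime p" and hooked_ge: "3 <= p"
 and hooked_char: "has_characteristic R p"
begin
abbreviation "Sy == sym_group p"

lemma emb_nat: "emb ([m] \<cdot> \<one>) = of_nat m * emb \<one>" for m :: nat by (induction m)
 (simp_all add: emb_add algebra_simps)

lemma emb_eq_0: "x : carrier R ==> (emb x = 0) = (x = \<zero>)" using emb_inj emb_zero by (metis
 inj_onD zero_closed)
sublocale hooks "emb ` carrier R" "emb \<one>" p proof
 show "prime p" "3 <= p" by (fact hooked_prime hooked_ge)+
 show "(of_nat m * emb \<one> = 0) = (p dvd m)" for m using emb_eq_0[of "[m] \<cdot> \<one>"]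
  hooked_char by (simp add: emb_nat has_characteristic_def)
qed

lemma emb_sign:
 assumes "x : carrier R"
 shows "[(sign qi :: int)] \<cdot> x : carrier R" "emb ([(sign qi :: int)] \<cdot> x) = of_int (sign
  qi) * emb x" proof -
 have "[(1::int)] \<cdot> x = x" "[(- 1::int)] \<cdot> x = \<ominus> x" by (simp_all add: assms
  add_pow_int_lt)
 thus "[(sign qi :: int)] \<cdot> x : carrier R" "emb ([(sign qi :: int)] \<cdot> x) = of_int (sign
  qi) * emb x" using assms by (cases qi rule: sign_cases; simp add: emb_minus)+
qed

lemma emb_finsum:
 assumes "finite A" "!!x. x : A ==> f x : carrier R"
 shows "emb (finsum R f A) = (SUM x:A. emb (f x))" using assms by (induction A rule: finite_induct)
  (simp_all add: emb_add)

lemma N_eq: "N = {1..p}" by (simp add: N_def)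

lemma permutes_carrier: "(g : carrier Sy) = (g permutes {1..p})" by (simp add: sym_group_def)
context fixes k :: nat assumes k: "k + 2 <= p"
begin
abbreviation (input) "Ys == young_perm_module R ((p - k) # replicate k 1) p"
abbreviation (input) "Ss == specht_module R ((p - k) # replicate k 1) p"
abbreviation (input) "Tb == tabloids ((p - k) # replicate k 1) p"

text \<open>Tabloids become lists and values move into the ring. On the Specht module the outcome is
  alternating (\<open>Ss_hat\<close>), although a general element of the permutation module does not
  give such a function.\<close>

definition hat :: "((nat => nat) => 'a) => nat list => 'r" where "hat v xs = (if xs : inj_lists p k
 then emb (v (tab p xs)) else 0)"

lemma Tb_finite: "finite Tb" by (rule finite_subset[of _ "{1..p} \<rightarrow>\<^sub>E {..<length
 ((p - k) # replicate k 1)}"]) (auto simp: tabloids_def intro: finite_PiE)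

lemma Ys_carrier: "(v : carrier Ys) = ((ALL ta:Tb. v ta : carrier R) & (ALL ta. ta ~: Tb --> v ta =
 \<zero>))" proof -
 have "finite {ta. v ta ~= \<zero>}" if "ALL ta. ta ~: Tb --> v ta = \<zero>" by (rule
  finite_subset[OF _ Tb_finite]) (use that in auto)
 thus ?thesis by (auto simp: young_perm_module_def perm_module_def)
qed

lemma Ys_val: "v : carrier Ys ==> v ta : carrier R" by (cases "ta : Tb") (auto simp: Ys_carrier)

lemma Ys_ops: "zero Ys = (%_. \<zero>)" "add Ys v w = (%x. v x \<oplus> w x)" "smult Ys a v = (%x. a
 \<otimes> v x)" "act Ys g v = (%x. if x : Tb then v (tabloid_act (m_inv Sy g) x) else \<zero>)" by
 (simp_all add: young_perm_module_def perm_module_def)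

lemma tabloid_act_Tb: "g permutes {1..p} ==> ta : Tb ==> tabloid_act g ta : Tb" by (erule
 tabloid_tab) (simp add: tab_act tab_tabloid map_inj_lists)

lemma Ys_gm: "Gmod Ys" unfolding young_perm_module_def proof (rule perm_module_group_module)
 fix g h x assume "g : carrier Sy" "h : carrier Sy"
 hence "inv' (g o h) = inv' h o inv' g" by (auto simp: permutes_bij permutes_carrier intro!:
  o_inv_distrib)
 thus "tabloid_act (mult (sym_group p) g h) x = tabloid_act g (tabloid_act h x)" by (simp add:
  tabloid_act_def sym_group_mult o_assoc)
qed (use tabloid_act_Tb in "auto simp: permutes_carrier tabloid_act_def sym_group_one")

lemma hat_zero: "hat (%_. \<zero>) = (%_. 0)" by (auto simp: hat_def)

lemma hat_add: "v : carrier Ys ==> w : carrier Ys ==> hat (add Ys v w) = (%xs. hat v xs + hat w xs)"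
 by (auto simp: hat_def Ys_ops emb_add Ys_val)

lemma hat_smult: "a : carrier R ==> v : carrier Ys ==> hat (smult Ys a v) = (%xs. emb a * hat v xs)"
 by (auto simp: hat_def Ys_ops emb_mult Ys_val)

lemma hat_act: "g permutes {1..p} ==> hat (act Ys g v) = (%xs. hat v (map (inv' g) xs))" by (auto
 simp: permutes_carrier map_inj_lists permutes_inv tab_tabloid tab_act hat_def Ys_ops)

lemma hat_inj: "v : carrier Ys ==> w : carrier Ys ==> hat v = hat w ==> v = w" proof
 fix ta assume vw: "v : carrier Ys" "w : carrier Ys" "hat v = hat w"
 show "v ta = w ta" proof (cases "ta : Tb")
  case True
  then obtain xs where xs: "xs : inj_lists p k" "ta = tab p xs" using tabloid_tab by blast
  hence "emb (v ta) = emb (w ta)" using fun_cong[OF vw(3), of xs] by (simp add: hat_def)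
  thus ?thesis using emb_inj Ys_val vw by (auto simp: inj_on_def)
  next case False
  thus ?thesis using vw by (simp add: Ys_carrier)
qed qed

lemma polytabloid_hat:
 assumes T: "T : tableaux ((p - k) # replicate k 1) p" and cs: "cs : inj_lists p k" "tabloid_of p T
  = tab p cs"
 shows "polytabloid R p T : carrier Ys" "hat (polytabloid R p T) xs = (SUM qi:column_stabilizer p T.
  of_int (sign qi) * (if map qi cs = xs then emb \<one> else 0))" proof -
 let ?CS = "column_stabilizer p T"
 have CS: "qi permutes {1..p}" if "qi : ?CS" for qi using that by (simp add: column_stabilizer_def
  permutes_carrier)
 have fin: "finite ?CS" by (rule finite_subset[OF _ finite_G]) (auto simp: column_stabilizer_def)
 have t: "tabloid_act qi (tabloid_of p T) = tab p (map qi cs)" "map qi cs : inj_lists p k" if "qi :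
  ?CS" for qi using tab_act[OF CS[OF that] cs(1)] cs(2) map_inj_lists[OF CS[OF that]] cs(1) by auto
 have bv: "basis_vec R x y : carrier R" for x y :: "nat => nat" by (simp add: basis_vec_def)
 have out: "polytabloid R p T ta = \<zero>" if "ta ~: Tb" for ta unfolding polytabloid_def proof
  (rule R.add.finprod_one_eqI)
  fix qi assume "qi : ?CS"
  thus "[(sign qi :: int)] \<cdot> basis_vec R (tabloid_act qi (tabloid_of p T)) ta = \<zero>" using
   t tab_tabloid that by (auto simp: basis_vec_def)
 qed
 have "polytabloid R p T ta : carrier R" for ta unfolding polytabloid_def by (rule R.finsum_closed)
  (use emb_sign(1)[OF bv] in auto)
 thus "polytabloid R p T : carrier Ys" by (simp add: out Ys_carrier)
 show "hat (polytabloid R p T) xs = (SUM qi:?CS. of_int (sign qi) * (if map qi cs = xs then emb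
  \<one> else 0))" proof (cases "xs : inj_lists p k")
  case True
  have "hat (polytabloid R p T) xs = (SUM qi:?CS. of_int (sign qi) * emb (basis_vec R (tabloid_act
   qi (tabloid_of p T)) (tab p xs)))" by (simp add: hat_def polytabloid_def True emb_finsum[OF fin]
   emb_sign[OF bv])
  also have "... = (SUM qi:?CS. of_int (sign qi) * (if map qi cs = xs then emb \<one> else 0))"
   proof (intro sum.cong refl)
   fix qi assume qi: "qi : ?CS"
   have "(tab p xs = tab p (map qi cs)) = (map qi cs = xs)" using tab_inj[OF True t(2)[OF qi]] by
    auto
   thus "of_int (sign qi) * emb (basis_vec R (tabloid_act qi (tabloid_of p T)) (tab p xs)) = of_int
    (sign qi) * (if map qi cs = xs then emb \<one> else 0)" by (auto simp: t(1)[OF qi]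
    basis_vec_def)
  qed
  finally show ?thesis .
  next case False
  hence "map qi cs ~= xs" if "qi : ?CS" for qi using t(2)[OF that] by auto
  thus ?thesis by (simp add: False hat_def)
qed qed

lemma Ss_def': "carrier Ss = lin_span R Ys (polytabloid R p ` tableaux ((p - k) # replicate k 1) p)"
 "zero Ss = zero Ys" "add Ss v w = add Ys v w" "smult Ss a v = smult Ys a v" "act Ss g v = act Ys g
 v" by (simp_all add: specht_module_def)

lemma tableau:
 assumes T: "T : tableaux ((p - k) # replicate k 1) p" obtains c0 cs where "cs : inj_lists p k"
  "tabloid_of p T = tab p cs" "distinct (c0 # cs)" "insert c0 (set cs) <= N" "length cs = k" "hat
  (polytabloid R p T) = polyfun (insert c0 (set cs)) cs" proof -
 have kp: "k < p" using k by simp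
 obtain c0 cs where c: "cs : inj_lists p k" "distinct (c0 # cs)" "c0 : {1..p}" "tabloid_of p T = tab
  p cs" "column_stabilizer p T = {qi. qi permutes insert c0 (set cs)}" by (rule hook_tableau[OF T
  kp])
 have "hat (polytabloid R p T) = polyfun (insert c0 (set cs)) cs" by (auto simp:
  polytabloid_hat(2)[OF T c(1,4)] polyfun_def c(5))
 moreover have "insert c0 (set cs) <= N" using c(3) inj_listsD(3)[OF c(1)] by (simp add: N_eq)
 ultimately show ?thesis using that c inj_listsD(1) by auto
qed

lemma poly_carrier: "polytabloid R p ` tableaux ((p - k) # replicate k 1) p <= carrier Ys" by (metis
 image_subsetI tableau polytabloid_hat(1))

lemmas Ss_span = lin_span_submodule[OF Ys_gm poly_carrier, folded Ss_def'(1)]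

lemma Ss_Ys: "v : carrier Ss ==> v : carrier Ys" proof -
 interpret Y: group_module R Sy Ys by (rule Ys_gm)
 show "v : carrier Ss ==> v : carrier Ys" using Y.submoduleE(1)[OF Ss_span(1)] by auto
qed

lemma Ss_closed: "zero Ys : carrier Ss" "v : carrier Ss ==> w : carrier Ss ==> add Ys v w : carrier
 Ss" "a : carrier R ==> v : carrier Ss ==> smult Ys a v : carrier Ss" proof -
 interpret Y: group_module R Sy Ys by (rule Ys_gm)
 show "zero Ys : carrier Ss" using subgroup.one_closed[OF submodule.axioms(1)[OF Ss_span(1)]] by
  simp
 show "v : carrier Ss ==> w : carrier Ss ==> add Ys v w : carrier Ss" "a : carrier R ==> v : carrier
  Ss ==> smult Ys a v : carrier Ss" using Y.submoduleE(4,5)[OF Ss_span(1)] by auto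
qed

lemma Ss_hat:
 assumes "v : carrier Ss"
 shows "hat v : Alt" "vec (hat v) : Zk k" proof -
 interpret Y: group_module R Sy Ys by (rule Ys_gm)
 let ?H = "{v : carrier Ys. hat v : Alt & vec (hat v) : Zk k}"
 have "submodule ?H R Ys" proof (rule submodule_closedI[OF Ys_gm])
  show "zero Ys : ?H" using Y.zero_closed hat_zero by (simp add: Ys_ops Zk_def)
  show "add Ys v w : ?H" if "v : ?H" "w : ?H" for v w using that by (auto simp: hat_add Alt_add
   vec_add Zk_def distrib_left)
  show "smult Ys a v : ?H" if "a : carrier R" "v : ?H" for a v using that by (auto simp: hat_smult
   Alt_smult vec_smult Zk_def sm_mult)
 qed auto
 moreover have "polytabloid R p ` tableaux ((p - k) # replicate k 1) p <= ?H" proof (rule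
  image_subsetI)
  fix T assume T: "T : tableaux ((p - k) # replicate k 1) p"
  obtain c0 cs where c: "distinct (c0 # cs)" "insert c0 (set cs) <= N" "length cs = k" "hat
   (polytabloid R p T) = polyfun (insert c0 (set cs)) cs" by (rule tableau[OF T])
  thus "polytabloid R p T : ?H" using poly_carrier T polyfun_Alt polyfun_Zk by auto
 qed
 ultimately have "carrier Ss <= ?H" by (rule Ss_span(3))
 thus "hat v : Alt" "vec (hat v) : Zk k" using assms by auto
qed

text \<open>Conjugation by g carries one column stabilizer to the other and preserves signs; this
  makes the Specht module stable under the group.\<close>

lemma poly_act:
 assumes T: "T : tableaux ((p - k) # replicate k 1) p" and g: "g permutes {1..p}"
 shows "T o inv' g : tableaux ((p - k) # replicate k 1) p" "act Ys g (polytabloid R p T) =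
  polytabloid R p (T o inv' g)" proof -
 interpret Y: group_module R Sy Ys by (rule Ys_gm)
 let ?T = "T o inv' g" and ?c = "%qi. g o qi o inv' g"
 note gi = permutes_inv[OF g]
 show T': "?T : tableaux ((p - k) # replicate k 1) p" using T bij_betw_trans[OF permutes_imp_bij[OF
  gi]] by (auto simp: tableaux_def)
 obtain c0 cs where c: "cs : inj_lists p k" "tabloid_of p T = tab p cs" by (rule tableau[OF T])
 have gcs: "map g cs : inj_lists p k" using c(1) map_inj_lists[OF g] by simp
 have tg: "tabloid_of p ?T = tab p (map g cs)" proof -
  have "tabloid_of p ?T = tabloid_act g (tabloid_of p T)" using permutes_in_image[OF gi] by (auto
   simp: tabloid_of_def tabloid_act_def)
  thus ?thesis using tab_act[OF g c(1)] c(2) by simp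
 qed
 have gg: "inv' g (g x) = x" "g (inv' g x) = x" for x using permutes_inverses[OF g] by auto
 have bij: "bij_betw ?c (column_stabilizer p T) (column_stabilizer p ?T)" proof (rule
  bij_betw_byWitness[where f' = "%qi. inv' g o qi o g"])
  show "?c ` column_stabilizer p T <= column_stabilizer p ?T" using permutes_compose[OF
   permutes_compose[OF gi] g] permutes_in_image[OF gi] gg by (auto simp: column_stabilizer_def
   permutes_carrier comp_assoc)
  show "(%qi. inv' g o qi o g) ` column_stabilizer p ?T <= column_stabilizer p T" proof (rule
   image_subsetI)
   fix qi assume qi: "qi : column_stabilizer p ?T"
   hence "snd (T (inv' g (qi (g x)))) = snd (T x)" if "x : {1..p}" for x using permutes_in_image[OF
    g] that gg(1) by (auto simp: column_stabilizer_def)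
   thus "inv' g o qi o g : column_stabilizer p T" using qi permutes_compose[OF g permutes_compose[OF
    _ gi]] by (auto simp: column_stabilizer_def permutes_carrier)
 qed qed (auto simp: fun_eq_iff gg)
 have "hat (act Ys g (polytabloid R p T)) xs = hat (polytabloid R p ?T) xs" for xs proof -
  have "hat (polytabloid R p ?T) xs = (SUM qi:column_stabilizer p T. of_int (sign (?c qi)) * (if map
   (?c qi) (map g cs) = xs then emb \<one> else 0))" unfolding polytabloid_hat(2)[OF T' gcs tg] by
   (rule sum.reindex_bij_betw[OF bij, symmetric])
  also have "... = hat (polytabloid R p T) (map (inv' g) xs)" unfolding polytabloid_hat(2)[OF T c]
   proof (intro sum.cong refl)
   fix qi assume qi: "qi : column_stabilizer p T"
   have pm: "permutation qi" "permutation g" "permutation (inv' g)" using qi g gi by (auto simp: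
    column_stabilizer_def permutes_carrier permutation_permutes)
   have "sign (?c qi) = sign qi" by (simp add: pm sign_compose permutation_compose sign_inverse)
   moreover have "(map (?c qi) (map g cs) = xs) = (map qi cs = map (inv' g) xs)" proof
    assume "map (?c qi) (map g cs) = xs"
    thus "map qi cs = map (inv' g) xs" by (auto simp: gg)
    next assume a: "map qi cs = map (inv' g) xs"
    have "map (?c qi) (map g cs) = map g (map qi cs)" by (simp add: gg)
    also have "... = xs" by (simp add: a gg comp_def)
    finally show "map (?c qi) (map g cs) = xs" .
   qed
   ultimately show "of_int (sign (?c qi)) * (if map (?c qi) (map g cs) = xs then emb \<one> else 0)
    = of_int (sign qi) * (if map qi cs = map (inv' g) xs then emb \<one> else 0)" by simp
  qed
  finally show ?thesis by (simp add: hat_act[OF g])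
 qed
 moreover have "polytabloid R p T : carrier Ys" "polytabloid R p ?T : carrier Ys" using poly_carrier
  T T' by auto
 ultimately show "act Ys g (polytabloid R p T) = polytabloid R p ?T" using hat_inj Y.act_closed g by
  (auto simp: permutes_carrier fun_eq_iff)
qed

lemma Ss_act:
 assumes v: "v : carrier Ss" and g: "g permutes {1..p}"
 shows "act Ys g v : carrier Ss" proof -
 interpret Y: group_module R Sy Ys by (rule Ys_gm)
 have gG: "g : carrier Sy" by (simp add: g permutes_carrier)
 let ?H = "{v : carrier Ys. act Ys g v : carrier Ss}"
 have z: "act Ys g (zero Ys) = zero Ys" by (auto simp: Ys_ops)
 have "submodule ?H R Ys" by (rule submodule_closedI[OF Ys_gm]) (use Ss_closed z Y.act_add[OF gG]
  Y.act_smult[OF gG] in auto)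
 moreover have "polytabloid R p ` tableaux ((p - k) # replicate k 1) p <= ?H" using poly_act[OF _ g]
  poly_carrier Ss_span(2) by auto
 ultimately show ?thesis using Ss_span(3) v by auto
qed

lemma phi:
 assumes "v : carrier Ss" "w : carrier Ss"
 shows "vec (hat (add Ys v w)) = vec (hat v) + vec (hat w)" "a : carrier R ==> vec (hat (smult Ys a
  v)) = sm (emb a) (vec (hat v))" "g permutes {1..p} ==> vec (hat (act Ys g v)) = Pm g * vec (hat
  v)" by (simp_all add: assms Ss_hat(1) Ss_Ys hat_add hat_smult hat_act vec_add vec_smult Pm_vec
  N_eq)

lemma phi_zero: "vec (hat (zero Ys)) = 0" by (simp add: Ys_ops hat_zero)

lemma phi_inj: "v : carrier Ss ==> w : carrier Ss ==> vec (hat v) = vec (hat w) ==> v = w" by (intro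
 hat_inj vec_inj Ss_hat Ss_Ys)

text \<open>The image is a submodule containing a polytabloid, which \<open>Cr\<close> does not
  kill, so it is everything by maximality. No standard basis or dimension count is involved.\<close>

lemma phi_surj:
 assumes z: "z : Zk k" obtains v where "v : carrier Ss" "vec (hat v) = z" proof -
 let ?V = "(%v. vec (hat v)) ` carrier Ss"
 obtain T where T: "T : tableaux ((p - k) # replicate k 1) p" using hook_tableau_exists[of k p] k by
  auto
 obtain c0 cs where c: "distinct (c0 # cs)" "insert c0 (set cs) <= N" "length cs = k" "hat
  (polytabloid R p T) = polyfun (insert c0 (set cs)) cs" by (rule tableau[OF T])
 let ?f = "vec (hat (polytabloid R p T))"
 have f: "polytabloid R p T : carrier Ss" using Ss_span(2) T by auto
 have "Zk k <= ?V" proof (rule Zk_maximal_group[where f = ?f])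
  show "?V <= Zk k" using Ss_hat by auto
  show "0 : ?V" by (rule image_eqI[where x = "zero Ys"]) (simp_all add: phi_zero Ss_closed(1))
  show "?f : ?V" using f by simp
  show "Cr * ?f ~= 0" using polyfun_Cr[OF refl c(1,2)] c(3,4) k by simp
  next fix x y assume "x : ?V" "y : ?V"
  then obtain v w where "v : carrier Ss" "x = vec (hat v)" "w : carrier Ss" "y = vec (hat w)" by
   auto
  thus "x + y : ?V" by (intro image_eqI[where x = "add Ys v w"]) (simp_all add: phi(1) Ss_closed(2))
  next fix a x assume a: "a : emb ` carrier R" and x: "x : ?V"
  obtain b where b: "b : carrier R" "a = emb b" using a by auto
  obtain v where v: "v : carrier Ss" "x = vec (hat v)" using x by auto
  show "sm a x : ?V" by (rule image_eqI[where x = "smult Ys b v"]) (use b v phi(2)[OF v(1) v(1)]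
   Ss_closed(3) in simp_all)
  next fix g x assume g: "g permutes N" and x: "x : ?V"
  obtain v where v: "v : carrier Ss" "x = vec (hat v)" using x by auto
  show "Pm g * x : ?V" by (rule image_eqI[where x = "act Ys g v"]) (use g v phi(3)[OF v(1) v(1)]
   Ss_act in "simp_all add: N_eq")
 qed (use k in simp)
 thus ?thesis using z that by auto
qed

lemma kap_nonzero: obtains v where "v : vecs (kap k)" "v ~= 0" proof -
 have "kap k ~= 0" using null_hk[OF k] by auto
 moreover have "kap k = 0" if "!!v. v : vecs (kap k) ==> v = 0" by (rule cols_test[of _ _ "kap k"])
  (use that vecs_idem in "auto simp: kap_idem")
 ultimately show ?thesis using that by auto
qed

text \<open>An element outside the kernel of \<open>Cr\<close> generates the whole Specht module, so
  it cannot be killed by a map onto a nonzero module.\<close>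

lemma gsubmodule_phi:
 assumes "Gmod D" "qi : Ghom Ss D" "simple_module R Sy D" "qi ` carrier Ss = carrier D" "v : carrier
  Ss" "qi v = zero D"
 shows "Cr * vec (hat v) = 0" proof (rule ccontr)
 assume nz: "Cr * vec (hat v) ~= 0"
 interpret D: group_module R Sy D by (rule assms(1))
 interpret Y: group_module R Sy Ys by (rule Ys_gm)
 have h: "!!x y. x : carrier Ss ==> y : carrier Ss ==> qi (add Ys x y) = add D (qi x) (qi y)" "!!a
  x. a : carrier R ==> x : carrier Ss ==> qi (smult Ys a x) = smult D a (qi x)" "!!g x. g : carrier
  Sy ==> x : carrier Ss ==> qi (act Ys g x) = act D g (qi x)" using assms(2) by (auto simp:
  gmod_hom_def Ss_def')
 have act0: "act D g (zero D) = zero D" if "g : carrier Sy" for g using D.act_add[OF that, of "zero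
  D" "zero D"] D.act_closed[OF that, of "zero D"] by simp
 let ?M = "{v : carrier Ss. qi v = zero D}"
 let ?U = "(%v. vec (hat v)) ` ?M"
 have z: "zero Ys : ?M" using Ss_Ys assms(5) h(2) assms(6) Ss_closed(1) by fastforce
 have "Zk k <= ?U" proof (rule Zk_maximal_group[where f = "vec (hat v)"])
  show "?U <= Zk k" using Ss_hat by auto
  show "0 : ?U" by (rule image_eqI[where x = "zero Ys"]) (use z in "simp_all add: phi_zero")
  show "vec (hat v) : ?U" "Cr * vec (hat v) ~= 0" using assms nz by auto
  next fix x y assume "x : ?U" "y : ?U"
  then obtain v w where v: "v : ?M" "x = vec (hat v)" and w: "w : ?M" "y = vec (hat w)" by auto
  show "x + y : ?U" by (rule image_eqI[where x = "add Ys v w"]) (use v w phi(1) Ss_closed(2) h(1) in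
   auto)
  next fix a x assume a: "a : emb ` carrier R" and x: "x : ?U"
  obtain b where b: "b : carrier R" "a = emb b" using a by auto
  obtain v where v: "v : ?M" "x = vec (hat v)" using x by auto
  show "sm a x : ?U" by (rule image_eqI[where x = "smult Ys b v"]) (use b v phi(2)[of v v]
   Ss_closed(3) h(2) in auto)
  next fix g x assume g: "g permutes N" and x: "x : ?U"
  obtain v where v: "v : ?M" "x = vec (hat v)" using x by auto
  show "Pm g * x : ?U" by (rule image_eqI[where x = "act Ys g v"]) (use g v phi(3)[of v v] Ss_act
   h(3) act0 in "auto simp: N_eq permutes_carrier")
 qed (use k in simp)
 hence "qi w = zero D" if "w : carrier Ss" for w using Ss_hat(2)[OF that] phi_inj[OF that] by auto
 hence "carrier D = {zero D}" using assms(4,5) by auto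
 thus False using assms(3) by (simp add: simple_module_def)
qed

lemma simple_quotient_mdl:
 assumes D: "Gmod D" "simple_module R Sy D" and qi: "qi : gmod_epi R Sy Ss D"
 shows "mdl D (hk k)" proof -
 interpret D: group_module R Sy D by (rule D(1))
 interpret Y: group_module R Sy Ys by (rule Ys_gm)
 have hom: "qi : Ghom Ss D" and sur: "qi ` carrier Ss = carrier D" using qi by (auto simp:
  gmod_epi_def)
 have h: "!!x y. x : carrier Ss ==> y : carrier Ss ==> qi (add Ys x y) = add D (qi x) (qi y)" "!!a
  x. a : carrier R ==> x : carrier Ss ==> qi (smult Ys a x) = smult D a (qi x)" "!!g x. g : carrier
  Sy ==> x : carrier Ss ==> qi (act Ys g x) = act D g (qi x)" using hom by (auto simp: gmod_hom_def
  Ss_def')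
 have m1: "\<ominus> \<one> : carrier R" by simp
 have Dneg: "add D x (smult D (\<ominus> \<one>) y) = x \<ominus>\<^bsub>D\<^esub> y" if "x :
  carrier D" "y : carrier D" for x y by (simp add: that D.smult_l_minus a_minus_def)
 \<comment> \<open>Two preimages of d differ by an element of the kernel of qi, which
   \<open>Cr\<close> kills by \<open>gsubmodule_phi\<close>; so the chosen preimage does not
   matter.\<close>
 define c where "c d = Cr * vec (hat (SOME v. v : carrier Ss & qi v = d))" for d
 have c: "c (qi v) = Cr * vec (hat v)" if v: "v : carrier Ss" for v proof -
  define w where "w = (SOME w. w : carrier Ss & qi w = qi v)"
  have w: "w : carrier Ss" "qi w = qi v" by (auto simp: w_def someI[of "%w. w : carrier Ss & qi w =
   qi v" v] v)
  let ?x = "add Ys v (smult Ys (\<ominus> \<one>) w)"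
  have pv: "qi v : carrier D" using sur v by auto
  have "qi ?x = zero D" by (simp add: h(1)[OF v Ss_closed(3)[OF m1 w(1)]] h(2)[OF m1 w(1)] w(2) Dneg
   pv a_minus_def D.r_neg)
  hence "Cr * vec (hat ?x) = 0" by (rule gsubmodule_phi[OF D(1) hom D(2) sur Ss_closed(2)[OF v
   Ss_closed(3)[OF m1 w(1)]]])
  moreover have "sm (emb (\<ominus> \<one>)) (vec (hat w)) = - vec (hat w)" by (simp add: ZkD(5)[OF
   Ss_hat(2)[OF w(1)]] emb_minus sm_minus_left)
  ultimately show ?thesis by (simp add: phi(1)[OF v Ss_closed(3)[OF m1 w(1)]] phi(2)[OF w(1) w(1)
   m1] c_def w_def[symmetric] rdiff)
 qed
 have ex: "EX v. v : carrier Ss & qi v = d" if "d : carrier D" for d using that[folded sur] by auto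
 have cadd: "c (add D d d') = c d + c d'" if dd: "d : carrier D" "d' : carrier D" for d d' proof -
  obtain v w where v: "v : carrier Ss" "qi v = d" and w: "w : carrier Ss" "qi w = d'" using ex[OF
   dd(1)] ex[OF dd(2)] by auto
  show ?thesis using c[OF Ss_closed(2)[OF v(1) w(1)]] h(1) c[OF v(1)] c[OF w(1)] phi(1) v w by (simp
   add: distrib_left)
 qed
 have csm: "c (smult D a d) = sm (emb a) (c d)" if ad: "a : carrier R" "d : carrier D" for a d proof
  -
  obtain v where v: "v : carrier Ss" "qi v = d" using ex[OF ad(2)] by auto
  show ?thesis using c[OF Ss_closed(3)[OF ad(1) v(1)]] h(2)[OF ad(1) v(1)] c[OF v(1)] phi(2)[OF v(1)
   v(1) ad(1)] v by (simp add: sm_mult)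
 qed
 have cvec: "c d : vecs (kap k)" if "d : carrier D" for d using ex[OF that] c Zk_Cr[OF Ss_hat(2)] by
  auto
 have cact: "c (act D g d) = hk k g * c d" if g: "g : carrier Sy" and d: "d : carrier D" for g d
  proof -
  obtain v where v: "v : carrier Ss" "qi v = d" using ex[OF d] by auto
  have gp: "g permutes {1..p}" using g by (simp add: permutes_carrier)
  have "c (act D g d) = Cr * (Pm g * vec (hat v))" using c[OF Ss_act[OF v(1) gp]] h(3)[OF g v(1)]
   phi(3)[OF v(1) v(1) gp] v by simp
  also have "... = Pm g * c d" using shift[OF Pm_Cr, of g "vec (hat v)"] gp c[OF v(1)] v by (simp
   add: N_eq massoc)
  finally show ?thesis using hk_apply[OF cvec[OF d]] by simp
 qed
 have c0: "c (zero D) = 0" using cadd[of "zero D" "zero D"] by simp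
 have sur': "EX d:carrier D. c d = v" if v: "v : vecs (kap k)" for v proof -
  obtain w where "w : carrier Ss" "vec (hat w) = an 1 * v" using phi_surj[OF Cr_Zk(1)[OF v]] by auto
  thus ?thesis using c[of w] Cr_Zk(2)[OF v] sur by auto
 qed
 let ?H = "{d : carrier D. c d = 0}"
 have "Gsub D ?H" unfolding gsubmodule_def by (intro conjI submodule_closedI[OF D(1)]) (auto simp:
  c0 cadd csm cact D.act_closed)
 hence "?H = {zero D} | ?H = carrier D" using D(2) by (auto simp: simple_module_def)
 moreover have "?H ~= carrier D" using kap_nonzero sur' by auto
 ultimately have ker: "d = zero D" if "d : carrier D" "c d = 0" for d using that by auto
 have "inj_on c (carrier D)" proof (rule inj_onI)
  fix x y assume xy: "x : carrier D" "y : carrier D" "c x = c y"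
  have "c (add D x (smult D (\<ominus> \<one>) y)) = 0" by (simp add: xy cadd csm cols_MK[OF
   vecs_cols[OF cvec[OF xy(2)]]] emb_minus sm_minus_left)
  thus "x = y" using ker xy Dneg D.minus_equality[of x "a_inv D y"] by (simp add: a_minus_def)
 qed
 moreover have "c ` carrier D = vecs (kap k)" using cvec sur' by auto
 ultimately have "coords D (hk k) c" by (simp add: coords_def cadd csm cact bij_betw_def)
 thus ?thesis by (auto simp: mdl_def D(1))
qed

text \<open>The hook module itself is a simple quotient by \<open>Zk_maximal_group\<close>, so the
  choice in \<open>simple_D\<close> is not void; \<open>simple_quotient_mdl\<close> then applies to
  whatever is chosen.\<close>

lemma simple_quotient_exists: "EX D :: ('a, nat => nat) vec_gmodule. Gfd D & simple_module R Sy D &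
 gmod_epi R Sy Ss D ~= {}" proof -
 define D where "D = std (hk k)"
 have m: "mdl D (hk k)" unfolding D_def by (rule mdl_std[OF hk_rep])
 then obtain c where D: "Gmod D" "coords D (hk k) c" by (auto simp: mdl_def)
 interpret D: group_module R Sy D by (rule D(1))
 note C = coordsD[OF D(2), unfolded unt_hk]
 have c0: "c (zero D) = 0" by (rule coords_zero[OF D])
 have ci: "x = y" if "x : carrier D" "y : carrier D" "c x = c y" for x y using C(2) that by (auto
  simp: inj_on_def)
 have simple: "simple_module R Sy D" unfolding simple_module_def proof (intro conjI allI impI)
  obtain v where "v : vecs (kap k)" "v ~= 0" by (rule kap_nonzero)
  thus "carrier D ~= {zero D}" using C(4) c0 by auto
  fix M assume M: "Gsub D M"
  hence sub: "submodule M R D" by (simp add: gsubmodule_def)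
  note ME = D.submoduleE[OF sub]
  have z: "zero D : M" using subgroup.one_closed[OF submodule.axioms(1)[OF sub]] by simp
  show "M = {zero D} | M = carrier D" proof (cases "M = {zero D}")
   case False
   then obtain x where x: "x : M" "x ~= zero D" using z by auto
   let ?U = "{v : Zk k. Cr * v : c ` M}"
   have xD: "x : carrier D" using ME(1) x by auto
   have ex: "an 1 * c x : ?U" "Cr * (an 1 * c x) ~= 0" using Cr_Zk[OF C(3)[OF xD]] x ci[OF xD, of
    "zero D"] c0 by auto
   have "Zk k <= ?U" proof (rule Zk_maximal_group[OF _ _ _ _ _ ex k])
    show "0 : ?U" using z c0 by (auto simp: Zk_def)
    next fix v w assume vw: "v : ?U" "w : ?U"
    then obtain x y where x: "x : M" "Cr * v = c x" and y: "y : M" "Cr * w = c y" by auto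
    have "x : carrier D" "y : carrier D" using ME(1) x y by auto
    hence "Cr * (v + w) = c (add D x y)" by (simp add: x y distrib_left C(5))
    thus "v + w : ?U" using vw ME(5)[OF x(1) y(1)] by (auto simp: Zk_def distrib_left)
    next fix a v assume a: "a : emb ` carrier R" and v: "v : ?U"
    then obtain x b where x: "x : M" "Cr * v = c x" and b: "b : carrier R" "a = emb b" by auto
    have "x : carrier D" using ME(1) x by auto
    hence "Cr * sm a v = c (smult D b x)" by (simp add: x b sm_mult C(6))
    thus "sm a v : ?U" using v a ME(4)[OF b(1) x(1)] by (auto simp: Zk_def sm_mult)
    next fix g v assume g: "g permutes N" and v: "v : ?U"
    then obtain x where x: "x : M" "Cr * v = c x" by auto
    have gG: "g : carrier Sy" using g by (simp add: permutes_carrier N_eq)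
    have xc: "x : carrier D" using ME(1) x by auto
    have "Cr * (Pm g * v) = c (act D g x)" using shift[OF Pm_Cr[OF g], of v] x C(7)[OF gG xc]
     hk_apply[OF C(3)[OF xc]] by (simp add: massoc)
    moreover have "act D g x : M" using M gG x by (auto simp: gsubmodule_def)
    moreover have "Pm g * v : Zk k" using v g shift[OF Pm_An[OF g, symmetric], of v] shift[OF
     Pm_Qd[OF g, symmetric], of k v] ZkD[of v k] OpD(1)[OF Pm_Op[OF g]] by (intro ZkI) (auto simp:
     OpL' massoc)
    ultimately show "Pm g * v : ?U" by auto
   qed blast
   have "y : M" if y: "y : carrier D" for y proof -
    have "Cr * (an 1 * c y) : c ` M" using Cr_Zk(1)[OF C(3)[OF y]] \<open>Zk k <= ?U\<close> by auto
    hence "c y : c ` M" unfolding Cr_Zk(2)[OF C(3)[OF y]] .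
    thus ?thesis using ci[OF y] ME(1) by auto
   qed
   thus ?thesis using ME(1) by auto
 qed simp qed
 define th where "th v = the_inv_into (carrier D) c (Cr * vec (hat v))" for v
 have th: "th v : carrier D" "c (th v) = Cr * vec (hat v)" if "v : carrier Ss" for v proof -
  have "Cr * vec (hat v) : c ` carrier D" using C(4)[OF Zk_Cr[OF Ss_hat(2)[OF that]]] by (metis
   imageI)
  thus "th v : carrier D" "c (th v) = Cr * vec (hat v)" by (auto simp: th_def the_inv_into_into[OF
   C(2)] f_the_inv_into_f[OF C(2)])
 qed
 have "th : gmod_epi R Sy Ss D" unfolding gmod_epi_def gmod_hom_def Ss_def'(3-5) proof (intro
  CollectI conjI ballI funcsetI)
  show "th v : carrier D" if "v : carrier Ss" for v by (rule th(1)[OF that])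
  show "th (add Ys v w) = add D (th v) (th w)" if v: "v : carrier Ss" and w: "w : carrier Ss" for v
   w using th v w Ss_closed(2)[OF v w] C(5) phi(1)[OF v w] by (intro ci) (auto simp: distrib_left)
  show "th (smult Ys a v) = smult D a (th v)" if a: "a : carrier R" and v: "v : carrier Ss" for a v
   using th v a Ss_closed(3)[OF a v] C(6) phi(2)[OF v v a] by (intro ci) (auto simp: sm_mult)
  show "th (act Ys g v) = act D g (th v)" if g: "g : carrier Sy" and v: "v : carrier Ss" for g v
   proof (rule ci)
   have gp: "g permutes {1..p}" using g by (simp add: permutes_carrier)
   show "th (act Ys g v) : carrier D" by (rule th(1)[OF Ss_act[OF v gp]])
   show "act D g (th v) : carrier D" by (rule D.act_closed[OF g th(1)[OF v]])
   have "c (th (act Ys g v)) = Cr * (Pm g * vec (hat v))" using th(2)[OF Ss_act[OF v gp]] phi(3)[OF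
    v v gp] by simp
   also have "... = Pm g * c (th v)" using shift[OF Pm_Cr, of g "vec (hat v)"] gp th(2)[OF v] by
    (simp add: N_eq massoc)
   also have "... = c (act D g (th v))" using C(7)[OF g th(1)[OF v]] hk_apply[OF C(3)[OF th(1)[OF
    v]]] by simp
   finally show "c (th (act Ys g v)) = c (act D g (th v))" .
  qed
  show "th ` carrier Ss = carrier D" proof
   show "th ` carrier Ss <= carrier D" using th(1) by auto
   show "carrier D <= th ` carrier Ss" proof
    fix d assume d: "d : carrier D"
    obtain v where v: "v : carrier Ss" "vec (hat v) = an 1 * c d" using phi_surj[OF Cr_Zk(1)[OF
     C(3)[OF d]]] by auto
    hence "th v = d" using ci[OF th(1)[OF v(1)] d] th(2)[OF v(1)] Cr_Zk(2)[OF C(3)[OF d]] by simp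
    thus "d : th ` carrier Ss" using v(1) by auto
 qed qed qed
 thus ?thesis using simple mdl_fd[OF m] by auto
qed

theorem mdl_hook_D: "mdl (hook_D R k p) (hk k)" proof -
 from someI_ex[OF simple_quotient_exists] have "Gfd (hook_D R k p)" "simple_module R Sy (hook_D R k
  p)" "gmod_epi R Sy Ss (hook_D R k p) ~= {}" by (auto simp: hook_D_def simple_D_def)
 thus ?thesis by (auto simp: simple_quotient_mdl fd_module_def)
qed
end
end
declare One_nat_def [simp]
context hooked
begin

section \<open>Multiplicities in tensor powers of Heller translates\<close>

lemma mdl_heller_power:
 assumes "mdl V rh" obtains om where "mdl (heller_power R Sy s V) om" "syzn s om rh" proof -
 have "EX om. mdl (heller_power R Sy s V) om & syzn s om rh" proof (induction s)
  case 0
  thus ?case by (auto simp: assms heller_power_def)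
  next case (Suc s)
  then obtain om where om: "mdl (heller_power R Sy s V) om" "syzn s om rh" by auto
  obtain om' where "mdl (heller R Sy (heller_power R Sy s V)) om'" "syz om' om" using mdl_heller[OF
   om(1)] by metis
  thus ?case using om(2) by (auto simp: heller_power_def)
 qed
 thus ?thesis using that by auto
qed

text \<open>The induction carries the bricks and the transfer of multiplicities from hooks to their
  translates together, because both must refer to the same syzygies W.\<close>

lemma heller_bricks: obtains W where "!!t. t <= p - 2 ==> mdl (heller_power R Sy s (hook_D R t p))
 (W t)" "bricks {..p - 2} W" "!!om rh m. syzn s om rh ==> decT rh m ==> dec {..p - 2} W om m" proof
 -
 have "EX W. (ALL t:{..p - 2}. mdl (heller_power R Sy s (hook_D R t p)) (W t)) & bricks {..p - 2} W
  & (ALL om rh m. syzn s om rh --> decT rh m --> dec {..p - 2} W om m)" proof (induction s)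
  case 0
  have "mdl (hook_D R t p) (hk t)" if "t : {..p - 2}" for t using that p_ge by (intro mdl_hook_D)
   auto
  thus ?case using bricks_hk by (intro exI[of _ hk]) (auto simp: heller_power_def)
  next case (Suc s)
  then obtain W where W: "!!t. t : {..p - 2} ==> mdl (heller_power R Sy s (hook_D R t p)) (W t)"
   "bricks {..p - 2} W" "!!om rh m. syzn s om rh ==> decT rh m ==> dec {..p - 2} W om m" by blast
  have "ALL t:{..p - 2}. EX om. mdl (heller_power R Sy (Suc s) (hook_D R t p)) om & syz om (W t) &
   (ALL q. q : homs om om --> q * q = q --> null om om q --> q = 0)" proof
   fix t assume "t : {..p - 2}"
   thus "EX om. mdl (heller_power R Sy (Suc s) (hook_D R t p)) om & syz om (W t) & (ALL q. q : homs
    om om --> q * q = q --> null om om q --> q = 0)" using mdl_heller[OF W(1)] unfolding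
    heller_power_def by (simp only: funpow.simps comp_apply) metis
  qed
  from bchoice[OF this] obtain W' where W': "ALL t:{..p - 2}. mdl (heller_power R Sy (Suc s) (hook_D
   R t p)) (W' t) & syz (W' t) (W t) & (ALL q. q : homs (W' t) (W' t) --> q * q = q --> null (W' t)
   (W' t) q --> q = 0)"
  ..
  show ?case proof (intro exI[of _ W'] conjI allI impI)
   show "bricks {..p - 2} W'" by (rule bricks_syz[OF W(2)]) (use W' in blast)+
   fix om rh m assume "syzn (Suc s) om rh" and d: "decT rh m"
   then obtain om' where om': "syz om om'" "syzn s om' rh" by auto
   show "dec {..p - 2} W' om m" by (rule dec_syz[OF W(3)[OF om'(2) d] om'(1) W'[THEN bspec, THEN
    conjunct2, THEN conjunct1]])
  qed (rule ballI, erule W'[THEN bspec, THEN conjunct1])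
 qed
 thus ?thesis by (elim exE conjE) (rule that; blast)
qed

text \<open>The tensor power of the r-th translate is an (n r)-th syzygy of the tensor power of the
  hook, so its multiplicities with respect to the (n r)-th translates are those of r = 0.\<close>

theorem summand_mult_heller:
 assumes "k <= p - 2" "n * k <= p - 2" "t <= p - 2"
 shows "summand_mult R Sy (tensor_power R Sy (heller_power R Sy r (hook_D R k p)) n) (heller_power R
  Sy (n * r) (hook_D R t p)) = hook_mult k n t" proof -
 have "mdl (hook_D R k p) (hk k)" using assms(1) p_ge by (intro mdl_hook_D) auto
 then obtain om where om: "mdl (heller_power R Sy r (hook_D R k p)) om" "syzn r om (hk k)" by (rule
  mdl_heller_power)
 obtain W where W: "!!t. t <= p - 2 ==> mdl (heller_power R Sy (n * r) (hook_D R t p)) (W t)"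
  "bricks {..p - 2} W" "!!om rh m. syzn (n * r) om rh ==> decT rh m ==> dec {..p - 2} W om m" by
  (rule heller_bricks[of "n * r"]) blast
 have "dec {..p - 2} W (tpow om n) (hook_mult k n)" by (rule W(3)[OF syzn_tpow[OF om(2) hk_rep]
  dec_tpow_hk[OF assms(2)]])
 thus ?thesis using summand_mult_eq[OF mdl_tensor_power[OF om(1)] W(2) _ _ W(1)[OF assms(3)]]
  assms(3) by simp
qed
end

section \<open>A commutative ring containing all fields on a type\<close>

text \<open>The integer component only serves to make the ring nontrivial.\<close>

typedef 'a kprod = "{x :: int \<times> ('a ring => 'a). ALL i. (cring i --> snd x i : carrier i) &
 (~cring i --> snd x i = undefined)}" proof
 show "(0, %i. if cring i then zero i else undefined) : {x :: int \<times> ('a ring => 'a). ALL i.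
  (cring i --> snd x i : carrier i) & (~cring i --> snd x i = undefined)}" by (auto intro:
  cring.cring_simprules)
qed
setup_lifting type_definition_kprod

text \<open>Fixing the value where the index is not a commutative ring makes equality of elements
  equality at all commutative rings.\<close>

definition pw_op :: "('a ring => 'a) => 'a ring => 'a" where "pw_op f = (%i. if cring i then f i
 else undefined)"

lemma pw_op_apply [simp]: "cring i ==> pw_op f i = f i" "~cring i ==> pw_op f i = undefined" by
 (simp_all add: pw_op_def)

lemma pw_op_eqI: "(!!i. cring i ==> f i = g i) ==> pw_op f = pw_op g" by (auto simp: pw_op_def)

lemma cring_laws:
 assumes "cring (i :: 'a ring)"
 shows "zero i : carrier i" "one i : carrier i" "x : carrier i ==> y : carrier i ==> add i x y :
  carrier i" "x : carrier i ==> y : carrier i ==> mult i x y : carrier i" "x : carrier i ==> a_inv i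
  x : carrier i" "x : carrier i ==> y : carrier i ==> z : carrier i ==> add i (add i x y) z = add i
  x (add i y z)" "x : carrier i ==> y : carrier i ==> z : carrier i ==> mult i (mult i x y) z = mult
  i x (mult i y z)" "x : carrier i ==> y : carrier i ==> z : carrier i ==> mult i (add i x y) z =
  add i (mult i x z) (mult i y z)" "x : carrier i ==> add i (zero i) x = x" "x : carrier i ==> add i
  x (zero i) = x" "x : carrier i ==> mult i (one i) x = x" "x : carrier i ==> add i (a_inv i x) x =
  zero i" "mult i (zero i) (zero i) = zero i" by (auto intro: assms cring.cring_simprules)

lemma cring_comm:
 assumes "cring (i :: 'a ring)" "x : carrier i" "y : carrier i"
 shows "add i x y = add i y x" "mult i x y = mult i y x" using assms by (auto intro:
  cring.cring_simprules)

instantiation kprod :: (type) comm_ring_1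
begin

lift_definition zero_kprod :: "'a kprod" is "(0, pw_op (%i. zero i))" by (auto simp: cring_laws)

lift_definition one_kprod :: "'a kprod" is "(1, pw_op (%i. one i))" by (auto simp: cring_laws)

lift_definition plus_kprod :: "'a kprod => 'a kprod => 'a kprod" is "%x y. (fst x + fst y, pw_op
 (%i. add i (snd x i) (snd y i)))" by (auto simp: cring_laws)

lift_definition times_kprod :: "'a kprod => 'a kprod => 'a kprod" is "%x y. (fst x * fst y, pw_op
 (%i. mult i (snd x i) (snd y i)))" by (auto simp: cring_laws)

lift_definition uminus_kprod :: "'a kprod => 'a kprod" is "%x. (- fst x, pw_op (%i. a_inv i (snd x
 i)))" by (auto simp: cring_laws)

definition minus_kprod :: "'a kprod => 'a kprod => 'a kprod" where "minus_kprod x y = x + - y"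

instance proof
 fix a b c :: "'a kprod"
 have id: "pw_op (snd x) = snd x" if "ALL i. (cring i --> snd x i : carrier i) & (~cring i --> snd x
  i = undefined)" for x :: "int \<times> ('a ring => 'a)" by (auto simp: that pw_op_def)
 show "a + b + c = a + (b + c)" by transfer (auto intro!: pw_op_eqI simp: cring_laws)
 show "a * b * c = a * (b * c)" by transfer (auto intro!: pw_op_eqI simp: cring_laws)
 show "(a + b) * c = a * c + b * c" by transfer (auto intro!: pw_op_eqI simp: cring_laws
  distrib_right)
 show "a + b = b + a" by transfer (auto intro!: pw_op_eqI intro: cring_comm)
 show "a * b = b * a" by transfer (auto intro!: pw_op_eqI intro: cring_comm)
 show "- a + a = 0" by transfer (auto intro!: pw_op_eqI simp: cring_laws)
 show "0 + a = a" proof transfer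
  fix x :: "int \<times> ('a ring => 'a)"
  assume x: "ALL i. (cring i --> snd x i : carrier i) & (~cring i --> snd x i = undefined)"
  have "pw_op (%i. add i (pw_op (%i. zero i) i) (snd x i)) = pw_op (snd x)" using x by (intro
   pw_op_eqI) (simp add: cring_laws)
  thus "(fst (0, pw_op (%i. zero i)) + fst x, pw_op (%i. add i (snd (0, pw_op (%i. zero i)) i) (snd
   x i))) = x" using id[OF x] by simp
 qed
 show "1 * a = a" proof transfer
  fix x :: "int \<times> ('a ring => 'a)"
  assume x: "ALL i. (cring i --> snd x i : carrier i) & (~cring i --> snd x i = undefined)"
  have "pw_op (%i. mult i (pw_op (%i. one i) i) (snd x i)) = pw_op (snd x)" using x by (intro
   pw_op_eqI) (simp add: cring_laws)
  thus "(fst (1, pw_op (%i. one i)) * fst x, pw_op (%i. mult i (snd (1, pw_op (%i. one i)) i) (snd x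
   i))) = x" using id[OF x] by simp
 qed
 show "a - b = a + - b" by (simp add: minus_kprod_def)
 show "(0::'a kprod) ~= 1" by transfer simp
qed
end

text \<open>A type cannot depend on the field, so the factors range over all commutative ring
  structures on \<open>'a\<close> and a field is placed in the factor indexed by itself. All other
  components are zero, including the integer.\<close>

lift_definition kemb :: "'a ring => 'a => 'a kprod" is "%r x. (0, pw_op (%i. if i = r & x : carrier
 r then x else zero i))" by (auto simp: cring_laws)

text \<open>Factors are indexed by plain ring records, so further record fields have to be
  dropped.\<close>

definition forget :: "('a, 'm) ring_scheme => 'a ring" where "forget R = \<lparr>carrier = carrier
 R, mult = mult R, one = one R, zero = zero R, add = add R\<rparr>"

lemma cring_forget:
 fixes R :: "('a, 'm) ring_scheme"
 assumes "field R"
 shows "cring (forget R)" proof -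
 interpret field R by (rule assms)
 show ?thesis proof (rule cringI)
  show "abelian_group (forget R)" by (rule abelian_groupI) (auto simp: forget_def a_comm a_lcomm)
  show "comm_monoid (forget R)" by (rule comm_monoidI) (auto simp: forget_def m_comm m_lcomm)
qed (auto simp: forget_def l_distr) qed

lemma kemb_hooked:
 fixes R :: "('a, 'm) ring_scheme"
 assumes R: "field R" and "prime p" "3 <= p" "has_characteristic R p"
 shows "hooked R p (kemb (forget R))" proof -
 interpret field R by (rule R)
 interpret S: group "sym_group p" by (rule sym_group_is_group)
 note cf = cring_forget[OF R]
 have [simp]: "carrier (forget R) = carrier R" "zero (forget R) = zero R" "add (forget R) = add R"
  "mult (forget R) = mult R" by (simp_all add: forget_def)
 show ?thesis proof (unfold_locales)
  show "finite (carrier (sym_group p))" using finite_permutations[of "{1..p}"] by (simp add: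
   sym_group_def)
  show "inj_on (kemb (forget R)) (carrier R)" proof (rule inj_onI)
   fix x y assume xy: "x : carrier R" "y : carrier R" "kemb (forget R) x = kemb (forget R) y"
   from xy(3) have "pw_op (%i. if i = forget R & x : carrier (forget R) then x else zero i) (forget
    R) = pw_op (%i. if i = forget R & y : carrier (forget R) then y else zero i) (forget R)" by
    transfer simp
   thus "x = y" using xy cf by simp
  qed
  let ?e = "%x i. if i = forget R & x : carrier (forget R) then x else zero i"
  fix x y assume xy: "x : carrier R" "y : carrier R"
  have "?e (add R x y) i = add i (?e x i) (?e y i)" "?e (mult R x y) i = mult i (?e x i) (?e y i)"
   if "cring i" for i using xy that by (cases "i = forget R"; simp add: cring_laws)+
  hence "pw_op (?e (add R x y)) = pw_op (%i. add i (pw_op (?e x) i) (pw_op (?e y) i))" "pw_op (?e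
   (mult R x y)) = pw_op (%i. mult i (pw_op (?e x) i) (pw_op (?e y) i))" by (intro pw_op_eqI; simp)+
  thus "kemb (forget R) (add R x y) = kemb (forget R) x + kemb (forget R) y" "kemb (forget R) (mult
   R x y) = kemb (forget R) x * kemb (forget R) y" by (transfer; simp)+
qed (use assms in auto) qed

lemma summand_mult_hook:
 fixes R :: "('a, 'm) ring_scheme"
 assumes "algebraically_closed R" "prime p" "3 <= p" "has_characteristic R p" and "k <= p - 2" "n *
  k <= p - 2" "t <= p - 2"
 shows "summand_mult R (sym_group p) (tensor_power R (sym_group p) (heller_power R (sym_group p) r
  (hook_D R k p)) n) (heller_power R (sym_group p) (n * r) (hook_D R t p)) = hook_mult k n t" proof
  -
 have "field R" using assms(1) by (simp add: algebraically_closed_def)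
 then interpret hooked R p "kemb (forget R)" by (rule kemb_hooked) (use assms in auto)
 show ?thesis by (rule summand_mult_heller[OF assms(5-7)])
qed

theorem theorem6p4:
  fixes F :: "nat \<Rightarrow> ('a, 'm) ring_scheme"
  assumes "\<And>p. prime p \<Longrightarrow> p \<ge> 3 \<Longrightarrow> algebraically_closed (F p)"
    and "\<And>p. prime p \<Longrightarrow> p \<ge> 3 \<Longrightarrow> has_characteristic (F p) p"
  shows
    "(\<forall>k n :: nat. n \<ge> 1 \<longrightarrow>
       (\<exists>p. prime p \<and> p \<ge> 3 \<and> k \<le> p - 2 \<and>
         (\<forall>r \<in> {0..2 * p - 3}. \<forall>q. prime q \<and> q \<ge> p \<longrightarrow> (\<forall>t \<in> {0..q - 2}.
            summand_mult (F q) (sym_group q)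
              (tensor_power (F q) (sym_group q)
                 (heller_power (F q) (sym_group q) r (hook_D (F q) k q)) n)
              (heller_power (F q) (sym_group q) (n * r) (hook_D (F q) t q))
            = (if t \<le> p - 2
               then summand_mult (F p) (sym_group p)
                      (tensor_power (F p) (sym_group p)
                         (heller_power (F p) (sym_group p) r (hook_D (F p) k p)) n)
                      (heller_power (F p) (sym_group p) (n * r) (hook_D (F p) t p))
               else 0)))))
     \<and> (\<forall>k t n :: nat. \<exists>L :: real.
          ((\<lambda>p. real (summand_mult (F p) (sym_group p)
                         (tensor_power (F p) (sym_group p) (hook_D (F p) k p) n)
                         (hook_D (F p) t p)))
             \<longlongrightarrow> L) (inf at_top (principal {p. prime p})))"
proof (intro conjI allI impI)
 let ?m = "%q r k n t. summand_mult (F q) (sym_group q) (tensor_power (F q) (sym_group q)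
  (heller_power (F q) (sym_group q) r (hook_D (F q) k q)) n) (heller_power (F q) (sym_group q) (n *
  r) (hook_D (F q) t q))"
 have main: "?m q r k n t = hook_mult k n t" if "prime q" "3 <= q" "k <= q - 2" "n * k <= q - 2" "t
  <= q - 2" for q r k n t using that assms by (intro summand_mult_hook) auto
 show "EX p. prime p & p >= 3 & k <= p - 2 & (ALL r : {0..2 * p - 3}. ALL q. prime q & q >= p -->
  (ALL t : {0..q - 2}. ?m q r k n t = (if t <= p - 2 then ?m p r k n t else 0)))" if "1 <= n" for k
  n proof -
  \<comment> \<open>The bound makes k and n k at most p - 2. By \<open>hook_mult_support\<close> the
    multiplicity is then 0 for t > p - 2, and both sides are values of the same p-free
    function.\<close>
  obtain p where p: "prime p" "k + n * k + 3 < p" using bigger_prime by auto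
  have "?m q r k n t = (if t <= p - 2 then ?m p r k n t else 0)" if "prime q & p <= q" "t : {0..q -
   2}" for r q t using that main[of q k n t r] main[of p k n t r] hook_mult_support[of n k t] p by
   auto
  thus ?thesis using p by (intro exI[of _ p]) simp
 qed
 fix k t n
 let ?l = "%p. real (summand_mult (F p) (sym_group p) (tensor_power (F p) (sym_group p) (hook_D (F
  p) k p) n) (hook_D (F p) t p))"
 \<comment> \<open>The case r = 0, where the Heller powers are the modules themselves; the sequence
   is constant along all large primes.\<close>
 have "?l p = hook_mult k n t" if "k + n * k + t + 3 <= p" "prime p" for p using main[of p k n t 0]
  that by (simp add: heller_power_def)
 hence "eventually (%p. ?l p = hook_mult k n t) (inf at_top (principal {p. prime p}))" unfolding
  eventually_inf_principal by (intro eventually_mono[OF eventually_ge_at_top[of "k + n * k + t +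
  3"]]) simp
 thus "EX L. (?l \<longlongrightarrow> L) (inf at_top (principal {p. prime p}))" by (intro exI
  tendsto_eventually)
qed
end
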